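(* Let $\Omega\subset\mathbb{R}^d$ ($d\ge3$) be a bounded open set with a given Riemannian metric $(g_{ij})$. Let $(h_{ij}^{a,\varepsilon},\kappa_{lb}^{a,\varepsilon})$ be a sequence of solutions on $\Omega$ to the Gauss-Codazzi-Ricci system associated with $(g_{ij})$, which is uniformly bounded in $L^p(\Omega)$ for some $p>2$. Then the weak limit field $(h_{ij}^a,\kappa_{lb}^a)$ of the sequence $(h_{ij}^{a,\varepsilon},\kappa_{lb}^{a,\varepsilon})$ in $L^p(\Omega)$ is still a solution to the Gauss-Codazzi-Ricci system.
   Context: Indices: $i,j,k,l,m,n$ run from $1$ to $d$; the normal indices $a,b,c$ run from $1$ to $N-d$, where $N$ is the dimension of the ambient Euclidean space $\mathbb{R}^N$. Repeated indices in a product are summed (including repeated normal indices, e.g. $h^a_{ji}h^a_{kl}$ is summed over $a$). $\partial_j=\partial/\partial x^j$. $(g_{ij})$ is the given metric, $(g^{ij})$ its inverse, and $$\Gamma_{ij}^k=\tfrac12 g^{kl}(\partial_j g_{il}+\partial_i g_{jl}-\partial_l g_{ij}),\qquad R_{ijkl}=g_{lm}\big(\partial_k\Gamma_{ij}^m-\partial_j\Gamma_{ik}^m+\Gamma_{ij}^n\Gamma_{nk}^m-\Gamma_{ik}^n\Gamma_{nj}^m\big).$$ The Gauss-Codazzi-Ricci system for unknowns $(h_{ij}^a,\kappa_{lb}^a)$ with $h_{ij}^a=h_{ji}^a$ (coefficients of the second fundamental form) and $\kappa_{kb}^a=-\kappa_{ka}^b$ (coefficients of the connection form on the normal bundle)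 consists of the following equations, for all values of the free indices: Gauss: $h_{ji}^ah_{kl}^a-h_{ki}^ah_{jl}^a=R_{ijkl}$; Codazzi: $\partial_k h_{lj}^a-\partial_l h_{kj}^a+\Gamma_{lj}^m h_{km}^a-\Gamma_{kj}^m h_{lm}^a+\kappa_{kb}^a h_{lj}^b-\kappa_{lb}^a h_{kj}^b=0$; Ricci: $\partial_k\kappa_{lb}^a-\partial_l\kappa_{kb}^a-g^{mn}(h_{ml}^ah_{kn}^b-h_{mk}^ah_{ln}^b)+\kappa_{kc}^a\kappa_{lb}^c-\kappa_{lc}^a\kappa_{kb}^c=0$. Solutions are understood in the sense of distributions on $\Omega$. The weak limit is the limit of the sequence, after passing to a weakly convergent subsequence if necessary, in the weak topology of $L^p(\Omega)$. *)

theory Defs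
  imports "HOL-Analysis.Analysis"
begin

section \<open>Differentiability classes and test functions\<close>

definition pd :: "'d \<Rightarrow> (real^'d::finite \<Rightarrow> real) \<Rightarrow> real^'d \<Rightarrow> real" where
  "pd i f x = frechet_derivative f (at x) (axis i 1)"

primrec Ck_on :: "nat \<Rightarrow> (real^'d::finite) set \<Rightarrow> (real^'d \<Rightarrow> real) \<Rightarrow> bool" where
  "Ck_on 0 S f \<longleftrightarrow> continuous_on S f"
| "Ck_on (Suc k) S f \<longleftrightarrow> f differentiable_on S \<and> (\<forall>i. Ck_on k S (pd i f))"

definition test_function :: "(real^'d::finite) set \<Rightarrow> (real^'d \<Rightarrow> real) \<Rightarrow> bool" where
  "test_function \<Omega> \<phi> \<longleftrightarrow> (\<forall>k. Ck_on k UNIV \<phi>) \<and>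
     compact (closure {x. \<phi> x \<noteq> 0}) \<and> closure {x. \<phi> x \<noteq> 0} \<subseteq> \<Omega>"

section \<open>Lebesgue spaces\<close>

definition in_Lp :: "real \<Rightarrow> (real^'d::finite) set \<Rightarrow> (real^'d \<Rightarrow> real) \<Rightarrow> bool" where
  "in_Lp p \<Omega> f \<longleftrightarrow> f \<in> borel_measurable (lebesgue_on \<Omega>) \<and>
     integrable (lebesgue_on \<Omega>) (\<lambda>x. \<bar>f x\<bar> powr p)"

definition Lp_norm :: "real \<Rightarrow> (real^'d::finite) set \<Rightarrow> (real^'d \<Rightarrow> real) \<Rightarrow> real" where
  "Lp_norm p \<Omega> f = (LINT x|lebesgue_on \<Omega>. \<bar>f x\<bar> powr p) powr (1 / p)"

definition in_L2_loc :: "(real^'d::finite) set \<Rightarrow> (real^'d \<Rightarrow> real) \<Rightarrow> bool" where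
  "in_L2_loc \<Omega> f \<longleftrightarrow> (\<forall>K. compact K \<and> K \<subseteq> \<Omega> \<longrightarrow> in_Lp 2 K f)"

text \<open>Weak convergence in \<open>L\<^sup>p\<close> for \<open>1 < p < \<infinity>\<close>, tested against the dual space \<open>L\<^sup>q\<close>,
  \<open>q = p / (p - 1)\<close>.\<close>

definition weakly_conv_Lp ::
  "real \<Rightarrow> (real^'d::finite) set \<Rightarrow> (nat \<Rightarrow> real^'d \<Rightarrow> real) \<Rightarrow> (real^'d \<Rightarrow> real) \<Rightarrow> bool" where
  "weakly_conv_Lp p \<Omega> F f \<longleftrightarrow> (\<forall>n. in_Lp p \<Omega> (F n)) \<and> in_Lp p \<Omega> f \<and>
     (\<forall>\<psi>. in_Lp (p / (p - 1)) \<Omega> \<psi> \<longrightarrow>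
        (\<lambda>n. LINT x|lebesgue_on \<Omega>. F n x * \<psi> x) \<longlonglongrightarrow> (LINT x|lebesgue_on \<Omega>. f x * \<psi> x))"

section \<open>Riemannian metrics in coordinates\<close>

text \<open>The regularity \<open>C\<^sup>2\<close> is the least for which the curvature below is classically defined
  and continuous; smooth metrics are included.\<close>

definition riemannian_metric_on ::
  "(real^'d::finite) set \<Rightarrow> (real^'d \<Rightarrow> real^'d^'d) \<Rightarrow> bool" where
  "riemannian_metric_on \<Omega> g \<longleftrightarrow>
     (\<forall>i j. Ck_on 2 \<Omega> (\<lambda>x. g x $ i $ j)) \<and>
     (\<forall>x\<in>\<Omega>. transpose (g x) = g x) \<and>
     (\<forall>x\<in>\<Omega>. \<forall>v. v \<noteq> 0 \<longrightarrow> v \<bullet> (g x *v v) > 0)"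

definition ginv :: "(real^'d::finite \<Rightarrow> real^'d^'d) \<Rightarrow> 'd \<Rightarrow> 'd \<Rightarrow> real^'d \<Rightarrow> real" where
  "ginv g i j x = matrix_inv (g x) $ i $ j"

text \<open>\<open>christoffel g k i j\<close> is \<open>\<Gamma>\<^sub>i\<^sub>j\<^sup>k\<close>: the upper index comes first.\<close>

definition christoffel ::
  "(real^'d::finite \<Rightarrow> real^'d^'d) \<Rightarrow> 'd \<Rightarrow> 'd \<Rightarrow> 'd \<Rightarrow> real^'d \<Rightarrow> real" where
  "christoffel g k i j x = 1 / 2 * (\<Sum>l\<in>UNIV. ginv g k l x *
     (pd j (\<lambda>y. g y $ i $ l) x + pd i (\<lambda>y. g y $ j $ l) x - pd l (\<lambda>y. g y $ i $ j) x))"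

definition riemann ::
  "(real^'d::finite \<Rightarrow> real^'d^'d) \<Rightarrow> 'd \<Rightarrow> 'd \<Rightarrow> 'd \<Rightarrow> 'd \<Rightarrow> real^'d \<Rightarrow> real" where
  "riemann g i j k l x = (\<Sum>m\<in>UNIV. g x $ l $ m *
     (pd k (christoffel g m i j) x - pd j (christoffel g m i k) x
      + (\<Sum>n\<in>UNIV. christoffel g n i j x * christoffel g m n k x)
      - (\<Sum>n\<in>UNIV. christoffel g n i k x * christoffel g m n j x)))"

section \<open>The Gauss-Codazzi-Ricci system\<close>

text \<open>The distribution on \<open>\<Omega>\<close> given by a locally integrable function, and its partial
  derivatives, both evaluated at a test function \<open>\<phi>\<close>.\<close>

definition distr_fun :: "(real^'d::finite) set \<Rightarrow> (real^'d \<Rightarrow> real) \<Rightarrow> (real^'d \<Rightarrow> real) \<Rightarrow> real" where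
  "distr_fun \<Omega> f \<phi> = (LINT x|lebesgue_on \<Omega>. f x * \<phi> x)"

definition distr_pd ::
  "(real^'d::finite) set \<Rightarrow> 'd \<Rightarrow> (real^'d \<Rightarrow> real) \<Rightarrow> (real^'d \<Rightarrow> real) \<Rightarrow> real" where
  "distr_pd \<Omega> k f \<phi> = - distr_fun \<Omega> f (pd k \<phi>)"

text \<open>Below \<open>c\<close> is the codimension \<open>N - d\<close>, so that normal indices range over \<open>{1..c}\<close>, while
  tangential indices range over the type \<open>'d\<close>. The field \<open>h a i j\<close> is \<open>h\<^sub>i\<^sub>j\<^sup>a\<close> and \<open>\<kappa> a l b\<close> is
  \<open>\<kappa>\<^sub>l\<^sub>b\<^sup>a\<close>: the upper index comes first.\<close>

type_synonym 'd sff = "nat \<Rightarrow> 'd \<Rightarrow> 'd \<Rightarrow> real^'d \<Rightarrow> real"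
type_synonym 'd nconn = "nat \<Rightarrow> 'd \<Rightarrow> nat \<Rightarrow> real^'d \<Rightarrow> real"

definition gauss_eq ::
  "nat \<Rightarrow> (real^'d::finite) set \<Rightarrow> (real^'d \<Rightarrow> real^'d^'d) \<Rightarrow> 'd sff \<Rightarrow> bool" where
  "gauss_eq c \<Omega> g h \<longleftrightarrow> (\<forall>i j k l \<phi>. test_function \<Omega> \<phi> \<longrightarrow>
     distr_fun \<Omega> (\<lambda>x. (\<Sum>a\<in>{1..c}. h a j i x * h a k l x) - (\<Sum>a\<in>{1..c}. h a k i x * h a j l x)) \<phi>
     = distr_fun \<Omega> (riemann g i j k l) \<phi>)"

definition codazzi_eq ::
  "nat \<Rightarrow> (real^'d::finite) set \<Rightarrow> (real^'d \<Rightarrow> real^'d^'d) \<Rightarrow> 'd sff \<Rightarrow> 'd nconn \<Rightarrow> bool" where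
  "codazzi_eq c \<Omega> g h \<kappa> \<longleftrightarrow> (\<forall>a\<in>{1..c}. \<forall>j k l \<phi>. test_function \<Omega> \<phi> \<longrightarrow>
     distr_pd \<Omega> k (h a l j) \<phi> - distr_pd \<Omega> l (h a k j) \<phi>
     + distr_fun \<Omega> (\<lambda>x.
         (\<Sum>m\<in>UNIV. christoffel g m l j x * h a k m x)
         - (\<Sum>m\<in>UNIV. christoffel g m k j x * h a l m x)
         + (\<Sum>b\<in>{1..c}. \<kappa> a k b x * h b l j x)
         - (\<Sum>b\<in>{1..c}. \<kappa> a l b x * h b k j x)) \<phi> = 0)"

definition ricci_eq ::
  "nat \<Rightarrow> (real^'d::finite) set \<Rightarrow> (real^'d \<Rightarrow> real^'d^'d) \<Rightarrow> 'd sff \<Rightarrow> 'd nconn \<Rightarrow> bool" where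
  "ricci_eq c \<Omega> g h \<kappa> \<longleftrightarrow> (\<forall>a\<in>{1..c}. \<forall>b\<in>{1..c}. \<forall>k l \<phi>. test_function \<Omega> \<phi> \<longrightarrow>
     distr_pd \<Omega> k (\<kappa> a l b) \<phi> - distr_pd \<Omega> l (\<kappa> a k b) \<phi>
     + distr_fun \<Omega> (\<lambda>x.
         - (\<Sum>m\<in>UNIV. \<Sum>n\<in>UNIV. ginv g m n x * (h a m l x * h b k n x - h a m k x * h b l n x))
         + (\<Sum>e\<in>{1..c}. \<kappa> a k e x * \<kappa> e l b x)
         - (\<Sum>e\<in>{1..c}. \<kappa> a l e x * \<kappa> e k b x)) \<phi> = 0)"

text \<open>Local square integrability is what gives the quadratic terms a meaning as distributions.
  The unknowns are classes of functions modulo null sets, hence the almost-everywhere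
  symmetries.\<close>

definition GCR_solution ::
  "nat \<Rightarrow> (real^'d::finite) set \<Rightarrow> (real^'d \<Rightarrow> real^'d^'d) \<Rightarrow> 'd sff \<Rightarrow> 'd nconn \<Rightarrow> bool" where
  "GCR_solution c \<Omega> g h \<kappa> \<longleftrightarrow>
     (\<forall>a\<in>{1..c}. \<forall>i j. in_L2_loc \<Omega> (h a i j)) \<and>
     (\<forall>a\<in>{1..c}. \<forall>b\<in>{1..c}. \<forall>l. in_L2_loc \<Omega> (\<kappa> a l b)) \<and>
     (\<forall>a\<in>{1..c}. \<forall>i j. AE x in lebesgue_on \<Omega>. h a i j x = h a j i x) \<and>
     (\<forall>a\<in>{1..c}. \<forall>b\<in>{1..c}. \<forall>k. AE x in lebesgue_on \<Omega>. \<kappa> a k b x = - \<kappa> b k a x) \<and>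
     gauss_eq c \<Omega> g h \<and> codazzi_eq c \<Omega> g h \<kappa> \<and> ricci_eq c \<Omega> g h \<kappa>"

definition bounded_fields_Lp ::
  "real \<Rightarrow> nat \<Rightarrow> (real^'d::finite) set \<Rightarrow> (nat \<Rightarrow> 'd sff) \<Rightarrow> (nat \<Rightarrow> 'd nconn) \<Rightarrow> bool" where
  "bounded_fields_Lp p c \<Omega> H K \<longleftrightarrow> (\<exists>B. \<forall>n.
     (\<forall>a\<in>{1..c}. \<forall>i j. in_Lp p \<Omega> (H n a i j) \<and> Lp_norm p \<Omega> (H n a i j) \<le> B) \<and>
     (\<forall>a\<in>{1..c}. \<forall>b\<in>{1..c}. \<forall>l. in_Lp p \<Omega> (K n a l b) \<and> Lp_norm p \<Omega> (K n a l b) \<le> B))"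

definition weak_limit_fields_Lp ::
  "real \<Rightarrow> nat \<Rightarrow> (real^'d::finite) set \<Rightarrow> (nat \<Rightarrow> 'd sff) \<Rightarrow> (nat \<Rightarrow> 'd nconn)
     \<Rightarrow> 'd sff \<Rightarrow> 'd nconn \<Rightarrow> bool" where
  "weak_limit_fields_Lp p c \<Omega> H K h \<kappa> \<longleftrightarrow>
     (\<forall>a\<in>{1..c}. \<forall>i j. weakly_conv_Lp p \<Omega> (\<lambda>n. H n a i j) (h a i j)) \<and>
     (\<forall>a\<in>{1..c}. \<forall>b\<in>{1..c}. \<forall>l. weakly_conv_Lp p \<Omega> (\<lambda>n. K n a l b) (\<kappa> a l b))"

end

theory Submission
  imports Defs "HOL-Library.Diagonal_Subsequence"
begin

text \<open>
  Every quadratic term of the system is a combination of expressions \<open>V\<^sub>k W\<^sub>l - V\<^sub>l W\<^sub>k\<close>, where the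
  vector fields \<open>V\<close> and \<open>W\<close> are rows of \<open>h\<close> or \<open>\<kappa>\<close>. The Codazzi and Ricci equations say that the
  curls of these fields are sums of products of \<open>L\<^sup>2\<close> functions, hence bounded in \<open>L\<^sup>1\<close> on compact sets,
  and a div-curl lemma makes \<open>V\<^sub>k W\<^sub>l - V\<^sub>l W\<^sub>k\<close> weakly continuous.

  The div-curl lemma uses a mollifier \<open>T\<^sub>s\<close> which is the divergence of an explicit kernel, a regularised
  gradient of the fundamental solution. A band \<open>T\<^sub>\<epsilon> v - T\<^sub>\<delta> v\<close> of a field with curl bounded in \<open>L\<^sup>1\<close>
  is then a gradient plus a divergence free remainder whose \<open>L\<^sup>1\<close> norm is \<open>O(\<delta>)\<close>; the extra integrability
  \<open>p > 2\<close> makes the remainder small in \<open>L\<^sup>2\<close> as well. The wedge product of two gradients integrates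
  to \<open>0\<close>, and the low frequency part \<open>T\<^sub>\<delta> v\<close> converges strongly. Since the curl of the weak limit is
  not known a priori, the estimate is applied to the differences of two members of the sequence.
\<close>

section \<open>Calculus of smooth functions\<close>

text \<open>Curls that are bounded only in L^1 are not compact in the dual of H^1. The remainder of
  a band is O(t) in L^1, but no L^2 bound uniform in the small scale is at hand. Orthogonality to
  gradients turns its squared L^2 norm into a pairing with v itself: v is cut at a height K, its
  bounded part meets the small L^1 norm, and its tail is small in L^2 uniformly in n because p > 2.
  Bands, and not single mollifications, are decomposed because one gradient kernel decays like
  |x|^(1-d) and is not integrable, while a difference of two scales decays like |x|^(-1-d). The
  wedge of two differences expands to a_n + a_m - b_nm - b_mn. The mixed terms converge by weak
  convergence in one index at a time, so smallness for all large n and m forces a_n to converge to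
  the wedge of the weak limits. Convolution and Fubini are used on the whole space, hence the
  passage to Borel representatives vanishing outside \<open>\<Omega>\<close>. In the Ricci equation
  the wedges carry merely continuous coefficients, which need a separate approximation. Weak limits
  are produced as Radon-Nikodym densities of limits of set functions.\<close>

lemma pd_eqI: "(f has_derivative f') (at x) \<Longrightarrow> pd i f x = f' (axis i 1)"
  unfolding pd_def by (metis frechet_derivative_at)

lemma pd_cong_open:
  assumes "open S" "\<And>x. x \<in> S \<Longrightarrow> f x = g x" "x \<in> S"
  shows "pd i f x = pd i g x"
proof -
  have "(f has_derivative f') (at x) \<longleftrightarrow> (g has_derivative f') (at x)" for f'
    using has_derivative_transform_within_open[OF _ assms(1,3)] assms(2) by metis
  then show ?thesis unfolding pd_def frechet_derivative_def by simp
qed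

text \<open>\<open>pd\<close> uses the derivative \<open>at x\<close>, not within the set, so
  agreement on \<open>S\<close> passes to derivatives only because \<open>S\<close> is open.\<close>

lemma Ck_on_cong_open:
  assumes "open S"
  shows "(\<And>x. x \<in> S \<Longrightarrow> f x = g x) \<Longrightarrow> Ck_on k S f \<longleftrightarrow> Ck_on k S g"
proof (induction k arbitrary: f g)
  case 0
  then show ?case by (auto intro: continuous_on_cong)
next
  case (Suc k)
  have "f differentiable_on S \<longleftrightarrow> g differentiable_on S"
    using Suc.prems by (auto simp: differentiable_on_def intro: differentiable_transform_within[where d=1])
  moreover have "Ck_on k S (pd i f) = Ck_on k S (pd i g)" for i
    by (rule Suc.IH) (rule pd_cong_open[OF assms Suc.prems])
  ultimately show ?case by simp
qed

lemma Ck_on_Suc_imp: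
  "Ck_on (Suc k) S f \<Longrightarrow> Ck_on k S f"
proof (induction k arbitrary: f)
  case 0
  then show ?case by (auto simp: differentiable_imp_continuous_on)
next
  case (Suc k)
  have "Ck_on (Suc k) S (pd i f)" for i using Suc.prems by (simp only: Ck_on.simps(2)[of "Suc k"]) 
  then have "Ck_on k S (pd i f)" for i by (rule Suc.IH)
  moreover have "f differentiable_on S" using Suc.prems by (simp only: Ck_on.simps(2)[of "Suc k"])
  ultimately show ?case by simp
qed

lemma Ck_on_imp_continuous_on: "Ck_on k S f \<Longrightarrow> continuous_on S f"
  by (induction k) (auto simp: differentiable_imp_continuous_on)

lemma Ck_on_subset: "Ck_on k S f \<Longrightarrow> T \<subseteq> S \<Longrightarrow> Ck_on k T f"
  by (induction k arbitrary: f) (auto intro: continuous_on_subset differentiable_on_subset)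

text \<open>Serves to glue a quotient, smooth where its denominator is positive, to the zero
  function off a support.\<close>

lemma Ck_on_Un_open:
  assumes "open S" "open T"
  shows "Ck_on k S f \<Longrightarrow> Ck_on k T f \<Longrightarrow> Ck_on k (S \<union> T) f"
proof (induction k arbitrary: f)
  case 0
  then show ?case using assms by (auto intro: continuous_on_open_Un)
next
  case (Suc k)
  have "f differentiable_on (S \<union> T)"
    using Suc.prems assms by (auto simp: differentiable_on_eq_differentiable_at open_Un)
  then show ?case using Suc by simp
qed

lemma pd_const [simp]: "pd i (\<lambda>x. c) = (\<lambda>x. 0)"
proof
  fix x show "pd i (\<lambda>x. c) x = 0"
    using pd_eqI[OF has_derivative_const[of c "at x"]] by simp
qed

lemma Ck_on_const [simp]: "Ck_on k S (\<lambda>x. c)"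
  by (induction k arbitrary: c) (auto simp: differentiable_on_def)

lemma bounded_linear_imp_Ck_on:
  assumes "bounded_linear f" shows "Ck_on k S f"
proof (cases k)
  case 0
  then show ?thesis using assms by (simp add: linear_continuous_on)
next
  case (Suc m)
  have "(f has_derivative f) (at x)" for x by (rule bounded_linear_imp_has_derivative[OF assms])
  then have "pd i f = (\<lambda>x. f (axis i 1))" for i by (auto simp: pd_eqI)
  moreover have "f differentiable_on S"
    by (simp add: assms bounded_linear_imp_differentiable_on)
  ultimately show ?thesis using Suc by simp
qed

lemma Ck_on_coord: "Ck_on k S (\<lambda>x. x $ i)"
  by (rule bounded_linear_imp_Ck_on) (rule bounded_linear_vec_nth)

lemma differentiable_at_has_pd:
  assumes "f differentiable (at x)"
  shows "(f has_derivative frechet_derivative f (at x)) (at x)"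
  using assms by (simp add: frechet_derivative_works)

lemma pd_add:
  assumes "f differentiable (at x)" "g differentiable (at x)"
  shows "pd i (\<lambda>x. f x + g x) x = pd i f x + pd i g x"
  using pd_eqI[OF has_derivative_add[OF assms[THEN differentiable_at_has_pd]]] by (simp add: pd_def)

lemma pd_mult:
  assumes "f differentiable (at x)" "g differentiable (at x)"
  shows "pd i (\<lambda>x. f x * g x) x = pd i f x * g x + f x * pd i g x"
  using pd_eqI[OF has_derivative_mult[OF assms[THEN differentiable_at_has_pd]]] by (simp add: pd_def)

lemma Ck_on_add:
  assumes "open S"
  shows "Ck_on k S f \<Longrightarrow> Ck_on k S g \<Longrightarrow> Ck_on k S (\<lambda>x. f x + g x)"
proof (induction k arbitrary: f g)
  case 0
  then show ?case by (auto intro: continuous_on_add)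
next
  case (Suc k)
  have "Ck_on k S (pd i (\<lambda>x. f x + g x))" for i
    using Suc assms 
    by (subst Ck_on_cong_open[OF assms pd_add]) (auto simp: differentiable_on_eq_differentiable_at)
  then show ?case using Suc.prems assms by (auto simp: differentiable_on_def)
qed

lemma Ck_on_mult:
  assumes "open S"
  shows "Ck_on k S f \<Longrightarrow> Ck_on k S g \<Longrightarrow> Ck_on k S (\<lambda>x. f x * g x)"
proof (induction k arbitrary: f g)
  case 0
  then show ?case by (auto intro: continuous_on_mult)
next
  case (Suc k)
  have "Ck_on k S f" "Ck_on k S g" using Suc.prems Ck_on_Suc_imp by blast+
  then have "Ck_on k S (pd i (\<lambda>x. f x * g x))" for i
    using Suc assms 
    by (subst Ck_on_cong_open[OF assms pd_mult])
       (auto simp: differentiable_on_eq_differentiable_at intro!: Ck_on_add)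
  then show ?case using Suc.prems assms by (auto simp: differentiable_on_def)
qed

lemma Ck_on_sum:
  assumes "open S" "\<And>i. i \<in> I \<Longrightarrow> Ck_on k S (f i)"
  shows "Ck_on k S (\<lambda>x. \<Sum>i\<in>I. f i x)"
  using assms(2) by (induction I rule: infinite_finite_induct) (auto intro: Ck_on_add[OF assms(1)])

lemma Ck_on_diff:
  assumes "open S" "Ck_on k S f" "Ck_on k S g"
  shows "Ck_on k S (\<lambda>x. f x - g x)"
  using Ck_on_add[OF assms(1,2) Ck_on_mult[OF assms(1) Ck_on_const[of k S "-1"] assms(3)]] by simp

text \<open>Higher chain rules are avoided by composing with a whole family of outer functions that
  is closed under differentiation up to finite linear combinations; the induction on
  \<open>k\<close> then runs for all indices \<open>j\<close> at once. Real powers and the bump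
  profiles are the two instances.\<close>

lemma Ck_on_compose_family:
  fixes \<beta> :: "'a \<Rightarrow> real \<Rightarrow> real" and g :: "real^'d::finite \<Rightarrow> real"
  assumes S: "open S" and T: "\<And>x. x \<in> S \<Longrightarrow> g x \<in> T"
    and der: "\<And>j t. t \<in> T \<Longrightarrow> (\<beta> j has_real_derivative (\<Sum>i\<in>I j. c j i * \<beta> (s j i) t)) (at t)"
  shows "Ck_on k S g \<Longrightarrow> Ck_on k S (\<lambda>x. \<beta> j (g x))"
proof (induction k arbitrary: j)
  case 0
  have "isCont (\<beta> j) t" if "t \<in> T" for t using der[OF that] by (rule DERIV_isCont)
  then have "continuous_on T (\<beta> j)" by (simp add: continuous_at_imp_continuous_on)
  then show ?case using 0 T by (auto intro: continuous_on_compose2)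
next
  case (Suc k)
  have gd: "g differentiable (at x)" if "x \<in> S" for x
    using Suc.prems S that by (auto simp: differentiable_on_eq_differentiable_at)
  have der': "((\<lambda>x. \<beta> j (g x)) has_derivative
      (\<lambda>h. frechet_derivative g (at x) h * (\<Sum>i\<in>I j. c j i * \<beta> (s j i) (g x)))) (at x)"
    if "x \<in> S" for x
    using has_derivative_compose[OF differentiable_at_has_pd[OF gd[OF that]]
      der[OF T[OF that], unfolded has_field_derivative_def]]
    by (simp add: mult.commute)
  then have pde: "pd l (\<lambda>x. \<beta> j (g x)) x = pd l g x * (\<Sum>i\<in>I j. c j i * \<beta> (s j i) (g x))" if "x \<in> S" for x l
    using pd_eqI that by (fastforce simp: pd_def[of _ g])
  have k: "Ck_on k S g" using Suc.prems by (rule Ck_on_Suc_imp)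
  have "Ck_on k S (pd l (\<lambda>x. \<beta> j (g x)))" for l
    using Suc.prems S
    by (subst Ck_on_cong_open[OF S pde]) 
       (auto intro!: Ck_on_mult Ck_on_sum Suc.IH k)
  moreover have "(\<lambda>x. \<beta> j (g x)) differentiable_on S"
    using der' S by (auto simp: differentiable_on_eq_differentiable_at differentiable_def)
  ultimately show ?case by simp
qed

lemma Ck_on_powr:
  assumes "open S" "\<And>x. x \<in> S \<Longrightarrow> f x > 0" "Ck_on k S f"
  shows "Ck_on k S (\<lambda>x. f x powr a)"
proof (rule Ck_on_compose_family[where \<beta>="\<lambda>a t. t powr a" and T="{0<..}" and I="\<lambda>_. {()}"
      and c="\<lambda>a _. a" and s="\<lambda>a _. a - 1"])
  show "((\<lambda>t. t powr j) has_real_derivative (\<Sum>i\<in>{()}. j * t powr (j - 1))) (at t)" if "t \<in> {0<..}" for j t :: real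
    using that by (auto intro!: derivative_eq_intros simp: powr_diff)
qed (use assms in auto)

lemma real_polynomial_function_Ck_on:
  assumes "open S" "real_polynomial_function f"
  shows "Ck_on k S f"
  using assms(2)
  by induction (auto intro: bounded_linear_imp_Ck_on Ck_on_add Ck_on_mult assms(1))

subsection \<open>Bump functions\<close>

text \<open>\<open>bump 0\<close> is the classical smooth function exp(-1/t) continued by 0. The
  powers of 1/t are carried along because its derivatives are combinations of them.\<close>

definition bump :: "nat \<Rightarrow> real \<Rightarrow> real" where
  "bump j t = (if t > 0 then (1 / t) ^ j * exp (- (1 / t)) else 0)"

lemma bump_tendsto_0: "(bump j \<longlongrightarrow> 0) (at 0)"
proof -
  have "((\<lambda>t::real. inverse t ^ j / exp (inverse t)) \<longlongrightarrow> 0) (at_right 0)"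
    by (rule filterlim_compose[OF tendsto_power_div_exp_0 filterlim_inverse_at_top_right])
  moreover have "\<forall>\<^sub>F t in at_right 0. inverse t ^ j / exp (inverse t) = bump j t"
    by (auto simp: eventually_at_filter bump_def exp_minus field_simps)
  ultimately have r: "(bump j \<longlongrightarrow> 0) (at_right 0)"
    by (rule Lim_transform_eventually)
  have "(bump j \<longlongrightarrow> 0) (at_left 0)"
    by (rule tendsto_eventually) (auto simp: eventually_at_filter bump_def)
  with r show ?thesis by (simp add: filterlim_split_at)
qed

lemma bump_deriv:
  "(bump j has_real_derivative bump (j + 2) t - real j * bump (j + 1) t) (at t)"
proof -
  consider "t > 0" | "t < 0" | "t = 0" by linarith
  then show ?thesis
  proof cases
    case 1
    have "((\<lambda>t. (1 / t) ^ j * exp (- (1 / t))) has_real_derivative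
        bump (j + 2) t - real j * bump (j + 1) t) (at t)"
      using 1 by (auto intro!: derivative_eq_intros simp: bump_def field_simps power2_eq_square)
         (cases j; auto simp: field_simps power2_eq_square)
    then show ?thesis
      by (rule has_field_derivative_transform_within_open[where S="{0<..}"]) (use 1 in \<open>auto simp: bump_def\<close>)
  next
    case 2
    have "((\<lambda>t. 0) has_real_derivative 0) (at t)" by simp
    then have "(bump j has_real_derivative 0) (at t)"
      by (rule has_field_derivative_transform_within_open[where S="{..<0}"]) (use 2 in \<open>auto simp: bump_def\<close>)
    then show ?thesis using 2 by (simp add: bump_def)
  next
    \<comment> \<open>Dividing by h raises the exponent by one, so the difference quotient at 0 is
      again a member of the family and tends to 0.\<close>
    case 3
    have "\<forall>\<^sub>F h in at 0. bump (Suc j) h = (bump j (0 + h) - bump j 0) / h"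
      by (auto simp: eventually_at_filter bump_def)
    then have "((\<lambda>h. (bump j (0 + h) - bump j 0) / h) \<longlongrightarrow> 0) (at 0)"
      by (rule Lim_transform_eventually[OF bump_tendsto_0])
    then show ?thesis using 3 by (simp add: DERIV_def bump_def)
  qed
qed

lemma Ck_on_bump:
  assumes "open S" "Ck_on k S g"
  shows "Ck_on k S (\<lambda>x. bump j (g x))"
proof (rule Ck_on_compose_family[OF assms(1) _ _ assms(2), where T=UNIV and I="\<lambda>_. {False, True}" 
      and c="\<lambda>j b. if b then 1 else - real j" and s="\<lambda>j b. if b then j + 2 else j + 1"])
  show "(bump j has_real_derivative (\<Sum>i\<in>{False, True}. (if i then 1 else - real j) *
      bump (if i then j + 2 else j + 1) t)) (at t)" for j t
    using bump_deriv[of j t] by simp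
qed simp

subsection \<open>Test functions\<close>

lemma test_function_smooth: "test_function \<Omega> \<phi> \<Longrightarrow> Ck_on k UNIV \<phi>"
  by (simp add: test_function_def)

lemma test_function_continuous: "test_function \<Omega> \<phi> \<Longrightarrow> continuous_on S \<phi>"
  using Ck_on_subset[of 0 UNIV \<phi> S] test_function_smooth[of \<Omega> \<phi> 0] by simp

lemma test_function_differentiable: "test_function \<Omega> \<phi> \<Longrightarrow> \<phi> differentiable (at x)"
  using test_function_smooth[of \<Omega> \<phi> 1] by (simp add: differentiable_on_def)

lemma test_function_pd_smooth: "test_function \<Omega> \<phi> \<Longrightarrow> Ck_on k UNIV (pd i \<phi>)"
  using test_function_smooth[of \<Omega> \<phi> "Suc k"] by simp

lemma compact_closure_subset: "compact C \<Longrightarrow> closure A \<subseteq> C \<Longrightarrow> compact (closure A)"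
  by (metis closed_closure compact_Int_closed inf.absorb_iff2)

lemma test_functionI:
  assumes "\<And>k. Ck_on k UNIV \<psi>" "compact C" "C \<subseteq> \<Omega>" "closure {x. \<psi> x \<noteq> 0} \<subseteq> C"
  shows "test_function \<Omega> \<psi>"
  unfolding test_function_def using assms compact_closure_subset[OF assms(2,4)] by auto

lemma test_function_support:
  assumes "test_function \<Omega> \<phi>"
  shows "compact (closure {x. \<phi> x \<noteq> 0})" "closure {x. \<phi> x \<noteq> 0} \<subseteq> \<Omega>"
  using assms by (simp_all only: test_function_def)

lemma closure_subset_support:
  assumes "{x. f x \<noteq> 0} \<subseteq> closure {x. \<phi> x \<noteq> 0}"
  shows "closure {x. f x \<noteq> 0} \<subseteq> closure {x. \<phi> x \<noteq> 0}"
  using assms by (simp add: closure_minimal)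

lemma test_function_mult_smooth:
  assumes "test_function \<Omega> \<phi>" "\<And>k. Ck_on k UNIV \<psi>"
  shows "test_function \<Omega> (\<lambda>x. \<phi> x * \<psi> x)"
proof -
  have "closure {x. \<phi> x * \<psi> x \<noteq> 0} \<subseteq> closure {x. \<phi> x \<noteq> 0}"
    by (rule closure_subset_support) (auto intro: closure_subset[THEN subsetD])
  then show ?thesis
    using assms test_function_support[OF assms(1)] test_function_smooth[OF assms(1)]
    by (intro test_functionI) (auto intro: Ck_on_mult)
qed

lemma pd_zero_outside_support:
  assumes "x \<notin> closure {x. \<phi> x \<noteq> 0}" shows "pd i \<phi> x = 0"
proof -
  have "pd i \<phi> x = pd i (\<lambda>x. 0) x"
    by (rule pd_cong_open[where S="- closure {x. \<phi> x \<noteq> 0}"])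
       (use assms closure_subset[of "{x. \<phi> x \<noteq> 0}"] in auto)
  then show ?thesis by simp
qed

lemma zero_outside_support: "x \<notin> closure {x. \<phi> x \<noteq> 0} \<Longrightarrow> \<phi> x = 0"
  using closure_subset[of "{x. \<phi> x \<noteq> 0}"] by auto

lemma test_function_pd:
  assumes "test_function \<Omega> \<phi>"
  shows "test_function \<Omega> (pd i \<phi>)"
proof -
  have "closure {x. pd i \<phi> x \<noteq> 0} \<subseteq> closure {x. \<phi> x \<noteq> 0}"
    by (rule closure_subset_support) (use pd_zero_outside_support[of _ \<phi> i] in blast)
  then show ?thesis using test_function_support[OF assms] test_function_pd_smooth[OF assms] 
    by (intro test_functionI)
qed

lemma smooth_ball_bump: "Ck_on k UNIV (\<lambda>x::real^'d::finite. bump 0 (r\<^sup>2 - (x - a) \<bullet> (x - a)))"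
proof -
  have "Ck_on k UNIV (\<lambda>x. r\<^sup>2 - (\<Sum>i\<in>UNIV. (x $ i - a $ i) * (x $ i - a $ i)))"
    by (intro Ck_on_diff Ck_on_const Ck_on_sum Ck_on_mult Ck_on_coord) auto
  then show ?thesis by (intro Ck_on_bump) (auto simp: inner_vec_def)
qed

text \<open>Dividing by a sum of bumps that is positive on the support gives the factorisation.\<close>

lemma test_function_factor:
  assumes \<Omega>: "open \<Omega>" and \<phi>: "test_function \<Omega> \<phi>"
  obtains \<phi>1 \<phi>2 where "test_function \<Omega> \<phi>1" "test_function \<Omega> \<phi>2" "\<And>x. \<phi> x = \<phi>1 x * \<phi>2 x"
proof -
  define C where "C = closure {x. \<phi> x \<noteq> 0}"
  have C: "compact C" "C \<subseteq> \<Omega>" using \<phi> by (auto simp: test_function_def C_def)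
  have "\<exists>r>0. cball a r \<subseteq> \<Omega>" if "a \<in> C" for a
    using that C \<Omega> open_contains_cball by blast
  then obtain r where r: "\<And>a. a \<in> C \<Longrightarrow> r a > 0 \<and> cball a (r a) \<subseteq> \<Omega>" by metis
  have "C \<subseteq> (\<Union>a\<in>C. ball a (r a))" using r by force
  then obtain A where A: "A \<subseteq> C" "finite A" "C \<subseteq> (\<Union>a\<in>A. ball a (r a))"
    using compactE_image[OF C(1), of C "\<lambda>a. ball a (r a)"] by auto
  define \<beta> where "\<beta> a x = bump 0 ((r a)\<^sup>2 - (x - a) \<bullet> (x - a))" for a x
  define S where "S x = (\<Sum>a\<in>A. \<beta> a x)" for x
  have \<beta>0: "\<beta> a x \<ge> 0" for a x by (simp add: \<beta>_def bump_def)
  have \<beta>pos: "\<beta> a x > 0 \<longleftrightarrow> x \<in> ball a (r a)" if "a \<in> A" for a x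
  proof -
    have "r a > 0" using r A that by auto
    then have "(x - a) \<bullet> (x - a) < (r a)\<^sup>2 \<longleftrightarrow> norm (x - a) < r a"
      unfolding power2_norm_eq_inner[symmetric] by (auto intro: power2_less_imp_less power_strict_mono)
    then show ?thesis by (auto simp: \<beta>_def bump_def dist_norm norm_minus_commute)
  qed
  have Spos: "S x > 0" if xC: "x \<in> C" for x
  proof -
    obtain a where a: "a \<in> A" "x \<in> ball a (r a)" using A(3) xC by blast
    then have "0 < \<beta> a x" using \<beta>pos by simp
    also have "\<beta> a x \<le> S x" unfolding S_def using a A \<beta>0 by (intro member_le_sum) auto
    finally show ?thesis .
  qed
  have Sk: "Ck_on k UNIV S" for k
    unfolding S_def[abs_def] \<beta>_def by (intro Ck_on_sum smooth_ball_bump) auto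
  have "{x. S x \<noteq> 0} \<subseteq> (\<Union>a\<in>A. cball a (r a))"
  proof
    fix x assume "x \<in> {x. S x \<noteq> 0}"
    then obtain a where "a \<in> A" "\<beta> a x \<noteq> 0" unfolding S_def by (auto elim: sum.not_neutral_contains_not_neutral)
    then have "x \<in> ball a (r a)" using \<beta>0[of a x] \<beta>pos[of a x] by auto
    then show "x \<in> (\<Union>a\<in>A. cball a (r a))" using \<open>a \<in> A\<close> by (force simp: less_imp_le)
  qed
  moreover have cU: "compact (\<Union>a\<in>A. cball a (r a))" using A by (intro compact_UN) auto
  ultimately have cl: "closure {x. S x \<noteq> 0} \<subseteq> (\<Union>a\<in>A. cball a (r a))"
    by (intro closure_minimal compact_imp_closed) auto
  have "(\<Union>a\<in>A. cball a (r a)) \<subseteq> \<Omega>"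
  proof (rule UN_least)
    fix a assume "a \<in> A"
    then have "a \<in> C" using A(1) by (rule subsetD[rotated])
    then show "cball a (r a) \<subseteq> \<Omega>" using r by simp
  qed
  then have "test_function \<Omega> S"
    using Sk cl cU by (intro test_functionI)
  \<comment> \<open>Smoothness is checked on two open sets that cover the space: where
    \<open>S\<close> is positive the division is smooth, and off the support of
    \<open>\<phi>\<close> the product is identically 0.\<close>
  moreover have "test_function \<Omega> (\<lambda>x. \<phi> x * S x powr (-1))"
  proof -
    have open1: "open {x. S x > 0}"
      using Ck_on_imp_continuous_on[OF Sk[of 0]] by (intro open_Collect_less) auto
    have open2: "open (- C)" using C by (simp add: compact_imp_closed open_Compl)
    have "Ck_on k UNIV (\<lambda>x. \<phi> x * S x powr (-1))" for k
    proof -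
      have "Ck_on k {x. S x > 0} (\<lambda>x. \<phi> x * S x powr (-1))"
        using open1 Sk test_function_smooth[OF \<phi>] by (intro Ck_on_mult Ck_on_powr) (auto intro: Ck_on_subset)
      moreover have "Ck_on k (- C) (\<lambda>x. \<phi> x * S x powr (-1))"
        by (subst Ck_on_cong_open[OF open2, of _ "\<lambda>x. 0"]) (auto simp: C_def dest: zero_outside_support)
      moreover have "{x. S x > 0} \<union> - C = UNIV" using Spos by auto
      ultimately show ?thesis using Ck_on_Un_open[OF open1 open2, of k "\<lambda>x. \<phi> x * S x powr (-1)"] by simp
    qed
    moreover have "closure {x. \<phi> x * S x powr (-1) \<noteq> 0} \<subseteq> closure {x. \<phi> x \<noteq> 0}"
      by (rule closure_subset_support) (auto intro: closure_subset[THEN subsetD])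
    ultimately show ?thesis using C unfolding C_def by - (rule test_functionI)
  qed
  moreover have "\<phi> x = S x * (\<phi> x * S x powr (-1))" for x
  proof (cases "x \<in> C")
    case True
    then show ?thesis using Spos[OF True] by (simp add: powr_neg_one)
  next
    case False
    then have "\<phi> x = 0" unfolding C_def by (rule zero_outside_support)
    then show ?thesis by simp
  qed
  ultimately show thesis by (rule that)
qed

section \<open>Square integrable functions\<close>

definition L2 :: "'a measure \<Rightarrow> ('a \<Rightarrow> real) \<Rightarrow> bool" where
  "L2 M f \<longleftrightarrow> f \<in> borel_measurable M \<and> integrable M (\<lambda>x. (f x)\<^sup>2)"

definition norm2 :: "'a measure \<Rightarrow> ('a \<Rightarrow> real) \<Rightarrow> real" where
  "norm2 M f = sqrt (LINT x|M. (f x)\<^sup>2)"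

lemma L2_measurable: "L2 M f \<Longrightarrow> f \<in> borel_measurable M"
  by (simp add: L2_def)

lemma norm2_nonneg: "norm2 M f \<ge> 0"
  by (simp add: norm2_def)

lemma norm2_square: "(norm2 M f)\<^sup>2 = (LINT x|M. (f x)\<^sup>2)"
  by (simp add: norm2_def)

lemma L2_mult_integrable:
  assumes "L2 M f" "L2 M g" shows "integrable M (\<lambda>x. f x * g x)"
proof (rule Bochner_Integration.integrable_bound)
  show "integrable M (\<lambda>x. (f x)\<^sup>2 + (g x)\<^sup>2)" using assms by (simp add: L2_def)
  have "\<bar>a * b\<bar> \<le> a\<^sup>2 + b\<^sup>2" for a b :: real
    using sum_squares_bound[of "\<bar>a\<bar>" "\<bar>b\<bar>"] mult_nonneg_nonneg[of "\<bar>a\<bar>" "\<bar>b\<bar>"]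
    unfolding abs_mult power2_abs by linarith
  then show "AE x in M. norm (f x * g x) \<le> norm ((f x)\<^sup>2 + (g x)\<^sup>2)" by simp
  show "(\<lambda>x. f x * g x) \<in> borel_measurable M" 
    using assms[THEN L2_measurable] by (rule borel_measurable_times)
qed

lemma L2_cmult: "L2 M f \<Longrightarrow> L2 M (\<lambda>x. c * f x)"
  by (auto simp: L2_def power_mult_distrib)

lemma L2_uminus: "L2 M f \<Longrightarrow> L2 M (\<lambda>x. - f x)"
  by (auto simp: L2_def)

lemma L2_add:
  assumes "L2 M f" "L2 M g" shows "L2 M (\<lambda>x. f x + g x)"
  unfolding L2_def
proof
  show "(\<lambda>x. f x + g x) \<in> borel_measurable M" 
    using assms[THEN L2_measurable] by (rule borel_measurable_add)
  have "integrable M (\<lambda>x. (f x)\<^sup>2 + (g x)\<^sup>2 + 2 * (f x * g x))" 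
    using assms L2_mult_integrable[OF assms] by (simp add: L2_def)
  then show "integrable M (\<lambda>x. (f x + g x)\<^sup>2)" by (simp add: power2_sum mult.assoc)
qed

lemma L2_diff: "L2 M f \<Longrightarrow> L2 M g \<Longrightarrow> L2 M (\<lambda>x. f x - g x)"
  using L2_add[OF _ L2_uminus, of M f g] by simp

lemma L2_zero: "L2 M (\<lambda>x. 0)"
  by (simp add: L2_def)

lemma L2_sum: "(\<And>i. i \<in> I \<Longrightarrow> L2 M (f i)) \<Longrightarrow> L2 M (\<lambda>x. \<Sum>i\<in>I. f i x)"
  by (induction I rule: infinite_finite_induct) (auto intro: L2_add L2_zero)

lemma L2_bound:
  assumes "L2 M g" "f \<in> borel_measurable M" "\<And>x. \<bar>f x\<bar> \<le> \<bar>g x\<bar>" shows "L2 M f"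
  unfolding L2_def
proof
  show "integrable M (\<lambda>x. (f x)\<^sup>2)"
    by (rule Bochner_Integration.integrable_bound[of _ "\<lambda>x. (g x)\<^sup>2"])
       (use assms in \<open>auto simp: L2_def abs_le_square_iff\<close>)
qed (use assms in auto)

text \<open>A bounded integrable kernel applied to an integrable function gives something both
  bounded and integrable. This is how the convolutions with kernel differences below are seen to lie
  in L^2, even when the data are only in L^1.\<close>

lemma L2_bounded_integrable:
  assumes "integrable M f" "\<And>x. \<bar>f x\<bar> \<le> B" shows "L2 M f"
  unfolding L2_def
proof
  show "integrable M (\<lambda>x. (f x)\<^sup>2)"
  proof (rule Bochner_Integration.integrable_bound)
    show "integrable M (\<lambda>x. B * f x)" using assms by simp
    have "\<bar>f x\<bar> * \<bar>f x\<bar> \<le> \<bar>B\<bar> * \<bar>f x\<bar>" for x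
      using assms(2)[of x] by (intro mult_right_mono) auto
    then show "AE x in M. norm ((f x)\<^sup>2) \<le> norm (B * f x)"
      by (auto simp: power2_eq_square abs_mult)
  qed (use assms in auto)
qed (use assms in auto)

lemma L2_Cauchy_Schwarz:
  assumes "L2 M f" "L2 M g"
  shows "\<bar>LINT x|M. f x * g x\<bar> \<le> norm2 M f * norm2 M g"
proof -
  let ?F = "LINT x|M. (f x)\<^sup>2" and ?G = "LINT x|M. (g x)\<^sup>2" and ?I = "LINT x|M. f x * g x"
  have q: "0 \<le> ?F - 2 * t * ?I + t\<^sup>2 * ?G" for t
  proof -
    have "0 \<le> (LINT x|M. (f x - t * g x)\<^sup>2)" by simp
    also have "(\<lambda>x. (f x - t * g x)\<^sup>2) = (\<lambda>x. (f x)\<^sup>2 - 2 * t * (f x * g x) + t\<^sup>2 * (g x)\<^sup>2)"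
      by (auto simp: power2_diff power_mult_distrib)
    also have "integral\<^sup>L M \<dots> = ?F - 2 * t * ?I + t\<^sup>2 * ?G"
      using assms L2_mult_integrable[OF assms] by (simp add: L2_def)
    finally show ?thesis .
  qed
  have "?I\<^sup>2 \<le> ?F * ?G"
  proof (cases "?G = 0")
    case True
    then have "AE x in M. (g x)\<^sup>2 = 0"
      using assms(2) by (subst (asm) integral_nonneg_eq_0_iff_AE) (auto simp: L2_def)
    then have "?I = 0" by (intro integral_eq_zero_AE) auto
    then show ?thesis using True by simp
  next
    case False
    have "?G \<ge> 0" by simp
    with False have "?G > 0" by (metis less_le)
    \<comment> \<open>This value of \<open>t\<close> minimises the quadratic polynomial
      \<open>q\<close>.\<close>
    with q[of "?I / ?G"] show ?thesis by (simp add: field_simps power2_eq_square)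
  qed
  then have "sqrt (?I\<^sup>2) \<le> sqrt (?F * ?G)" by (rule real_sqrt_le_mono)
  then show ?thesis by (simp add: norm2_def real_sqrt_mult)
qed

lemma norm2_triangle:
  assumes "L2 M f" "L2 M g"
  shows "norm2 M (\<lambda>x. f x + g x) \<le> norm2 M f + norm2 M g"
proof (rule power2_le_imp_le)
  have "(norm2 M (\<lambda>x. f x + g x))\<^sup>2 = (LINT x|M. (f x)\<^sup>2 + 2 * (f x * g x) + (g x)\<^sup>2)"
    unfolding norm2_square by (simp add: power2_sum algebra_simps)
  also have "\<dots> = (norm2 M f)\<^sup>2 + 2 * (LINT x|M. f x * g x) + (norm2 M g)\<^sup>2"
    using assms L2_mult_integrable[OF assms] by (simp add: L2_def norm2_square)
  also have "\<dots> \<le> (norm2 M f + norm2 M g)\<^sup>2"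
    using L2_Cauchy_Schwarz[OF assms] by (simp add: power2_sum)
  finally show "(norm2 M (\<lambda>x. f x + g x))\<^sup>2 \<le> (norm2 M f + norm2 M g)\<^sup>2" .
qed (simp add: norm2_nonneg)

lemma norm2_uminus: "norm2 M (\<lambda>x. - f x) = norm2 M f"
  by (simp add: norm2_def)

lemma norm2_triangle_diff:
  assumes "L2 M f" "L2 M g"
  shows "norm2 M (\<lambda>x. f x - g x) \<le> norm2 M f + norm2 M g"
  using norm2_triangle[OF assms(1) L2_uminus[OF assms(2)]] by (simp add: norm2_uminus)

section \<open>Affine substitutions\<close>

lemma
  fixes f :: "'a::euclidean_space \<Rightarrow> real"
  assumes c: "c \<noteq> 0" and f: "integrable lborel f"
  shows integrable_lborel_affine: "integrable lborel (\<lambda>x. f (t + c *\<^sub>R x))"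
    and integral_lborel_affine: "(LINT x|lborel. f (t + c *\<^sub>R x)) = integral\<^sup>L lborel f / \<bar>c\<bar> ^ DIM('a)"
proof -
  have fm[measurable]: "f \<in> borel_measurable borel" using f by auto
  let ?D = "density (distr lborel borel (\<lambda>x. t + c *\<^sub>R x)) (\<lambda>_. ennreal (\<bar>c\<bar> ^ DIM('a)))"
  have eq: "lborel = ?D" by (rule lborel_affine[OF c])
  have "integrable ?D f" using f by (subst eq[symmetric])
  then have "integrable lborel (\<lambda>x. \<bar>c\<bar> ^ DIM('a) * f (t + c *\<^sub>R x))"
    by (subst (asm) integrable_density) (auto simp: integrable_distr_eq)
  then show "integrable lborel (\<lambda>x. f (t + c *\<^sub>R x))" using c by simp
  have "integral\<^sup>L lborel f = integral\<^sup>L ?D f" by (subst eq[symmetric]) (rule refl)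
  also have "\<dots> = \<bar>c\<bar> ^ DIM('a) * (LINT x|lborel. f (t + c *\<^sub>R x))"
    by (subst integral_density) (auto simp: integral_distr)
  finally show "(LINT x|lborel. f (t + c *\<^sub>R x)) = integral\<^sup>L lborel f / \<bar>c\<bar> ^ DIM('a)"
    using c by (simp add: field_simps)
qed

lemma
  fixes f :: "'a::euclidean_space \<Rightarrow> real"
  assumes "integrable lborel f"
  shows integrable_lborel_translate: "integrable lborel (\<lambda>x. f (x - y))"
    and integral_lborel_translate: "(LINT x|lborel. f (x - y)) = integral\<^sup>L lborel f"
    and integrable_lborel_reflect: "integrable lborel (\<lambda>x. f (y - x))"
    and integral_lborel_reflect: "(LINT x|lborel. f (y - x)) = integral\<^sup>L lborel f"
  using integrable_lborel_affine[of 1 f "-y"] integral_lborel_affine[of 1 f "-y"]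
    integrable_lborel_affine[of "-1" f y] integral_lborel_affine[of "-1" f y] assms by simp_all

section \<open>Convolution with bounded kernels\<close>

definition conv :: "('a::euclidean_space \<Rightarrow> real) \<Rightarrow> ('a \<Rightarrow> real) \<Rightarrow> 'a \<Rightarrow> real" where
  "conv K v x = (LINT y|lborel. K (x - y) * v y)"

lemma conv_measurable [measurable]:
  assumes [measurable]: "K \<in> borel_measurable borel" "v \<in> borel_measurable borel"
  shows "conv K v \<in> borel_measurable borel"
  unfolding conv_def[abs_def] by measurable

lemma bounded_mult_integrable:
  fixes K :: "'a \<Rightarrow> real"
  assumes "integrable M v" "K \<in> borel_measurable M" "\<And>x. \<bar>K x\<bar> \<le> B"
  shows "integrable M (\<lambda>x. K x * v x)"
proof (rule Bochner_Integration.integrable_bound)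
  show "integrable M (\<lambda>x. B * v x)" using assms by simp
  have "\<bar>K x\<bar> * \<bar>v x\<bar> \<le> \<bar>B\<bar> * \<bar>v x\<bar>" for x
    using assms(3)[of x] by (intro mult_right_mono) auto
  then show "AE x in M. norm (K x * v x) \<le> norm (B * v x)" by (simp add: abs_mult)
qed (use assms in auto)

lemma conv_integrand:
  fixes K v :: "'a::euclidean_space \<Rightarrow> real"
  assumes [measurable]: "K \<in> borel_measurable borel" and "\<And>x. \<bar>K x\<bar> \<le> B" "integrable lborel v"
  shows "integrable lborel (\<lambda>y. K (x - y) * v y)"
  by (rule bounded_mult_integrable[where B=B]) (use assms in auto)

lemma conv_bound:
  assumes K: "K \<in> borel_measurable borel" "\<And>x. \<bar>K x\<bar> \<le> B" and v: "integrable lborel v"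
  shows "\<bar>conv K v x\<bar> \<le> B * (LINT y|lborel. \<bar>v y\<bar>)"
proof -
  have "\<bar>conv K v x\<bar> \<le> (LINT y|lborel. \<bar>K (x - y) * v y\<bar>)" unfolding conv_def by (rule integral_abs_bound)
  also have "\<dots> \<le> (LINT y|lborel. B * \<bar>v y\<bar>)"
    using integrable_abs[OF conv_integrand[OF K v, of x]] v K(2)
    by (intro integral_mono) (auto simp: abs_mult intro!: mult_right_mono)
  finally show ?thesis by simp
qed

lemma conv_diff_kernel:
  assumes "K1 \<in> borel_measurable borel" "\<And>x. \<bar>K1 x\<bar> \<le> B1"
    "K2 \<in> borel_measurable borel" "\<And>x. \<bar>K2 x\<bar> \<le> B2" "integrable lborel v"
  shows "conv (\<lambda>x. K1 x - K2 x) v x = conv K1 v x - conv K2 v x"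
  unfolding conv_def left_diff_distrib
  by (intro Bochner_Integration.integral_diff conv_integrand[OF assms(1,2,5)] conv_integrand[OF assms(3,4,5)])

lemma conv_diff:
  assumes "K \<in> borel_measurable borel" "\<And>x. \<bar>K x\<bar> \<le> B" "integrable lborel v" "integrable lborel w"
  shows "conv K (\<lambda>y. v y - w y) x = conv K v x - conv K w x"
  unfolding conv_def right_diff_distrib
  by (intro Bochner_Integration.integral_diff conv_integrand[OF assms(1,2,3)] conv_integrand[OF assms(1,2,4)])

lemma pair_mult_integrable:
  fixes f :: "'a::euclidean_space \<Rightarrow> real" and g :: "'b::euclidean_space \<Rightarrow> real"
  assumes f: "integrable lborel f" and g: "integrable lborel g"
  shows "integrable (lborel \<Otimes>\<^sub>M lborel) (\<lambda>(y, x). f y * g x)"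
proof (rule lborel_pair.Fubini_integrable)
  have [measurable]: "f \<in> borel_measurable borel" "g \<in> borel_measurable borel" using f g by auto
  show "(\<lambda>(y, x). f y * g x) \<in> borel_measurable (lborel \<Otimes>\<^sub>M lborel)" by measurable
  have "(\<lambda>y. LINT x|lborel. norm (case (y, x) of (y, x) \<Rightarrow> f y * g x)) = (\<lambda>y. \<bar>f y\<bar> * (LINT x|lborel. \<bar>g x\<bar>))"
    by (simp add: abs_mult)
  then show "integrable lborel (\<lambda>y. LINT x|lborel. norm (case (y, x) of (y, x) \<Rightarrow> f y * g x))"
    using f by simp
  show "AE y in lborel. integrable lborel (\<lambda>x. case (y, x) of (y, x) \<Rightarrow> f y * g x)"
    using g by simp
qed

text \<open>All double integrals below converge because their integrands are bounded multiples of \<open>\<bar>a (x - y)\<bar> * \<bar>f y\<bar>\<close>.\<close>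

lemma conv_pair_integrable:
  fixes a f :: "'a::euclidean_space \<Rightarrow> real" and g :: "'a \<times> 'a \<Rightarrow> real"
  assumes a: "integrable lborel a" and f: "integrable lborel f"
    and g[measurable]: "g \<in> borel_measurable borel" and B: "\<And>z. \<bar>g z\<bar> \<le> B"
  shows "integrable (lborel \<Otimes>\<^sub>M lborel) (\<lambda>(y, x). a (x - y) * f y * g (x, y))"
proof -
  have [measurable]: "a \<in> borel_measurable borel" "f \<in> borel_measurable borel" using a f by auto
  have g2[measurable]: "g \<in> borel_measurable (borel \<Otimes>\<^sub>M borel)" using g by (simp add: borel_prod)
  have 0: "integrable (lborel \<Otimes>\<^sub>M lborel) (\<lambda>(y, x). a (x - y) * f y)"
  proof (rule lborel_pair.Fubini_integrable)
    have "(\<lambda>y. LINT x|lborel. norm (case (y, x) of (y, x) \<Rightarrow> a (x - y) * f y)) = 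
       (\<lambda>y. (LINT x|lborel. \<bar>a x\<bar>) * \<bar>f y\<bar>)"
      using integral_lborel_translate[OF integrable_abs[OF a]] by (simp add: abs_mult)
    then show "integrable lborel (\<lambda>y. LINT x|lborel. norm (case (y, x) of (y, x) \<Rightarrow> a (x - y) * f y))"
      using f by simp
    show "AE y in lborel. integrable lborel (\<lambda>x. case (y, x) of (y, x) \<Rightarrow> a (x - y) * f y)"
      using integrable_lborel_translate[OF a] by simp
  qed measurable
  show ?thesis
  proof (rule Bochner_Integration.integrable_bound)
    show "integrable (lborel \<Otimes>\<^sub>M lborel) (\<lambda>z. B * (case z of (y, x) \<Rightarrow> a (x - y) * f y))"
      using 0 by simp
    have "\<bar>a (x - y) * f y\<bar> * \<bar>g (x, y)\<bar> \<le> \<bar>a (x - y) * f y\<bar> * \<bar>B\<bar>" for x y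
      using B[of "(x, y)"] by (intro mult_left_mono) auto
    then show "AE z in lborel \<Otimes>\<^sub>M lborel. norm (case z of (y, x) \<Rightarrow> a (x - y) * f y * g (x, y))
        \<le> norm (B * (case z of (y, x) \<Rightarrow> a (x - y) * f y))"
      by (auto simp: abs_mult mult_ac)
  qed measurable
qed

lemma
  fixes a f :: "'a::euclidean_space \<Rightarrow> real" and g :: "'a \<Rightarrow> real"
  assumes a: "integrable lborel a" and f: "integrable lborel f"
  shows conv_integrable: "integrable lborel (conv a f)"
    and conv_norm1: "(LINT x|lborel. \<bar>conv a f x\<bar>) \<le> (LINT x|lborel. \<bar>a x\<bar>) * (LINT x|lborel. \<bar>f x\<bar>)"
proof -
  have [measurable]: "a \<in> borel_measurable borel" "f \<in> borel_measurable borel" using a f by auto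
  have 1: "integrable (lborel \<Otimes>\<^sub>M lborel) (\<lambda>(y, x). a (x - y) * f y)"
    using conv_pair_integrable[OF a f, of "\<lambda>_. 1" 1] by simp
  have 2: "integrable (lborel \<Otimes>\<^sub>M lborel) (\<lambda>(y, x). \<bar>a (x - y)\<bar> * \<bar>f y\<bar>)"
    using conv_pair_integrable[OF integrable_abs[OF a] integrable_abs[OF f], of "\<lambda>_. 1" 1] by simp
  show i: "integrable lborel (conv a f)"
    using lborel_pair.integrable_snd[OF 1] unfolding conv_def[abs_def] .
  have "(LINT x|lborel. \<bar>conv a f x\<bar>) \<le> (LINT x|lborel. LINT y|lborel. \<bar>a (x - y)\<bar> * \<bar>f y\<bar>)"
  proof (rule integral_mono_AE)
    show "integrable lborel (\<lambda>x. \<bar>conv a f x\<bar>)" using i by simp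
    show "integrable lborel (\<lambda>x. LINT y|lborel. \<bar>a (x - y)\<bar> * \<bar>f y\<bar>)"
      using lborel_pair.integrable_snd[OF 2] .
    show "AE x in lborel. \<bar>conv a f x\<bar> \<le> (LINT y|lborel. \<bar>a (x - y)\<bar> * \<bar>f y\<bar>)"
      using integral_abs_bound[of lborel] by (auto simp: conv_def abs_mult[symmetric])
  qed
  also have "\<dots> = (LINT y|lborel. LINT x|lborel. \<bar>a (x - y)\<bar> * \<bar>f y\<bar>)"
    by (rule lborel_pair.Fubini_integral[OF 2])
  also have "\<dots> = (LINT x|lborel. \<bar>a x\<bar>) * (LINT x|lborel. \<bar>f x\<bar>)"
    using integral_lborel_translate[OF integrable_abs[OF a]] by simp
  finally show "(LINT x|lborel. \<bar>conv a f x\<bar>) \<le> (LINT x|lborel. \<bar>a x\<bar>) * (LINT x|lborel. \<bar>f x\<bar>)" .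
qed

lemma conv_swap:
  fixes a f :: "'a::euclidean_space \<Rightarrow> real" and g :: "'a \<Rightarrow> real"
  assumes a: "integrable lborel a" and f: "integrable lborel f"
    and g[measurable]: "g \<in> borel_measurable borel" and B: "\<And>z. \<bar>g z\<bar> \<le> B"
  shows "(LINT x|lborel. conv a f x * g x) = (LINT y|lborel. f y * (LINT x|lborel. a (x - y) * g x))"
proof -
  have 1: "integrable (lborel \<Otimes>\<^sub>M lborel) (\<lambda>(y, x). a (x - y) * f y * g x)"
    using conv_pair_integrable[OF a f, of "\<lambda>(x, y). g x" B] B by (simp add: borel_prod[symmetric] split: prod.splits)
  have "(LINT x|lborel. conv a f x * g x) = (LINT x|lborel. LINT y|lborel. a (x - y) * f y * g x)"
    by (simp add: conv_def)
  also have "\<dots> = (LINT y|lborel. LINT x|lborel. a (x - y) * f y * g x)"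
    by (rule lborel_pair.Fubini_integral[OF 1])
  also have "\<dots> = (LINT y|lborel. f y * (LINT x|lborel. a (x - y) * g x))"
    by (intro Bochner_Integration.integral_cong refl, subst integral_mult_right_zero[symmetric])
       (auto intro!: Bochner_Integration.integral_cong simp: mult_ac)
  finally show ?thesis .
qed

text \<open>The inner product of two convolutions depends on the kernels only through the
  correlations of their translates. Identities between such correlations, proved for smooth kernels,
  therefore transfer to convolutions with data that are merely integrable.\<close>

lemma conv_conv_integral:
  fixes a b f v :: "'a::euclidean_space \<Rightarrow> real"
  assumes a: "integrable lborel a" and f: "integrable lborel f" and v: "integrable lborel v"
    and b[measurable]: "b \<in> borel_measurable borel" and B: "\<And>z. \<bar>b z\<bar> \<le> B"
  shows "(LINT x|lborel. conv a f x * conv b v x) =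
    (LINT y|lborel. f y * (LINT z|lborel. v z * (LINT x|lborel. a (x - y) * b (x - z))))"
proof -
  have [measurable]: "a \<in> borel_measurable borel" "v \<in> borel_measurable borel" using a v by auto
  have "(LINT x|lborel. conv a f x * conv b v x) =
      (LINT y|lborel. f y * (LINT x|lborel. a (x - y) * conv b v x))"
    using conv_bound[OF b B v] by (intro conv_swap[OF a f]) auto
  moreover have "(LINT x|lborel. a (x - y) * conv b v x) =
      (LINT z|lborel. v z * (LINT x|lborel. a (x - y) * b (x - z)))" for y
  proof -
    have 1: "integrable (lborel \<Otimes>\<^sub>M lborel) (\<lambda>(z, x). a (x - y) * b (x - z) * v z)"
    proof (rule Bochner_Integration.integrable_bound)
      have "integrable (lborel \<Otimes>\<^sub>M lborel) (\<lambda>(z, x). v z * a (x - y))"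
        by (rule pair_mult_integrable[OF v integrable_lborel_translate[OF a, of y]])
      then show "integrable (lborel \<Otimes>\<^sub>M lborel) (\<lambda>p. B * (case p of (z, x) \<Rightarrow> v z * a (x - y)))" by simp
      have "\<bar>v z * a (x - y)\<bar> * \<bar>b (x - z)\<bar> \<le> \<bar>v z * a (x - y)\<bar> * \<bar>B\<bar>" for x z
        using B[of "x - z"] by (intro mult_left_mono) auto
      then show "AE p in lborel \<Otimes>\<^sub>M lborel. norm (case p of (z, x) \<Rightarrow> a (x - y) * b (x - z) * v z)
        \<le> norm (B * (case p of (z, x) \<Rightarrow> v z * a (x - y)))"
        by (auto simp: abs_mult mult_ac)
    qed measurable
    have "(LINT x|lborel. a (x - y) * conv b v x) = (LINT x|lborel. LINT z|lborel. a (x - y) * b (x - z) * v z)"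
      by (simp add: conv_def mult.assoc)
    also have "\<dots> = (LINT z|lborel. LINT x|lborel. a (x - y) * b (x - z) * v z)"
      by (rule lborel_pair.Fubini_integral[OF 1])
    also have "\<dots> = (LINT z|lborel. v z * (LINT x|lborel. a (x - y) * b (x - z)))"
      by (simp add: mult.commute)
    finally show ?thesis .
  qed
  ultimately show ?thesis by simp
qed

lemma conv_selfadjoint:
  fixes \<eta> f g :: "'a::euclidean_space \<Rightarrow> real"
  assumes \<eta>: "integrable lborel \<eta>" "\<And>x. \<bar>\<eta> x\<bar> \<le> B" "\<And>x. \<eta> (- x) = \<eta> x"
    and f: "integrable lborel f" and g: "integrable lborel g"
  shows "(LINT x|lborel. conv \<eta> f x * g x) = (LINT x|lborel. f x * conv \<eta> g x)"
proof -
  have [measurable]: "\<eta> \<in> borel_measurable borel" "f \<in> borel_measurable borel" "g \<in> borel_measurable borel"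
    using \<eta> f g by auto
  have 1: "integrable (lborel \<Otimes>\<^sub>M lborel) (\<lambda>(y, x). \<eta> (x - y) * f y * g x)"
  proof (rule Bochner_Integration.integrable_bound)
    have "integrable (lborel \<Otimes>\<^sub>M lborel) (\<lambda>(y, x). f y * g x)"
      by (rule pair_mult_integrable[OF f g])
    then show "integrable (lborel \<Otimes>\<^sub>M lborel) (\<lambda>p. B * (case p of (y, x) \<Rightarrow> f y * g x))" by simp
    have "\<bar>f y * g x\<bar> * \<bar>\<eta> (x - y)\<bar> \<le> \<bar>f y * g x\<bar> * \<bar>B\<bar>" for x y
      using \<eta>(2)[of "x - y"] by (intro mult_left_mono) auto
    then show "AE p in lborel \<Otimes>\<^sub>M lborel. norm (case p of (y, x) \<Rightarrow> \<eta> (x - y) * f y * g x)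
        \<le> norm (B * (case p of (y, x) \<Rightarrow> f y * g x))"
      by (auto simp: abs_mult mult_ac)
  qed measurable
  have "(LINT x|lborel. conv \<eta> f x * g x) = (LINT x|lborel. LINT y|lborel. \<eta> (x - y) * f y * g x)"
    by (simp add: conv_def)
  also have "\<dots> = (LINT y|lborel. LINT x|lborel. \<eta> (x - y) * f y * g x)"
    by (rule lborel_pair.Fubini_integral[OF 1])
  also have "\<dots> = (LINT y|lborel. f y * conv \<eta> g y)"
  proof (intro Bochner_Integration.integral_cong refl)
    fix y
    have "\<eta> (x - y) * f y * g x = f y * (\<eta> (y - x) * g x)" for x
      using \<eta>(3)[of "x - y"] by simp
    then have "(LINT x|lborel. \<eta> (x - y) * f y * g x) = (LINT x|lborel. f y * (\<eta> (y - x) * g x))" by presburger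
    then show "(LINT x|lborel. \<eta> (x - y) * f y * g x) = f y * conv \<eta> g y"
      by (simp add: conv_def)
  qed
  finally show ?thesis .
qed

lemma conv_L2:
  fixes a v :: "'a::euclidean_space \<Rightarrow> real"
  assumes a: "integrable lborel a" "\<And>x. \<bar>a x\<bar> \<le> B" and v: "integrable lborel v" "L2 lborel v"
  shows "L2 lborel (conv a v)" and "norm2 lborel (conv a v) \<le> (LINT x|lborel. \<bar>a x\<bar>) * norm2 lborel v"
proof -
  have [measurable]: "a \<in> borel_measurable borel" "v \<in> borel_measurable borel" using a v by auto
  show L: "L2 lborel (conv a v)"
    by (rule L2_bounded_integrable[OF conv_integrable[OF a(1) v(1)] conv_bound[OF _ a(2) v(1)]]) measurable
  have v2: "integrable lborel (\<lambda>y. (v y)\<^sup>2)" using v by (simp add: L2_def)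
  let ?A = "LINT x|lborel. \<bar>a x\<bar>"
  have pt: "(conv a v x)\<^sup>2 \<le> ?A * conv (\<lambda>y. \<bar>a y\<bar>) (\<lambda>y. (v y)\<^sup>2) x" for x
  proof -
    \<comment> \<open>The kernel is split evenly: Cauchy-Schwarz for \<open>?f\<close> and
      \<open>?g\<close> leaves one factor equal to the L^1 norm of \<open>a\<close> and the other a
      convolution of |a| with v^2, to which the L^1 bound applies.\<close>
    let ?f = "\<lambda>y. sqrt \<bar>a (x - y)\<bar>" and ?g = "\<lambda>y. sqrt \<bar>a (x - y)\<bar> * \<bar>v y\<bar>"
    have f: "L2 lborel ?f" using integrable_lborel_reflect[OF integrable_abs[OF a(1)], of x] by (simp add: L2_def)
    have g: "L2 lborel ?g"
      using conv_integrand[of "\<lambda>x. \<bar>a x\<bar>" B "\<lambda>y. (v y)\<^sup>2" x] a v2 by (simp add: L2_def power_mult_distrib)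
    have "\<bar>conv a v x\<bar> \<le> (LINT y|lborel. \<bar>a (x - y) * v y\<bar>)" unfolding conv_def by (rule integral_abs_bound)
    also have "\<dots> = (LINT y|lborel. ?f y * ?g y)" by (simp add: abs_mult mult.assoc[symmetric])
    also have "\<dots> \<le> norm2 lborel ?f * norm2 lborel ?g" using L2_Cauchy_Schwarz[OF f g] by linarith
    finally have "\<bar>conv a v x\<bar>\<^sup>2 \<le> (norm2 lborel ?f * norm2 lborel ?g)\<^sup>2" by (intro power_mono) auto
    also have "\<dots> = (LINT y|lborel. \<bar>a (x - y)\<bar>) * conv (\<lambda>y. \<bar>a y\<bar>) (\<lambda>y. (v y)\<^sup>2) x"
      by (simp add: power_mult_distrib norm2_square conv_def)
    also have "(LINT y|lborel. \<bar>a (x - y)\<bar>) = ?A" by (rule integral_lborel_reflect[OF integrable_abs[OF a(1)]])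
    finally show ?thesis by simp
  qed
  note ci = conv_integrable[OF integrable_abs[OF a(1)] v2]
  have "(norm2 lborel (conv a v))\<^sup>2 \<le> (LINT x|lborel. ?A * conv (\<lambda>y. \<bar>a y\<bar>) (\<lambda>y. (v y)\<^sup>2) x)"
    unfolding norm2_square using L ci pt by (intro integral_mono) (auto simp: L2_def)
  also have "\<dots> = ?A * (LINT x|lborel. conv (\<lambda>y. \<bar>a y\<bar>) (\<lambda>y. (v y)\<^sup>2) x)" by simp
  also have "\<dots> \<le> ?A * (LINT x|lborel. \<bar>conv (\<lambda>y. \<bar>a y\<bar>) (\<lambda>y. (v y)\<^sup>2) x\<bar>)"
    using ci by (intro mult_left_mono integral_mono) auto
  also have "\<dots> \<le> ?A * (?A * (norm2 lborel v)\<^sup>2)"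
    using conv_norm1[OF integrable_abs[OF a(1)] v2] by (intro mult_left_mono) (auto simp: norm2_square)
  finally have "(norm2 lborel (conv a v))\<^sup>2 \<le> (?A * norm2 lborel v)\<^sup>2"
    by (simp add: power_mult_distrib power2_eq_square mult_ac)
  then show "norm2 lborel (conv a v) \<le> ?A * norm2 lborel v"
    by (rule power2_le_imp_le) (simp add: norm2_nonneg)
qed

section \<open>The regularised fundamental solution\<close>

lemma Ck_on_differentiable_at: "Ck_on (Suc k) UNIV f \<Longrightarrow> f differentiable (at x)"
  by (simp add: differentiable_on_def)

lemma pd_cmult:
  assumes "f differentiable (at x)"
  shows "pd i (\<lambda>x. c * f x) x = c * pd i f x"
  using pd_mult[OF differentiable_const[of c] assms, of i] by simp

lemma pd_diff:
  assumes "f differentiable (at x)" "g differentiable (at x)"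
  shows "pd i (\<lambda>x. f x - g x) x = pd i f x - pd i g x"
  using pd_eqI[OF has_derivative_diff[OF assms[THEN differentiable_at_has_pd]]] by (simp add: pd_def)

lemma pd_coord: "pd k (\<lambda>x. x $ m) x = (if k = m then 1 else 0)"
  using pd_eqI[OF bounded_linear_imp_has_derivative[OF bounded_linear_vec_nth[of m]], of k x]
  by (simp add: axis_def)

text \<open>The squared distance to the origin, regularised at the scale \<open>s\<close>; powers of
  it replace the singular powers of |x| in the fundamental solution.\<close>

definition qf :: "real \<Rightarrow> real^'d::finite \<Rightarrow> real" where
  "qf s x = s\<^sup>2 + x \<bullet> x"

lemma qf_pos: "s > 0 \<Longrightarrow> qf s x > 0"
  by (simp add: qf_def add_pos_nonneg)

lemma qf_ge: "qf s x \<ge> s\<^sup>2"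
  by (simp add: qf_def)

lemma qf_mono: "0 \<le> s \<Longrightarrow> s \<le> t \<Longrightarrow> qf s x \<le> qf t x"
  by (simp add: qf_def)

text \<open>The bookkeeping rule of all decay estimates below: a coordinate factor costs one half in
  the exponent of \<open>qf\<close>.\<close>

lemma coord_le_qf: "\<bar>x $ m\<bar> \<le> qf s x powr (1 / 2)"
proof -
  have "\<bar>x $ m\<bar> \<le> norm x" by (rule component_le_norm_cart)
  also have "\<dots> = sqrt (x \<bullet> x)" by (rule norm_eq_sqrt_inner)
  also have "\<dots> \<le> sqrt (qf s x)" by (simp add: qf_def)
  also have "\<dots> = qf s x powr (1 / 2)" by (rule powr_half_sqrt[symmetric]) (simp add: qf_def)
  finally show ?thesis .
qed

lemma Ck_on_qf: "Ck_on k UNIV (qf s)"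
proof -
  have "Ck_on k UNIV (\<lambda>x. s\<^sup>2 + (\<Sum>i\<in>UNIV. x $ i * x $ i))"
    by (intro Ck_on_add Ck_on_const Ck_on_sum Ck_on_mult Ck_on_coord) auto
  then show ?thesis by (simp add: qf_def[abs_def] inner_vec_def)
qed

lemma Ck_on_qf_powr: "s > 0 \<Longrightarrow> Ck_on k UNIV (\<lambda>x. qf s x powr a)"
  by (rule Ck_on_powr) (auto simp: qf_pos Ck_on_qf)

lemma qf_powr_measurable [measurable]: "(\<lambda>x. qf s x powr a) \<in> borel_measurable borel"
  unfolding qf_def by measurable

lemma pd_qf_powr:
  fixes x :: "real^'d::finite"
  assumes "s > 0"
  shows "pd k (\<lambda>x. qf s x powr a) x = 2 * a * x $ k * qf s x powr (a - 1)"
proof -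
  have 1: "(qf s has_derivative (\<lambda>h. 2 * (x \<bullet> h))) (at x)"
    unfolding qf_def[abs_def] by (auto intro!: derivative_eq_intros simp: inner_commute)
  have "((\<lambda>t. t powr a) has_real_derivative a * qf s x powr (a - 1)) (at (qf s x))"
    using qf_pos[OF assms, of x] by (rule has_real_derivative_powr)
  from has_derivative_compose[OF 1 this[unfolded has_field_derivative_def]]
  have "((\<lambda>x. qf s x powr a) has_derivative (\<lambda>h. a * qf s x powr (a - 1) * (2 * (x \<bullet> h)))) (at x)" .
  from pd_eqI[OF this, of k] show ?thesis by (simp add: inner_axis)
qed

subsection \<open>Integrability of powers\<close>

text \<open>The one-dimensional factor for \<open>qf_powr_integrable\<close>. The condition on
  \<open>\<beta>\<close> is integrability of t^(-2\<beta>) at infinity.\<close>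

lemma one_plus_square_powr_nn_integral:
  assumes "\<beta> > 1 / 2"
  shows "(\<integral>\<^sup>+t. ennreal ((1 + t\<^sup>2) powr (- \<beta>)) \<partial>lborel) < \<infinity>"
proof -
  let ?f = "\<lambda>t::real. (1 + t\<^sup>2) powr (- \<beta>)"
  have 1: "(\<integral>\<^sup>+t. ennreal (t powr (- 2 * \<beta>)) * indicator {1..} t \<partial>lborel)
      = ennreal (0 - 1 powr (1 - 2 * \<beta>) / (1 - 2 * \<beta>))"
  proof (rule nn_integral_FTC_atLeast[where F="\<lambda>t. t powr (1 - 2 * \<beta>) / (1 - 2 * \<beta>)" and a=1 and T=0])
    show "DERIV (\<lambda>t. t powr (1 - 2 * \<beta>) / (1 - 2 * \<beta>)) t :> t powr (- 2 * \<beta>)" if "1 \<le> t" for t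
      using DERIV_cdivide[OF has_real_derivative_powr[of t "1 - 2 * \<beta>"], of "1 - 2 * \<beta>"] that assms by simp
    have "((\<lambda>t. t powr (1 - 2 * \<beta>)) \<longlongrightarrow> 0) at_top"
      using assms by (intro tendsto_neg_powr filterlim_ident) auto
    then show "((\<lambda>t. t powr (1 - 2 * \<beta>) / (1 - 2 * \<beta>)) \<longlongrightarrow> 0) at_top"
      using tendsto_divide_zero by blast
  qed auto
  have 2: "?f t \<le> t powr (- 2 * \<beta>)" if "t \<ge> 1" for t
  proof -
    have "(1 + t\<^sup>2) powr (- \<beta>) \<le> (t\<^sup>2) powr (- \<beta>)"
      using that assms by (intro powr_mono2') auto
    also have "\<dots> = t powr (- 2 * \<beta>)" using that by (simp add: powr_powr flip: powr_numeral)
    finally show ?thesis .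
  qed
  have 3: "?f t \<le> 1" for t using assms powr_mono2'[of "-\<beta>" 1 "1 + t\<^sup>2"] by simp
  have h: "(\<integral>\<^sup>+t. ennreal (?f t) * indicator {0..} t \<partial>lborel) < \<infinity>"
  proof -
    have "(\<integral>\<^sup>+t. ennreal (?f t) * indicator {0..} t \<partial>lborel) \<le>
      (\<integral>\<^sup>+t. indicator {0..<1::real} t + ennreal (t powr (- 2 * \<beta>)) * indicator {1..} t \<partial>lborel)"
      using 2 3 by (intro nn_integral_mono) (auto simp: indicator_def intro: order_trans ennreal_leI)
    also have "\<dots> = 1 + ennreal (0 - 1 powr (1 - 2 * \<beta>) / (1 - 2 * \<beta>))"
      by (subst nn_integral_add, simp, simp, unfold 1, simp)
    finally show ?thesis by (rule order_le_less_trans) simp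
  qed
  have h': "(\<integral>\<^sup>+t. ennreal (?f t) * indicator {..0} t \<partial>lborel) =
      (\<integral>\<^sup>+t. ennreal (?f t) * indicator {0..} t \<partial>lborel)"
    by (subst nn_integral_real_affine[where c="-1" and t=0]) (auto simp: indicator_def)
  have "(\<integral>\<^sup>+t. ennreal (?f t) \<partial>lborel) \<le>
      (\<integral>\<^sup>+t. ennreal (?f t) * indicator {..0} t + ennreal (?f t) * indicator {0..} t \<partial>lborel)"
    by (intro nn_integral_mono) (auto simp: indicator_def)
  also have "\<dots> = (\<integral>\<^sup>+t. ennreal (?f t) * indicator {..0} t \<partial>lborel) + 
      (\<integral>\<^sup>+t. ennreal (?f t) * indicator {0..} t \<partial>lborel)"
    by (rule nn_integral_add) auto
  also have "\<dots> < \<infinity>" using h h' by simp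
  finally show ?thesis .
qed

text \<open>Since 1 + |x|^2 dominates 1 plus the square of each coordinate, the power is bounded by
  a product over the coordinates, each with exponent a / d. Tonelli reduces the claim to dimension
  one, and a > d / 2 becomes a / d > 1 / 2.\<close>

lemma qf_powr_integrable:
  assumes s: "s > 0" and a: "a > real CARD('d) / 2"
  shows "integrable lborel (\<lambda>x::real^'d::finite. qf s x powr (- a))"
proof (rule integrableI_bounded)
  let ?D = "real CARD('d)"
  \<comment> \<open>With this constant c (1 + |x|^2) is at most \<open>qf s x\<close>, which reduces
    the estimate to the scale 1.\<close>
  define c where "c = min 1 (s\<^sup>2)"
  have c: "c > 0" using s by (simp add: c_def)
  have D: "?D > 0" by simp
  let ?\<beta> = "a / ?D"
  have \<beta>: "?\<beta> > 1 / 2" using a D by (simp add: field_simps)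
  have bd: "qf s x powr (- a) \<le> c powr (- a) * (\<Prod>b\<in>Basis. (1 + (x \<bullet> b)\<^sup>2) powr (- ?\<beta>))" for x :: "real^'d"
  proof -
    have "c * (1 + x \<bullet> x) \<le> qf s x"
      using mult_right_mono[of c 1 "x \<bullet> x"] by (auto simp: qf_def c_def distrib_left)
    moreover have "0 < c * (1 + x \<bullet> x)" using c by (intro mult_pos_pos add_pos_nonneg) auto
    moreover have "- a \<le> 0" using a D by linarith
    ultimately have "qf s x powr (- a) \<le> (c * (1 + x \<bullet> x)) powr (- a)"
      by (intro powr_mono2')
    also have "\<dots> = c powr (- a) * (1 + x \<bullet> x) powr (- a)" by (rule powr_mult)
    also have "\<dots> \<le> c powr (- a) * (\<Prod>b\<in>Basis. (1 + (x \<bullet> b)\<^sup>2) powr (- ?\<beta>))"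
    proof (rule mult_left_mono)
    have "(1 + x \<bullet> x) powr (- a) = (\<Prod>b\<in>(Basis :: (real^'d) set). (1 + x \<bullet> x) powr (- ?\<beta>))"
      by (simp add: powr_powr flip: powr_realpow')
    also have "\<dots> \<le> (\<Prod>b\<in>Basis. (1 + (x \<bullet> b)\<^sup>2) powr (- ?\<beta>))"
    proof (intro prod_mono conjI powr_mono2')
      fix b :: "real^'d" assume b: "b \<in> Basis"
      have "(x \<bullet> b)\<^sup>2 \<le> (norm x)\<^sup>2" using power_mono[OF Basis_le_norm[OF b, of x], of 2] by simp
      then show "1 + (x \<bullet> b)\<^sup>2 \<le> 1 + x \<bullet> x" by (simp add: power2_norm_eq_inner)
    qed (use \<beta> in \<open>auto intro: add_pos_nonneg\<close>)
    finally show "(1 + x \<bullet> x) powr (- a) \<le> (\<Prod>b\<in>Basis. (1 + (x \<bullet> b)\<^sup>2) powr (- ?\<beta>))" .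
    qed simp
    finally show ?thesis .
  qed
  have "(\<integral>\<^sup>+(x::real^'d). norm (qf s x powr (- a)) \<partial>lborel) \<le>
    (\<integral>\<^sup>+(x::real^'d). ennreal (c powr (- a)) * (\<Prod>b\<in>Basis. ennreal ((1 + (x \<bullet> b)\<^sup>2) powr (- ?\<beta>))) \<partial>lborel)"
    using bd by (intro nn_integral_mono) (simp add: prod_ennreal ennreal_mult[symmetric] prod_nonneg ennreal_leI)
  also have "\<dots> = ennreal (c powr (- a)) * (\<Prod>b\<in>(Basis :: (real^'d) set). (\<integral>\<^sup>+t. ennreal ((1 + t\<^sup>2) powr (- ?\<beta>)) \<partial>lborel))"
  proof (subst nn_integral_cmult)
    show "ennreal (c powr (- a)) * (\<integral>\<^sup>+(x::real^'d). (\<Prod>b\<in>Basis. ennreal ((1 + (x \<bullet> b)\<^sup>2) powr (- ?\<beta>))) \<partial>lborel) =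
      ennreal (c powr (- a)) * (\<Prod>b\<in>(Basis :: (real^'d) set). (\<integral>\<^sup>+t. ennreal ((1 + t\<^sup>2) powr (- ?\<beta>)) \<partial>lborel))"
      by (subst nn_integral_lborel_prod[where f="\<lambda>b t. ennreal ((1 + t\<^sup>2) powr (- ?\<beta>))"]) auto
  qed measurable
  also have "\<dots> < \<infinity>"
    using one_plus_square_powr_nn_integral[OF \<beta>] 
    by (auto simp: ennreal_mult_less_top power_less_top_ennreal)
  finally show "(\<integral>\<^sup>+(x::real^'d). norm (qf s x powr (- a)) \<partial>lborel) < \<infinity>" .
qed measurable

lemma powr_neg_diff_bound:
  fixes u v :: real
  assumes "0 < u" "u \<le> v" "a > 0"
  shows "\<bar>u powr (- a) - v powr (- a)\<bar> \<le> a * (v - u) * u powr (- a - 1)"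
proof (cases "u = v")
  case False
  then have "u < v" using assms by simp
  moreover have "((\<lambda>t. t powr (- a)) has_real_derivative - a * t powr (- a - 1)) (at t)" if "u \<le> t" "t \<le> v" for t
    using that assms by (intro has_real_derivative_powr) auto
  ultimately obtain z where z: "u < z" "z < v" "v powr (- a) - u powr (- a) = (v - u) * (- a * z powr (- a - 1))"
    using MVT2[of u v "\<lambda>t. t powr (- a)" "\<lambda>t. - a * t powr (- a - 1)"] by auto
  have "z powr (- a - 1) \<le> u powr (- a - 1)" using z assms by (intro powr_mono2') auto
  then have "a * (v - u) * z powr (- a - 1) \<le> a * (v - u) * u powr (- a - 1)"
    using assms by (intro mult_left_mono) auto
  moreover have "\<bar>u powr (- a) - v powr (- a)\<bar> = a * (v - u) * z powr (- a - 1)"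
    using z assms by (subst abs_minus_commute) (simp add: abs_mult)
  ultimately show ?thesis by simp
qed simp

text \<open>\<open>qf t x - qf s x\<close> does not depend on \<open>x\<close>, so by the mean value
  theorem a difference of two scales gains a full power of \<open>qf\<close>, that is, two orders of
  decay in |x|.\<close>

lemma qf_powr_diff_bound:
  assumes "0 < s" "s \<le> t" "a > 0"
  shows "\<bar>qf s x powr (- a) - qf t x powr (- a)\<bar> \<le> a * (t\<^sup>2 - s\<^sup>2) * qf s x powr (- a - 1)"
  using powr_neg_diff_bound[OF qf_pos[OF assms(1), of x] qf_mono[of s t x] assms(3)] assms
  by (simp add: qf_def)

subsection \<open>The kernels\<close>

text \<open>\<open>grd s m\<close> is, up to a constant, the \<open>m\<close>-th derivative of \<open>(s\<^sup>2 + \<bar>x\<bar>\<^sup>2) powr (1 - d / 2)\<close>, and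
  \<open>moll s\<close> is its divergence, the approximate identity.\<close>

definition moll_mass :: "'d::finite itself \<Rightarrow> real" where
  "moll_mass _ = (LINT x::real^'d|lborel. real CARD('d) * qf 1 x powr (- (real CARD('d) / 2) - 1))"

definition moll :: "real \<Rightarrow> real^'d::finite \<Rightarrow> real" where
  "moll s x = real CARD('d) * s\<^sup>2 * qf s x powr (- (real CARD('d) / 2) - 1) / moll_mass TYPE('d)"

definition grd :: "real \<Rightarrow> 'd \<Rightarrow> real^'d::finite \<Rightarrow> real" where
  "grd s m x = x $ m * qf s x powr (- (real CARD('d) / 2)) / moll_mass TYPE('d)"

lemma moll_mass_pos: "moll_mass TYPE('d::finite) > 0"
proof -
  let ?f = "\<lambda>x::real^'d. real CARD('d) * qf 1 x powr (- (real CARD('d) / 2) - 1)"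
  have i: "integrable lborel ?f"
    using qf_powr_integrable[of 1 "real CARD('d) / 2 + 1", where 'd='d] by simp
  have "moll_mass TYPE('d) \<ge> 0" unfolding moll_mass_def by (intro integral_nonneg_AE) simp
  moreover have "moll_mass TYPE('d) \<noteq> 0"
  proof
    assume "moll_mass TYPE('d) = 0"
    then have "AE x in lborel. ?f x = 0"
      unfolding moll_mass_def using i by (subst (asm) integral_nonneg_eq_0_iff_AE) auto
    moreover have "?f x \<noteq> 0" for x using qf_pos[of 1 x] by simp
    ultimately have "AE x::real^'d in lborel. False" by simp
    then have "emeasure lborel (UNIV::(real^'d) set) = 0" by (simp add: AE_iff_measurable[OF _ refl])
    then show False by simp
  qed
  ultimately show ?thesis by simp
qed

lemma moll_measurable [measurable]: "moll s \<in> borel_measurable borel"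
  unfolding moll_def[abs_def] by measurable

lemma moll_nonneg: "moll s x \<ge> 0"
  using moll_mass_pos[where 'd='a] by (simp add: moll_def)

lemma moll_even: "moll s (- x) = moll s x"
  by (simp add: moll_def qf_def)

lemma moll_bounded:
  assumes "s > 0"
  obtains B where "\<And>x::real^'d::finite. \<bar>moll s x\<bar> \<le> B"
proof
  fix x :: "real^'d"
  have "qf s x powr (- (real CARD('d) / 2) - 1) \<le> (s\<^sup>2) powr (- (real CARD('d) / 2) - 1)"
    using assms qf_ge[of s x] by (intro powr_mono2') auto
  then show "\<bar>moll s x\<bar> \<le> real CARD('d) * s\<^sup>2 * (s\<^sup>2) powr (- (real CARD('d) / 2) - 1) / moll_mass TYPE('d)"
    unfolding abs_of_nonneg[OF moll_nonneg] unfolding moll_def using moll_mass_pos[where 'd='d]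
    by (intro divide_right_mono mult_left_mono) auto
qed

lemma qf_scale:
  assumes "s > 0" shows "qf (s * t) (s *\<^sub>R x) powr a = s powr (2 * a) * qf t x powr a"
proof -
  have "qf (s * t) (s *\<^sub>R x) = s\<^sup>2 * qf t x" by (simp add: qf_def algebra_simps power2_eq_square)
  moreover have "0 \<le> qf t x" by (simp add: qf_def)
  moreover have "(s\<^sup>2) powr a = s powr (2 * a)" using assms by (simp add: powr_powr flip: powr_numeral)
  ultimately show ?thesis by (simp add: powr_mult)
qed

lemma moll_scale:
  fixes x :: "real^'d::finite"
  assumes "s > 0" shows "moll s (s *\<^sub>R x) = moll 1 x / s ^ CARD('d)"
proof -
  have "s powr (2 * (- (real CARD('d) / 2) - 1)) = s powr (- real CARD('d)) * s powr (-2)"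
    by (simp add: powr_add[symmetric])
  also have "\<dots> = 1 / (s ^ CARD('d) * s\<^sup>2)"
    using assms by (simp add: powr_minus powr_realpow field_simps)
  finally show ?thesis
    using qf_scale[OF assms, of 1 x "- (real CARD('d) / 2) - 1"] assms by (simp add: moll_def)
qed

lemma moll_integrable: "s > 0 \<Longrightarrow> integrable lborel (moll s :: real^'d::finite \<Rightarrow> real)"
  using qf_powr_integrable[of s "real CARD('d) / 2 + 1", where 'd='d] by (simp add: moll_def[abs_def])

lemma moll_integral:
  assumes s: "s > 0" shows "(LINT x::real^'d::finite|lborel. moll s x) = 1"
proof -
  have "(LINT x::real^'d|lborel. moll 1 x) = 
      (LINT x::real^'d|lborel. real CARD('d) * qf 1 x powr (- (real CARD('d) / 2) - 1)) / moll_mass TYPE('d)"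
    by (simp add: moll_def)
  also have "\<dots> = 1" unfolding moll_mass_def[of "TYPE('d)", symmetric] using moll_mass_pos[where 'd='d] by simp
  finally have "(LINT x::real^'d|lborel. moll 1 x) = 1" .
  moreover have "(LINT x::real^'d|lborel. moll s (s *\<^sub>R x)) = (LINT x::real^'d|lborel. moll s x) / s ^ CARD('d)"
    using integral_lborel_affine[OF _ moll_integrable[OF s], of s 0] s by simp
  moreover have "(LINT x::real^'d|lborel. moll s (s *\<^sub>R x)) = (LINT x::real^'d|lborel. moll 1 x) / s ^ CARD('d)"
    by (simp add: moll_scale[OF s])
  ultimately show ?thesis using s by simp
qed

lemma grd_smooth: "s > 0 \<Longrightarrow> Ck_on k UNIV (grd s m)"
  unfolding grd_def[abs_def] divide_inverse 
  by (intro Ck_on_mult Ck_on_coord Ck_on_qf_powr Ck_on_const) auto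

lemma pd_grd:
  fixes x :: "real^'d::finite"
  assumes s: "s > 0"
  shows "pd k (grd s m) x = ((if k = m then 1 else 0) * qf s x powr (- (real CARD('d) / 2)) - 
    real CARD('d) * x $ k * x $ m * qf s x powr (- (real CARD('d) / 2) - 1)) / moll_mass TYPE('d)"
proof -
  have "grd s m = (\<lambda>x. 1 / moll_mass TYPE('d) * (x $ m * qf s x powr (- (real CARD('d) / 2))))"
    by (simp add: grd_def[abs_def])
  note e = this
  note c = Ck_on_coord[of "Suc 0" UNIV] Ck_on_qf_powr[OF s, of "Suc 0"]
  note d = Ck_on_differentiable_at[of 0]
  have "pd k (grd s m) x = 1 / moll_mass TYPE('d) * (pd k (\<lambda>x. x $ m) x * qf s x powr (- (real CARD('d) / 2)) +
      x $ m * pd k (\<lambda>x. qf s x powr (- (real CARD('d) / 2))) x)"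
    unfolding e
    by (subst pd_cmult pd_mult; (intro d Ck_on_mult c open_UNIV)?)+ (rule refl)
  then show ?thesis by (simp add: pd_coord pd_qf_powr[OF s] mult_ac)
qed

text \<open>Symmetry of the Hessian of the potential whose gradient is \<open>grd\<close>.\<close>

lemma pd_grd_sym: "s > 0 \<Longrightarrow> pd k (grd s m) = pd m (grd s k)"
  by (auto simp: fun_eq_iff pd_grd mult_ac)

text \<open>The squares of the coordinates sum to \<open>qf s x - s\<^sup>2\<close>, so the
  contributions of order \<open>qf s x powr (- d / 2)\<close> cancel and only the term with the
  factor \<open>s\<^sup>2\<close> survives. This is where the form of \<open>moll\<close> comes
  from.\<close>

lemma pd_grd_divergence:
  fixes x :: "real^'d::finite"
  assumes s: "s > 0"
  shows "(\<Sum>m\<in>UNIV. pd m (grd s m) x) = moll s x"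
proof -
  let ?D = "real CARD('d)"
  have q: "qf s x powr (- (?D / 2)) = qf s x * qf s x powr (- (?D / 2) - 1)"
    using qf_pos[OF s, of x] by (simp add: powr_diff)
  have "(\<Sum>m\<in>UNIV. pd m (grd s m) x) = 
    (?D * qf s x powr (- (?D / 2)) - ?D * (\<Sum>m\<in>UNIV. x $ m * x $ m) * qf s x powr (- (?D / 2) - 1)) / moll_mass TYPE('d)"
    by (simp add: pd_grd[OF s] sum_divide_distrib[symmetric] sum_subtractf sum_distrib_left sum_distrib_right mult.assoc)
  also have "(\<Sum>m\<in>UNIV. x $ m * x $ m) = qf s x - s\<^sup>2" by (simp add: qf_def inner_vec_def)
  finally show ?thesis by (simp add: q moll_def algebra_simps)
qed

text \<open>Written out so that the symmetry in \<open>k\<close> and \<open>l\<close> and the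
  boundedness can both be read off.\<close>

lemma pd_pd_grd:
  fixes x :: "real^'d::finite"
  assumes s: "s > 0"
  shows "pd l (pd k (grd s m)) x = real CARD('d) * 
    (- ((if k = m then 1 else 0) * x $ l + (if l = k then 1 else 0) * x $ m + (if l = m then 1 else 0) * x $ k)
        * qf s x powr (- (real CARD('d) / 2) - 1)
     + (real CARD('d) + 2) * x $ k * x $ m * x $ l * qf s x powr (- (real CARD('d) / 2) - 2)) / moll_mass TYPE('d)"
proof -
  let ?D = "real CARD('d)"
  have e: "pd k (grd s m) = (\<lambda>x. 1 / moll_mass TYPE('d) * ((if k = m then 1 else 0) * qf s x powr (- (?D / 2)) - 
    ?D * (x $ k * (x $ m * qf s x powr (- (?D / 2) - 1)))))"
    by (simp add: fun_eq_iff pd_grd[OF s] mult.assoc)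
  note c = Ck_on_coord[of "Suc 0" UNIV] Ck_on_qf_powr[OF s, of "Suc 0"] Ck_on_const[of "Suc 0" UNIV]
  note d = Ck_on_differentiable_at[of 0]
  have "pd l (pd k (grd s m)) x = 1 / moll_mass TYPE('d) * 
    ((if k = m then 1 else 0) * pd l (\<lambda>x. qf s x powr (- (?D / 2))) x - 
      ?D * (pd l (\<lambda>x. x $ k) x * (x $ m * qf s x powr (- (?D / 2) - 1)) + 
        x $ k * (pd l (\<lambda>x. x $ m) x * qf s x powr (- (?D / 2) - 1) + 
          x $ m * pd l (\<lambda>x. qf s x powr (- (?D / 2) - 1)) x)))"
    unfolding e
    by (subst pd_cmult pd_diff pd_mult; (intro d Ck_on_diff Ck_on_mult c open_UNIV)?)+ (rule refl)
  also have "(if k = m then 1 else 0) * pd l (\<lambda>x. qf s x powr (- (?D / 2))) x - 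
      ?D * (pd l (\<lambda>x. x $ k) x * (x $ m * qf s x powr (- (?D / 2) - 1)) + 
        x $ k * (pd l (\<lambda>x. x $ m) x * qf s x powr (- (?D / 2) - 1) + 
          x $ m * pd l (\<lambda>x. qf s x powr (- (?D / 2) - 1)) x))
    = ?D * (- ((if k = m then 1 else 0) * x $ l + (if l = k then 1 else 0) * x $ m + (if l = m then 1 else 0) * x $ k)
        * qf s x powr (- (?D / 2) - 1)
     + (?D + 2) * x $ k * x $ m * x $ l * qf s x powr (- (?D / 2) - 2))"
    unfolding pd_qf_powr[OF s] pd_coord by (simp add: algebra_simps)
  finally show ?thesis by simp
qed

lemma pd_pd_grd_sym: "s > 0 \<Longrightarrow> pd l (pd k (grd s m)) = pd k (pd l (grd s m))"
  by (auto simp: fun_eq_iff pd_pd_grd algebra_simps)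

text \<open>The slowly decaying leading parts of the two gradient kernels cancel. The divergence of
  this field is the difference of two mollifiers, which is what produces a band.\<close>

definition gdiff :: "real \<Rightarrow> real \<Rightarrow> 'd \<Rightarrow> real^'d::finite \<Rightarrow> real" where
  "gdiff s t m x = grd s m x - grd t m x"

lemma gdiff_smooth: "s > 0 \<Longrightarrow> t > 0 \<Longrightarrow> Ck_on k UNIV (gdiff s t m)"
  unfolding gdiff_def[abs_def] by (intro Ck_on_diff grd_smooth) auto

lemma Ck_on_measurable: "Ck_on k UNIV f \<Longrightarrow> f \<in> borel_measurable borel"
  by (intro borel_measurable_continuous_onI Ck_on_imp_continuous_on)

lemma pd_gdiff:
  assumes "s > 0" "t > 0"
  shows "pd k (gdiff s t m) x = pd k (grd s m) x - pd k (grd t m) x"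
  unfolding gdiff_def[abs_def]
  by (intro pd_diff Ck_on_differentiable_at[OF grd_smooth] assms)

lemma pd_pd_gdiff:
  assumes "s > 0" "t > 0"
  shows "pd l (pd k (gdiff s t m)) x = pd l (pd k (grd s m)) x - pd l (pd k (grd t m)) x"
proof -
  have "pd k (gdiff s t m) = (\<lambda>x. pd k (grd s m) x - pd k (grd t m) x)"
    by (simp add: fun_eq_iff pd_gdiff assms)
  moreover have "pd k (grd u m) differentiable (at x)" if "u > 0" for u
    using grd_smooth[OF that, of "Suc (Suc 0)" m] by (intro Ck_on_differentiable_at[of 0]) simp
  ultimately show ?thesis using assms by (simp add: pd_diff)
qed

lemma pd_gdiff_sym: "s > 0 \<Longrightarrow> t > 0 \<Longrightarrow> pd k (gdiff s t m) = pd m (gdiff s t k)"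
  by (simp add: fun_eq_iff pd_gdiff pd_grd_sym[of _ k m])

lemma pd_pd_gdiff_sym: "s > 0 \<Longrightarrow> t > 0 \<Longrightarrow> pd l (pd k (gdiff s t m)) = pd k (pd l (gdiff s t m))"
  by (simp add: fun_eq_iff pd_pd_gdiff pd_pd_grd_sym[of _ l k])

lemma pd_gdiff_divergence:
  "s > 0 \<Longrightarrow> t > 0 \<Longrightarrow> (\<Sum>m\<in>UNIV. pd m (gdiff s t m) x) = moll s x - moll t x"
  by (simp add: pd_gdiff sum_subtractf pd_grd_divergence)

lemma abs_coord_mult_qf:
  assumes "s > 0"
  shows "\<bar>x $ m\<bar> * qf s x powr a \<le> qf s x powr (a + 1 / 2)"
proof -
  have "\<bar>x $ m\<bar> * qf s x powr a \<le> qf s x powr (1 / 2) * qf s x powr a"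
    by (intro mult_right_mono coord_le_qf) simp
  then show ?thesis by (simp add: powr_add[symmetric] add.commute)
qed

lemma qf_powr_le:
  assumes "s > 0" "a \<le> 0" shows "qf s x powr a \<le> (s\<^sup>2) powr a"
  using assms qf_ge[of s x] by (intro powr_mono2') auto

lemma grd_bounded:
  fixes x :: "real^'d::finite"
  assumes s: "s > 0"
  shows "\<bar>grd s m x\<bar> \<le> (s\<^sup>2) powr (- (real CARD('d) / 2) + 1 / 2) / moll_mass TYPE('d)"
proof -
  have "1 \<le> real CARD('d)" using one_le_card_finite[where 'a='d] by linarith
  then have "\<bar>x $ m\<bar> * qf s x powr (- (real CARD('d) / 2)) \<le> (s\<^sup>2) powr (- (real CARD('d) / 2) + 1 / 2)"
    using abs_coord_mult_qf[OF s, of x m "- (real CARD('d) / 2)"] 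
      qf_powr_le[OF s, of "- (real CARD('d) / 2) + 1 / 2" x] by linarith
  then show ?thesis using moll_mass_pos[where 'd='d]
    by (simp add: grd_def abs_mult divide_right_mono)
qed

lemma gdiff_bounded:
  assumes "s > 0" "t > 0"
  obtains B where "\<And>m. \<And>x::real^'d::finite. \<bar>gdiff s t m x\<bar> \<le> B"
proof
  fix m and x :: "real^'d"
  show "\<bar>gdiff s t m x\<bar> \<le> (s\<^sup>2) powr (- (real CARD('d) / 2) + 1 / 2) / moll_mass TYPE('d) + 
    (t\<^sup>2) powr (- (real CARD('d) / 2) + 1 / 2) / moll_mass TYPE('d)"
    unfolding gdiff_def using grd_bounded[OF assms(1), of m x] grd_bounded[OF assms(2), of m x] by linarith
qed

text \<open>The difference of scales gains 1 in the exponent of \<open>qf\<close> and the coordinate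
  factor loses 1 / 2. The resulting exponent d / 2 + 1 / 2 is above the threshold d / 2 of
  integrability.\<close>

lemma gdiff_integrable:
  assumes st: "0 < s" "s \<le> t"
  shows "integrable lborel (gdiff s t m :: real^'d::finite \<Rightarrow> real)"
proof (rule Bochner_Integration.integrable_bound)
  let ?D = "real CARD('d)"
  let ?C = "?D / 2 * (t\<^sup>2 - s\<^sup>2) / moll_mass TYPE('d)"
  show "integrable lborel (\<lambda>x::real^'d. ?C * qf s x powr (- (?D / 2 + 1 / 2)))"
    by (intro Bochner_Integration.integrable_mult_right impI qf_powr_integrable st) simp
  show "AE x in lborel. norm (gdiff s t m x) \<le> norm (?C * qf s x powr (- (?D / 2 + 1 / 2)))"
  proof (rule AE_I2)
    fix x :: "real^'d"
    have ts: "t\<^sup>2 - s\<^sup>2 \<ge> 0" using st by simp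
    have "\<bar>gdiff s t m x\<bar> = \<bar>x $ m\<bar> * \<bar>qf s x powr (- (?D / 2)) - qf t x powr (- (?D / 2))\<bar> / moll_mass TYPE('d)"
      using moll_mass_pos[where 'd='d]
      by (simp add: gdiff_def grd_def abs_mult diff_divide_distrib[symmetric] right_diff_distrib[symmetric])
    also have "\<dots> \<le> \<bar>x $ m\<bar> * (?D / 2 * (t\<^sup>2 - s\<^sup>2) * qf s x powr (- (?D / 2) - 1)) / moll_mass TYPE('d)"
      using moll_mass_pos[where 'd='d] qf_powr_diff_bound[OF st, of "?D / 2" x]
      by (intro divide_right_mono mult_left_mono) auto
    also have "\<dots> = ?C * (\<bar>x $ m\<bar> * qf s x powr (- (?D / 2) - 1))" by simp
    also have "\<dots> \<le> ?C * qf s x powr (- (?D / 2) - 1 + 1 / 2)"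
      using ts moll_mass_pos[where 'd='d] abs_coord_mult_qf[OF st(1), of x m "- (?D / 2) - 1"]
      by (intro mult_left_mono divide_nonneg_pos mult_nonneg_nonneg) auto
    also have "- (?D / 2) - 1 + 1 / 2 = - (?D / 2 + 1 / 2)" by simp
    finally show "norm (gdiff s t m x) \<le> norm (?C * qf s x powr (- (?D / 2 + 1 / 2)))"
      using ts moll_mass_pos[where 'd='d] by (simp add: abs_mult)
  qed
qed (use gdiff_smooth[of s t 0 m] st in \<open>auto intro: Ck_on_measurable[of 0]\<close>)

text \<open>Both terms of the derivative gain a power of \<open>qf\<close> from the difference of
  scales; in the second one the product of two coordinates is at most \<open>qf s x\<close> and so
  pays for the additional negative power.\<close>

lemma pd_gdiff_decay:
  fixes x :: "real^'d::finite"
  assumes st: "0 < s" "s \<le> t"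
  defines "D \<equiv> real CARD('d)"
  shows "\<bar>pd k (gdiff s t m) x\<bar> \<le> 
    (D / 2 + D * (D / 2 + 1)) * (t\<^sup>2 - s\<^sup>2) / moll_mass TYPE('d) * qf s x powr (- (D / 2 + 1))"
proof -
  have t: "t > 0" using st by simp
  have D: "D > 0" by (simp add: D_def)
  let ?a = "qf s x powr (- (D / 2)) - qf t x powr (- (D / 2))"
  let ?b = "qf s x powr (- (D / 2 + 1)) - qf t x powr (- (D / 2 + 1))"
  let ?Q = "qf s x powr (- (D / 2 + 1))"
  have e: "- (D / 2) - 1 = - (D / 2 + 1)" by simp
  have eq: "pd k (gdiff s t m) x = ((if k = m then 1 else 0) * ?a - D * (x $ k * x $ m) * ?b) / moll_mass TYPE('d)"
    unfolding pd_gdiff[OF st(1) t] pd_grd[OF st(1)] pd_grd[OF t] D_def[symmetric] e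
    by (simp add: diff_divide_distrib[symmetric] algebra_simps)
  have a: "\<bar>?a\<bar> \<le> D / 2 * (t\<^sup>2 - s\<^sup>2) * ?Q"
    using qf_powr_diff_bound[OF st, of "D / 2" x] D by simp
  have "\<bar>x $ k\<bar> * \<bar>x $ m\<bar> \<le> qf s x powr (1 / 2) * qf s x powr (1 / 2)"
    by (intro mult_mono coord_le_qf) auto
  then have xx: "\<bar>x $ k * x $ m\<bar> \<le> qf s x" using qf_pos[OF st(1), of x] by (simp add: abs_mult powr_add[symmetric])
  have ts: "t\<^sup>2 - s\<^sup>2 \<ge> 0" using st by simp
  have "\<bar>x $ k * x $ m\<bar> * \<bar>?b\<bar> \<le> qf s x * ((D / 2 + 1) * (t\<^sup>2 - s\<^sup>2) * qf s x powr (- (D / 2 + 1) - 1))"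
    using xx qf_powr_diff_bound[OF st, of "D / 2 + 1" x] D by (intro mult_mono) auto
  also have "\<dots> = (D / 2 + 1) * (t\<^sup>2 - s\<^sup>2) * (qf s x * qf s x powr (- (D / 2 + 1) - 1))" by simp
  also have "qf s x * qf s x powr (- (D / 2 + 1) - 1) = ?Q"
    using qf_pos[OF st(1), of x] powr_mult_base[of "qf s x" "- (D / 2 + 1) - 1"] 
    by (simp add: algebra_simps)
  finally have b: "\<bar>x $ k * x $ m\<bar> * \<bar>?b\<bar> \<le> (D / 2 + 1) * (t\<^sup>2 - s\<^sup>2) * ?Q" .
  have "\<bar>(if k = m then 1 else 0) * ?a - D * (x $ k * x $ m) * ?b\<bar> \<le> \<bar>?a\<bar> + D * (\<bar>x $ k * x $ m\<bar> * \<bar>?b\<bar>)"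
  proof -
    have "\<bar>D * (x $ k * x $ m) * ?b\<bar> = D * (\<bar>x $ k * x $ m\<bar> * \<bar>?b\<bar>)" using D by (simp add: abs_mult mult.assoc)
    moreover have "\<bar>(if k = m then 1 else 0) * ?a\<bar> \<le> \<bar>?a\<bar>" by simp
    ultimately show ?thesis by linarith
  qed
  also have "\<dots> \<le> D / 2 * (t\<^sup>2 - s\<^sup>2) * ?Q + D * ((D / 2 + 1) * (t\<^sup>2 - s\<^sup>2) * ?Q)"
    using a b D by (intro add_mono mult_left_mono) auto
  finally have "\<bar>pd k (gdiff s t m) x\<bar> \<le> (D / 2 * (t\<^sup>2 - s\<^sup>2) * ?Q + D * ((D / 2 + 1) * (t\<^sup>2 - s\<^sup>2) * ?Q)) / moll_mass TYPE('d)"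
    unfolding eq abs_divide using moll_mass_pos[where 'd='d] by (simp add: divide_right_mono)
  also have "\<dots> = (D / 2 + D * (D / 2 + 1)) * (t\<^sup>2 - s\<^sup>2) / moll_mass TYPE('d) * ?Q"
    by (simp add: algebra_simps)
  finally show ?thesis .
qed

lemma pd_gdiff_measurable: "s > 0 \<Longrightarrow> t > 0 \<Longrightarrow> pd k (gdiff s t m) \<in> borel_measurable borel"
  using gdiff_smooth[of s t "Suc 0" m] by (intro Ck_on_measurable[of 0]) simp

lemma pd_gdiff_integrable:
  assumes st: "0 < s" "s \<le> t"
  shows "integrable lborel (pd k (gdiff s t m) :: real^'d::finite \<Rightarrow> real)"
proof (rule Bochner_Integration.integrable_bound)
  let ?D = "real CARD('d)"
  let ?C = "(?D / 2 + ?D * (?D / 2 + 1)) * (t\<^sup>2 - s\<^sup>2) / moll_mass TYPE('d)"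
  show "integrable lborel (\<lambda>x::real^'d. ?C * qf s x powr (- (?D / 2 + 1)))"
    by (intro Bochner_Integration.integrable_mult_right impI qf_powr_integrable st) simp
  show "AE x in lborel. norm (pd k (gdiff s t m) x) \<le> norm (?C * qf s x powr (- (?D / 2 + 1)))"
    using order_trans[OF pd_gdiff_decay[OF st, of k m] abs_ge_self] by auto
qed (use pd_gdiff_measurable[of s t k m] st in auto)

lemma pd_gdiff_bounded:
  assumes st: "0 < s" "s \<le> t"
  obtains B where "\<And>k m. \<And>x::real^'d::finite. \<bar>pd k (gdiff s t m) x\<bar> \<le> B"
proof
  fix k m and x :: "real^'d"
  let ?D = "real CARD('d)"
  let ?C = "(?D / 2 + ?D * (?D / 2 + 1)) * (t\<^sup>2 - s\<^sup>2) / moll_mass TYPE('d)"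
  have "?C \<ge> 0" using st moll_mass_pos[where 'd='d] by (intro divide_nonneg_pos mult_nonneg_nonneg) auto
  moreover have "qf s x powr (- (?D / 2 + 1)) \<le> (s\<^sup>2) powr (- (?D / 2 + 1))"
    by (rule qf_powr_le[OF st(1)]) simp
  ultimately have "?C * qf s x powr (- (?D / 2 + 1)) \<le> ?C * (s\<^sup>2) powr (- (?D / 2 + 1))" 
    by (intro mult_left_mono)
  then show "\<bar>pd k (gdiff s t m) x\<bar> \<le> ?C * (s\<^sup>2) powr (- (?D / 2 + 1))"
    using pd_gdiff_decay[OF st, of k m x] by linarith
qed

text \<open>In the second integration by parts a first derivative of the kernel is the bounded
  factor, so its own derivatives have to be bounded. Each coordinate costs 1 / 2, and the exponent -
  d / 2 - 1 / 2 that both terms end with is negative.\<close>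

lemma pd_pd_grd_bounded:
  fixes x :: "real^'d::finite"
  assumes s: "s > 0"
  defines "D \<equiv> real CARD('d)"
  shows "\<bar>pd l (pd k (grd s m)) x\<bar> \<le> D * (3 + (D + 2)) * (s\<^sup>2) powr (- (D / 2) - 1 / 2) / moll_mass TYPE('d)"
proof -
  have D: "D > 0" by (simp add: D_def)
  let ?q1 = "qf s x powr (- (D / 2) - 1)" and ?q2 = "qf s x powr (- (D / 2) - 2)"
  let ?B = "(s\<^sup>2) powr (- (D / 2) - 1 / 2)"
  have h: "qf s x powr (- (D / 2) - 1 / 2) \<le> ?B" using D by (intro qf_powr_le[OF s]) auto
  have 1: "\<bar>x $ i\<bar> * ?q1 \<le> ?B" for i
  proof -
    have e: "- (D / 2) - 1 + 1 / 2 = - (D / 2) - 1 / 2" by simp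
    show ?thesis using order_trans[OF abs_coord_mult_qf[OF s, of x i "- (D / 2) - 1", unfolded e] h] .
  qed
  have 2: "\<bar>x $ k * x $ m * x $ l\<bar> * ?q2 \<le> ?B"
  proof -
    have "\<bar>x $ k\<bar> * (\<bar>x $ m\<bar> * (\<bar>x $ l\<bar> * ?q2)) \<le> \<bar>x $ k\<bar> * (\<bar>x $ m\<bar> * qf s x powr (- (D / 2) - 2 + 1 / 2))"
      by (intro mult_left_mono abs_coord_mult_qf[OF s]) auto
    also have "\<dots> \<le> \<bar>x $ k\<bar> * qf s x powr (- (D / 2) - 2 + 1 / 2 + 1 / 2)"
      by (intro mult_left_mono abs_coord_mult_qf[OF s]) auto
    also have "\<dots> \<le> qf s x powr (- (D / 2) - 2 + 1 / 2 + 1 / 2 + 1 / 2)"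
      by (rule abs_coord_mult_qf[OF s])
    also have "- (D / 2) - 2 + 1 / 2 + 1 / 2 + 1 / 2 = - (D / 2) - 1 / 2" by simp
    also note h
    finally show ?thesis by (simp add: abs_mult mult.assoc)
  qed
  let ?d = "\<lambda>i j. if i = j then 1 else (0::real)"
  have "\<bar>(?d k m * x $ l + ?d l k * x $ m + ?d l m * x $ k) * ?q1\<bar> \<le> \<bar>x $ l\<bar> * ?q1 + \<bar>x $ m\<bar> * ?q1 + \<bar>x $ k\<bar> * ?q1"
  proof -
    have "\<bar>?d k m * x $ l + ?d l k * x $ m + ?d l m * x $ k\<bar> * ?q1 \<le> (\<bar>x $ l\<bar> + \<bar>x $ m\<bar> + \<bar>x $ k\<bar>) * ?q1"
      by (intro mult_right_mono) auto
    then show ?thesis by (simp add: abs_mult distrib_right)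
  qed
  also have "\<dots> \<le> 3 * ?B" using 1[of l] 1[of m] 1[of k] by linarith
  finally have 3: "\<bar>(?d k m * x $ l + ?d l k * x $ m + ?d l m * x $ k) * ?q1\<bar> \<le> 3 * ?B" .
  have 4: "\<bar>(D + 2) * (x $ k * x $ m * x $ l * ?q2)\<bar> \<le> (D + 2) * ?B"
    using 2 D by (simp add: abs_mult)
  have "\<bar>- ((?d k m * x $ l + ?d l k * x $ m + ?d l m * x $ k) * ?q1) + (D + 2) * (x $ k * x $ m * x $ l * ?q2)\<bar>
    \<le> (3 + (D + 2)) * ?B"
    using 3 4 unfolding distrib_right[of 3] by linarith
  then have "D * \<bar>- ((?d k m * x $ l + ?d l k * x $ m + ?d l m * x $ k) * ?q1) + (D + 2) * (x $ k * x $ m * x $ l * ?q2)\<bar> / moll_mass TYPE('d)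
    \<le> D * ((3 + (D + 2)) * ?B) / moll_mass TYPE('d)"
    using D moll_mass_pos[where 'd='d] by (intro divide_right_mono mult_left_mono) auto
  moreover have "\<bar>pd l (pd k (grd s m)) x\<bar> = D * \<bar>- ((?d k m * x $ l + ?d l k * x $ m + ?d l m * x $ k) * ?q1) + (D + 2) * (x $ k * x $ m * x $ l * ?q2)\<bar> / moll_mass TYPE('d)"
    unfolding pd_pd_grd[OF s] D_def[symmetric] 
    using D moll_mass_pos[where 'd='d] by (simp add: abs_mult mult.assoc)
  ultimately show ?thesis by (simp add: mult.assoc)
qed

lemma pd_pd_gdiff_bounded:
  assumes "s > 0" "t > 0"
  obtains B where "\<And>l k m. \<And>x::real^'d::finite. \<bar>pd l (pd k (gdiff s t m)) x\<bar> \<le> B"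
proof
  fix l k m and x :: "real^'d"
  let ?D = "real CARD('d)"
  let ?B = "\<lambda>s. ?D * (3 + (?D + 2)) * (s\<^sup>2) powr (- (?D / 2) - 1 / 2) / moll_mass TYPE('d)"
  show "\<bar>pd l (pd k (gdiff s t m)) x\<bar> \<le> ?B s + ?B t"
    unfolding pd_pd_gdiff[OF assms] 
    using pd_pd_grd_bounded[OF assms(1), of l k m x] pd_pd_grd_bounded[OF assms(2), of l k m x] by linarith
qed

lemma grd_scale:
  fixes x :: "real^'d::finite"
  assumes "s > 0" shows "grd (s * t) m (s *\<^sub>R x) = s * grd t m x / s ^ CARD('d)"
proof -
  have "s powr (2 * (- (real CARD('d) / 2))) = 1 / s ^ CARD('d)"
    using assms by (simp add: powr_minus powr_realpow field_simps)
  then show ?thesis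
    using qf_scale[OF assms, of t x "- (real CARD('d) / 2)"] assms by (simp add: grd_def mult_ac)
qed

text \<open>The kernels between the scales 1 and 2, summed over the directions so that one constant
  serves every \<open>m\<close>; scaling transports it to all dyadic steps.\<close>

definition gconst :: "'d::finite itself \<Rightarrow> real" where
  "gconst _ = (\<Sum>m::'d\<in>UNIV. LINT x::real^'d|lborel. \<bar>gdiff 1 2 m x\<bar>)"

lemma gconst_nonneg: "gconst TYPE('d::finite) \<ge> 0"
  unfolding gconst_def by (intro sum_nonneg integral_nonneg_AE) auto

text \<open>When the scales and the argument are multiplied by s together, \<open>grd\<close> is
  homogeneous of degree 1 - d. Integration restores the factor s^d, so the L^1 norm is proportional
  to s.\<close>

lemma gdiff_double_norm1:
  assumes s: "s > 0"
  shows "(LINT x::real^'d::finite|lborel. \<bar>gdiff s (2 * s) m x\<bar>) \<le> s * gconst TYPE('d)"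
proof -
  have i: "integrable lborel (\<lambda>x::real^'d. \<bar>gdiff s (2 * s) m x\<bar>)"
    using gdiff_integrable[of s "2 * s"] s by (intro integrable_abs) auto
  have "\<bar>gdiff s (2 * s) m (s *\<^sub>R x)\<bar> = s * \<bar>gdiff 1 2 m x\<bar> / s ^ CARD('d)" for x :: "real^'d"
    using grd_scale[OF s, of 1 m x] grd_scale[OF s, of 2 m x] s 
    by (simp add: gdiff_def mult.commute[of s 2] diff_divide_distrib[symmetric] right_diff_distrib[symmetric] abs_mult)
  then have "(LINT x::real^'d|lborel. \<bar>gdiff s (2 * s) m (s *\<^sub>R x)\<bar>) = s * (LINT x::real^'d|lborel. \<bar>gdiff 1 2 m x\<bar>) / s ^ CARD('d)"
    by simp
  moreover have "(LINT x::real^'d|lborel. \<bar>gdiff s (2 * s) m (s *\<^sub>R x)\<bar>) = (LINT x::real^'d|lborel. \<bar>gdiff s (2 * s) m x\<bar>) / s ^ CARD('d)"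
    using integral_lborel_affine[OF _ i, of s 0] s by simp
  ultimately have "(LINT x::real^'d|lborel. \<bar>gdiff s (2 * s) m x\<bar>) = s * (LINT x::real^'d|lborel. \<bar>gdiff 1 2 m x\<bar>)"
    using s by simp
  moreover have "(LINT x::real^'d|lborel. \<bar>gdiff 1 2 m x\<bar>) \<le> gconst TYPE('d)"
    unfolding gconst_def by (rule member_le_sum) auto
  ultimately show ?thesis using s by (simp add: mult_left_mono)
qed

text \<open>Telescoping over dyadic scales leaves the geometric series t / 2 + t / 4 + ... . The
  bound is independent of \<open>J\<close>, so the small scale may be sent to 0 while one factor
  \<open>t\<close> is gained.\<close>

lemma gdiff_norm1:
  assumes t: "t > 0"
  shows "(LINT x::real^'d::finite|lborel. \<bar>gdiff (t / 2 ^ J) t m x\<bar>) \<le> t * gconst TYPE('d)"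
proof -
  have le: "t / 2 ^ J \<le> t" for J using t by (simp add: divide_le_eq mult_le_cancel_left1)
  \<comment> \<open>The induction needs the partial sum of the geometric series; the plain bound by
    \<open>t\<close> would not be inductive.\<close>
  have "(LINT x::real^'d|lborel. \<bar>gdiff (t / 2 ^ J) t m x\<bar>) \<le> t * (1 - 1 / 2 ^ J) * gconst TYPE('d)"
  proof (induction J)
    case 0
    then show ?case by (simp add: gdiff_def)
  next
    case (Suc J)
    let ?s = "t / 2 ^ Suc J"
    have s: "?s > 0" "2 * ?s = t / 2 ^ J" using t by auto
    have i1: "integrable lborel (gdiff ?s (2 * ?s) m :: real^'d \<Rightarrow> real)" using s by (intro gdiff_integrable) auto
    have i2: "integrable lborel (gdiff (t / 2 ^ J) t m :: real^'d \<Rightarrow> real)" using t le by (intro gdiff_integrable) auto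
    have i3: "integrable lborel (gdiff ?s t m :: real^'d \<Rightarrow> real)" by (rule gdiff_integrable[OF s(1) le])
    have "(LINT x::real^'d|lborel. \<bar>gdiff ?s t m x\<bar>) \<le> (LINT x::real^'d|lborel. \<bar>gdiff ?s (2 * ?s) m x\<bar> + \<bar>gdiff (t / 2 ^ J) t m x\<bar>)"
    proof (rule integral_mono)
      show "\<bar>gdiff ?s t m x\<bar> \<le> \<bar>gdiff ?s (2 * ?s) m x\<bar> + \<bar>gdiff (t / 2 ^ J) t m x\<bar>" for x
        unfolding gdiff_def s(2) by linarith
    qed (use i1 i2 i3 in auto)
    also have "\<dots> = (LINT x::real^'d|lborel. \<bar>gdiff ?s (2 * ?s) m x\<bar>) + (LINT x::real^'d|lborel. \<bar>gdiff (t / 2 ^ J) t m x\<bar>)"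
      using i1 i2 by simp
    also have "\<dots> \<le> ?s * gconst TYPE('d) + t * (1 - 1 / 2 ^ J) * gconst TYPE('d)"
      using gdiff_double_norm1[OF s(1)] Suc.IH by (rule add_mono)
    also have "\<dots> = t * (1 - 1 / 2 ^ Suc J) * gconst TYPE('d)" by (simp add: field_simps)
    finally show ?case .
  qed
  also have "\<dots> \<le> t * gconst TYPE('d)"
    using t gconst_nonneg[where 'd='d] by (intro mult_right_mono) (auto simp: mult_le_cancel_left1)
  finally show ?thesis .
qed

section \<open>Integration by parts for the kernels\<close>

lemma
  fixes a :: "real^'d::finite \<Rightarrow> real"
  assumes "a differentiable (at (t + c *\<^sub>R x))"
  shows pd_affine: "pd k (\<lambda>y. a (t + c *\<^sub>R y)) x = c * pd k a (t + c *\<^sub>R x)"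
    and differentiable_affine: "(\<lambda>y. a (t + c *\<^sub>R y)) differentiable (at x)"
proof -
  let ?A = "frechet_derivative a (at (t + c *\<^sub>R x))"
  have "((\<lambda>y. t + c *\<^sub>R y) has_derivative (\<lambda>h. c *\<^sub>R h)) (at x)"
    by (auto intro!: derivative_eq_intros)
  from has_derivative_compose[OF this differentiable_at_has_pd[OF assms]]
  have d: "((\<lambda>y. a (t + c *\<^sub>R y)) has_derivative (\<lambda>h. ?A (c *\<^sub>R h))) (at x)" .
  then show "(\<lambda>y. a (t + c *\<^sub>R y)) differentiable (at x)" by (auto simp: differentiable_def)
  have "linear ?A" using differentiable_at_has_pd[OF assms] has_derivative_linear by blast
  then show "pd k (\<lambda>y. a (t + c *\<^sub>R y)) x = c * pd k a (t + c *\<^sub>R x)"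
    using pd_eqI[OF d, of k] by (simp add: pd_def linear_cmul)
qed

lemma Ck_on_affine: "Ck_on k UNIV a \<Longrightarrow> Ck_on k UNIV (\<lambda>y. a (t + c *\<^sub>R y))"
proof (induction k arbitrary: a)
  case 0
  then show ?case by (auto intro!: continuous_intros continuous_on_compose2[of UNIV a])
next
  case (Suc k)
  have d: "a differentiable (at x)" for x using Suc.prems by (rule Ck_on_differentiable_at)
  have "pd i (\<lambda>y. a (t + c *\<^sub>R y)) = (\<lambda>y. c * pd i a (t + c *\<^sub>R y))" for i
    by (rule ext) (rule pd_affine[OF d])
  moreover have "Ck_on k UNIV (\<lambda>y. c * pd i a (t + c *\<^sub>R y))" for i
    using Suc by (intro Ck_on_mult Ck_on_const) auto
  ultimately show ?case using differentiable_affine[OF d] by (simp add: differentiable_on_def)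
qed

lemma
  assumes "Ck_on (Suc 0) UNIV a"
  shows pd_translate: "pd k (\<lambda>x. a (x - y)) x = pd k a (x - y)"
    and pd_reflect: "pd k (\<lambda>x. a (y - x)) x = - pd k a (y - x)"
  using pd_affine[OF Ck_on_differentiable_at[OF assms], where t="- y" and c=1 and x=x and k=k]
    pd_affine[OF Ck_on_differentiable_at[OF assms], where t=y and c="- 1" and x=x and k=k] by simp_all

lemma
  assumes "Ck_on n UNIV a"
  shows Ck_on_translate: "Ck_on n UNIV (\<lambda>x. a (x - y))"
    and Ck_on_reflect: "Ck_on n UNIV (\<lambda>x. a (y - x))"
  using Ck_on_affine[OF assms, where t="- y" and c=1] Ck_on_affine[OF assms, where t=y and c="- 1"] by simp_all

text \<open>The increment of \<open>u\<close> along a unit vector has integral \<open>0\<close>; by Fubini it is the integral of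
  the derivative.\<close>

lemma integral_pd_eq_0:
  fixes u :: "real^'d::finite \<Rightarrow> real"
  assumes u: "Ck_on (Suc 0) UNIV u" and i: "integrable lborel u" and i': "integrable lborel (pd k u)"
  shows "(LINT x|lborel. pd k u x) = 0"
proof -
  let ?e = "axis k 1 :: real^'d"
  have c: "continuous_on UNIV (pd k u)" using u by simp
  have [measurable]: "pd k u \<in> borel_measurable borel" using c by (rule borel_measurable_continuous_onI)
  have ftc: "(LINT t|lborel. pd k u (x + t *\<^sub>R ?e) * indicator {0..1} t) = u (x + ?e) - u x" for x
  proof -
    have "(LINT t|lborel. pd k u (x + t *\<^sub>R ?e) * indicator {0..1} t) = u (x + 1 *\<^sub>R ?e) - u (x + 0 *\<^sub>R ?e)"
    proof (rule integral_FTC_Icc_real)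
      fix t :: real
      have "((\<lambda>t. x + t *\<^sub>R ?e) has_derivative (\<lambda>h. h *\<^sub>R ?e)) (at t)"
        by (auto intro!: derivative_eq_intros)
      from has_derivative_compose[OF this differentiable_at_has_pd[OF Ck_on_differentiable_at[OF u]]]
      have "((\<lambda>t. u (x + t *\<^sub>R ?e)) has_derivative (\<lambda>h. frechet_derivative u (at (x + t *\<^sub>R ?e)) (h *\<^sub>R ?e))) (at t)" .
      moreover have lin: "linear (frechet_derivative u (at (x + t *\<^sub>R ?e)))"
        using differentiable_at_has_pd[OF Ck_on_differentiable_at[OF u]] has_derivative_linear by blast
      moreover have "(\<lambda>h. frechet_derivative u (at (x + t *\<^sub>R ?e)) (h *\<^sub>R ?e)) = (*) (pd k u (x + t *\<^sub>R ?e))"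
      proof
        fix h show "frechet_derivative u (at (x + t *\<^sub>R ?e)) (h *\<^sub>R ?e) = pd k u (x + t *\<^sub>R ?e) * h"
          unfolding pd_def linear_cmul[OF lin] by (simp add: mult.commute)
      qed
      ultimately show "DERIV (\<lambda>t. u (x + t *\<^sub>R ?e)) t :> pd k u (x + t *\<^sub>R ?e)"
        by (simp only: has_field_derivative_def)
      have "isCont (\<lambda>t. x + t *\<^sub>R ?e) t" by (intro continuous_intros)
      moreover have "isCont (pd k u) (x + t *\<^sub>R ?e)" using c by (simp add: continuous_on_eq_continuous_at)
      ultimately show "isCont (\<lambda>t. pd k u (x + t *\<^sub>R ?e)) t" by (rule isCont_o2)
    qed simp
    then show ?thesis by simp
  qed
  have tr: "integrable lborel (\<lambda>x. h (x + y))" "(LINT x|lborel. h (x + y)) = integral\<^sup>L lborel h"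
    if "integrable lborel h" for h :: "real^'d \<Rightarrow> real" and y
    using integrable_lborel_translate[OF that, of "- y"] integral_lborel_translate[OF that, of "- y"] by simp_all
  let ?F = "\<lambda>(t, x). pd k u (x + t *\<^sub>R ?e) * indicator {0..1} t"
  have F: "integrable (lborel \<Otimes>\<^sub>M lborel) ?F"
  proof (rule lborel_pair.Fubini_integrable)
    have "(\<lambda>t. LINT x|lborel. norm (?F (t, x))) = (\<lambda>t. (LINT x|lborel. \<bar>pd k u x\<bar>) * indicator {0..1} t)"
      using tr(2)[OF integrable_abs[OF i']] by (simp add: abs_mult)
    then show "integrable lborel (\<lambda>t. LINT x|lborel. norm (?F (t, x)))" by simp
    show "AE t in lborel. integrable lborel (\<lambda>x. ?F (t, x))" using tr(1)[OF i'] by simp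
  qed measurable
  have "(LINT x|lborel. pd k u x) = (LINT t::real|lborel. (LINT x|lborel. pd k u x) * indicator {0..1} t)"
    by simp
  also have "\<dots> = (LINT t|lborel. LINT x|lborel. pd k u (x + t *\<^sub>R ?e) * indicator {0..1} t)"
    using tr(2)[OF i'] by simp
  also have "\<dots> = (LINT x|lborel. LINT t|lborel. pd k u (x + t *\<^sub>R ?e) * indicator {0..1} t)"
    by (rule lborel_pair.Fubini_integral[OF F, symmetric])
  also have "\<dots> = (LINT x|lborel. u (x + ?e) - u x)" by (simp add: ftc)
  also have "\<dots> = 0" using tr[OF i] i by simp
  finally show ?thesis .
qed

text \<open>The derivative of the product of the two translates has integral 0. Integrability is
  supplied by \<open>a\<close> and boundedness by \<open>b\<close>.\<close>

lemma kernel_integration_by_parts: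
  fixes a b :: "real^'d::finite \<Rightarrow> real"
  assumes a: "Ck_on (Suc 0) UNIV a" "integrable lborel a" "integrable lborel (pd k a)"
    and b: "Ck_on (Suc 0) UNIV b" "\<And>x. \<bar>b x\<bar> \<le> B" "\<And>x. \<bar>pd k b x\<bar> \<le> B'"
  shows "(LINT x|lborel. pd k a (x - y) * b (x - z)) = - (LINT x|lborel. a (x - y) * pd k b (x - z))"
proof -
  let ?u = "\<lambda>x. a (x - y) * b (x - z)"
  have [measurable]: "b \<in> borel_measurable borel" "pd k b \<in> borel_measurable borel"
    using b(1) Ck_on_measurable[OF b(1)] by (auto intro: Ck_on_measurable[of 0])
  have u: "Ck_on (Suc 0) UNIV ?u" by (intro Ck_on_mult Ck_on_translate a b) simp
  have pdu: "pd k ?u = (\<lambda>x. pd k a (x - y) * b (x - z) + a (x - y) * pd k b (x - z))"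
    using pd_mult[OF Ck_on_differentiable_at[OF Ck_on_translate[OF a(1)]] Ck_on_differentiable_at[OF Ck_on_translate[OF b(1)]]]
    by (simp add: fun_eq_iff pd_translate[OF a(1)] pd_translate[OF b(1)])
  have i1: "integrable lborel (\<lambda>x. pd k a (x - y) * b (x - z))"
    using bounded_mult_integrable[OF integrable_lborel_translate[OF a(3), of y], of "\<lambda>x. b (x - z)" B] b(2)
    by (simp add: mult.commute)
  have i2: "integrable lborel (\<lambda>x. a (x - y) * pd k b (x - z))"
    using bounded_mult_integrable[OF integrable_lborel_translate[OF a(2), of y], of "\<lambda>x. pd k b (x - z)" B'] b(3)
    by (simp add: mult.commute)
  have i0: "integrable lborel ?u"
    using bounded_mult_integrable[OF integrable_lborel_translate[OF a(2), of y], of "\<lambda>x. b (x - z)" B] b(2)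
    by (simp add: mult.commute)
  have "(LINT x|lborel. pd k ?u x) = 0"
    by (rule integral_pd_eq_0[OF u i0]) (use i1 i2 pdu in simp)
  then show ?thesis using i1 i2 by (simp add: pdu)
qed

section \<open>Splitting a field into a gradient and a small remainder\<close>

text \<open>\<open>f m k\<close> represents the distribution \<open>- (\<partial>\<^sub>m v\<^sub>k - \<partial>\<^sub>k v\<^sub>m)\<close>.\<close>

definition curl_data :: "('d \<Rightarrow> real^'d::finite \<Rightarrow> real) \<Rightarrow> ('d \<Rightarrow> 'd \<Rightarrow> real^'d \<Rightarrow> real) \<Rightarrow> bool" where
  "curl_data v f \<longleftrightarrow> (\<forall>k. integrable lborel (v k) \<and> L2 lborel (v k)) \<and>
     (\<forall>m k. integrable lborel (f m k) \<and> (AE x in lborel. f m k x = - f k m x)) \<and>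
     (\<forall>\<psi> m k. (\<forall>n. Ck_on n UNIV \<psi>) \<longrightarrow>
        (LINT x|lborel. v k x * pd m \<psi> x - v m x * pd k \<psi> x) = (LINT x|lborel. f m k x * \<psi> x))"

definition band :: "real \<Rightarrow> real \<Rightarrow> (real^'d::finite \<Rightarrow> real) \<Rightarrow> real^'d \<Rightarrow> real" where
  "band s t u x = conv (moll s) u x - conv (moll t) u x"

text \<open>The \<open>k\<close>-th derivative of the potential obtained by summing
  \<open>conv (gdiff s t m) (v m)\<close> over \<open>m\<close>, with the derivative put on the
  kernel.\<close>

definition gpart :: "real \<Rightarrow> real \<Rightarrow> ('d \<Rightarrow> real^'d::finite \<Rightarrow> real) \<Rightarrow> 'd \<Rightarrow> real^'d \<Rightarrow> real" where
  "gpart s t v k x = (\<Sum>m\<in>UNIV. conv (pd k (gdiff s t m)) (v m) x)"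

text \<open>The curl convolved with the same kernels; the sign comes from the convention that
  \<open>f\<close> is the negative of the curl.\<close>

definition epart :: "real \<Rightarrow> real \<Rightarrow> ('d \<Rightarrow> 'd \<Rightarrow> real^'d::finite \<Rightarrow> real) \<Rightarrow> 'd \<Rightarrow> real^'d \<Rightarrow> real" where
  "epart s t f k x = - (\<Sum>m\<in>UNIV. conv (gdiff s t m) (f m k) x)"

lemma gdiff_measurable: "s > 0 \<Longrightarrow> t > 0 \<Longrightarrow> gdiff s t m \<in> borel_measurable borel"
  by (rule Ck_on_measurable[OF gdiff_smooth])

text \<open>A Helmholtz decomposition: the band is the sum over \<open>m\<close> of v_k convolved
  with the \<open>m\<close>-th derivative of \<open>gdiff s t m\<close>. Exchanging the indices
  \<open>m\<close> and \<open>k\<close> gives the gradient and costs exactly the curl.\<close>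

lemma band_eq:
  fixes v :: "'d::finite \<Rightarrow> real^'d \<Rightarrow> real"
  assumes cd: "curl_data v f" and st: "0 < s" "s \<le> t"
  shows "band s t (v k) x = gpart s t v k x + epart s t f k x"
proof -
  have t: "t > 0" using st by simp
  have v: "integrable lborel (v k)" for k using cd by (simp add: curl_data_def)
  obtain B where B: "\<And>k m. \<And>x::real^'d. \<bar>pd k (gdiff s t m) x\<bar> \<le> B" using pd_gdiff_bounded[OF st] by blast
  note pm = pd_gdiff_measurable[OF st(1) t]
  have 1: "conv (pd m (gdiff s t m)) (v k) x - conv (pd k (gdiff s t m)) (v m) x = - conv (gdiff s t m) (f m k) x" for m
  proof -
    \<comment> \<open>The reflected kernel is inserted into the weak curl identity. It is smooth
      without compact support, which is why \<open>curl_data\<close> demands the identity for all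
      smooth functions.\<close>
    let ?\<psi> = "\<lambda>y. gdiff s t m (x - y)"
    have "\<forall>n. Ck_on n UNIV ?\<psi>" using gdiff_smooth[OF st(1) t] by (auto intro: Ck_on_reflect)
    then have "(LINT y|lborel. v k y * pd m ?\<psi> y - v m y * pd k ?\<psi> y) = (LINT y|lborel. f m k y * ?\<psi> y)"
      using cd unfolding curl_data_def by blast
    then have "(LINT y|lborel. - (pd m (gdiff s t m) (x - y) * v k y - pd k (gdiff s t m) (x - y) * v m y)) = conv (gdiff s t m) (f m k) x"
      by (simp add: pd_reflect[OF gdiff_smooth[OF st(1) t]] conv_def mult.commute)
    moreover have "(LINT y|lborel. pd m (gdiff s t m) (x - y) * v k y - pd k (gdiff s t m) (x - y) * v m y)
      = conv (pd m (gdiff s t m)) (v k) x - conv (pd k (gdiff s t m)) (v m) x"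
      unfolding conv_def by (intro Bochner_Integration.integral_diff conv_integrand[OF pm B v])
    ultimately show ?thesis by (simp only: Bochner_Integration.integral_minus)
  qed
  obtain B1 where B1: "\<And>x::real^'d. \<bar>moll s x\<bar> \<le> B1" using moll_bounded[OF st(1)] by blast
  obtain B2 where B2: "\<And>x::real^'d. \<bar>moll t x\<bar> \<le> B2" using moll_bounded[OF t] by blast
  have "band s t (v k) x = conv (\<lambda>x. moll s x - moll t x) (v k) x"
    unfolding band_def by (rule conv_diff_kernel[symmetric, OF _ B1 _ B2 v]) auto
  also have "\<dots> = (\<Sum>m\<in>UNIV. conv (pd m (gdiff s t m)) (v k) x)"
    unfolding conv_def pd_gdiff_divergence[OF st(1) t, symmetric] sum_distrib_right
    by (intro Bochner_Integration.integral_sum conv_integrand[OF pm B v])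
  also have "\<dots> = (\<Sum>m\<in>UNIV. conv (pd k (gdiff s t m)) (v m) x - conv (gdiff s t m) (f m k) x)"
    using 1 by (intro sum.cong refl) (simp add: algebra_simps)
  finally show ?thesis by (simp add: gpart_def epart_def sum_subtractf)
qed

lemma moll_norm1: "s > 0 \<Longrightarrow> (LINT x::real^'d::finite|lborel. \<bar>moll s x\<bar>) = 1"
  by (simp add: moll_nonneg moll_integral)

lemma moll_conv_L2:
  fixes v :: "real^'d::finite \<Rightarrow> real"
  assumes "s > 0" "integrable lborel v" "L2 lborel v"
  shows "L2 lborel (conv (moll s) v)" "norm2 lborel (conv (moll s) v) \<le> norm2 lborel v"
proof -
  obtain B where "\<And>x::real^'d. \<bar>moll s x\<bar> \<le> B" using moll_bounded[OF assms(1)] by blast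
  from conv_L2[OF moll_integrable[OF assms(1)] this assms(2,3)]
  show "L2 lborel (conv (moll s) v)" "norm2 lborel (conv (moll s) v) \<le> norm2 lborel v"
    by (simp_all add: moll_norm1[OF assms(1)])
qed

lemma moll_conv_L1:
  fixes v :: "real^'d::finite \<Rightarrow> real"
  assumes "s > 0" "integrable lborel v"
  shows "integrable lborel (conv (moll s) v)" "(LINT x|lborel. \<bar>conv (moll s) v x\<bar>) \<le> (LINT x|lborel. \<bar>v x\<bar>)"
  using conv_integrable[OF moll_integrable[OF assms(1)] assms(2)] 
    conv_norm1[OF moll_integrable[OF assms(1)] assms(2)] by (simp_all add: moll_norm1[OF assms(1)])

lemma moll_conv_adjoint:
  fixes f g :: "real^'d::finite \<Rightarrow> real"
  assumes "s > 0" "integrable lborel f" "integrable lborel g"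
  shows "(LINT x|lborel. conv (moll s) f x * g x) = (LINT x|lborel. f x * conv (moll s) g x)"
proof -
  obtain B where "\<And>x::real^'d. \<bar>moll s x\<bar> \<le> B" using moll_bounded[OF assms(1)] by blast
  from conv_selfadjoint[OF moll_integrable[OF assms(1)] this moll_even assms(2,3)] show ?thesis .
qed

lemma
  fixes u :: "real^'d::finite \<Rightarrow> real"
  assumes st: "0 < s" "0 < t" and u: "integrable lborel u"
  shows band_integrable: "integrable lborel (band s t u)"
    and band_norm1: "(LINT x|lborel. \<bar>band s t u x\<bar>) \<le> 2 * (LINT x|lborel. \<bar>u x\<bar>)"
    and band_L2: "L2 lborel u \<Longrightarrow> L2 lborel (band s t u)"
    and band_norm2: "L2 lborel u \<Longrightarrow> norm2 lborel (band s t u) \<le> 2 * norm2 lborel u"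
proof -
  note a = moll_conv_L1[OF st(1) u] and b = moll_conv_L1[OF st(2) u]
  show i: "integrable lborel (band s t u)" unfolding band_def[abs_def] using a b by auto
  have "(LINT x|lborel. \<bar>band s t u x\<bar>) \<le> (LINT x|lborel. \<bar>conv (moll s) u x\<bar> + \<bar>conv (moll t) u x\<bar>)"
    using i a b by (intro integral_mono) (auto simp: band_def)
  also have "\<dots> = (LINT x|lborel. \<bar>conv (moll s) u x\<bar>) + (LINT x|lborel. \<bar>conv (moll t) u x\<bar>)"
    using a b by (intro Bochner_Integration.integral_add) auto
  finally show "(LINT x|lborel. \<bar>band s t u x\<bar>) \<le> 2 * (LINT x|lborel. \<bar>u x\<bar>)"
    using a b by linarith
  assume L: "L2 lborel u"
  note a = moll_conv_L2[OF st(1) u L] and b = moll_conv_L2[OF st(2) u L]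
  show "L2 lborel (band s t u)" unfolding band_def[abs_def] by (rule L2_diff[OF a(1) b(1)])
  show "norm2 lborel (band s t u) \<le> 2 * norm2 lborel u"
    unfolding band_def[abs_def] using norm2_triangle_diff[OF a(1) b(1)] a(2) b(2) by linarith
qed

lemma band_adjoint:
  fixes f g :: "real^'d::finite \<Rightarrow> real"
  assumes "0 < s" "0 < t" and f: "integrable lborel f" "L2 lborel f" and g: "integrable lborel g" "L2 lborel g"
  shows "(LINT x|lborel. band s t f x * g x) = (LINT x|lborel. f x * band s t g x)"
  unfolding band_def left_diff_distrib right_diff_distrib
  using moll_conv_adjoint[OF assms(1) f(1) g(1)] moll_conv_adjoint[OF assms(2) f(1) g(1)]
    L2_mult_integrable[OF moll_conv_L2(1)[OF assms(1) f] g(2)] L2_mult_integrable[OF moll_conv_L2(1)[OF assms(2) f] g(2)]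
    L2_mult_integrable[OF f(2) moll_conv_L2(1)[OF assms(1) g]] L2_mult_integrable[OF f(2) moll_conv_L2(1)[OF assms(2) g]]
  by simp

lemma
  fixes f :: "'d::finite \<Rightarrow> 'd \<Rightarrow> real^'d \<Rightarrow> real"
  assumes st: "0 < s" "s \<le> t" and f: "\<And>m k. integrable lborel (f m k)"
  shows epart_integrable: "integrable lborel (epart s t f k)"
    and epart_L2: "L2 lborel (epart s t f k)"
proof -
  have t: "t > 0" using st by simp
  show i: "integrable lborel (epart s t f k)"
    unfolding epart_def[abs_def]
    by (intro integrable_minus Bochner_Integration.integrable_sum conv_integrable gdiff_integrable st f)
  obtain B where B: "\<And>m. \<And>x::real^'d. \<bar>gdiff s t m x\<bar> \<le> B" using gdiff_bounded[OF st(1) t] by blast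
  have "\<bar>epart s t f k x\<bar> \<le> (\<Sum>m\<in>UNIV. B * (LINT y|lborel. \<bar>f m k y\<bar>))" for x
  proof -
    have "\<bar>epart s t f k x\<bar> \<le> (\<Sum>m\<in>UNIV. \<bar>conv (gdiff s t m) (f m k) x\<bar>)"
      unfolding epart_def abs_minus_cancel by (rule sum_abs)
    also have "\<dots> \<le> (\<Sum>m\<in>UNIV. B * (LINT y|lborel. \<bar>f m k y\<bar>))"
      by (intro sum_mono conv_bound gdiff_measurable st t B f)
    finally show ?thesis .
  qed
  then show "L2 lborel (epart s t f k)" by (rule L2_bounded_integrable[OF i])
qed

text \<open>Young's inequality in L^1 with \<open>gdiff_norm1\<close>: the kernel is one derivative
  better than a mollifier, and this shows up as the factor \<open>t\<close>.\<close>

lemma epart_norm1: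
  fixes f :: "'d::finite \<Rightarrow> 'd \<Rightarrow> real^'d \<Rightarrow> real"
  assumes t: "0 < t" and f: "\<And>m k. integrable lborel (f m k)"
  shows "(LINT x|lborel. \<bar>epart (t / 2 ^ J) t f k x\<bar>) \<le> t * gconst TYPE('d) * (\<Sum>m\<in>UNIV. LINT y|lborel. \<bar>f m k y\<bar>)"
proof -
  let ?s = "t / 2 ^ J"
  have st: "0 < ?s" "?s \<le> t" using t by (auto simp: divide_le_eq mult_le_cancel_left1)
  have ci: "integrable lborel (\<lambda>x. \<bar>conv (gdiff ?s t m) (f m k) x\<bar>)" for m
    by (intro integrable_abs conv_integrable gdiff_integrable st f)
  have "(LINT x|lborel. \<bar>epart ?s t f k x\<bar>) \<le> (LINT x|lborel. (\<Sum>m\<in>UNIV. \<bar>conv (gdiff ?s t m) (f m k) x\<bar>))"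
  proof (rule integral_mono)
    show "\<bar>epart ?s t f k x\<bar> \<le> (\<Sum>m\<in>UNIV. \<bar>conv (gdiff ?s t m) (f m k) x\<bar>)" for x
      unfolding epart_def abs_minus_cancel by (rule sum_abs)
  qed (use ci epart_integrable[of ?s t f, OF st f] in auto)
  also have "\<dots> = (\<Sum>m\<in>UNIV. LINT x|lborel. \<bar>conv (gdiff ?s t m) (f m k) x\<bar>)"
    by (rule Bochner_Integration.integral_sum) (rule ci)
  also have "\<dots> \<le> (\<Sum>m\<in>UNIV. t * gconst TYPE('d) * (LINT y|lborel. \<bar>f m k y\<bar>))"
  proof (rule sum_mono)
    fix m
    have "(LINT x|lborel. \<bar>conv (gdiff ?s t m) (f m k) x\<bar>) \<le> (LINT x::real^'d|lborel. \<bar>gdiff ?s t m x\<bar>) * (LINT y|lborel. \<bar>f m k y\<bar>)"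
      by (intro conv_norm1 gdiff_integrable st f)
    also have "\<dots> \<le> t * gconst TYPE('d) * (LINT y|lborel. \<bar>f m k y\<bar>)"
      by (intro mult_right_mono gdiff_norm1 t) auto
    finally show "(LINT x|lborel. \<bar>conv (gdiff ?s t m) (f m k) x\<bar>) \<le> t * gconst TYPE('d) * (LINT y|lborel. \<bar>f m k y\<bar>)" .
  qed
  finally show ?thesis by (simp add: sum_distrib_left)
qed

text \<open>In the second identity one integration by parts moves \<open>k\<close> to the right, the
  second derivatives are exchanged, and another one moves \<open>l\<close> to the left. It expresses
  at the level of kernels that gradients are curl free.\<close>

lemma gdiff_kernel_by_parts:
  assumes st: "0 < s" "s \<le> t"
  shows "(LINT x|lborel. pd k (gdiff s t m) (x - y) * gdiff s t n (x - z)) =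
    - (LINT x|lborel. gdiff s t m (x - y) * pd k (gdiff s t n) (x - z))" (is ?A)
    and "(LINT x|lborel. pd k (gdiff s t m) (x - y) * pd l (gdiff s t n) (x - z)) =
    (LINT x|lborel. pd l (gdiff s t m) (x - y) * pd k (gdiff s t n) (x - z))" (is ?B)
proof -
  have t: "t > 0" using st by simp
  obtain B0 where B0: "\<And>m. \<And>x::real^'a. \<bar>gdiff s t m x\<bar> \<le> B0" using gdiff_bounded[OF st(1) t] by blast
  obtain B1 where B1: "\<And>k m. \<And>x::real^'a. \<bar>pd k (gdiff s t m) x\<bar> \<le> B1" using pd_gdiff_bounded[OF st] by blast
  obtain B2 where B2: "\<And>l k m. \<And>x::real^'a. \<bar>pd l (pd k (gdiff s t m)) x\<bar> \<le> B2" using pd_pd_gdiff_bounded[OF st(1) t] by blast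
  note g = gdiff_smooth[OF st(1) t] gdiff_integrable[OF st] pd_gdiff_integrable[OF st]
  show ?A by (rule kernel_integration_by_parts[OF g g(1) B0 B1])
  have p: "Ck_on (Suc 0) UNIV (pd l (gdiff s t n))" for l
    using gdiff_smooth[OF st(1) t, of "Suc (Suc 0)" n] by simp
  have "(LINT x|lborel. pd k (gdiff s t m) (x - y) * pd l (gdiff s t n) (x - z)) =
      - (LINT x|lborel. gdiff s t m (x - y) * pd k (pd l (gdiff s t n)) (x - z))"
    by (rule kernel_integration_by_parts[OF g p B1 B2])
  also have "\<dots> = - (LINT x|lborel. gdiff s t m (x - y) * pd l (pd k (gdiff s t n)) (x - z))"
    by (simp only: pd_pd_gdiff_sym[OF st(1) t, of k l n])
  also have "\<dots> = (LINT x|lborel. pd l (gdiff s t m) (x - y) * pd k (gdiff s t n) (x - z))"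
    by (subst kernel_integration_by_parts[OF g p B1 B2]) simp
  finally show ?B .
qed

lemma gpart_L2:
  fixes v :: "'d::finite \<Rightarrow> real^'d \<Rightarrow> real"
  assumes st: "0 < s" "s \<le> t" and v: "\<And>k. integrable lborel (v k)"
  shows "L2 lborel (gpart s t v k)"
proof -
  obtain B1 where B1: "\<And>k m. \<And>x::real^'d. \<bar>pd k (gdiff s t m) x\<bar> \<le> B1" using pd_gdiff_bounded[OF st] by blast
  have "L2 lborel (conv (pd k (gdiff s t m)) (v m))" for m
  proof (rule L2_bounded_integrable[OF conv_integrable[OF pd_gdiff_integrable[OF st] v]])
    show "\<bar>conv (pd k (gdiff s t m)) (v m) x\<bar> \<le> B1 * (LINT y|lborel. \<bar>v m y\<bar>)" for x
      by (rule conv_bound[OF pd_gdiff_measurable B1 v]) (use st in auto)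
  qed
  then show ?thesis unfolding gpart_def[abs_def] by (intro L2_sum)
qed

lemma conv_gdiff_L2:
  fixes v :: "real^'d::finite \<Rightarrow> real"
  assumes st: "0 < s" "s \<le> t" and v: "integrable lborel v"
  shows "L2 lborel (conv (pd k (gdiff s t m)) v)" "L2 lborel (conv (gdiff s t m) v)"
proof -
  have t: "t > 0" using st by simp
  obtain B1 where B1: "\<And>k m. \<And>x::real^'d. \<bar>pd k (gdiff s t m) x\<bar> \<le> B1" using pd_gdiff_bounded[OF st] by blast
  obtain B0 where B0: "\<And>m. \<And>x::real^'d. \<bar>gdiff s t m x\<bar> \<le> B0" using gdiff_bounded[OF st(1) t] by blast
  show "L2 lborel (conv (pd k (gdiff s t m)) v)"
    by (rule L2_bounded_integrable[OF conv_integrable[OF pd_gdiff_integrable[OF st] v] 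
      conv_bound[OF pd_gdiff_measurable[OF st(1) t] B1 v]])
  show "L2 lborel (conv (gdiff s t m) v)"
    by (rule L2_bounded_integrable[OF conv_integrable[OF gdiff_integrable[OF st] v] 
      conv_bound[OF gdiff_measurable[OF st(1) t] B0 v]])
qed

lemma integral_sum_mult_sum:
  assumes "\<And>i. i \<in> I \<Longrightarrow> L2 M (f i)" "\<And>j. j \<in> J \<Longrightarrow> L2 M (g j)"
  shows "(LINT x|M. (\<Sum>i\<in>I. f i x) * (\<Sum>j\<in>J. g j x)) = (\<Sum>i\<in>I. \<Sum>j\<in>J. LINT x|M. f i x * g j x)"
proof -
  have "(LINT x|M. (\<Sum>i\<in>I. f i x) * (\<Sum>j\<in>J. g j x)) = (LINT x|M. (\<Sum>i\<in>I. (\<Sum>j\<in>J. f i x * g j x)))"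
    by (simp add: sum_product)
  also have "\<dots> = (\<Sum>i\<in>I. LINT x|M. (\<Sum>j\<in>J. f i x * g j x))"
    using assms by (intro Bochner_Integration.integral_sum Bochner_Integration.integrable_sum L2_mult_integrable)
  also have "\<dots> = (\<Sum>i\<in>I. \<Sum>j\<in>J. LINT x|M. f i x * g j x)"
    using assms by (intro sum.cong refl Bochner_Integration.integral_sum L2_mult_integrable)
  finally show ?thesis .
qed

text \<open>Curl-freeness of the gradient parts: \<open>\<nabla>z \<and> \<nabla>y\<close> is a divergence, so its integral vanishes.\<close>

lemma gpart_wedge:
  fixes v w :: "'d::finite \<Rightarrow> real^'d \<Rightarrow> real"
  assumes st: "0 < s" "s \<le> t" and v: "\<And>k. integrable lborel (v k)" and w: "\<And>k. integrable lborel (w k)"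
  shows "(LINT x|lborel. gpart s t v k x * gpart s t w l x) = (LINT x|lborel. gpart s t v l x * gpart s t w k x)"
proof -
  have t: "t > 0" using st by simp
  obtain B1 where B1: "\<And>k m. \<And>x::real^'d. \<bar>pd k (gdiff s t m) x\<bar> \<le> B1" using pd_gdiff_bounded[OF st] by blast
  note eq = integral_sum_mult_sum[OF conv_gdiff_L2(1)[OF st v] conv_gdiff_L2(1)[OF st w]]
  show ?thesis
    unfolding gpart_def eq
      conv_conv_integral[OF pd_gdiff_integrable[OF st] v w pd_gdiff_measurable[OF st(1) t] B1]
      gdiff_kernel_by_parts(2)[OF st, of k _ _ l] ..
qed

text \<open>The remainder is divergence free because \<open>f\<close> is antisymmetric, hence orthogonal to gradients.\<close>

lemma epart_orthogonal:
  fixes v :: "'d::finite \<Rightarrow> real^'d \<Rightarrow> real"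
  assumes st: "0 < s" "s \<le> t" and v: "\<And>k. integrable lborel (v k)" 
    and f: "\<And>m k. integrable lborel (f m k)" "\<And>m k. AE x in lborel. f m k x = - f k m x"
  shows "(\<Sum>k\<in>UNIV. LINT x|lborel. epart s t f k x * gpart s t v k x) = 0"
proof -
  have t: "t > 0" using st by simp
  obtain B0 where B0: "\<And>m. \<And>x::real^'d. \<bar>gdiff s t m x\<bar> \<le> B0" using gdiff_bounded[OF st(1) t] by blast
  obtain B1 where B1: "\<And>k m. \<And>x::real^'d. \<bar>pd k (gdiff s t m) x\<bar> \<le> B1" using pd_gdiff_bounded[OF st] by blast
  define S where "S m k = (\<Sum>n\<in>UNIV. LINT x|lborel. conv (pd k (gdiff s t m)) (f m k) x * conv (gdiff s t n) (v n) x)" for m k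
  have T: "(LINT x|lborel. conv (gdiff s t m) (f m k) x * conv (pd k (gdiff s t n)) (v n) x) =
      - (LINT x|lborel. conv (pd k (gdiff s t m)) (f m k) x * conv (gdiff s t n) (v n) x)" for m k n
    unfolding conv_conv_integral[OF gdiff_integrable[OF st] f(1) v pd_gdiff_measurable[OF st(1) t] B1]
      conv_conv_integral[OF pd_gdiff_integrable[OF st] f(1) v gdiff_measurable[OF st(1) t] B0]
      gdiff_kernel_by_parts(1)[OF st] by simp
  have "(LINT x|lborel. epart s t f k x * gpart s t v k x) = (\<Sum>m\<in>UNIV. S m k)" for k
  proof -
    have "(LINT x|lborel. epart s t f k x * gpart s t v k x) = 
       - (LINT x|lborel. (\<Sum>m\<in>UNIV. conv (gdiff s t m) (f m k) x) * (\<Sum>n\<in>UNIV. conv (pd k (gdiff s t n)) (v n) x))"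
      unfolding epart_def gpart_def by simp
    also have "\<dots> = - (\<Sum>m\<in>UNIV. \<Sum>n\<in>UNIV. LINT x|lborel. conv (gdiff s t m) (f m k) x * conv (pd k (gdiff s t n)) (v n) x)"
      by (subst integral_sum_mult_sum[OF conv_gdiff_L2(2)[OF st f(1)] conv_gdiff_L2(1)[OF st v]]) (rule refl)
    also have "\<dots> = (\<Sum>m\<in>UNIV. S m k)" unfolding T S_def by (simp add: sum_negf)
    finally show ?thesis .
  qed
  then have sum: "(\<Sum>k\<in>UNIV. LINT x|lborel. epart s t f k x * gpart s t v k x) = (\<Sum>k\<in>UNIV. \<Sum>m\<in>UNIV. S m k)" by simp
  \<comment> \<open>The derivative of the kernel is symmetric in \<open>k\<close> and
    \<open>m\<close> while \<open>f\<close> is antisymmetric; the factor with \<open>v\<close> is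
    the same for both orders. Hence the double sum equals its own negative.\<close>
  have "S m k = - S k m" for m k
  proof -
    have "conv (pd k (gdiff s t m)) (f m k) x = - conv (pd m (gdiff s t k)) (f k m) x" for x
    proof -
      have "conv (pd k (gdiff s t m)) (f m k) x = (LINT y|lborel. - (pd m (gdiff s t k) (x - y) * f k m y))"
        unfolding conv_def pd_gdiff_sym[OF st(1) t, of k m]
      proof (rule integral_cong_AE)
        have [measurable]: "f m k \<in> borel_measurable borel" "f k m \<in> borel_measurable borel" 
          "pd m (gdiff s t k) \<in> borel_measurable borel" using f(1) pd_gdiff_measurable[OF st(1) t] by auto
        show "(\<lambda>y. pd m (gdiff s t k) (x - y) * f m k y) \<in> borel_measurable lborel" by measurable
        show "(\<lambda>y. - (pd m (gdiff s t k) (x - y) * f k m y)) \<in> borel_measurable lborel" by measurable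
        show "AE y in lborel. pd m (gdiff s t k) (x - y) * f m k y = - (pd m (gdiff s t k) (x - y) * f k m y)"
          using f(2)[of m k] by eventually_elim simp
      qed
      then show ?thesis by (simp add: conv_def)
    qed
    then show ?thesis unfolding S_def by (simp add: sum_negf)
  qed
  then have "(\<Sum>k\<in>UNIV. \<Sum>m\<in>UNIV. S m k) = (\<Sum>k\<in>UNIV. \<Sum>m\<in>UNIV. - S k m)" by (intro sum.cong refl)
  also have "\<dots> = - (\<Sum>k\<in>UNIV. \<Sum>m\<in>UNIV. S m k)" by (simp add: sum_negf) (rule sum.swap)
  finally show ?thesis unfolding sum by linarith
qed

text \<open>Absorbs the linear term: if X exceeded b + sqrt a, then (X - b) X would exceed
  a.\<close>

lemma le_of_square_le:
  fixes X a b :: real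
  assumes "X\<^sup>2 \<le> a + b * X" "a \<ge> 0" "b \<ge> 0" "X \<ge> 0"
  shows "X \<le> b + sqrt a"
proof (rule ccontr)
  assume "\<not> X \<le> b + sqrt a"
  then have X: "X > b + sqrt a" by simp
  have s: "sqrt a \<ge> 0" using assms by simp
  have "X * X - b * X = (X - b) * X" by (simp add: algebra_simps)
  also have "(X - b) * X > sqrt a * sqrt a"
    using X s assms by (intro mult_strict_mono') auto
  finally show False using assms by (simp add: power2_eq_square)
qed

text \<open>Interpolation: the remainder is small in \<open>L\<^sup>1\<close>, and its \<open>L\<^sup>2\<close> norm is controlled by pairing it 
  with \<open>v\<close>, which is bounded up to a part \<open>u\<close> that is small in \<open>L\<^sup>2\<close>.\<close>

lemma epart_norm2:
  fixes v :: "'d::finite \<Rightarrow> real^'d \<Rightarrow> real"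
  assumes cd: "curl_data v f" and t: "t > 0" and M: "M \<ge> 0"
    and u: "\<And>k. L2 lborel (u k)" "\<And>k. integrable lborel (u k)" "\<And>k. norm2 lborel (u k) \<le> \<tau>" "\<And>k x. \<bar>v k x - u k x\<bar> \<le> M"
  shows "norm2 lborel (epart (t / 2 ^ J) t f k) \<le> 2 * real CARD('d) * \<tau> + 
     sqrt (2 * M * (t * gconst TYPE('d) * (\<Sum>k\<in>UNIV. \<Sum>m\<in>UNIV. LINT y|lborel. \<bar>f m k y\<bar>)))"
proof -
  let ?s = "t / 2 ^ J"
  have st: "0 < ?s" "?s \<le> t" using t by (auto simp: divide_le_eq mult_le_cancel_left1)
  have v: "integrable lborel (v k)" "L2 lborel (v k)" for k using cd by (auto simp: curl_data_def)
  have f: "integrable lborel (f m k)" "AE x in lborel. f m k x = - f k m x" for m k using cd by (auto simp: curl_data_def)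
  have \<tau>: "\<tau> \<ge> 0" using u(3) norm2_nonneg order_trans by blast
  let ?e = "epart ?s t f"
  let ?F = "t * gconst TYPE('d) * (\<Sum>k\<in>UNIV. \<Sum>m\<in>UNIV. LINT y|lborel. \<bar>f m k y\<bar>)"
  note e = epart_integrable[of ?s t f, OF st f(1)] epart_L2[of ?s t f, OF st f(1)]
  \<comment> \<open>The norm of the whole vector field, since orthogonality to gradients holds only
    after summation over the components.\<close>
  define X where "X = sqrt (\<Sum>k\<in>UNIV. (norm2 lborel (?e k))\<^sup>2)"
  have X2: "X\<^sup>2 = (\<Sum>k\<in>UNIV. (norm2 lborel (?e k))\<^sup>2)" unfolding X_def by (simp add: sum_nonneg)
  have X0: "X \<ge> 0" unfolding X_def by (simp add: sum_nonneg)
  have eX: "norm2 lborel (?e k) \<le> X" for k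
  proof (rule power2_le_imp_le[OF _ X0])
    show "(norm2 lborel (?e k))\<^sup>2 \<le> X\<^sup>2" unfolding X2 by (rule member_le_sum) auto
  qed
  have "X\<^sup>2 = (\<Sum>k\<in>UNIV. LINT x|lborel. ?e k x * ?e k x)"
    unfolding X2 norm2_square by (simp add: power2_eq_square)
  \<comment> \<open>Adding the vanishing pairing with the gradient part completes the remainder to
    the full band of \<open>v\<close>.\<close>
  also have "\<dots> = (\<Sum>k\<in>UNIV. LINT x|lborel. ?e k x * ?e k x) + (\<Sum>k\<in>UNIV. LINT x|lborel. ?e k x * gpart ?s t v k x)"
    using epart_orthogonal[of ?s t v f, OF st v(1) f] by simp
  also have "\<dots> = (\<Sum>k\<in>UNIV. (LINT x|lborel. ?e k x * ?e k x) + (LINT x|lborel. ?e k x * gpart ?s t v k x))"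
    by (simp add: sum.distrib)
  also have "\<dots> = (\<Sum>k\<in>UNIV. LINT x|lborel. band ?s t (?e k) x * v k x)"
  proof (rule sum.cong[OF refl])
    fix k
    have "(LINT x|lborel. ?e k x * ?e k x) + (LINT x|lborel. ?e k x * gpart ?s t v k x) =
       (LINT x|lborel. ?e k x * ?e k x + ?e k x * gpart ?s t v k x)"
      by (rule Bochner_Integration.integral_add[symmetric])
        (intro L2_mult_integrable e gpart_L2 st v)+
    also have "\<dots> = (LINT x|lborel. ?e k x * band ?s t (v k) x)"
      by (simp add: band_eq[OF cd st] algebra_simps)
    \<comment> \<open>The band operator is moved to the remainder, so that \<open>v\<close> appears
      unmollified and can be split pointwise into \<open>u\<close> and a part bounded by
      \<open>M\<close>.\<close>
    also have "\<dots> = (LINT x|lborel. band ?s t (?e k) x * v k x)"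
      by (rule band_adjoint[OF st(1) t e v, symmetric])
    finally show "(LINT x|lborel. ?e k x * ?e k x) + (LINT x|lborel. ?e k x * gpart ?s t v k x) = 
      (LINT x|lborel. band ?s t (?e k) x * v k x)" .
  qed
  also have "\<dots> \<le> (\<Sum>k\<in>UNIV. 2 * M * (t * gconst TYPE('d) * (\<Sum>m\<in>UNIV. LINT y|lborel. \<bar>f m k y\<bar>)) + 2 * X * \<tau>)"
  proof (rule sum_mono)
    fix k
    have bi: "integrable lborel (band ?s t (?e k))" and bL: "L2 lborel (band ?s t (?e k))"
      by (intro band_integrable band_L2 st t e)+
    have i1: "integrable lborel (\<lambda>x. band ?s t (?e k) x * u k x)" by (rule L2_mult_integrable[OF bL u(1)])
    have i2: "integrable lborel (\<lambda>x. band ?s t (?e k) x * v k x)" by (rule L2_mult_integrable[OF bL v(2)])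
    have "(LINT x|lborel. band ?s t (?e k) x * v k x) \<le> (LINT x|lborel. M * \<bar>band ?s t (?e k) x\<bar> + band ?s t (?e k) x * u k x)"
    proof (rule integral_mono)
      fix x
      have "band ?s t (?e k) x * (v k x - u k x) \<le> \<bar>band ?s t (?e k) x\<bar> * \<bar>v k x - u k x\<bar>"
        by (metis abs_ge_self abs_mult)
      also have "\<dots> \<le> \<bar>band ?s t (?e k) x\<bar> * M" by (intro mult_left_mono u) simp
      finally show "band ?s t (?e k) x * v k x \<le> M * \<bar>band ?s t (?e k) x\<bar> + band ?s t (?e k) x * u k x"
        by (simp add: algebra_simps)
    qed (use i1 i2 bi in auto)
    also have "\<dots> = M * (LINT x|lborel. \<bar>band ?s t (?e k) x\<bar>) + (LINT x|lborel. band ?s t (?e k) x * u k x)"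
      using i1 bi by simp
    also have "\<dots> \<le> M * (2 * (t * gconst TYPE('d) * (\<Sum>m\<in>UNIV. LINT y|lborel. \<bar>f m k y\<bar>))) + (2 * X) * \<tau>"
    proof (intro add_mono mult_left_mono M)
      show "(LINT x|lborel. \<bar>band ?s t (?e k) x\<bar>) \<le> 2 * (t * gconst TYPE('d) * (\<Sum>m\<in>UNIV. LINT y|lborel. \<bar>f m k y\<bar>))"
        using band_norm1[OF st(1) t e(1)[of k]] epart_norm1[where f=f and J=J and k=k, OF t f(1)] by linarith
      have "(LINT x|lborel. band ?s t (?e k) x * u k x) \<le> norm2 lborel (band ?s t (?e k)) * norm2 lborel (u k)"
        using L2_Cauchy_Schwarz[OF bL u(1)[of k]] by linarith
      also have "\<dots> \<le> (2 * X) * \<tau>"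
        using band_norm2[OF st(1) t e(1)[of k] e(2)[of k]] eX[of k] X0
        by (intro mult_mono u norm2_nonneg) auto
      finally show "(LINT x|lborel. band ?s t (?e k) x * u k x) \<le> (2 * X) * \<tau>" .
    qed
    finally show "(LINT x|lborel. band ?s t (?e k) x * v k x) \<le> 
      2 * M * (t * gconst TYPE('d) * (\<Sum>m\<in>UNIV. LINT y|lborel. \<bar>f m k y\<bar>)) + 2 * X * \<tau>" by simp
  qed
  also have "\<dots> = 2 * M * ?F + (2 * real CARD('d) * \<tau>) * X"
    by (simp add: sum.distrib sum_distrib_left mult_ac)
  finally have "X\<^sup>2 \<le> 2 * M * ?F + (2 * real CARD('d) * \<tau>) * X" .
  moreover have "2 * M * ?F \<ge> 0"
    using M t gconst_nonneg[where 'd='d] by (intro mult_nonneg_nonneg sum_nonneg integral_nonneg_AE) auto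
  ultimately have "X \<le> 2 * real CARD('d) * \<tau> + sqrt (2 * M * ?F)"
    using \<tau> X0 by (intro le_of_square_le) auto
  then show ?thesis using eX[of k] by linarith
qed

text \<open>All products in the expansion contain a remainder except gradient times gradient, which
  by \<open>gpart_wedge\<close> is symmetric in \<open>k\<close> and \<open>l\<close> and cancels.
  Bands have norm at most 2 A and gradient parts at most 2 A + \<rho>, so each of the two orders
  contributes 2 A \<rho> + (2 A + \<rho>) \<rho>.\<close>

lemma band_wedge_bound:
  fixes v w :: "'d::finite \<Rightarrow> real^'d \<Rightarrow> real"
  assumes v: "curl_data v f" and w: "curl_data w f'" and st: "0 < s" "s \<le> t"
    and A: "\<And>k. norm2 lborel (v k) \<le> A" "\<And>k. norm2 lborel (w k) \<le> A"
    and \<rho>: "\<And>k. norm2 lborel (epart s t f k) \<le> \<rho>" "\<And>k. norm2 lborel (epart s t f' k) \<le> \<rho>"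
  shows "\<bar>(LINT x|lborel. band s t (v k) x * band s t (w l) x) - (LINT x|lborel. band s t (v l) x * band s t (w k) x)\<bar>
    \<le> 2 * \<rho> * (4 * A + \<rho>)"
proof -
  have t: "t > 0" using st by simp
  have v': "integrable lborel (v k)" "L2 lborel (v k)" for k using v by (auto simp: curl_data_def)
  have w': "integrable lborel (w k)" "L2 lborel (w k)" for k using w by (auto simp: curl_data_def)
  have f: "integrable lborel (f m k)" "integrable lborel (f' m k)" for m k using v w by (auto simp: curl_data_def)
  have \<rho>0: "\<rho> \<ge> 0" using \<rho>(1)[of k] norm2_nonneg[of lborel "epart s t f k"] by linarith
  have A0: "A \<ge> 0" using A(1)[of k] norm2_nonneg[of lborel "v k"] by linarith
  have bv: "L2 lborel (band s t (v k))" and bw: "L2 lborel (band s t (w k))" for k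
    by (intro band_L2 st t v' w')+
  have gv: "L2 lborel (gpart s t v k)" and gw: "L2 lborel (gpart s t w k)" for k
    by (intro gpart_L2 st v' w')+
  have ev: "L2 lborel (epart s t f k)" and ew: "L2 lborel (epart s t f' k)" for k
    by (intro epart_L2 st f)+
  have nb: "norm2 lborel (band s t (w k)) \<le> 2 * A" "norm2 lborel (band s t (v k)) \<le> 2 * A" for k
    using band_norm2[OF st(1) t w'] band_norm2[OF st(1) t v'] A by (meson mult_left_mono order_trans zero_le_numeral)+
  have ng: "norm2 lborel (gpart s t v k) \<le> 2 * A + \<rho>" for k
  proof -
    have "gpart s t v k = (\<lambda>x. band s t (v k) x - epart s t f k x)" using band_eq[OF v st] by (simp add: fun_eq_iff)
    then show ?thesis using norm2_triangle_diff[OF bv[of k] ev[of k]] nb(2)[of k] \<rho>(1)[of k] by simp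
  qed
  have split: "(LINT x|lborel. band s t (v k) x * band s t (w l) x) = 
     (LINT x|lborel. epart s t f k x * band s t (w l) x) + ((LINT x|lborel. gpart s t v k x * epart s t f' l x)
       + (LINT x|lborel. gpart s t v k x * gpart s t w l x))" for k l
  proof -
    have "(LINT x|lborel. band s t (v k) x * band s t (w l) x) =
      (LINT x|lborel. epart s t f k x * band s t (w l) x + (gpart s t v k x * epart s t f' l x + gpart s t v k x * gpart s t w l x))"
      by (intro Bochner_Integration.integral_cong refl) (simp add: band_eq[OF v st] band_eq[OF w st] algebra_simps)
    then show ?thesis
      using L2_mult_integrable[OF ev bw] L2_mult_integrable[OF gv ew] L2_mult_integrable[OF gv gw] by simp
  qed
  have b1: "\<bar>LINT x|lborel. epart s t f k x * band s t (w l) x\<bar> \<le> \<rho> * (2 * A)" for k l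
    using order_trans[OF L2_Cauchy_Schwarz[OF ev bw] mult_mono[OF \<rho>(1) nb(1) \<rho>0 norm2_nonneg]] .
  have b2: "\<bar>LINT x|lborel. gpart s t v k x * epart s t f' l x\<bar> \<le> (2 * A + \<rho>) * \<rho>" for k l
  proof (rule order_trans[OF L2_Cauchy_Schwarz[OF gv ew]])
    show "norm2 lborel (gpart s t v k) * norm2 lborel (epart s t f' l) \<le> (2 * A + \<rho>) * \<rho>"
      using A0 \<rho>0 by (intro mult_mono ng \<rho> norm2_nonneg) simp
  qed
  have "2 * \<rho> * (4 * A + \<rho>) = 2 * (\<rho> * (2 * A)) + 2 * ((2 * A + \<rho>) * \<rho>)" by (simp add: algebra_simps)
  then show ?thesis
    unfolding split[of k l] split[of l k] gpart_wedge[of s t v w k l, OF st v'(1) w'(1)]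
    using b1[of k l] b1[of l k] b2[of k l] b2[of l k] by linarith
qed

section \<open>The approximate identity\<close>

lemma moll_conv_tendsto_pointwise:
  fixes g :: "real^'d::finite \<Rightarrow> real"
  assumes g: "continuous_on UNIV g" "\<And>x. \<bar>g x\<bar> \<le> B" and s: "\<And>j. s j > 0" "s \<longlonglongrightarrow> 0"
  shows "(\<lambda>j. conv (moll (s j)) g x) \<longlonglongrightarrow> g x"
proof -
  have [measurable]: "g \<in> borel_measurable borel" using g by (intro borel_measurable_continuous_onI)
  \<comment> \<open>The substitution y = x - s_j u fixes the kernel at scale 1 and moves the scale
    into the argument of \<open>g\<close>, ready for dominated convergence.\<close>
  have eq: "conv (moll (s j)) g x = (LINT u|lborel. moll 1 u * g (x - s j *\<^sub>R u))" for j
  proof -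
    let ?F = "\<lambda>y. moll (s j) (x - y) * g y"
    have i: "integrable lborel ?F"
      using bounded_mult_integrable[OF integrable_lborel_reflect[OF moll_integrable[OF s(1)[of j]], of x], of g B] g(2)
      by (simp add: mult.commute)
    have "(LINT u|lborel. ?F (x + (- s j) *\<^sub>R u)) = (LINT y|lborel. ?F y) / (s j) ^ CARD('d)"
      using integral_lborel_affine[OF _ i, of "- s j" x] s(1)[of j] by simp
    moreover have "?F (x + (- s j) *\<^sub>R u) = moll 1 u * g (x - s j *\<^sub>R u) / (s j) ^ CARD('d)" for u
      using moll_scale[OF s(1)[of j], of u] by simp
    ultimately have "(LINT u|lborel. moll 1 u * g (x - s j *\<^sub>R u)) / (s j) ^ CARD('d) = (LINT y|lborel. ?F y) / (s j) ^ CARD('d)"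
      by simp
    then show ?thesis using s(1)[of j] by (simp add: conv_def)
  qed
  have "(\<lambda>j. LINT u|lborel. moll 1 u * g (x - s j *\<^sub>R u)) \<longlonglongrightarrow> (LINT u::real^'d|lborel. moll 1 u * g x)"
  proof (rule integral_dominated_convergence[where w="\<lambda>u. B * moll 1 u"])
    show "integrable lborel (\<lambda>u::real^'d. B * moll 1 u)" using moll_integrable[of 1, where 'd='d] by simp
    show "AE u in lborel. (\<lambda>j. moll 1 u * g (x - s j *\<^sub>R u)) \<longlonglongrightarrow> moll 1 u * g x"
    proof (intro AE_I2 tendsto_mult tendsto_const)
      fix u :: "real^'d"
      have "(\<lambda>j. x - s j *\<^sub>R u) \<longlonglongrightarrow> x - 0 *\<^sub>R u" by (intro tendsto_diff tendsto_scaleR tendsto_const s)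
      then have "(\<lambda>j. x - s j *\<^sub>R u) \<longlonglongrightarrow> x" by simp
      then show "(\<lambda>j. g (x - s j *\<^sub>R u)) \<longlonglongrightarrow> g x"
        by (rule continuous_on_tendsto_compose[OF g(1)]) auto
    qed
    show "AE u in lborel. norm (moll 1 u * g (x - s j *\<^sub>R u)) \<le> B * moll 1 u" for j
    proof (rule AE_I2)
      fix u :: "real^'d"
      have "\<bar>moll 1 u * g (x - s j *\<^sub>R u)\<bar> = moll 1 u * \<bar>g (x - s j *\<^sub>R u)\<bar>" by (simp add: abs_mult moll_nonneg)
      also have "\<dots> \<le> moll 1 u * B" by (rule mult_left_mono[OF g(2) moll_nonneg])
      finally show "norm (moll 1 u * g (x - s j *\<^sub>R u)) \<le> B * moll 1 u" unfolding real_norm_def mult.commute[of B] .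
    qed
  qed measurable
  then show ?thesis unfolding eq using moll_integral[of 1, where 'd='d] by simp
qed

text \<open>A measurable function is an almost everywhere limit of continuous ones. Clamping these
  to [-M, M] and cutting them off beyond radius R + 1 keeps the limit and provides an integrable
  majorant.\<close>

lemma bounded_continuous_approx:
  fixes u :: "real^'d::finite \<Rightarrow> real"
  assumes u[measurable]: "u \<in> borel_measurable borel" and M: "\<And>x. \<bar>u x\<bar> \<le> M" 
    and R: "\<And>x. norm x > R \<Longrightarrow> u x = 0" and \<eta>: "\<eta> > 0"
  obtains g where "continuous_on UNIV g" "\<And>x. \<bar>g x\<bar> \<le> M" "integrable lborel g" 
    "L2 lborel g" "norm2 lborel (\<lambda>x. u x - g x) < \<eta>"
proof -
  have M0: "M \<ge> 0" using M[of 0] by linarith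
  have "u \<in> borel_measurable lebesgue" using u by (simp add: measurable_completion)
  then have "u measurable_on UNIV" by (rule lebesgue_measurable_imp_measurable_on) simp
  then obtain N h where N: "negligible N" and h: "\<And>n. continuous_on UNIV (h n)"
    and lim: "\<And>x. x \<notin> N \<Longrightarrow> (\<lambda>n. h n x) \<longlonglongrightarrow> u x"
    unfolding measurable_on_def by auto
  \<comment> \<open>A continuous cutoff equal to 1 where |x| is at most \<open>R\<close> and to 0
    beyond R + 1.\<close>
  define c where "c x = max 0 (min 1 (R + 1 - norm x))" for x :: "real^'d"
  define g where "g n x = c x * max (- M) (min M (h n x))" for n x
  have gc: "continuous_on UNIV (g n)" for n
    unfolding g_def c_def by (intro continuous_intros h)
  have [measurable]: "g n \<in> borel_measurable borel" for n by (rule borel_measurable_continuous_onI[OF gc])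
  have gM: "\<bar>g n x\<bar> \<le> M" for n x
  proof -
    have "\<bar>c x\<bar> \<le> 1" "\<bar>max (- M) (min M (h n x))\<bar> \<le> M" using M0 by (auto simp: c_def)
    then have "\<bar>c x\<bar> * \<bar>max (- M) (min M (h n x))\<bar> \<le> 1 * M" by (intro mult_mono) auto
    then show ?thesis by (simp add: g_def abs_mult)
  qed
  have gR: "g n x = 0" if "norm x > R + 1" for n x using that by (simp add: g_def c_def)
  have ib: "integrable lborel (\<lambda>x::real^'d. C * indicator (cball 0 (R + 1)) x)" for C :: real
    by (intro integrable_mult_right integrable_real_indicator emeasure_compact_finite) (auto intro: emeasure_compact_finite)
  have gi: "integrable lborel (g n)" for n
  proof (rule Bochner_Integration.integrable_bound[OF ib[of M]])
    show "AE x in lborel. norm (g n x) \<le> norm (M * indicator (cball 0 (R + 1)) x)"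
      using gM M0 gR by (auto simp: indicator_def not_le)
  qed measurable
  have AE: "AE x in lborel. x \<notin> N"
  proof -
    have "AE x in lebesgue. x \<notin> N" using N by (simp add: negligible_iff_null_sets AE_not_in)
    then show ?thesis by (simp add: AE_completion_iff)
  qed
  have cx: "(\<lambda>n. g n x) \<longlonglongrightarrow> u x" if "x \<notin> N" for x
  proof -
    have "(\<lambda>n. g n x) \<longlonglongrightarrow> c x * max (- M) (min M (u x))"
      unfolding g_def by (intro tendsto_mult tendsto_max tendsto_min tendsto_const lim that)
    moreover have "max (- M) (min M (u x)) = u x" using M[of x] by auto
    moreover have "c x * u x = u x" using R[of x] by (cases "norm x > R") (auto simp: c_def)
    ultimately show ?thesis by simp
  qed
  have "(\<lambda>n. LINT x|lborel. (u x - g n x)\<^sup>2) \<longlonglongrightarrow> (LINT x::real^'d|lborel. 0)"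
  proof (rule integral_dominated_convergence[OF _ _ ib[of "(2 * M)\<^sup>2"]])
    show "AE x in lborel. (\<lambda>n. (u x - g n x)\<^sup>2) \<longlonglongrightarrow> 0"
      using AE
    proof eventually_elim
      case (elim x)
      have "(\<lambda>n. (u x - g n x)\<^sup>2) \<longlonglongrightarrow> (u x - u x)\<^sup>2" by (intro tendsto_power tendsto_diff tendsto_const cx elim)
      then show ?case by simp
    qed
    show "AE x in lborel. norm ((u x - g n x)\<^sup>2) \<le> (2 * M)\<^sup>2 * indicator (cball 0 (R + 1)) x" for n
    proof (rule AE_I2)
      fix x
      have "\<bar>u x - g n x\<bar> \<le> 2 * M" using M[of x] gM[of n x] by linarith
      then have "(u x - g n x)\<^sup>2 \<le> (2 * M)\<^sup>2" using power_mono[of "\<bar>u x - g n x\<bar>" "2 * M" 2] by simp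
      then show "norm ((u x - g n x)\<^sup>2) \<le> (2 * M)\<^sup>2 * indicator (cball 0 (R + 1)) x"
        using gR[of x n] R[of x] by (auto simp: indicator_def)
    qed
  qed measurable
  then have "(\<lambda>n. norm2 lborel (\<lambda>x. u x - g n x)) \<longlonglongrightarrow> sqrt 0"
    unfolding norm2_def by (intro tendsto_real_sqrt) simp
  then have "\<forall>\<^sub>F n in sequentially. norm2 lborel (\<lambda>x. u x - g n x) < \<eta>"
    using \<eta> by (intro order_tendstoD) auto
  then obtain n where "norm2 lborel (\<lambda>x. u x - g n x) < \<eta>" by (auto simp: eventually_sequentially)
  then show thesis using that[of "g n"] gc gM gi L2_bounded_integrable[OF gi gM] by blast
qed

lemma L2_truncate:
  assumes v: "L2 M v" and \<eta>: "\<eta> > 0"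
  obtains n :: nat where "norm2 M (\<lambda>x. v x - max (- real n) (min (real n) (v x))) < \<eta>"
proof -
  have [measurable]: "v \<in> borel_measurable M" using v by (rule L2_measurable)
  have "(\<lambda>n. LINT x|M. (v x - max (- real n) (min (real n) (v x)))\<^sup>2) \<longlonglongrightarrow> (LINT x|M. 0)"
  proof (rule integral_dominated_convergence[where w="\<lambda>x. (v x)\<^sup>2"])
    show "AE x in M. (\<lambda>n. (v x - max (- real n) (min (real n) (v x)))\<^sup>2) \<longlonglongrightarrow> 0"
    proof (intro AE_I2 tendsto_eventually)
      fix x
      obtain n0 where "\<bar>v x\<bar> \<le> real n0" using real_arch_simple by blast
      then show "\<forall>\<^sub>F n in sequentially. (v x - max (- real n) (min (real n) (v x)))\<^sup>2 = 0"
        unfolding eventually_sequentially by (intro exI[of _ n0]) (auto simp: max_def min_def)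
    qed
    show "AE x in M. norm ((v x - max (- real n) (min (real n) (v x)))\<^sup>2) \<le> (v x)\<^sup>2" for n
      by (intro AE_I2) (auto simp: abs_le_square_iff[symmetric] max_def min_def)
    show "integrable M (\<lambda>x. (v x)\<^sup>2)" using v by (simp add: L2_def)
  qed measurable
  then have "(\<lambda>n. norm2 M (\<lambda>x. v x - max (- real n) (min (real n) (v x)))) \<longlonglongrightarrow> sqrt 0"
    unfolding norm2_def by (intro tendsto_real_sqrt) simp
  then have "\<forall>\<^sub>F n in sequentially. norm2 M (\<lambda>x. v x - max (- real n) (min (real n) (v x))) < \<eta>"
    using \<eta> by (intro order_tendstoD) auto
  then show thesis using that by (auto simp: eventually_sequentially)
qed

lemma L2_continuous_approx:
  fixes v :: "real^'d::finite \<Rightarrow> real"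
  assumes v: "L2 lborel v" and R: "\<And>x. norm x > R \<Longrightarrow> v x = 0" and \<eta>: "\<eta> > 0"
  obtains g B where "continuous_on UNIV g" "\<And>x. \<bar>g x\<bar> \<le> B" "integrable lborel g" 
    "L2 lborel g" "norm2 lborel (\<lambda>x. v x - g x) < \<eta>"
proof -
  have [measurable]: "v \<in> borel_measurable borel" using L2_measurable[OF v] by simp
  obtain n :: nat where n: "norm2 lborel (\<lambda>x. v x - max (- real n) (min (real n) (v x))) < \<eta> / 2"
    using L2_truncate[OF v, of "\<eta> / 2"] \<eta> by auto
  let ?u = "\<lambda>x. max (- real n) (min (real n) (v x))"
  have uL: "L2 lborel ?u" by (rule L2_bound[OF v]) (auto simp: max_def min_def)
  obtain g where g: "continuous_on UNIV g" "\<And>x. \<bar>g x\<bar> \<le> real n" "integrable lborel g" 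
    "L2 lborel g" "norm2 lborel (\<lambda>x. ?u x - g x) < \<eta> / 2"
    by (rule bounded_continuous_approx[of ?u "real n" R "\<eta> / 2"]) (use R \<eta> in \<open>auto simp: max_def min_def\<close>)
  have "norm2 lborel (\<lambda>x. (v x - ?u x) + (?u x - g x)) \<le> norm2 lborel (\<lambda>x. v x - ?u x) + norm2 lborel (\<lambda>x. ?u x - g x)"
    by (intro norm2_triangle L2_diff v uL g)
  then have "norm2 lborel (\<lambda>x. v x - g x) < \<eta>" using n g(5) by simp
  then show thesis using that g by blast
qed

text \<open>Replacing one factor \<open>v\<close> by a bounded continuous \<open>g\<close> costs the
  same for every \<open>j\<close>, because mollification does not increase the L^2 norm; for
  \<open>g\<close> the pointwise convergence is dominated by a multiple of |v|.\<close>

lemma moll_conv_weak: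
  fixes v :: "real^'d::finite \<Rightarrow> real"
  assumes v: "integrable lborel v" "L2 lborel v" and R: "\<And>x. norm x > R \<Longrightarrow> v x = 0" 
    and s: "\<And>j. s j > 0" "s \<longlonglongrightarrow> 0"
  shows "(\<lambda>j. LINT x|lborel. conv (moll (s j)) v x * v x) \<longlonglongrightarrow> (norm2 lborel v)\<^sup>2"
proof (rule LIMSEQ_I)
  fix r :: real assume r: "r > 0"
  \<comment> \<open>Each of the two replacement errors is at most \<eta> times the norm of
    \<open>v\<close>, hence at most r / 3; the added 1 keeps the denominator positive.\<close>
  define \<eta> where "\<eta> = r / 3 / (norm2 lborel v + 1)"
  have nv: "norm2 lborel v \<ge> 0" by (rule norm2_nonneg)
  have \<eta>: "\<eta> > 0" using r nv by (simp add: \<eta>_def)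
  have \<eta>v: "\<eta> * norm2 lborel v \<le> r / 3"
  proof -
    have "\<eta> * norm2 lborel v \<le> \<eta> * (norm2 lborel v + 1)" using \<eta> by simp
    also have "\<dots> = r / 3"
      using nonzero_eq_divide_eq[of "norm2 lborel v + 1" \<eta> "r / 3"] nv \<eta>_def by linarith
    finally show ?thesis .
  qed
  obtain g B where g: "continuous_on UNIV g" "\<And>x. \<bar>g x\<bar> \<le> B" "integrable lborel g" 
    "L2 lborel g" "norm2 lborel (\<lambda>x. v x - g x) < \<eta>"
    using L2_continuous_approx[OF v(2) R \<eta>] by blast
  have [measurable]: "v \<in> borel_measurable borel" "g \<in> borel_measurable borel" using v g by auto
  have Tg: "\<bar>conv (moll (s j)) g x\<bar> \<le> B" for j x
  proof -
    have "\<bar>conv (moll (s j)) g x\<bar> \<le> (LINT y|lborel. \<bar>moll (s j) (x - y) * g y\<bar>)"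
      unfolding conv_def by (rule integral_abs_bound)
    also have "\<dots> \<le> (LINT y|lborel. B * moll (s j) (x - y))"
    proof (rule integral_mono)
      have "integrable lborel (\<lambda>y. moll (s j) (x - y) * g y)"
        using bounded_mult_integrable[OF integrable_lborel_reflect[OF moll_integrable[OF s(1)[of j]], of x], of g B] g(2)
        by (simp add: mult.commute)
      then show "integrable lborel (\<lambda>y. \<bar>moll (s j) (x - y) * g y\<bar>)" by simp
      show "integrable lborel (\<lambda>y. B * moll (s j) (x - y))"
        using integrable_lborel_reflect[OF moll_integrable[OF s(1)[of j]], of x] by simp
      show "\<bar>moll (s j) (x - y) * g y\<bar> \<le> B * moll (s j) (x - y)" for y
        using mult_right_mono[OF g(2)[of y] moll_nonneg[of "s j" "x - y"]] by (simp add: abs_mult moll_nonneg mult.commute)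
    qed
    also have "\<dots> = B" using integral_lborel_reflect[OF moll_integrable[OF s(1)[of j]], of x] moll_integral[OF s(1)[of j], where 'd='d] by simp
    finally show ?thesis .
  qed
  have "(\<lambda>j. LINT x|lborel. conv (moll (s j)) g x * v x) \<longlonglongrightarrow> (LINT x|lborel. g x * v x)"
  proof (rule integral_dominated_convergence[where w="\<lambda>x. B * \<bar>v x\<bar>"])
    show "AE x in lborel. (\<lambda>j. conv (moll (s j)) g x * v x) \<longlonglongrightarrow> g x * v x"
      by (intro AE_I2 tendsto_mult tendsto_const moll_conv_tendsto_pointwise[OF g(1,2) s])
    show "AE x in lborel. norm (conv (moll (s j)) g x * v x) \<le> B * \<bar>v x\<bar>" for j
      using mult_right_mono[OF Tg abs_ge_zero] by (auto simp: abs_mult)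
  qed (use v in auto)
  then obtain j0 where j0: "\<And>j. j \<ge> j0 \<Longrightarrow> \<bar>(LINT x|lborel. conv (moll (s j)) g x * v x) - (LINT x|lborel. g x * v x)\<bar> < r / 3"
    using LIMSEQ_D[of _ _ "r / 3"] r by fastforce
  show "\<exists>j0. \<forall>j\<ge>j0. norm ((LINT x|lborel. conv (moll (s j)) v x * v x) - (norm2 lborel v)\<^sup>2) < r"
  proof (intro exI allI impI)
    fix j assume "j \<ge> j0"
    let ?T = "conv (moll (s j))"
    have d: "L2 lborel (\<lambda>x. v x - g x)" "integrable lborel (\<lambda>x. v x - g x)" using v g by (auto intro: L2_diff)
    obtain Bm where Bm: "\<And>x::real^'d. \<bar>moll (s j) x\<bar> \<le> Bm" using moll_bounded[OF s(1)[of j]] by blast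
    have Td: "?T (\<lambda>x. v x - g x) x = ?T v x - ?T g x" for x
      by (rule conv_diff[OF _ Bm v(1) g(3)]) auto
    note Tv = moll_conv_L2[OF s(1)[of j] v] and Tg' = moll_conv_L2[OF s(1)[of j] g(3,4)] and Td' = moll_conv_L2[OF s(1)[of j] d(2,1)]
    have nv2: "(norm2 lborel v)\<^sup>2 = (LINT x|lborel. v x * v x)"
      unfolding norm2_square by (simp add: power2_eq_square)
    have "(LINT x|lborel. ?T v x * v x) - (norm2 lborel v)\<^sup>2 = 
      (LINT x|lborel. ?T (\<lambda>x. v x - g x) x * v x) + ((LINT x|lborel. ?T g x * v x) - (LINT x|lborel. g x * v x))
       - (LINT x|lborel. (v x - g x) * v x)"
      using L2_mult_integrable[OF Tv(1) v(2)] L2_mult_integrable[OF Tg'(1) v(2)] L2_mult_integrable[OF v(2) v(2)] 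
        L2_mult_integrable[OF g(4) v(2)]
      by (simp add: Td left_diff_distrib nv2)
    moreover have "\<bar>LINT x|lborel. ?T (\<lambda>x. v x - g x) x * v x\<bar> \<le> r / 3"
    proof -
      have "\<bar>LINT x|lborel. ?T (\<lambda>x. v x - g x) x * v x\<bar> \<le> norm2 lborel (?T (\<lambda>x. v x - g x)) * norm2 lborel v"
        by (rule L2_Cauchy_Schwarz[OF Td'(1) v(2)])
      also have "\<dots> \<le> \<eta> * norm2 lborel v" using Td'(2) g(5) nv by (intro mult_right_mono) auto
      finally show ?thesis using \<eta>v by linarith
    qed
    moreover have "\<bar>LINT x|lborel. (v x - g x) * v x\<bar> \<le> r / 3"
    proof -
      have "\<bar>LINT x|lborel. (v x - g x) * v x\<bar> \<le> norm2 lborel (\<lambda>x. v x - g x) * norm2 lborel v"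
        by (rule L2_Cauchy_Schwarz[OF d(1) v(2)])
      also have "\<dots> \<le> \<eta> * norm2 lborel v" using g(5) nv by (intro mult_right_mono) auto
      finally show ?thesis using \<eta>v by linarith
    qed
    ultimately show "norm ((LINT x|lborel. ?T v x * v x) - (norm2 lborel v)\<^sup>2) < r"
      using j0[OF \<open>j \<ge> j0\<close>] unfolding real_norm_def by linarith
  qed
qed

text \<open>Weak convergence and contractivity give strong convergence.\<close>

lemma moll_conv_L2_tendsto:
  fixes v :: "real^'d::finite \<Rightarrow> real"
  assumes v: "integrable lborel v" "L2 lborel v" and R: "\<And>x. norm x > R \<Longrightarrow> v x = 0" 
    and s: "\<And>j. s j > 0" "s \<longlonglongrightarrow> 0"
  shows "(\<lambda>j. norm2 lborel (\<lambda>x. conv (moll (s j)) v x - v x)) \<longlonglongrightarrow> 0"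
proof -
  let ?T = "\<lambda>j. conv (moll (s j)) v"
  note T = moll_conv_L2[OF s(1) v]
  have b: "(norm2 lborel (\<lambda>x. ?T j x - v x))\<^sup>2 \<le> 2 * (norm2 lborel v)\<^sup>2 - 2 * (LINT x|lborel. ?T j x * v x)" for j
  proof -
    have "(norm2 lborel (\<lambda>x. ?T j x - v x))\<^sup>2 = (LINT x|lborel. (?T j x)\<^sup>2 + (v x)\<^sup>2 - 2 * (?T j x * v x))"
      unfolding norm2_square by (simp add: power2_diff mult.assoc)
    also have "\<dots> = (norm2 lborel (?T j))\<^sup>2 + (norm2 lborel v)\<^sup>2 - 2 * (LINT x|lborel. ?T j x * v x)"
      using T(1)[of j] v L2_mult_integrable[OF T(1)[of j] v(2)] by (simp add: norm2_square L2_def)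
    also have "\<dots> \<le> 2 * (norm2 lborel v)\<^sup>2 - 2 * (LINT x|lborel. ?T j x * v x)"
      using power_mono[OF T(2)[of j] norm2_nonneg, of 2] by simp
    finally show ?thesis .
  qed
  have "(\<lambda>j. 2 * (norm2 lborel v)\<^sup>2 - 2 * (LINT x|lborel. ?T j x * v x)) \<longlonglongrightarrow> 2 * (norm2 lborel v)\<^sup>2 - 2 * (norm2 lborel v)\<^sup>2"
    by (intro tendsto_diff tendsto_mult tendsto_const moll_conv_weak[OF v R s])
  then have lim: "(\<lambda>j. 2 * (norm2 lborel v)\<^sup>2 - 2 * (LINT x|lborel. ?T j x * v x)) \<longlonglongrightarrow> 0" by simp
  have "(\<lambda>j. (norm2 lborel (\<lambda>x. ?T j x - v x))\<^sup>2) \<longlonglongrightarrow> 0"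
    by (rule tendsto_sandwich[OF always_eventually always_eventually tendsto_const lim]) (use b in auto)
  then have "(\<lambda>j. sqrt ((norm2 lborel (\<lambda>x. ?T j x - v x))\<^sup>2)) \<longlonglongrightarrow> sqrt 0" by (rule tendsto_real_sqrt)
  then show ?thesis by (simp add: norm2_nonneg)
qed

lemma moll_conv_inner_tendsto:
  fixes v w :: "real^'d::finite \<Rightarrow> real"
  assumes v: "integrable lborel v" "L2 lborel v" "\<And>x. norm x > R \<Longrightarrow> v x = 0" 
    and w: "integrable lborel w" "L2 lborel w" "\<And>x. norm x > R \<Longrightarrow> w x = 0" 
    and s: "\<And>j. s j > 0" "s \<longlonglongrightarrow> 0"
  shows "(\<lambda>j. LINT x|lborel. conv (moll (s j)) v x * conv (moll (s j)) w x) \<longlonglongrightarrow> (LINT x|lborel. v x * w x)"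
proof (rule LIM_zero_cancel)
  let ?V = "\<lambda>j. conv (moll (s j)) v" and ?W = "\<lambda>j. conv (moll (s j)) w"
  note V = moll_conv_L2[OF s(1) v(1,2)] and W = moll_conv_L2[OF s(1) w(1,2)]
  have b: "\<bar>(LINT x|lborel. ?V j x * ?W j x) - (LINT x|lborel. v x * w x)\<bar> \<le>
     norm2 lborel (\<lambda>x. ?V j x - v x) * norm2 lborel w + norm2 lborel v * norm2 lborel (\<lambda>x. ?W j x - w x)" for j
  proof -
    have "(LINT x|lborel. ?V j x * ?W j x) - (LINT x|lborel. v x * w x) =
      (LINT x|lborel. (?V j x - v x) * ?W j x) + (LINT x|lborel. v x * (?W j x - w x))"
      using L2_mult_integrable[OF V(1)[of j] W(1)[of j]] L2_mult_integrable[OF v(2) W(1)[of j]] L2_mult_integrable[OF v(2) w(2)]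
      by (simp add: left_diff_distrib right_diff_distrib)
    moreover have "\<bar>LINT x|lborel. (?V j x - v x) * ?W j x\<bar> \<le> norm2 lborel (\<lambda>x. ?V j x - v x) * norm2 lborel w"
      by (rule order_trans[OF L2_Cauchy_Schwarz[OF L2_diff[OF V(1) v(2)] W(1)] mult_left_mono[OF W(2) norm2_nonneg]])
    moreover have "\<bar>LINT x|lborel. v x * (?W j x - w x)\<bar> \<le> norm2 lborel v * norm2 lborel (\<lambda>x. ?W j x - w x)"
      by (rule L2_Cauchy_Schwarz[OF v(2) L2_diff[OF W(1) w(2)]])
    ultimately show ?thesis by linarith
  qed
  have "(\<lambda>j. norm2 lborel (\<lambda>x. ?V j x - v x) * norm2 lborel w + norm2 lborel v * norm2 lborel (\<lambda>x. ?W j x - w x))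
    \<longlonglongrightarrow> 0 * norm2 lborel w + norm2 lborel v * 0"
    by (intro tendsto_add tendsto_mult tendsto_const moll_conv_L2_tendsto[OF v s] moll_conv_L2_tendsto[OF w s])
  then have lim: "(\<lambda>j. norm2 lborel (\<lambda>x. ?V j x - v x) * norm2 lborel w + norm2 lborel v * norm2 lborel (\<lambda>x. ?W j x - w x))
    \<longlonglongrightarrow> 0" by simp
  show "(\<lambda>j. (LINT x|lborel. ?V j x * ?W j x) - (LINT x|lborel. v x * w x)) \<longlonglongrightarrow> 0"
    by (rule Lim_null_comparison[OF always_eventually lim]) (simp add: b)
qed

text \<open>A mollified field is its band plus its low-frequency part of norm at most \<theta>. The
  cross terms cost \<theta> A + 2 A \<theta> for each of the two orders, hence 6 A \<theta>. All
  bounds are uniform in the dyadic index \<open>J\<close>, and letting it grow removes the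
  mollifier.\<close>

lemma wedge_estimate:
  fixes v w :: "'d::finite \<Rightarrow> real^'d \<Rightarrow> real"
  assumes v: "curl_data v f" "\<And>k x. norm x > R \<Longrightarrow> v k x = 0" 
    and w: "curl_data w f'" "\<And>k x. norm x > R \<Longrightarrow> w k x = 0" and t: "t > 0"
    and A: "\<And>k. norm2 lborel (v k) \<le> A" "\<And>k. norm2 lborel (w k) \<le> A"
    and \<rho>: "\<And>J k. norm2 lborel (epart (t / 2 ^ J) t f k) \<le> \<rho>" "\<And>J k. norm2 lborel (epart (t / 2 ^ J) t f' k) \<le> \<rho>"
    and \<theta>: "\<And>k. norm2 lborel (conv (moll t) (v k)) \<le> \<theta>" "\<And>k. norm2 lborel (conv (moll t) (w k)) \<le> \<theta>"
  shows "\<bar>(LINT x|lborel. v k x * w l x) - (LINT x|lborel. v l x * w k x)\<bar> \<le> 2 * \<rho> * (4 * A + \<rho>) + 6 * A * \<theta>"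
proof -
  define s where "s J = t / 2 ^ J" for J :: nat
  have st: "0 < s J" "s J \<le> t" for J using t by (auto simp: s_def divide_le_eq mult_le_cancel_left1)
  have s0: "s \<longlonglongrightarrow> 0"
  proof -
    have "(\<lambda>J. t * (1 / 2) ^ J) \<longlonglongrightarrow> t * 0" by (intro tendsto_mult tendsto_const LIMSEQ_power_zero) simp
    moreover have "s = (\<lambda>J. t * (1 / 2) ^ J)" by (simp add: fun_eq_iff s_def power_divide)
    ultimately show ?thesis by simp
  qed
  have v': "integrable lborel (v k)" "L2 lborel (v k)" for k using v by (auto simp: curl_data_def)
  have w': "integrable lborel (w k)" "L2 lborel (w k)" for k using w by (auto simp: curl_data_def)
  have A0: "A \<ge> 0" using A(1)[of k] norm2_nonneg[of lborel "v k"] by linarith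
  have \<theta>0: "\<theta> \<ge> 0" using \<theta>(1)[of k] norm2_nonneg[of lborel "conv (moll t) (v k)"] by linarith
  let ?I = "\<lambda>J k l. LINT x|lborel. conv (moll (s J)) (v k) x * conv (moll (s J)) (w l) x"
  have low: "\<bar>?I J k l - (LINT x|lborel. band (s J) t (v k) x * band (s J) t (w l) x)\<bar> \<le> 3 * A * \<theta>" for J k l
  proof -
    have Ts: "L2 lborel (conv (moll (s J)) (w l))" "norm2 lborel (conv (moll (s J)) (w l)) \<le> A"
      by (rule moll_conv_L2[OF st(1) w'(1) w'(2)], rule order_trans[OF moll_conv_L2(2)[OF st(1) w'(1) w'(2)] A(2)])
    have Tv: "L2 lborel (conv (moll t) (v k))" and Tw: "L2 lborel (conv (moll t) (w l))"
      by (rule moll_conv_L2[OF t v'(1) v'(2)], rule moll_conv_L2[OF t w'(1) w'(2)])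
    have P: "L2 lborel (band (s J) t (v k))" and P': "L2 lborel (band (s J) t (w l))"
      by (rule band_L2[OF st(1) t v'(1) v'(2)], rule band_L2[OF st(1) t w'(1) w'(2)])
    have nP: "norm2 lborel (band (s J) t (v k)) \<le> 2 * A"
      by (rule order_trans[OF band_norm2[OF st(1) t v'(1) v'(2)]]) (simp add: A)
    have "?I J k l = (LINT x|lborel. band (s J) t (v k) x * band (s J) t (w l) x + 
       (conv (moll t) (v k) x * conv (moll (s J)) (w l) x + band (s J) t (v k) x * conv (moll t) (w l) x))"
      by (intro Bochner_Integration.integral_cong refl) (simp add: band_def algebra_simps)
    also have "\<dots> = (LINT x|lborel. band (s J) t (v k) x * band (s J) t (w l) x) + 
       ((LINT x|lborel. conv (moll t) (v k) x * conv (moll (s J)) (w l) x) + 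
        (LINT x|lborel. band (s J) t (v k) x * conv (moll t) (w l) x))"
      using L2_mult_integrable[OF P P'] L2_mult_integrable[OF Tv Ts(1)] L2_mult_integrable[OF P Tw] by simp
    finally have eq: "?I J k l - (LINT x|lborel. band (s J) t (v k) x * band (s J) t (w l) x) = 
       (LINT x|lborel. conv (moll t) (v k) x * conv (moll (s J)) (w l) x) + 
        (LINT x|lborel. band (s J) t (v k) x * conv (moll t) (w l) x)" by simp
    have 1: "\<bar>LINT x|lborel. conv (moll t) (v k) x * conv (moll (s J)) (w l) x\<bar> \<le> \<theta> * A"
      by (rule order_trans[OF L2_Cauchy_Schwarz[OF Tv Ts(1)] mult_mono[OF \<theta>(1) Ts(2) \<theta>0 norm2_nonneg]])
    have 2: "\<bar>LINT x|lborel. band (s J) t (v k) x * conv (moll t) (w l) x\<bar> \<le> (2 * A) * \<theta>"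
      by (rule order_trans[OF L2_Cauchy_Schwarz[OF P Tw] mult_mono[OF nP \<theta>(2) _ norm2_nonneg]]) (use A0 in simp)
    have "3 * A * \<theta> = \<theta> * A + (2 * A) * \<theta>" by (simp add: algebra_simps)
    then show ?thesis unfolding eq using 1 2 by linarith
  qed
  have bd: "\<bar>?I J k l - ?I J l k\<bar> \<le> 2 * \<rho> * (4 * A + \<rho>) + 6 * A * \<theta>" for J
    using low[of J k l] low[of J l k] band_wedge_bound[OF v(1) w(1) st A \<rho>[of J, folded s_def], of k l] by linarith
  have lim: "(\<lambda>J. ?I J k l) \<longlonglongrightarrow> (LINT x|lborel. v k x * w l x)" for k l
    by (rule moll_conv_inner_tendsto[OF v'(1) v'(2) v(2) w'(1) w'(2) w(2) st(1) s0])
  have "(\<lambda>J. \<bar>?I J k l - ?I J l k\<bar>) \<longlonglongrightarrow> \<bar>(LINT x|lborel. v k x * w l x) - (LINT x|lborel. v l x * w k x)\<bar>"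
    by (rule tendsto_rabs[OF tendsto_diff[OF lim lim]])
  then show ?thesis by (rule LIMSEQ_le_const2) (use bd in blast)
qed

section \<open>Localisation\<close>

lemma compact_abs_bound:
  fixes h :: "'a::metric_space \<Rightarrow> real"
  assumes "continuous_on K h" "compact K"
  obtains B where "B \<ge> 0" "\<And>x. x \<in> K \<Longrightarrow> \<bar>h x\<bar> \<le> B"
proof -
  have "bounded (h ` K)" by (rule compact_imp_bounded[OF compact_continuous_image[OF assms]])
  then obtain B where B: "\<forall>y\<in>h ` K. norm y \<le> B" unfolding bounded_iff ..
  show thesis
  proof (rule that[of "max B 0"])
    fix x assume "x \<in> K"
    then have "norm (h x) \<le> B" using B by blast
    then show "\<bar>h x\<bar> \<le> max B 0" by simp
  qed simp
qed

lemma test_function_bounded: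
  assumes "test_function \<Omega> \<phi>" obtains B where "B \<ge> 0" "\<And>x. \<bar>\<phi> x\<bar> \<le> B"
proof -
  obtain B where B: "B \<ge> 0" "\<And>x. x \<in> closure {x. \<phi> x \<noteq> 0} \<Longrightarrow> \<bar>\<phi> x\<bar> \<le> B"
    by (rule compact_abs_bound[OF test_function_continuous[OF assms] test_function_support(1)[OF assms]]) blast
  show thesis
  proof (rule that[OF B(1)])
    fix x show "\<bar>\<phi> x\<bar> \<le> B"
    proof (cases "x \<in> closure {x. \<phi> x \<noteq> 0}")
      case True
      then show ?thesis by (rule B(2))
    next
      case False
      then have "\<phi> x = 0" by (rule zero_outside_support)
      then show ?thesis using B(1) by simp
    qed
  qed
qed

lemma test_function_measurable: "test_function \<Omega> \<phi> \<Longrightarrow> \<phi> \<in> borel_measurable borel"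
  by (rule borel_measurable_continuous_onI[OF test_function_continuous])

lemma test_function_mult_integrable:
  fixes u :: "real^'d::finite \<Rightarrow> real"
  assumes "test_function \<Omega> \<phi>" "integrable lborel u"
  shows "integrable lborel (\<lambda>x. \<phi> x * u x)"
proof -
  obtain B where "\<And>x. \<bar>\<phi> x\<bar> \<le> B" using test_function_bounded[OF assms(1)] by blast
  then show ?thesis using test_function_measurable[OF assms(1)] by (intro bounded_mult_integrable[OF assms(2)]) auto
qed

lemma test_function_mult_L2:
  fixes u :: "real^'d::finite \<Rightarrow> real"
  assumes "test_function \<Omega> \<phi>" "L2 lborel u"
  shows "L2 lborel (\<lambda>x. \<phi> x * u x)"
proof -
  obtain B where B: "B \<ge> 0" "\<And>x. \<bar>\<phi> x\<bar> \<le> B" using test_function_bounded[OF assms(1)] by blast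
  show ?thesis
  proof (rule L2_bound[OF L2_cmult[OF assms(2), of B]])
    show "(\<lambda>x. \<phi> x * u x) \<in> borel_measurable lborel"
      using test_function_measurable[OF assms(1)] L2_measurable[OF assms(2)] by simp
    show "\<bar>\<phi> x * u x\<bar> \<le> \<bar>B * u x\<bar>" for x
      using mult_right_mono[OF B(2)[of x] abs_ge_zero[of "u x"]] B(1) by (simp add: abs_mult)
  qed
qed

lemma mult_indicator_support: "\<phi> x * (indicat_real (closure {x. \<phi> x \<noteq> 0}) x * a) = \<phi> x * a"
proof (cases "x \<in> closure {x. \<phi> x \<noteq> 0}")
  case False
  then have "\<phi> x = 0" by (rule zero_outside_support)
  then show ?thesis by simp
qed simp

text \<open>The product rule adds the wedge of the gradient of \<open>\<phi>\<close> with
  \<open>U\<close>, which is of order zero. Since \<open>\<phi>\<close> times any smooth function is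
  a test function in \<open>\<Omega>\<close>, the local weak identity becomes one against all smooth
  functions, as \<open>curl_data\<close> requires.\<close>

lemma localize_curl:
  fixes U :: "'d::finite \<Rightarrow> real^'d \<Rightarrow> real"
  assumes \<phi>: "test_function \<Omega> \<phi>" and U: "\<And>k. integrable lborel (U k)" "\<And>k. L2 lborel (U k)"
    and F: "\<And>m k. integrable lborel (\<lambda>x. indicator (closure {x. \<phi> x \<noteq> 0}) x * F m k x)" "\<And>m k x. F m k x = - F k m x"
    and curl: "\<And>m k \<psi>. test_function \<Omega> \<psi> \<Longrightarrow> 
      (LINT x|lborel. U k x * pd m \<psi> x - U m x * pd k \<psi> x) = (LINT x|lborel. F m k x * \<psi> x)"
  shows "curl_data (\<lambda>k x. \<phi> x * U k x) (\<lambda>m k x. \<phi> x * F m k x - (pd m \<phi> x * U k x - pd k \<phi> x * U m x))"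
  unfolding curl_data_def
proof (intro conjI allI impI)
  have \<phi>F: "integrable lborel (\<lambda>x. \<phi> x * F m k x)" for m k
  proof -
    show ?thesis using test_function_mult_integrable[OF \<phi> F(1)[of m k]] unfolding mult_indicator_support .
  qed
  have pU: "integrable lborel (\<lambda>x. pd m \<phi> x * U k x)" for m k
    by (rule test_function_mult_integrable[OF test_function_pd[OF \<phi>] U(1)])
  show "integrable lborel (\<lambda>x. \<phi> x * U k x)" for k by (rule test_function_mult_integrable[OF \<phi> U(1)])
  show "L2 lborel (\<lambda>x. \<phi> x * U k x)" for k by (rule test_function_mult_L2[OF \<phi> U(2)])
  show "integrable lborel (\<lambda>x. \<phi> x * F m k x - (pd m \<phi> x * U k x - pd k \<phi> x * U m x))" for m k
    using \<phi>F pU by simp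
  show "AE x in lborel. \<phi> x * F m k x - (pd m \<phi> x * U k x - pd k \<phi> x * U m x) =
      - (\<phi> x * F k m x - (pd k \<phi> x * U m x - pd m \<phi> x * U k x))" for m k
    using F(2)[of m k] by simp
  fix \<psi> :: "real^'d \<Rightarrow> real" and m k
  assume \<psi>: "\<forall>n. Ck_on n UNIV \<psi>"
  then have \<phi>\<psi>: "test_function \<Omega> (\<lambda>x. \<phi> x * \<psi> x)" by (intro test_function_mult_smooth[OF \<phi>]) auto
  have d\<psi>: "\<psi> differentiable (at x)" for x using \<psi> Ck_on_differentiable_at by blast
  have pm: "pd i (\<lambda>x. \<phi> x * \<psi> x) x = pd i \<phi> x * \<psi> x + \<phi> x * pd i \<psi> x" for i x
    by (rule pd_mult[OF test_function_differentiable[OF \<phi>] d\<psi>])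
  have p\<psi>: "test_function \<Omega> (\<lambda>x. pd i \<phi> x * \<psi> x)" for i
    using \<psi> by (intro test_function_mult_smooth[OF test_function_pd[OF \<phi>]]) auto
  have i1: "integrable lborel (\<lambda>x. pd i \<phi> x * \<psi> x * U j x)" for i j
    by (rule test_function_mult_integrable[OF p\<psi> U(1)])
  have i2: "integrable lborel (\<lambda>x. pd i (\<lambda>x. \<phi> x * \<psi> x) x * U j x)" for i j
    by (rule test_function_mult_integrable[OF test_function_pd[OF \<phi>\<psi>] U(1)])
  have i3: "integrable lborel (\<lambda>x. \<phi> x * \<psi> x * F m k x)"
  proof -
    have eq: "\<phi> x * \<psi> x * (indicator (closure {x. \<phi> x \<noteq> 0}) x * F m k x) = \<phi> x * \<psi> x * F m k x" for x
      using mult_indicator_support[of \<phi> x "F m k x"] by (metis mult.assoc mult.commute)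
    show ?thesis using test_function_mult_integrable[OF \<phi>\<psi> F(1)[of m k]] unfolding eq .
  qed
  have "(LINT x|lborel. \<phi> x * U k x * pd m \<psi> x - \<phi> x * U m x * pd k \<psi> x) =
    (LINT x|lborel. (pd m (\<lambda>x. \<phi> x * \<psi> x) x * U k x - pd k (\<lambda>x. \<phi> x * \<psi> x) x * U m x)
       - (pd m \<phi> x * \<psi> x * U k x - pd k \<phi> x * \<psi> x * U m x))"
    by (intro Bochner_Integration.integral_cong refl) (simp add: pm algebra_simps)
  also have "\<dots> = (LINT x|lborel. pd m (\<lambda>x. \<phi> x * \<psi> x) x * U k x - pd k (\<lambda>x. \<phi> x * \<psi> x) x * U m x)
       - (LINT x|lborel. pd m \<phi> x * \<psi> x * U k x - pd k \<phi> x * \<psi> x * U m x)"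
    using i1 i2 by (intro Bochner_Integration.integral_diff) auto
  also have "(LINT x|lborel. pd m (\<lambda>x. \<phi> x * \<psi> x) x * U k x - pd k (\<lambda>x. \<phi> x * \<psi> x) x * U m x) = 
      (LINT x|lborel. F m k x * (\<phi> x * \<psi> x))"
    using curl[OF \<phi>\<psi>, of k m] by (simp add: mult.commute)
  also have "(LINT x|lborel. F m k x * (\<phi> x * \<psi> x)) - (LINT x|lborel. pd m \<phi> x * \<psi> x * U k x - pd k \<phi> x * \<psi> x * U m x) =
      (LINT x|lborel. \<phi> x * \<psi> x * F m k x - (pd m \<phi> x * \<psi> x * U k x - pd k \<phi> x * \<psi> x * U m x))"
    using i1 i3 by (subst Bochner_Integration.integral_diff) (auto simp: mult.commute)
  also have "\<dots> = (LINT x|lborel. (\<phi> x * F m k x - (pd m \<phi> x * U k x - pd k \<phi> x * U m x)) * \<psi> x)"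
    by (intro Bochner_Integration.integral_cong refl) (simp add: algebra_simps)
  finally show "(LINT x|lborel. \<phi> x * U k x * pd m \<psi> x - \<phi> x * U m x * pd k \<psi> x) =
    (LINT x|lborel. (\<phi> x * F m k x - (pd m \<phi> x * U k x - pd k \<phi> x * U m x)) * \<psi> x)" .
qed

text \<open>The smooth functions in \<open>curl_data\<close> may be unbounded. The common ball
  containing all supports makes the separate products integrable, so the identities can be
  subtracted.\<close>

lemma curl_data_diff:
  fixes v w :: "'d::finite \<Rightarrow> real^'d \<Rightarrow> real"
  assumes v: "curl_data v f" and w: "curl_data w f'"
    and R: "\<And>k x. norm x > R \<Longrightarrow> v k x = 0" "\<And>k x. norm x > R \<Longrightarrow> w k x = 0"
      "\<And>m k x. norm x > R \<Longrightarrow> f m k x = 0" "\<And>m k x. norm x > R \<Longrightarrow> f' m k x = 0"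
  shows "curl_data (\<lambda>k x. v k x - w k x) (\<lambda>m k x. f m k x - f' m k x)"
proof -
  have bi: "integrable lborel (\<lambda>x. u x * h x)" 
    if u: "integrable lborel u" "\<And>x. norm x > R \<Longrightarrow> u x = 0" and h: "continuous_on UNIV h" for u h :: "real^'d \<Rightarrow> real"
  proof -
    obtain B where B: "B \<ge> 0" "\<And>x. x \<in> cball 0 R \<Longrightarrow> \<bar>h x\<bar> \<le> B"
      by (rule compact_abs_bound[OF continuous_on_subset[OF h subset_UNIV] compact_cball]) blast
    have eq: "(\<lambda>x. u x * h x) = (\<lambda>x. (indicator (cball 0 R) x * h x) * u x)"
      using u(2) by (auto simp: fun_eq_iff indicator_def not_le)
    have hm: "h \<in> borel_measurable lborel" using borel_measurable_continuous_onI[OF h] by simp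
    show ?thesis unfolding eq
    proof (rule bounded_mult_integrable[OF u(1)])
      show "\<bar>indicator (cball 0 R) x * h x\<bar> \<le> B" for x using B(2)[of x] B(1) by (simp add: indicator_def)
      show "(\<lambda>x. indicator (cball 0 R) x * h x) \<in> borel_measurable lborel" 
        by (intro borel_measurable_times borel_measurable_indicator hm) simp
    qed
  qed
  have v': "integrable lborel (v k)" "L2 lborel (v k)" for k using v by (auto simp: curl_data_def)
  have w': "integrable lborel (w k)" "L2 lborel (w k)" for k using w by (auto simp: curl_data_def)
  have f: "integrable lborel (f m k)" "integrable lborel (f' m k)" for m k using v w by (auto simp: curl_data_def)
  show ?thesis
    unfolding curl_data_def
  proof (intro conjI allI impI)
    show "integrable lborel (\<lambda>x. v k x - w k x)" "L2 lborel (\<lambda>x. v k x - w k x)" for k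
      using v' w' by (auto intro: L2_diff)
    show "integrable lborel (\<lambda>x. f m k x - f' m k x)" for m k using f by simp
    show "AE x in lborel. f m k x - f' m k x = - (f k m x - f' k m x)" for m k
    proof -
      have "AE x in lborel. f m k x = - f k m x" "AE x in lborel. f' m k x = - f' k m x"
        using v w by (auto simp: curl_data_def)
      then show ?thesis by eventually_elim simp
    qed
    fix \<psi> :: "real^'d \<Rightarrow> real" and m k
    assume \<psi>: "\<forall>n. Ck_on n UNIV \<psi>"
    have c: "continuous_on UNIV \<psi>" "continuous_on UNIV (pd i \<psi>)" for i
      using \<psi>[rule_format, of 0] \<psi>[rule_format, of 1] by auto
    have e: "(LINT x|lborel. v k x * pd m \<psi> x - v m x * pd k \<psi> x) = (LINT x|lborel. f m k x * \<psi> x)"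
      "(LINT x|lborel. w k x * pd m \<psi> x - w m x * pd k \<psi> x) = (LINT x|lborel. f' m k x * \<psi> x)"
      using v w \<psi> unfolding curl_data_def by blast+
    have "(LINT x|lborel. (v k x - w k x) * pd m \<psi> x - (v m x - w m x) * pd k \<psi> x) =
      (LINT x|lborel. (v k x * pd m \<psi> x - v m x * pd k \<psi> x) - (w k x * pd m \<psi> x - w m x * pd k \<psi> x))"
      by (intro Bochner_Integration.integral_cong refl) (simp add: algebra_simps)
    also have "\<dots> = (LINT x|lborel. f m k x * \<psi> x) - (LINT x|lborel. f' m k x * \<psi> x)"
      unfolding e[symmetric]
      by (intro Bochner_Integration.integral_diff Bochner_Integration.integrable_diff bi v' w' R c)
    also have "\<dots> = (LINT x|lborel. (f m k x - f' m k x) * \<psi> x)"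
      unfolding left_diff_distrib
      by (intro Bochner_Integration.integral_diff[symmetric] bi f R c)
    finally show "(LINT x|lborel. (v k x - w k x) * pd m \<psi> x - (v m x - w m x) * pd k \<psi> x) = (LINT x|lborel. (f m k x - f' m k x) * \<psi> x)" .
  qed
qed

section \<open>Uniform tails in L^p and compactness of mollification at a fixed scale\<close>

lemma Lp_tail:
  assumes v[measurable]: "v \<in> borel_measurable M" and i: "integrable M (\<lambda>x. \<bar>v x\<bar> powr p)" 
    and B: "(LINT x|M. \<bar>v x\<bar> powr p) \<le> B" and p: "p > 2" and K: "K > 0"
  shows "L2 M (\<lambda>x. v x - max (- K) (min K (v x)))"
    and "norm2 M (\<lambda>x. v x - max (- K) (min K (v x))) \<le> sqrt (K powr (2 - p) * B)"
proof -
  let ?u = "\<lambda>x. v x - max (- K) (min K (v x))"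
  \<comment> \<open>Below the height \<open>K\<close> the difference is 0; above it the exponent 2 -
    p is negative, so |v|^(2-p) is at most K^(2-p).\<close>
  have pt: "(?u x)\<^sup>2 \<le> K powr (2 - p) * \<bar>v x\<bar> powr p" for x
  proof (cases "\<bar>v x\<bar> \<le> K")
    case True
    then have "?u x = 0" by auto
    then show ?thesis by simp
  next
    case False
    have "\<bar>?u x\<bar> \<le> \<bar>v x\<bar>" using K by auto
    then have "(?u x)\<^sup>2 \<le> \<bar>v x\<bar>\<^sup>2" using abs_le_square_iff by fastforce
    also have "\<bar>v x\<bar>\<^sup>2 = \<bar>v x\<bar> powr (2 - p) * \<bar>v x\<bar> powr p"
      using False K by (simp add: powr_add[symmetric])
    also have "\<dots> \<le> K powr (2 - p) * \<bar>v x\<bar> powr p"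
      using False K p by (intro mult_right_mono powr_mono2') auto
    finally show ?thesis .
  qed
  have i2: "integrable M (\<lambda>x. K powr (2 - p) * \<bar>v x\<bar> powr p)" using i by simp
  have iu: "integrable M (\<lambda>x. (?u x)\<^sup>2)"
  proof (rule Bochner_Integration.integrable_bound[OF i2])
    show "AE x in M. norm ((?u x)\<^sup>2) \<le> norm (K powr (2 - p) * \<bar>v x\<bar> powr p)"
      using pt by (intro AE_I2) simp
  qed measurable
  then show "L2 M ?u" by (simp add: L2_def)
  have "(LINT x|M. (?u x)\<^sup>2) \<le> (LINT x|M. K powr (2 - p) * \<bar>v x\<bar> powr p)"
    by (rule integral_mono[OF iu i2 pt])
  also have "\<dots> \<le> K powr (2 - p) * B" using B by (simp add: mult_left_mono)
  finally show "norm2 M ?u \<le> sqrt (K powr (2 - p) * B)" unfolding norm2_def by (rule real_sqrt_le_mono)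
qed

text \<open>From |x|^2 <= 2 |x - y|^2 + 2 R^2. The entry 2 of the maximum pays for |x - y|^2, the
  other entry trades the constant 1 + 2 R^2 for a multiple of s^2.\<close>

lemma qf_compare:
  fixes x y :: "real^'d::finite"
  assumes "s > 0" "norm y \<le> R"
  shows "qf 1 x \<le> max 2 ((1 + 2 * R\<^sup>2) / s\<^sup>2) * qf s (x - y)"
proof -
  have "norm x \<le> norm (x - y) + norm y" using norm_triangle_ineq[of "x - y" y] by simp
  then have "(norm x)\<^sup>2 \<le> (norm (x - y) + R)\<^sup>2" using assms(2) by (intro power_mono) auto
  also have "\<dots> \<le> 2 * (norm (x - y))\<^sup>2 + 2 * R\<^sup>2"
    using sum_squares_bound[of "norm (x - y)" R] by (simp add: power2_sum)
  finally have "qf 1 x \<le> (1 + 2 * R\<^sup>2) / s\<^sup>2 * s\<^sup>2 + 2 * (norm (x - y))\<^sup>2"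
    using assms(1) by (simp add: qf_def power2_norm_eq_inner)
  also have "\<dots> \<le> max 2 ((1 + 2 * R\<^sup>2) / s\<^sup>2) * s\<^sup>2 + max 2 ((1 + 2 * R\<^sup>2) / s\<^sup>2) * (norm (x - y))\<^sup>2"
    by (intro add_mono mult_right_mono) auto
  also have "\<dots> = max 2 ((1 + 2 * R\<^sup>2) / s\<^sup>2) * qf s (x - y)"
    by (simp add: qf_def power2_norm_eq_inner distrib_left)
  finally show ?thesis .
qed

lemma moll_compare:
  assumes s: "s > 0"
  obtains C where "C \<ge> 0" "\<And>x y::real^'d::finite. norm y \<le> R \<Longrightarrow> moll s (x - y) \<le> C * moll 1 x"
proof
  let ?m = "max 2 ((1 + 2 * R\<^sup>2) / s\<^sup>2)" and ?e = "- (real CARD('d) / 2) - 1"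
  show "s\<^sup>2 * (1 / ?m) powr ?e \<ge> 0" by simp
  fix x y :: "real^'d" assume "norm y \<le> R"
  have m: "?m > 0" by auto
  have "1 / ?m * qf 1 x \<le> qf s (x - y)"
    using qf_compare[OF s \<open>norm y \<le> R\<close>, of x] m by (simp add: pos_divide_le_eq mult.commute)
  moreover have "1 / ?m * qf 1 x > 0" using m qf_pos[of 1 x] by simp
  ultimately have "qf s (x - y) powr ?e \<le> (1 / ?m * qf 1 x) powr ?e"
    by (intro powr_mono2') auto
  also have "\<dots> = (1 / ?m) powr ?e * qf 1 x powr ?e" by (rule powr_mult)
  finally have "real CARD('d) * s\<^sup>2 * qf s (x - y) powr ?e / moll_mass TYPE('d) \<le> 
     real CARD('d) * s\<^sup>2 * ((1 / ?m) powr ?e * qf 1 x powr ?e) / moll_mass TYPE('d)"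
    using moll_mass_pos[where 'd='d] by (intro divide_right_mono mult_left_mono) auto
  then show "moll s (x - y) \<le> s\<^sup>2 * (1 / ?m) powr ?e * moll 1 x"
    by (simp add: moll_def mult_ac)
qed

text \<open>Testing weak convergence with translates of the kernel gives pointwise convergence of
  the mollified functions. The supports in a common ball yield the fixed square integrable majorant
  C L \<open>moll 1\<close>, and dominated convergence makes the convergence strong.\<close>

lemma moll_conv_compact:
  fixes v :: "nat \<Rightarrow> real^'d::finite \<Rightarrow> real"
  assumes t: "t > 0" and v: "\<And>n. integrable lborel (v n)" "\<And>n. (LINT x|lborel. \<bar>v n x\<bar>) \<le> L" "\<And>n x. norm x > R \<Longrightarrow> v n x = 0"
    and v0: "integrable lborel v0" "L2 lborel v0"
    and weak: "\<And>x. (\<lambda>n. LINT y|lborel. moll t (x - y) * v n y) \<longlonglongrightarrow> (LINT y|lborel. moll t (x - y) * v0 y)"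
  shows "(\<lambda>n. norm2 lborel (\<lambda>x. conv (moll t) (v n) x - conv (moll t) v0 x)) \<longlonglongrightarrow> 0"
proof -
  obtain C where C: "C \<ge> 0" "\<And>x y::real^'d. norm y \<le> R \<Longrightarrow> moll t (x - y) \<le> C * moll 1 x" by (rule moll_compare[OF t, of R]) blast
  have [measurable]: "v n \<in> borel_measurable borel" "v0 \<in> borel_measurable borel" for n using v v0 by auto
  have bd: "\<bar>conv (moll t) (v n) x\<bar> \<le> C * L * moll 1 x" for n x
  proof -
    have "\<bar>conv (moll t) (v n) x\<bar> \<le> (LINT y|lborel. \<bar>moll t (x - y) * v n y\<bar>)"
      unfolding conv_def by (rule integral_abs_bound)
    also have "\<dots> \<le> (LINT y|lborel. C * moll 1 x * \<bar>v n y\<bar>)"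
    proof (rule integral_mono)
      obtain B where B: "\<And>x::real^'d. \<bar>moll t x\<bar> \<le> B" using moll_bounded[OF t] by blast
      show "integrable lborel (\<lambda>y. \<bar>moll t (x - y) * v n y\<bar>)"
        by (rule integrable_abs[OF conv_integrand[OF _ B v(1)]]) simp
      show "integrable lborel (\<lambda>y. C * moll 1 x * \<bar>v n y\<bar>)" using v(1)[of n] by simp
      show "\<bar>moll t (x - y) * v n y\<bar> \<le> C * moll 1 x * \<bar>v n y\<bar>" for y
      proof (cases "norm y > R")
        case True
        then show ?thesis using v(3) by simp
      next
        case False
        then have "moll t (x - y) * \<bar>v n y\<bar> \<le> C * moll 1 x * \<bar>v n y\<bar>" by (intro mult_right_mono C) auto
        then show ?thesis by (simp add: abs_mult moll_nonneg)
      qed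
    qed
    also have "\<dots> = C * moll 1 x * (LINT y|lborel. \<bar>v n y\<bar>)" by simp
    also have "\<dots> \<le> C * moll 1 x * L" using C(1) by (intro mult_left_mono v) (auto simp: moll_nonneg)
    finally show ?thesis by (simp add: mult_ac)
  qed
  have m1: "L2 lborel (\<lambda>x::real^'d. C * L * moll 1 x)"
  proof -
    obtain B where "\<And>x::real^'d. \<bar>moll 1 x\<bar> \<le> B" using moll_bounded[of 1] by auto
    then show ?thesis by (intro L2_cmult L2_bounded_integrable[OF moll_integrable[of 1]]) auto
  qed
  have T0: "L2 lborel (conv (moll t) v0)" by (rule moll_conv_L2[OF t v0])
  have "(\<lambda>n. LINT x|lborel. (conv (moll t) (v n) x - conv (moll t) v0 x)\<^sup>2) \<longlonglongrightarrow> (LINT x::real^'d|lborel. 0)"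
  proof (rule integral_dominated_convergence)
    show "integrable lborel (\<lambda>x. 2 * ((C * L * moll 1 x)\<^sup>2 + (conv (moll t) v0 x)\<^sup>2))"
      using m1 T0 by (simp add: L2_def)
    show "AE x in lborel. (\<lambda>n. (conv (moll t) (v n) x - conv (moll t) v0 x)\<^sup>2) \<longlonglongrightarrow> 0"
    proof (rule AE_I2)
      fix x
      have "(\<lambda>n. conv (moll t) (v n) x) \<longlonglongrightarrow> conv (moll t) v0 x" using weak[of x] by (simp add: conv_def)
      then have "(\<lambda>n. (conv (moll t) (v n) x - conv (moll t) v0 x)\<^sup>2) \<longlonglongrightarrow> (conv (moll t) v0 x - conv (moll t) v0 x)\<^sup>2"
        by (intro tendsto_power tendsto_diff tendsto_const)
      then show "(\<lambda>n. (conv (moll t) (v n) x - conv (moll t) v0 x)\<^sup>2) \<longlonglongrightarrow> 0" by simp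
    qed
    show "AE x in lborel. norm ((conv (moll t) (v n) x - conv (moll t) v0 x)\<^sup>2) \<le> 2 * ((C * L * moll 1 x)\<^sup>2 + (conv (moll t) v0 x)\<^sup>2)" for n
    proof (rule AE_I2)
      fix x
      have "(conv (moll t) (v n) x - conv (moll t) v0 x)\<^sup>2 \<le> 2 * ((conv (moll t) (v n) x)\<^sup>2 + (conv (moll t) v0 x)\<^sup>2)"
        using sum_squares_bound[of "conv (moll t) (v n) x" "- conv (moll t) v0 x"] by (simp add: power2_diff)
      also have "(conv (moll t) (v n) x)\<^sup>2 \<le> (C * L * moll 1 x)\<^sup>2"
        using power_mono[OF bd[of n x], of 2] by simp
      finally show "norm ((conv (moll t) (v n) x - conv (moll t) v0 x)\<^sup>2) \<le> 2 * ((C * L * moll 1 x)\<^sup>2 + (conv (moll t) v0 x)\<^sup>2)"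
        by simp
    qed
  qed measurable
  then have "(\<lambda>n. norm2 lborel (\<lambda>x. conv (moll t) (v n) x - conv (moll t) v0 x)) \<longlonglongrightarrow> sqrt 0"
    unfolding norm2_def by (intro tendsto_real_sqrt) simp
  then show ?thesis by simp
qed

text \<open>For a fixed late n and m tending to infinity the mixed terms approach c_n and c'_n, both
  close to l, so a_n + a_m is close to 2 l. Comparing two late values of m shows that
  \<open>a\<close> is Cauchy, and its limit z satisfies 2 z = 2 l.\<close>

lemma double_index_limit:
  fixes a :: "nat \<Rightarrow> real" and b :: "nat \<Rightarrow> nat \<Rightarrow> real"
  assumes small: "\<And>r. r > 0 \<Longrightarrow> \<exists>n0. \<forall>n\<ge>n0. \<forall>m\<ge>n0. \<bar>a n + a m - b n m - b m n\<bar> \<le> r"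
    and b: "\<And>n. (\<lambda>m. b n m) \<longlonglongrightarrow> c n" "\<And>n. (\<lambda>m. b m n) \<longlonglongrightarrow> c' n"
    and c: "c \<longlonglongrightarrow> l" "c' \<longlonglongrightarrow> l"
  shows "a \<longlonglongrightarrow> l"
proof -
  \<comment> \<open>The bound \<open>m1\<close> depends on \<open>n\<close>, since the mixed terms
    converge for each fixed \<open>n\<close> without any uniformity. The five shares r / 5 are the
    wedge error, the two limits in \<open>m\<close> and the two limits in \<open>n\<close>.\<close>
  have key: "\<exists>n1. \<forall>n\<ge>n1. \<exists>m1. \<forall>m\<ge>m1. \<bar>a n + a m - 2 * l\<bar> \<le> r" if "r > 0" for r
  proof -
    obtain n0 where n0: "\<And>n m. n \<ge> n0 \<Longrightarrow> m \<ge> n0 \<Longrightarrow> \<bar>a n + a m - b n m - b m n\<bar> \<le> r / 5" using small[of "r / 5"] \<open>r > 0\<close> by auto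
    obtain n1 where n1: "\<And>n. n \<ge> n1 \<Longrightarrow> \<bar>c n - l\<bar> < r / 5" using LIMSEQ_D[OF c(1), of "r / 5"] \<open>r > 0\<close> by auto
    obtain n2 where n2: "\<And>n. n \<ge> n2 \<Longrightarrow> \<bar>c' n - l\<bar> < r / 5" using LIMSEQ_D[OF c(2), of "r / 5"] \<open>r > 0\<close> by auto
    show ?thesis
    proof (rule exI[of _ "max n0 (max n1 n2)"], intro allI impI)
      fix n assume n: "max n0 (max n1 n2) \<le> n"
      obtain m1 where m1: "\<And>m. m \<ge> m1 \<Longrightarrow> \<bar>b n m - c n\<bar> < r / 5" using LIMSEQ_D[OF b(1), of "r / 5" n] \<open>r > 0\<close> by auto
      obtain m2 where m2: "\<And>m. m \<ge> m2 \<Longrightarrow> \<bar>b m n - c' n\<bar> < r / 5" using LIMSEQ_D[OF b(2), of "r / 5" n] \<open>r > 0\<close> by auto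
      show "\<exists>m1. \<forall>m\<ge>m1. \<bar>a n + a m - 2 * l\<bar> \<le> r"
      proof (intro exI[of _ "max n0 (max m1 m2)"] allI impI)
        fix m assume "max n0 (max m1 m2) \<le> m"
        then show "\<bar>a n + a m - 2 * l\<bar> \<le> r"
          using n0[of n m, unfolded abs_le_iff] n1[of n, unfolded abs_less_iff] n2[of n, unfolded abs_less_iff] 
            m1[of m, unfolded abs_less_iff] m2[of m, unfolded abs_less_iff] n 
          unfolding abs_le_iff by simp
      qed
    qed
  qed
  have "Cauchy a"
  proof (rule metric_CauchyI)
    fix e :: real assume "e > 0"
    \<comment> \<open>One fixed index suffices here: all late values of \<open>a\<close> lie within
      e / 3 of 2 l - a_n1.\<close>
    then obtain n1 where "\<forall>n\<ge>n1. \<exists>m1. \<forall>m\<ge>m1. \<bar>a n + a m - 2 * l\<bar> \<le> e / 3" using key[of "e / 3"] by auto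
    then obtain m1 where m1: "\<And>m. m \<ge> m1 \<Longrightarrow> \<bar>a n1 + a m - 2 * l\<bar> \<le> e / 3" by blast
    have "dist (a m) (a n) < e" if "m \<ge> m1" "n \<ge> m1" for m n
      using m1[OF that(1), unfolded abs_le_iff] m1[OF that(2), unfolded abs_le_iff] \<open>e > 0\<close> 
      unfolding dist_real_def abs_less_iff by simp
    then show "\<exists>M. \<forall>m\<ge>M. \<forall>n\<ge>M. dist (a m) (a n) < e" by blast
  qed
  then obtain z where z: "a \<longlonglongrightarrow> z" using Cauchy_convergent convergent_def by blast
  have "\<bar>2 * z - 2 * l\<bar> \<le> r" if r: "r > 0" for r
  proof -
    obtain n1 where n1: "\<And>n. n \<ge> n1 \<Longrightarrow> \<exists>m1. \<forall>m\<ge>m1. \<bar>a n + a m - 2 * l\<bar> \<le> r" using key[OF r] by blast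
    have "\<bar>a n + z - 2 * l\<bar> \<le> r" if "n \<ge> n1" for n
    proof (rule LIMSEQ_le_const2)
      show "(\<lambda>m. \<bar>a n + a m - 2 * l\<bar>) \<longlonglongrightarrow> \<bar>a n + z - 2 * l\<bar>"
        by (intro tendsto_rabs tendsto_diff tendsto_add tendsto_const z)
    qed (use n1[OF that] in blast)
    moreover have "(\<lambda>n. \<bar>a n + z - 2 * l\<bar>) \<longlonglongrightarrow> \<bar>z + z - 2 * l\<bar>"
      by (intro tendsto_rabs tendsto_diff tendsto_add tendsto_const z)
    ultimately have "\<bar>z + z - 2 * l\<bar> \<le> r" by (intro LIMSEQ_le_const2) blast+
    then show ?thesis by simp
  qed
  then have "z = l" using field_le_epsilon[of "\<bar>2 * z - 2 * l\<bar>" 0] by auto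
  then show ?thesis using z by simp
qed

section \<open>The div-curl lemma\<close>

text \<open>The hypotheses of the div-curl lemma in one predicate, for Borel fields that vanish
  outside \<open>\<Omega>\<close>. \<open>F n m k\<close> is the negative of the (m, k) component of
  the curl of \<open>V n\<close>. It is controlled only on compact subsets of
  \<open>\<Omega>\<close>, because continuous coefficients may blow up at the boundary.\<close>

definition admissible :: "real \<Rightarrow> (real^'d::finite) set \<Rightarrow> (nat \<Rightarrow> 'd \<Rightarrow> real^'d \<Rightarrow> real) \<Rightarrow> 
    ('d \<Rightarrow> real^'d \<Rightarrow> real) \<Rightarrow> (nat \<Rightarrow> 'd \<Rightarrow> 'd \<Rightarrow> real^'d \<Rightarrow> real) \<Rightarrow> bool" where
  "admissible p \<Omega> V V0 F \<longleftrightarrow>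
    (\<forall>n k. V n k \<in> borel_measurable borel \<and> (\<forall>x. x \<notin> \<Omega> \<longrightarrow> V n k x = 0)) \<and>
    (\<exists>B. \<forall>n k. integrable lborel (\<lambda>x. \<bar>V n k x\<bar> powr p) \<and> (LINT x|lborel. \<bar>V n k x\<bar> powr p) \<le> B) \<and>
    (\<forall>k. V0 k \<in> borel_measurable borel \<and> (\<forall>x. x \<notin> \<Omega> \<longrightarrow> V0 k x = 0) \<and> integrable lborel (\<lambda>x. \<bar>V0 k x\<bar> powr p)) \<and>
    (\<forall>k \<psi>. \<psi> \<in> borel_measurable borel \<longrightarrow> (\<forall>x. x \<notin> \<Omega> \<longrightarrow> \<psi> x = 0) \<longrightarrow> 
       integrable lborel (\<lambda>x. \<bar>\<psi> x\<bar> powr (p / (p - 1))) \<longrightarrow>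
       (\<lambda>n. LINT x|lborel. V n k x * \<psi> x) \<longlonglongrightarrow> (LINT x|lborel. V0 k x * \<psi> x)) \<and>
    (\<forall>n m k x. F n m k x = - F n k m x) \<and>
    (\<forall>C. compact C \<longrightarrow> C \<subseteq> \<Omega> \<longrightarrow> (\<exists>B. \<forall>n m k. integrable lborel (\<lambda>x. indicat_real C x * F n m k x) \<and> 
       (LINT x|lborel. \<bar>indicat_real C x * F n m k x\<bar>) \<le> B)) \<and>
    (\<forall>n m k \<phi>. test_function \<Omega> \<phi> \<longrightarrow>
       (LINT x|lborel. V n k x * pd m \<phi> x - V n m x * pd k \<phi> x) = (LINT x|lborel. F n m k x * \<phi> x))"

lemma powr_le_1_plus:
  fixes a :: real assumes "0 < r" "r \<le> p" shows "\<bar>a\<bar> powr r \<le> 1 + \<bar>a\<bar> powr p"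
proof (cases "\<bar>a\<bar> \<le> 1")
  case True
  then have "\<bar>a\<bar> powr r \<le> 1 powr r" using assms by (intro powr_mono2) auto
  also have "\<dots> \<le> 1 + \<bar>a\<bar> powr p" by simp
  finally show ?thesis .
next
  case False
  then have "\<bar>a\<bar> powr r \<le> \<bar>a\<bar> powr p" using assms by (intro powr_mono) auto
  then show ?thesis by simp
qed

text \<open>Everything follows from |u|^r <= 1 + |u|^p on \<open>\<Omega>\<close> and the finite
  measure of \<open>\<Omega>\<close>.\<close>

lemma Lp_bounded_support:
  fixes u :: "real^'d::finite \<Rightarrow> real"
  assumes \<Omega>: "open \<Omega>" "bounded \<Omega>" and p: "p > 2" and u[measurable]: "u \<in> borel_measurable borel"
    and z: "\<And>x. x \<notin> \<Omega> \<Longrightarrow> u x = 0" and i: "integrable lborel (\<lambda>x. \<bar>u x\<bar> powr p)"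
  shows "0 < r \<Longrightarrow> r \<le> p \<Longrightarrow> integrable lborel (\<lambda>x. \<bar>u x\<bar> powr r)"
    and "integrable lborel u" "L2 lborel u"
    and "(LINT x|lborel. \<bar>u x\<bar>) \<le> measure lborel \<Omega> + (LINT x|lborel. \<bar>u x\<bar> powr p)"
    and "norm2 lborel u \<le> sqrt (measure lborel \<Omega> + (LINT x|lborel. \<bar>u x\<bar> powr p))"
proof -
  have [measurable]: "\<Omega> \<in> sets borel" using \<Omega> by simp
  let ?g = "\<lambda>x. indicat_real \<Omega> x + \<bar>u x\<bar> powr p"
  have i\<Omega>: "integrable lborel (indicat_real \<Omega>)"
    using emeasure_bounded_finite[OF \<Omega>(2)] by (intro integrable_real_indicator) auto
  have g: "integrable lborel ?g" using i i\<Omega> by simp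
  have gi: "integral\<^sup>L lborel ?g = measure lborel \<Omega> + (LINT x|lborel. \<bar>u x\<bar> powr p)"
    using i i\<Omega> by simp
  have pt: "\<bar>u x\<bar> powr r \<le> ?g x" if "0 < r" "r \<le> p" for r x
    using powr_le_1_plus[OF that, of "u x"] z[of x] by (cases "x \<in> \<Omega>") auto
  show ir: "integrable lborel (\<lambda>x. \<bar>u x\<bar> powr r)" if "0 < r" "r \<le> p" for r
  proof (rule Bochner_Integration.integrable_bound[OF g])
    show "AE x in lborel. norm (\<bar>u x\<bar> powr r) \<le> norm (?g x)"
      using pt[OF that] by (intro AE_I2) (auto intro: order_trans)
  qed measurable
  have "\<bar>u x\<bar> powr 2 = (u x)\<^sup>2" for x by (cases "u x = 0") auto
  then have 2: "integrable lborel (\<lambda>x. (u x)\<^sup>2)" "\<And>x. (u x)\<^sup>2 \<le> ?g x" using ir[of 2] pt[of 2] p by auto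
  show "L2 lborel u" using 2 by (simp add: L2_def)
  have 1: "integrable lborel (\<lambda>x. \<bar>u x\<bar>)" "\<And>x. \<bar>u x\<bar> \<le> ?g x" using ir[of 1] pt[of 1] p by auto
  then show "integrable lborel u" by (subst (asm) integrable_abs_iff) auto
  show "(LINT x|lborel. \<bar>u x\<bar>) \<le> measure lborel \<Omega> + (LINT x|lborel. \<bar>u x\<bar> powr p)"
    unfolding gi[symmetric] by (rule integral_mono[OF 1(1) g 1(2)])
  show "norm2 lborel u \<le> sqrt (measure lborel \<Omega> + (LINT x|lborel. \<bar>u x\<bar> powr p))"
    unfolding norm2_def gi[symmetric] by (intro real_sqrt_le_mono integral_mono[OF 2(1) g 2(2)])
qed

text \<open>Collects what the wedge estimate asks of the cut-off fields, with constants that depend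
  neither on \<open>n\<close> nor on the component. The integrand of the L^1 bound on
  \<open>f\<close> lives on the support of \<open>\<phi>\<close>, a compact set on which
  \<open>F\<close> is controlled.\<close>

lemma admissible_cutoff:
  fixes V :: "nat \<Rightarrow> 'd::finite \<Rightarrow> real^'d \<Rightarrow> real"
  assumes \<Omega>: "open \<Omega>" "bounded \<Omega>" and p: "p > 2" and ad: "admissible p \<Omega> V V0 F" and \<phi>: "test_function \<Omega> \<phi>"
  obtains f B A L C where
    "\<And>n. curl_data (\<lambda>k x. \<phi> x * V n k x) (f n)"
    "\<And>n m k x. x \<notin> \<Omega> \<Longrightarrow> f n m k x = 0"
    "\<And>n k. integrable lborel (\<lambda>x. \<bar>\<phi> x * V n k x\<bar> powr p)"
    "\<And>n k. (LINT x|lborel. \<bar>\<phi> x * V n k x\<bar> powr p) \<le> B"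
    "\<And>n k. norm2 lborel (\<lambda>x. \<phi> x * V n k x) \<le> A"
    "\<And>n k. (LINT x|lborel. \<bar>\<phi> x * V n k x\<bar>) \<le> L"
    "\<And>n m k. (LINT x|lborel. \<bar>f n m k x\<bar>) \<le> C"
proof -
  note ad' = ad[unfolded admissible_def]
  have Vm[measurable]: "V n k \<in> borel_measurable borel" for n k using conjunct1[OF ad'] by simp
  have Vz: "x \<notin> \<Omega> \<Longrightarrow> V n k x = 0" for n k x using conjunct1[OF ad'] by simp
  obtain B0 where B0: "\<And>n k. integrable lborel (\<lambda>x. \<bar>V n k x\<bar> powr p)" "\<And>n k. (LINT x|lborel. \<bar>V n k x\<bar> powr p) \<le> B0"
    using conjunct1[OF conjunct2[OF ad']] by blast
  note ad'' = conjunct2[OF conjunct2[OF conjunct2[OF conjunct2[OF ad']]]]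
  have anti: "F n m k x = - F n k m x" for n m k x by (rule conjunct1[OF ad'', rule_format])
  let ?S = "closure {x. \<phi> x \<noteq> 0}"
  have S: "compact ?S" "?S \<subseteq> \<Omega>" by (rule test_function_support[OF \<phi>])+
  obtain BF where BF: "\<And>n m k. integrable lborel (\<lambda>x. indicat_real ?S x * F n m k x)" 
      "\<And>n m k. (LINT x|lborel. \<bar>indicat_real ?S x * F n m k x\<bar>) \<le> BF"
    using conjunct1[OF conjunct2[OF ad''], rule_format, OF S] by blast
  have curl: "(LINT x|lborel. V n k x * pd m \<psi> x - V n m x * pd k \<psi> x) = (LINT x|lborel. F n m k x * \<psi> x)"
    if "test_function \<Omega> \<psi>" for n m k \<psi> by (rule conjunct2[OF conjunct2[OF ad''], rule_format, OF that])
  note VL = Lp_bounded_support[OF \<Omega> p Vm Vz B0(1)]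
  define f where "f n m k x = \<phi> x * F n m k x - (pd m \<phi> x * V n k x - pd k \<phi> x * V n m x)" for n m k x
  have cd: "curl_data (\<lambda>k x. \<phi> x * V n k x) (f n)" for n
    unfolding f_def[abs_def] by (rule localize_curl[OF \<phi> VL(2,3) BF(1) anti curl])
  have off: "x \<notin> ?S" if "x \<notin> \<Omega>" for x using S that by blast
  have fz: "f n m k x = 0" if "x \<notin> \<Omega>" for n m k x
    using zero_outside_support[OF off[OF that]] pd_zero_outside_support[OF off[OF that]] by (simp add: f_def)
  obtain b where b: "b \<ge> 0" "\<And>x. \<bar>\<phi> x\<bar> \<le> b" by (rule test_function_bounded[OF \<phi>]) blast
  have "\<exists>b. \<forall>x. \<bar>pd m \<phi> x\<bar> \<le> b" for m
    by (rule test_function_bounded[OF test_function_pd[OF \<phi>, of m]]) blast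
  then obtain bd where bd: "\<And>m x. \<bar>pd m \<phi> x\<bar> \<le> bd m" by metis
  define b' where "b' = (\<Sum>m\<in>UNIV. \<bar>bd m\<bar>)"
  have b': "\<bar>pd m \<phi> x\<bar> \<le> b'" for m x
  proof -
    have "\<bar>bd m\<bar> \<le> b'" unfolding b'_def by (rule member_le_sum) auto
    then show ?thesis using bd[where x=x and m=m] by linarith
  qed
  have b'0: "b' \<ge> 0" unfolding b'_def by (simp add: sum_nonneg)
  have [measurable]: "\<phi> \<in> borel_measurable borel" by (rule test_function_measurable[OF \<phi>])
  have pt: "\<bar>\<phi> x * V n k x\<bar> powr p \<le> b powr p * \<bar>V n k x\<bar> powr p" for n k x
  proof -
    have "\<bar>\<phi> x * V n k x\<bar> powr p \<le> (b * \<bar>V n k x\<bar>) powr p"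
      using b p by (intro powr_mono2) (auto simp: abs_mult intro: mult_right_mono)
    then show ?thesis by (simp add: powr_mult)
  qed
  have ip: "integrable lborel (\<lambda>x. \<bar>\<phi> x * V n k x\<bar> powr p)" for n k
  proof (rule Bochner_Integration.integrable_bound)
    show "integrable lborel (\<lambda>x. b powr p * \<bar>V n k x\<bar> powr p)" using B0(1) by simp
    show "AE x in lborel. norm (\<bar>\<phi> x * V n k x\<bar> powr p) \<le> norm (b powr p * \<bar>V n k x\<bar> powr p)"
      using pt by (intro AE_I2) simp
  qed measurable
  have Bp: "(LINT x|lborel. \<bar>\<phi> x * V n k x\<bar> powr p) \<le> b powr p * B0" for n k
  proof -
    have "(LINT x|lborel. \<bar>\<phi> x * V n k x\<bar> powr p) \<le> (LINT x|lborel. b powr p * \<bar>V n k x\<bar> powr p)"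
      using B0(1) by (intro integral_mono[OF ip _ pt]) simp
    also have "\<dots> \<le> b powr p * B0" using B0(2)[of n k] by (simp add: mult_left_mono)
    finally show ?thesis .
  qed
  have \<phi>Vm: "(\<lambda>x. \<phi> x * V n k x) \<in> borel_measurable borel" for n k by measurable
  have \<phi>Vz: "x \<notin> \<Omega> \<Longrightarrow> \<phi> x * V n k x = 0" for n k x using Vz by simp
  note L = Lp_bounded_support[OF \<Omega> p \<phi>Vm \<phi>Vz ip]
  have nA: "norm2 lborel (\<lambda>x. \<phi> x * V n k x) \<le> sqrt (measure lborel \<Omega> + b powr p * B0)" for n k
    by (rule order_trans[OF L(5)], assumption) (intro real_sqrt_le_mono add_left_mono Bp)
  have nL: "(LINT x|lborel. \<bar>\<phi> x * V n k x\<bar>) \<le> measure lborel \<Omega> + b powr p * B0" for n k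
    by (rule order_trans[OF L(4)], assumption) (intro add_left_mono Bp)
  have nV: "(LINT x|lborel. \<bar>V n k x\<bar>) \<le> measure lborel \<Omega> + B0" for n k
    by (rule order_trans[OF VL(4)], assumption) (intro add_left_mono B0(2))
  have nC: "(LINT x|lborel. \<bar>f n m k x\<bar>) \<le> b * BF + 2 * (b' * (measure lborel \<Omega> + B0))" for n m k
  proof -
    have i: "integrable lborel (\<lambda>x. \<bar>indicat_real ?S x * F n m k x\<bar>)" "integrable lborel (\<lambda>x. \<bar>V n k x\<bar>)" "integrable lborel (\<lambda>x. \<bar>V n m x\<bar>)"
      using BF(1) VL(2) by (auto intro: integrable_abs)
    have "(LINT x|lborel. \<bar>f n m k x\<bar>) \<le> (LINT x|lborel. b * \<bar>indicat_real ?S x * F n m k x\<bar> + (b' * \<bar>V n k x\<bar> + b' * \<bar>V n m x\<bar>))"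
    proof (rule integral_mono)
      show "integrable lborel (\<lambda>x. \<bar>f n m k x\<bar>)" using cd[of n] by (auto simp: curl_data_def)
      show "integrable lborel (\<lambda>x. b * \<bar>indicat_real ?S x * F n m k x\<bar> + (b' * \<bar>V n k x\<bar> + b' * \<bar>V n m x\<bar>))"
        using i by (intro Bochner_Integration.integrable_add integrable_mult_right)
      fix x
      have "\<bar>\<phi> x * F n m k x\<bar> \<le> b * \<bar>indicat_real ?S x * F n m k x\<bar>"
        unfolding mult_indicator_support[of \<phi> x "F n m k x", symmetric] abs_mult[of "\<phi> x"] by (intro mult_right_mono b) simp
      moreover have "\<bar>pd m \<phi> x * V n k x\<bar> \<le> b' * \<bar>V n k x\<bar>" "\<bar>pd k \<phi> x * V n m x\<bar> \<le> b' * \<bar>V n m x\<bar>"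
        unfolding abs_mult by (intro mult_right_mono b' abs_ge_zero)+
      ultimately show "\<bar>f n m k x\<bar> \<le> b * \<bar>indicat_real ?S x * F n m k x\<bar> + (b' * \<bar>V n k x\<bar> + b' * \<bar>V n m x\<bar>)"
        unfolding f_def by linarith
    qed
    also have "\<dots> = b * (LINT x|lborel. \<bar>indicat_real ?S x * F n m k x\<bar>) + (b' * (LINT x|lborel. \<bar>V n k x\<bar>) + b' * (LINT x|lborel. \<bar>V n m x\<bar>))"
      using i by simp
    also have "\<dots> \<le> b * BF + (b' * (measure lborel \<Omega> + B0) + b' * (measure lborel \<Omega> + B0))"
      by (intro add_mono mult_left_mono BF nV b b'0)
    finally show ?thesis by simp
  qed
  show thesis by (rule that[OF cd fz ip Bp nA nL nC])
qed

section \<open>Choice of the truncation height and of the scales\<close>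

lemma tail_parameter:
  fixes p B \<epsilon> :: real assumes "p > 2" "\<epsilon> > 0"
  obtains K where "K > 0" "sqrt (K powr (2 - p) * B) \<le> \<epsilon>"
proof -
  have "((\<lambda>K. K powr (2 - p)) \<longlongrightarrow> 0) at_top" using assms by (intro tendsto_neg_powr filterlim_ident) simp
  then have "((\<lambda>K. sqrt (K powr (2 - p) * B)) \<longlongrightarrow> sqrt (0 * B)) at_top" by (intro tendsto_real_sqrt tendsto_mult tendsto_const)
  then have "\<forall>\<^sub>F K in at_top. sqrt (K powr (2 - p) * B) < \<epsilon>" using assms(2) by (intro order_tendstoD) auto
  then have "\<forall>\<^sub>F K in at_top. sqrt (K powr (2 - p) * B) < \<epsilon> \<and> K > 0" using eventually_gt_at_top by eventually_elim auto
  then obtain K where "sqrt (K powr (2 - p) * B) < \<epsilon>" "K > 0" by (auto simp: eventually_at_top_linorder)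
  then show thesis using that[of K] by simp
qed

text \<open>The order of choice is essential: \<rho> fixes the height \<open>K\<close> of the
  truncation, and \<open>K\<close> then fixes the scale \<open>t0\<close>. Neither depends on n, m
  or the dyadic index.\<close>

lemma cutoff_remainder:
  fixes v :: "nat \<Rightarrow> 'd::finite \<Rightarrow> real^'d \<Rightarrow> real"
  assumes p: "p > 2" and cd: "\<And>n m. curl_data (\<lambda>k x. v n k x - v m k x) (\<lambda>i k x. f n i k x - f m i k x)"
    and v: "\<And>n k. integrable lborel (v n k)" "\<And>n k. integrable lborel (\<lambda>x. \<bar>v n k x\<bar> powr p)" "\<And>n k. (LINT x|lborel. \<bar>v n k x\<bar> powr p) \<le> B"
    and f: "\<And>n i k. integrable lborel (f n i k)" "\<And>n i k. (LINT x|lborel. \<bar>f n i k x\<bar>) \<le> C"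
    and \<rho>: "\<rho> > 0"
  obtains t0 where "t0 > 0" "\<And>t J n m k. 0 < t \<Longrightarrow> t \<le> t0 \<Longrightarrow> norm2 lborel (epart (t / 2 ^ J) t (\<lambda>i k x. f n i k x - f m i k x) k) \<le> \<rho>"
proof -
  let ?D = "real CARD('d)"
  have D: "?D > 0" by simp
  \<comment> \<open>A difference of two fields has two tails, so their joint bound \<rho> / (4 d)
    enters \<open>epart_norm2\<close> with the factor 2 d and uses up \<rho> / 2.\<close>
  obtain K where K: "K > 0" "sqrt (K powr (2 - p) * B) \<le> \<rho> / (8 * ?D)"
    by (rule tail_parameter[OF p, of "\<rho> / (8 * ?D)" B]) (use \<rho> D in auto)
  have C0: "C \<ge> 0"
    by (rule order_trans[OF _ f(2)[of 0 undefined undefined]]) simp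
  let ?G = "2 * (2 * K) * (gconst TYPE('d) * (?D * (?D * (2 * C))))"
  have G0: "?G \<ge> 0" using K C0 gconst_nonneg[where 'd='d] by simp
  \<comment> \<open>Chosen so that t0 (G + 1) is the square of the other half of \<rho>, with G
    standing for \<open>?G\<close>; the added 1 excludes division by 0.\<close>
  define t0 where "t0 = (\<rho> / 2)\<^sup>2 / (?G + 1)"
  have t0: "t0 > 0" unfolding t0_def using \<rho> G0 by (intro divide_pos_pos zero_less_power add_nonneg_pos) auto
  have bound: "norm2 lborel (epart (t / 2 ^ J) t (\<lambda>i k x. f n i k x - f m i k x) k) \<le> \<rho>" if t: "0 < t" "t \<le> t0" for t J n m k
  proof -
    define T where "T y = max (- K) (min K y)" for y
    have vm: "v n k \<in> borel_measurable lborel" for n k using v(1) by auto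
    note tl = Lp_tail[OF vm v(2,3) p K(1), folded T_def]
    have ti: "integrable lborel (\<lambda>x. v n k x - T (v n k x))" for n k
    proof (rule Bochner_Integration.integrable_bound[OF v(1)[of n k]])
      show "(\<lambda>x. v n k x - T (v n k x)) \<in> borel_measurable lborel" using tl(1) by (rule L2_measurable)
      show "AE x in lborel. norm (v n k x - T (v n k x)) \<le> norm (v n k x)"
        using K(1) by (intro AE_I2) (auto simp: T_def max_def min_def)
    qed
    \<comment> \<open>The difference of the two tails. What is left of the field is a difference of
      two truncations, hence bounded by 2 K.\<close>
    let ?u = "\<lambda>k x. (v n k x - T (v n k x)) - (v m k x - T (v m k x))"
    have "norm2 lborel (epart (t / 2 ^ J) t (\<lambda>i k x. f n i k x - f m i k x) k) \<le> 2 * ?D * (\<rho> / (8 * ?D) + \<rho> / (8 * ?D)) + 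
       sqrt (2 * (2 * K) * (t * gconst TYPE('d) * (\<Sum>k\<in>UNIV. \<Sum>i\<in>UNIV. LINT y|lborel. \<bar>f n i k y - f m i k y\<bar>)))"
    proof (rule epart_norm2[OF cd t(1), of "2 * K" ?u])
      show "L2 lborel (?u k)" for k by (intro L2_diff tl)
      show "integrable lborel (?u k)" for k by (intro Bochner_Integration.integrable_diff ti)
      show "norm2 lborel (?u k) \<le> \<rho> / (8 * ?D) + \<rho> / (8 * ?D)" for k
        by (rule order_trans[OF norm2_triangle_diff[OF tl(1) tl(1)]]) (intro add_mono order_trans[OF tl(2) K(2)])
      show "\<bar>v n k x - v m k x - ?u k x\<bar> \<le> 2 * K" for k x
        using K(1) by (auto simp: T_def max_def min_def)
    qed (use K in simp)
    also have "2 * ?D * (\<rho> / (8 * ?D) + \<rho> / (8 * ?D)) = \<rho> / 2" using D by (simp add: field_simps)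
    also have "sqrt (2 * (2 * K) * (t * gconst TYPE('d) * (\<Sum>k\<in>UNIV. \<Sum>i\<in>UNIV. LINT y|lborel. \<bar>f n i k y - f m i k y\<bar>))) \<le> \<rho> / 2"
    proof -
      have "(LINT y|lborel. \<bar>f n i k y - f m i k y\<bar>) \<le> 2 * C" for i k
      proof -
        have "(LINT y|lborel. \<bar>f n i k y - f m i k y\<bar>) \<le> (LINT y|lborel. \<bar>f n i k y\<bar> + \<bar>f m i k y\<bar>)"
          using f(1) by (intro integral_mono) auto
        also have "\<dots> = (LINT y|lborel. \<bar>f n i k y\<bar>) + (LINT y|lborel. \<bar>f m i k y\<bar>)"
          using f(1) by (intro Bochner_Integration.integral_add integrable_abs)
        finally show ?thesis using f(2)[of n i k] f(2)[of m i k] by linarith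
      qed
      then have "(\<Sum>k\<in>(UNIV::'d set). \<Sum>i\<in>(UNIV::'d set). LINT y|lborel. \<bar>f n i k y - f m i k y\<bar>) \<le> (\<Sum>k\<in>(UNIV::'d set). \<Sum>i\<in>(UNIV::'d set). 2 * C)"
        by (intro sum_mono)
      then have "2 * (2 * K) * (t * gconst TYPE('d) * (\<Sum>k\<in>UNIV. \<Sum>i\<in>UNIV. LINT y|lborel. \<bar>f n i k y - f m i k y\<bar>))
          \<le> 2 * (2 * K) * (t * gconst TYPE('d) * (?D * (?D * (2 * C))))"
        using K t gconst_nonneg[where 'd='d] by (intro mult_left_mono) auto
      also have "\<dots> = t * ?G" by simp
      also have "\<dots> \<le> t0 * (?G + 1)" using t t0 G0 by (intro mult_mono) auto
      also have "\<dots> = (\<rho> / 2)\<^sup>2"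
      proof -
        have "?G + 1 \<noteq> 0" using G0 by linarith
        then show ?thesis using t0_def by (rule nonzero_eq_divide_eq[THEN iffD1])
      qed
      finally show ?thesis using \<rho> by (intro real_le_lsqrt) auto
    qed
    finally show ?thesis by simp
  qed
  show thesis by (rule that[OF t0 bound])
qed

text \<open>At a fixed scale each sequence of mollified cut-off fields converges strongly; passing
  through the common limit gives the bound for differences.\<close>

lemma cutoff_low_frequency:
  fixes V :: "nat \<Rightarrow> 'd::finite \<Rightarrow> real^'d \<Rightarrow> real"
  assumes \<Omega>: "open \<Omega>" "bounded \<Omega>" and p: "p > 2" and ad: "admissible p \<Omega> V V0 F" and \<phi>: "test_function \<Omega> \<phi>"
    and t: "t > 0" and \<theta>: "\<theta> > 0"
  obtains n0 where "\<And>n m k. n \<ge> n0 \<Longrightarrow> m \<ge> n0 \<Longrightarrow> norm2 lborel (conv (moll t) (\<lambda>x. \<phi> x * V n k x - \<phi> x * V m k x)) \<le> \<theta>"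
proof -
  obtain f B A L C where
    c1: "\<And>n. curl_data (\<lambda>k x. \<phi> x * V n k x) (f n)" and
    c2: "\<And>n k. (LINT x|lborel. \<bar>\<phi> x * V n k x\<bar>) \<le> L"
    by (rule admissible_cutoff[OF \<Omega> p ad \<phi>]) blast
  note ad' = ad[unfolded admissible_def]
  have Vz: "x \<notin> \<Omega> \<Longrightarrow> V n k x = 0" for n k x using conjunct1[OF ad'] by simp
  note ad3 = conjunct1[OF conjunct2[OF conjunct2[OF ad']]] and weak = conjunct1[OF conjunct2[OF conjunct2[OF conjunct2[OF ad']]], rule_format]
  have V0: "V0 k \<in> borel_measurable borel" "x \<notin> \<Omega> \<Longrightarrow> V0 k x = 0" "integrable lborel (\<lambda>x. \<bar>V0 k x\<bar> powr p)" for k x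
    using ad3 by auto
  have cut: "integrable lborel (\<lambda>x. \<phi> x * V n k x)" "L2 lborel (\<lambda>x. \<phi> x * V n k x)" for n k
    using c1[of n] by (auto simp: curl_data_def)
  obtain R where R: "\<And>x. x \<in> \<Omega> \<Longrightarrow> norm x \<le> R" using \<Omega>(2) unfolding bounded_iff by blast
  have Rz: "\<phi> x * V n k x = 0" if "norm x > R" for n k x using Vz[of x] R[of x] that by (cases "x \<in> \<Omega>") auto
  have v0: "integrable lborel (\<lambda>x. \<phi> x * V0 k x)" "L2 lborel (\<lambda>x. \<phi> x * V0 k x)" for k
    by (intro test_function_mult_integrable[OF \<phi>] test_function_mult_L2[OF \<phi>] 
        Lp_bounded_support(2,3)[OF \<Omega> p V0]; assumption)+
  obtain bm where bm: "\<And>x::real^'d. \<bar>moll t x\<bar> \<le> bm" using moll_bounded[OF t] by blast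
  obtain b where b: "b \<ge> 0" "\<And>x. \<bar>\<phi> x\<bar> \<le> b" by (rule test_function_bounded[OF \<phi>]) blast
  have \<phi>m[measurable]: "\<phi> \<in> borel_measurable borel" by (rule test_function_measurable[OF \<phi>])
  have \<phi>z: "\<phi> x = 0" if "x \<notin> \<Omega>" for x
  proof -
    have "x \<notin> closure {x. \<phi> x \<noteq> 0}" using test_function_support(2)[OF \<phi>] that by blast
    then show ?thesis by (rule zero_outside_support)
  qed
  have w: "(\<lambda>n. LINT y|lborel. moll t (x - y) * (\<phi> y * V n k y)) \<longlonglongrightarrow> (LINT y|lborel. moll t (x - y) * (\<phi> y * V0 k y))" for x k
  proof -
    \<comment> \<open>The cutoff makes the kernel vanish outside \<open>\<Omega>\<close>; being also
      bounded, it is a legitimate dual test function.\<close>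
    let ?\<psi> = "\<lambda>y. moll t (x - y) * \<phi> y"
    have [measurable]: "\<Omega> \<in> sets borel" using \<Omega> by simp
    have "integrable lborel (\<lambda>y. \<bar>?\<psi> y\<bar> powr (p / (p - 1)))"
    proof (rule Bochner_Integration.integrable_bound)
      show "integrable lborel (\<lambda>y. (bm * b) powr (p / (p - 1)) * indicat_real \<Omega> y)"
        using emeasure_bounded_finite[OF \<Omega>(2)] by (intro integrable_mult_right integrable_real_indicator) auto
      show "AE y in lborel. norm (\<bar>?\<psi> y\<bar> powr (p / (p - 1))) \<le> norm ((bm * b) powr (p / (p - 1)) * indicat_real \<Omega> y)"
      proof (rule AE_I2)
        fix y
        have bm0: "bm \<ge> 0" using bm[of 0] by linarith
        have "\<bar>?\<psi> y\<bar> \<le> bm * b" unfolding abs_mult by (rule mult_mono[OF bm b(2) bm0 abs_ge_zero])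
        then have "\<bar>?\<psi> y\<bar> powr (p / (p - 1)) \<le> (bm * b) powr (p / (p - 1))" using p by (intro powr_mono2) auto
        then show "norm (\<bar>?\<psi> y\<bar> powr (p / (p - 1))) \<le> norm ((bm * b) powr (p / (p - 1)) * indicat_real \<Omega> y)"
          using \<phi>z[of y] by (cases "y \<in> \<Omega>") auto
      qed
    qed measurable
    then have "(\<lambda>n. LINT y|lborel. V n k y * ?\<psi> y) \<longlonglongrightarrow> (LINT y|lborel. V0 k y * ?\<psi> y)"
      by (intro weak) (simp_all add: \<phi>z)
    then show ?thesis by (simp add: mult_ac)
  qed
  have "\<forall>\<^sub>F n in sequentially. norm2 lborel (\<lambda>x. conv (moll t) (\<lambda>x. \<phi> x * V n k x) x - conv (moll t) (\<lambda>x. \<phi> x * V0 k x) x) < \<theta> / 2" for k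
    by (rule order_tendstoD(2)[OF moll_conv_compact[OF t cut(1) c2 Rz v0 w]]) (use \<theta> in auto)
  then have "\<forall>\<^sub>F n in sequentially. \<forall>k. norm2 lborel (\<lambda>x. conv (moll t) (\<lambda>x. \<phi> x * V n k x) x - conv (moll t) (\<lambda>x. \<phi> x * V0 k x) x) < \<theta> / 2"
    by (rule eventually_all_finite)
  then obtain n0 where n0: "\<And>n k. n \<ge> n0 \<Longrightarrow> norm2 lborel (\<lambda>x. conv (moll t) (\<lambda>x. \<phi> x * V n k x) x - conv (moll t) (\<lambda>x. \<phi> x * V0 k x) x) < \<theta> / 2"
    by (auto simp: eventually_sequentially)
  have "norm2 lborel (conv (moll t) (\<lambda>x. \<phi> x * V n k x - \<phi> x * V m k x)) \<le> \<theta>" if "n \<ge> n0" "m \<ge> n0" for n m k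
  proof -
    define T where "T n = conv (moll t) (\<lambda>x. \<phi> x * V n k x)" for n
    define T0 where "T0 = conv (moll t) (\<lambda>x. \<phi> x * V0 k x)"
    have TL: "L2 lborel (T n)" for n unfolding T_def by (rule moll_conv_L2[OF t cut])
    have T0L: "L2 lborel T0" unfolding T0_def by (rule moll_conv_L2[OF t v0])
    have "conv (moll t) (\<lambda>x. \<phi> x * V n k x - \<phi> x * V m k x) = (\<lambda>x. (T n x - T0 x) - (T m x - T0 x))"
      unfolding T_def T0_def by (rule ext, subst conv_diff[OF _ bm cut(1) cut(1)]) auto
    then show ?thesis
      using norm2_triangle_diff[OF L2_diff[OF TL T0L] L2_diff[OF TL T0L], of n m] n0[OF that(1), of k, folded T_def T0_def] n0[OF that(2), of k, folded T_def T0_def] by simp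
  qed
  then show thesis by (rule that)
qed

text \<open>The parameters are fixed in the order r, then \<rho> and \<theta>, then the scale t from
  \<rho>, and finally the index n0 from t and \<theta>.\<close>

lemma wedge_differences_small:
  fixes V W :: "nat \<Rightarrow> 'd::finite \<Rightarrow> real^'d \<Rightarrow> real"
  assumes \<Omega>: "open \<Omega>" "bounded \<Omega>" and p: "p > 2" and V: "admissible p \<Omega> V V0 F" and W: "admissible p \<Omega> W W0 F'"
    and \<phi>: "test_function \<Omega> \<phi>1" "test_function \<Omega> \<phi>2" and r: "r > 0"
  shows "\<exists>n0. \<forall>n\<ge>n0. \<forall>m\<ge>n0.
    \<bar>(LINT x|lborel. (\<phi>1 x * V n k x - \<phi>1 x * V m k x) * (\<phi>2 x * W n l x - \<phi>2 x * W m l x)) -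
     (LINT x|lborel. (\<phi>1 x * V n l x - \<phi>1 x * V m l x) * (\<phi>2 x * W n k x - \<phi>2 x * W m k x))\<bar> \<le> r"
proof -
  obtain f B A L C where
    v: "\<And>n. curl_data (\<lambda>k x. \<phi>1 x * V n k x) (f n)" and fz: "\<And>n m k x. x \<notin> \<Omega> \<Longrightarrow> f n m k x = 0" and
    vp: "\<And>n k. integrable lborel (\<lambda>x. \<bar>\<phi>1 x * V n k x\<bar> powr p)" "\<And>n k. (LINT x|lborel. \<bar>\<phi>1 x * V n k x\<bar> powr p) \<le> B" and
    vA: "\<And>n k. norm2 lborel (\<lambda>x. \<phi>1 x * V n k x) \<le> A" and fC: "\<And>n m k. (LINT x|lborel. \<bar>f n m k x\<bar>) \<le> C"
    by (rule admissible_cutoff[OF \<Omega> p V \<phi>(1)]) blast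
  obtain f' B' A' L' C' where
    w: "\<And>n. curl_data (\<lambda>k x. \<phi>2 x * W n k x) (f' n)" and fz': "\<And>n m k x. x \<notin> \<Omega> \<Longrightarrow> f' n m k x = 0" and
    wp: "\<And>n k. integrable lborel (\<lambda>x. \<bar>\<phi>2 x * W n k x\<bar> powr p)" "\<And>n k. (LINT x|lborel. \<bar>\<phi>2 x * W n k x\<bar> powr p) \<le> B'" and
    wA: "\<And>n k. norm2 lborel (\<lambda>x. \<phi>2 x * W n k x) \<le> A'" and fC': "\<And>n m k. (LINT x|lborel. \<bar>f' n m k x\<bar>) \<le> C'"
    by (rule admissible_cutoff[OF \<Omega> p W \<phi>(2)]) blast
  obtain R where R: "\<And>x. x \<in> \<Omega> \<Longrightarrow> norm x \<le> R" using \<Omega>(2) unfolding bounded_iff by blast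
  have out: "x \<notin> \<Omega>" if "norm x > R" for x using R[of x] that by auto
  have Vz: "V n k x = 0" "W n k x = 0" if "x \<notin> \<Omega>" for n k x
    using conjunct1[OF V[unfolded admissible_def]] conjunct1[OF W[unfolded admissible_def]] that by simp_all
  have Rv: "\<phi>1 x * V n k x = 0" "\<phi>2 x * W n k x = 0" if "norm x > R" for n k x using Vz[OF out[OF that]] by simp_all
  have vd: "curl_data (\<lambda>k x. \<phi>1 x * V n k x - \<phi>1 x * V m k x) (\<lambda>i k x. f n i k x - f m i k x)" for n m
    by (rule curl_data_diff[OF v v, of R]) (simp_all add: Rv fz[OF out])
  have wd: "curl_data (\<lambda>k x. \<phi>2 x * W n k x - \<phi>2 x * W m k x) (\<lambda>i k x. f' n i k x - f' m i k x)" for n m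
    by (rule curl_data_diff[OF w w, of R]) (simp_all add: Rv fz'[OF out])
  have vi: "integrable lborel (\<lambda>x. \<phi>1 x * V n k x)" "L2 lborel (\<lambda>x. \<phi>1 x * V n k x)" "integrable lborel (f n i k)" for n k i
    using v[of n] by (auto simp: curl_data_def)
  have wi: "integrable lborel (\<lambda>x. \<phi>2 x * W n k x)" "L2 lborel (\<lambda>x. \<phi>2 x * W n k x)" "integrable lborel (f' n i k)" for n k i
    using w[of n] by (auto simp: curl_data_def)
  define A1 where "A1 = A + A'"
  have A0: "0 \<le> A" "0 \<le> A'" using order_trans[OF norm2_nonneg vA] order_trans[OF norm2_nonneg wA] .
  have nd: "norm2 lborel (\<lambda>x. \<phi>1 x * V n k x - \<phi>1 x * V m k x) \<le> 2 * A1" 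
      "norm2 lborel (\<lambda>x. \<phi>2 x * W n k x - \<phi>2 x * W m k x) \<le> 2 * A1" for n m k
    using norm2_triangle_diff[OF vi(2) vi(2), of n k m k] vA[of n k] vA[of m k]
      norm2_triangle_diff[OF wi(2) wi(2), of n k m k] wA[of n k] wA[of m k] A0 by (auto simp: A1_def)
  have A1: "A1 \<ge> 0" using A0 by (simp add: A1_def)
  \<comment> \<open>The entry 1 of the minimum bounds 8 A1 + \<rho> by 8 A1 + 1, the other entry
    then brings the remainder term below r / 2.\<close>
  define \<rho> where "\<rho> = min 1 (r / (4 * (8 * A1 + 1)))"
  have \<rho>: "\<rho> > 0" "\<rho> \<le> 1" using r A1 by (auto simp: \<rho>_def)
  have \<rho>r: "2 * \<rho> * (4 * (2 * A1) + \<rho>) \<le> r / 2"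
  proof -
    have "2 * \<rho> * (4 * (2 * A1) + \<rho>) \<le> 2 * (r / (4 * (8 * A1 + 1))) * (8 * A1 + 1)"
      using \<rho> A1 r by (intro mult_mono) (auto simp: \<rho>_def)
    also have "\<dots> = r / 2" using A1 by (simp add: divide_simps)
    finally show ?thesis .
  qed
  \<comment> \<open>The differences have norm at most 2 A1, so the low-frequency term is 12 A1
    \<theta>, and 24 A1 \<theta> <= r is what is wanted.\<close>
  define \<theta> where "\<theta> = r / (24 * A1 + 1)"
  have \<theta>: "\<theta> > 0" using r A1 by (simp add: \<theta>_def)
  have \<theta>r: "6 * (2 * A1) * \<theta> \<le> r / 2"
  proof -
    have "24 * A1 * r \<le> (24 * A1 + 1) * r" using r by (intro mult_right_mono) auto
    then have "24 * A1 * \<theta> \<le> r" using A1 by (simp add: \<theta>_def pos_divide_le_eq mult_ac)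
    then show ?thesis by simp
  qed
  obtain t1 where t1: "t1 > 0" "\<And>t J n m k. 0 < t \<Longrightarrow> t \<le> t1 \<Longrightarrow> norm2 lborel (epart (t / 2 ^ J) t (\<lambda>i k x. f n i k x - f m i k x) k) \<le> \<rho>"
    by (rule cutoff_remainder[where f=f and v="\<lambda>n k x. \<phi>1 x * V n k x", OF p vd vi(1) vp vi(3) fC \<rho>(1)]) blast
  obtain t2 where t2: "t2 > 0" "\<And>t J n m k. 0 < t \<Longrightarrow> t \<le> t2 \<Longrightarrow> norm2 lborel (epart (t / 2 ^ J) t (\<lambda>i k x. f' n i k x - f' m i k x) k) \<le> \<rho>"
    by (rule cutoff_remainder[where f=f' and v="\<lambda>n k x. \<phi>2 x * W n k x", OF p wd wi(1) wp wi(3) fC' \<rho>(1)]) blast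
  define t where "t = min t1 t2"
  have t: "t > 0" "t \<le> t1" "t \<le> t2" using t1(1) t2(1) by (auto simp: t_def)
  obtain n1 where n1: "\<And>n m k. n \<ge> n1 \<Longrightarrow> m \<ge> n1 \<Longrightarrow> norm2 lborel (conv (moll t) (\<lambda>x. \<phi>1 x * V n k x - \<phi>1 x * V m k x)) \<le> \<theta>"
    by (rule cutoff_low_frequency[OF \<Omega> p V \<phi>(1) t(1) \<theta>]) blast
  obtain n2 where n2: "\<And>n m k. n \<ge> n2 \<Longrightarrow> m \<ge> n2 \<Longrightarrow> norm2 lborel (conv (moll t) (\<lambda>x. \<phi>2 x * W n k x - \<phi>2 x * W m k x)) \<le> \<theta>"
    by (rule cutoff_low_frequency[OF \<Omega> p W \<phi>(2) t(1) \<theta>]) blast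
  show ?thesis
  proof (rule exI[of _ "max n1 n2"], intro allI impI)
    fix n m assume nm: "max n1 n2 \<le> n" "max n1 n2 \<le> m"
    have "\<bar>(LINT x|lborel. (\<phi>1 x * V n k x - \<phi>1 x * V m k x) * (\<phi>2 x * W n l x - \<phi>2 x * W m l x)) -
     (LINT x|lborel. (\<phi>1 x * V n l x - \<phi>1 x * V m l x) * (\<phi>2 x * W n k x - \<phi>2 x * W m k x))\<bar> 
      \<le> 2 * \<rho> * (4 * (2 * A1) + \<rho>) + 6 * (2 * A1) * \<theta>"
    proof (rule wedge_estimate[OF vd _ wd _ t(1) nd t1(2)[OF t(1,2)] t2(2)[OF t(1,3)], of R])
      show "\<phi>1 x * V n k x - \<phi>1 x * V m k x = 0" if "R < norm x" for k x by (simp only: Rv[OF that] diff_self)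
      show "\<phi>2 x * W n k x - \<phi>2 x * W m k x = 0" if "R < norm x" for k x by (simp only: Rv[OF that] diff_self)
      show "norm2 lborel (conv (moll t) (\<lambda>x. \<phi>1 x * V n k x - \<phi>1 x * V m k x)) \<le> \<theta>" for k using nm by (intro n1) auto
      show "norm2 lborel (conv (moll t) (\<lambda>x. \<phi>2 x * W n k x - \<phi>2 x * W m k x)) \<le> \<theta>" for k using nm by (intro n2) auto
    qed
    also have "\<dots> \<le> r" using \<rho>r \<theta>r by linarith
    finally show "\<bar>(LINT x|lborel. (\<phi>1 x * V n k x - \<phi>1 x * V m k x) * (\<phi>2 x * W n l x - \<phi>2 x * W m l x)) -
     (LINT x|lborel. (\<phi>1 x * V n l x - \<phi>1 x * V m l x) * (\<phi>2 x * W n k x - \<phi>2 x * W m k x))\<bar> \<le> r" .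
  qed
qed

lemma cutoff_weak_limit:
  fixes V :: "nat \<Rightarrow> 'd::finite \<Rightarrow> real^'d \<Rightarrow> real"
  assumes \<Omega>: "open \<Omega>" "bounded \<Omega>" and p: "p > 2" and ad: "admissible p \<Omega> V V0 F" and \<phi>: "test_function \<Omega> \<phi>"
    and u: "u \<in> borel_measurable borel" "\<And>x. x \<notin> \<Omega> \<Longrightarrow> u x = 0" "integrable lborel (\<lambda>x. \<bar>u x\<bar> powr p)"
  shows "(\<lambda>n. LINT x|lborel. \<phi> x * V n k x * u x) \<longlonglongrightarrow> (LINT x|lborel. \<phi> x * V0 k x * u x)"
proof -
  note weak = conjunct1[OF conjunct2[OF conjunct2[OF conjunct2[OF ad[unfolded admissible_def]]]], rule_format]
  obtain b where b: "b \<ge> 0" "\<And>x. \<bar>\<phi> x\<bar> \<le> b" by (rule test_function_bounded[OF \<phi>]) blast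
  have [measurable]: "\<phi> \<in> borel_measurable borel" "u \<in> borel_measurable borel" using test_function_measurable[OF \<phi>] u by auto
  \<comment> \<open>As p > 2, the dual exponent is at most p, so on a bounded set a function in L^p
    is itself a dual test function.\<close>
  have q: "0 < p / (p - 1)" "p / (p - 1) \<le> p" using p by (auto simp: divide_le_eq)
  have "integrable lborel (\<lambda>x. \<bar>\<phi> x * u x\<bar> powr (p / (p - 1)))"
  proof (rule Bochner_Integration.integrable_bound)
    show "integrable lborel (\<lambda>x. b powr (p / (p - 1)) * \<bar>u x\<bar> powr (p / (p - 1)))"
      by (intro integrable_mult_right Lp_bounded_support(1)[OF \<Omega> p u q])
    show "AE x in lborel. norm (\<bar>\<phi> x * u x\<bar> powr (p / (p - 1))) \<le> norm (b powr (p / (p - 1)) * \<bar>u x\<bar> powr (p / (p - 1)))"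
    proof (rule AE_I2)
      fix x
      have "\<bar>\<phi> x * u x\<bar> powr (p / (p - 1)) \<le> (b * \<bar>u x\<bar>) powr (p / (p - 1))"
        using b q by (intro powr_mono2) (auto simp: abs_mult intro: mult_right_mono)
      then show "norm (\<bar>\<phi> x * u x\<bar> powr (p / (p - 1))) \<le> norm (b powr (p / (p - 1)) * \<bar>u x\<bar> powr (p / (p - 1)))"
        by (simp add: powr_mult)
    qed
  qed measurable
  then have "(\<lambda>n. LINT x|lborel. V n k x * (\<phi> x * u x)) \<longlonglongrightarrow> (LINT x|lborel. V0 k x * (\<phi> x * u x))"
    by (intro weak) (simp_all add: u(2))
  then show ?thesis by (simp add: mult_ac)
qed

text \<open>Both fields need a cutoff before they can be mollified on the whole space, hence the
  factorisation of \<open>\<phi>\<close>. The curl estimate enters only through differences of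
  members of the two sequences.\<close>

lemma div_curl:
  fixes V W :: "nat \<Rightarrow> 'd::finite \<Rightarrow> real^'d \<Rightarrow> real"
  assumes \<Omega>: "open \<Omega>" "bounded \<Omega>" and p: "p > 2" and V: "admissible p \<Omega> V V0 F" and W: "admissible p \<Omega> W W0 F'"
    and \<phi>: "test_function \<Omega> \<phi>"
  shows "(\<lambda>n. LINT x|lborel. \<phi> x * (V n k x * W n l x - V n l x * W n k x)) \<longlonglongrightarrow>
    (LINT x|lborel. \<phi> x * (V0 k x * W0 l x - V0 l x * W0 k x))"
proof -
  obtain \<phi>1 \<phi>2 where \<phi>12: "test_function \<Omega> \<phi>1" "test_function \<Omega> \<phi>2" "\<And>x. \<phi> x = \<phi>1 x * \<phi>2 x"
    by (rule test_function_factor[OF \<Omega>(1) \<phi>]) blast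
  note V' = V[unfolded admissible_def] and W' = W[unfolded admissible_def]
  have Vn: "V n k \<in> borel_measurable borel" "x \<notin> \<Omega> \<Longrightarrow> V n k x = 0" "integrable lborel (\<lambda>x. \<bar>V n k x\<bar> powr p)" for n k x
    using conjunct1[OF V'] conjunct1[OF conjunct2[OF V']] by auto
  have Wn: "W n k \<in> borel_measurable borel" "x \<notin> \<Omega> \<Longrightarrow> W n k x = 0" "integrable lborel (\<lambda>x. \<bar>W n k x\<bar> powr p)" for n k x
    using conjunct1[OF W'] conjunct1[OF conjunct2[OF W']] by auto
  have V0: "V0 k \<in> borel_measurable borel" "x \<notin> \<Omega> \<Longrightarrow> V0 k x = 0" "integrable lborel (\<lambda>x. \<bar>V0 k x\<bar> powr p)" for k x
    using conjunct1[OF conjunct2[OF conjunct2[OF V']]] by auto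
  have W0: "W0 k \<in> borel_measurable borel" "x \<notin> \<Omega> \<Longrightarrow> W0 k x = 0" "integrable lborel (\<lambda>x. \<bar>W0 k x\<bar> powr p)" for k x
    using conjunct1[OF conjunct2[OF conjunct2[OF W']]] by auto
  have L: "L2 lborel (\<lambda>x. \<phi>1 x * V n k x)" "L2 lborel (\<lambda>x. \<phi>2 x * W n k x)" 
    "L2 lborel (\<lambda>x. \<phi>1 x * V0 k x)" "L2 lborel (\<lambda>x. \<phi>2 x * W0 k x)" for n k
    using Lp_bounded_support(3)[OF \<Omega> p Vn] Lp_bounded_support(3)[OF \<Omega> p Wn]
      Lp_bounded_support(3)[OF \<Omega> p V0] Lp_bounded_support(3)[OF \<Omega> p W0]
    by (auto intro: test_function_mult_L2[OF \<phi>12(1)] test_function_mult_L2[OF \<phi>12(2)])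
  define J where "J v w = (LINT x|lborel. (\<phi>1 x * v k x) * (\<phi>2 x * w l x)) - (LINT x|lborel. (\<phi>1 x * v l x) * (\<phi>2 x * w k x))"
    for v w :: "'d \<Rightarrow> real^'d \<Rightarrow> real"
  have J: "J v w = (LINT x|lborel. \<phi> x * (v k x * w l x - v l x * w k x))"
    if "\<And>k. L2 lborel (\<lambda>x. \<phi>1 x * v k x)" "\<And>k. L2 lborel (\<lambda>x. \<phi>2 x * w k x)" for v w
  proof -
    have "J v w = (LINT x|lborel. (\<phi>1 x * v k x) * (\<phi>2 x * w l x) - (\<phi>1 x * v l x) * (\<phi>2 x * w k x))"
      unfolding J_def by (rule Bochner_Integration.integral_diff[symmetric]) (intro L2_mult_integrable that)+
    also have "\<dots> = (LINT x|lborel. \<phi> x * (v k x * w l x - v l x * w k x))"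
      by (intro Bochner_Integration.integral_cong refl) (simp add: \<phi>12(3) algebra_simps)
    finally show ?thesis .
  qed
  have "(\<lambda>n. J (V n) (W n)) \<longlonglongrightarrow> J V0 W0"
  \<comment> \<open>By bilinearity \<open>J\<close> of two differences is the expression a_n + a_m -
    b_nm - b_mn. In the mixed terms one argument is fixed, so weak convergence of the other is
    enough.\<close>
  proof (rule double_index_limit[where b="\<lambda>n m. J (V n) (W m)" and c="\<lambda>n. J (V n) W0" and c'="\<lambda>m. J V0 (W m)"])
    fix r :: real assume "r > 0"
    from wedge_differences_small[OF \<Omega> p V W \<phi>12(1,2) this, of k l]
    obtain n0 where n0: "\<And>n m. n \<ge> n0 \<Longrightarrow> m \<ge> n0 \<Longrightarrow>
      \<bar>(LINT x|lborel. (\<phi>1 x * V n k x - \<phi>1 x * V m k x) * (\<phi>2 x * W n l x - \<phi>2 x * W m l x)) -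
       (LINT x|lborel. (\<phi>1 x * V n l x - \<phi>1 x * V m l x) * (\<phi>2 x * W n k x - \<phi>2 x * W m k x))\<bar> \<le> r" by blast
    have exp: "(LINT x|lborel. (\<phi>1 x * V n k x - \<phi>1 x * V m k x) * (\<phi>2 x * W n l x - \<phi>2 x * W m l x)) =
      (LINT x|lborel. (\<phi>1 x * V n k x) * (\<phi>2 x * W n l x)) + (LINT x|lborel. (\<phi>1 x * V m k x) * (\<phi>2 x * W m l x))
      - (LINT x|lborel. (\<phi>1 x * V n k x) * (\<phi>2 x * W m l x)) - (LINT x|lborel. (\<phi>1 x * V m k x) * (\<phi>2 x * W n l x))" for n m k l
    proof -
      have "(LINT x|lborel. (\<phi>1 x * V n k x - \<phi>1 x * V m k x) * (\<phi>2 x * W n l x - \<phi>2 x * W m l x)) =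
        (LINT x|lborel. (\<phi>1 x * V n k x) * (\<phi>2 x * W n l x) + (\<phi>1 x * V m k x) * (\<phi>2 x * W m l x)
        - (\<phi>1 x * V n k x) * (\<phi>2 x * W m l x) - (\<phi>1 x * V m k x) * (\<phi>2 x * W n l x))"
        by (intro Bochner_Integration.integral_cong refl) (simp add: algebra_simps)
      then show ?thesis using L2_mult_integrable[OF L(1) L(2)] by simp
    qed
    have eq: "J (V n) (W n) + J (V m) (W m) - J (V n) (W m) - J (V m) (W n) = 
      (LINT x|lborel. (\<phi>1 x * V n k x - \<phi>1 x * V m k x) * (\<phi>2 x * W n l x - \<phi>2 x * W m l x)) -
       (LINT x|lborel. (\<phi>1 x * V n l x - \<phi>1 x * V m l x) * (\<phi>2 x * W n k x - \<phi>2 x * W m k x))" for n m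
      unfolding exp J_def by simp
    show "\<exists>n0. \<forall>n\<ge>n0. \<forall>m\<ge>n0. \<bar>J (V n) (W n) + J (V m) (W m) - J (V n) (W m) - J (V m) (W n)\<bar> \<le> r"
      unfolding eq using n0 by blast
  next
    have lim: "(\<lambda>m. J v (W m)) \<longlonglongrightarrow> J v W0" 
      if v: "\<And>k. v k \<in> borel_measurable borel" "\<And>k x. x \<notin> \<Omega> \<Longrightarrow> v k x = 0" "\<And>k. integrable lborel (\<lambda>x. \<bar>v k x\<bar> powr p)" for v
    proof -
      have "(\<lambda>m. LINT x|lborel. (\<phi>1 x * v i x) * (\<phi>2 x * W m j x)) \<longlonglongrightarrow> (LINT x|lborel. (\<phi>1 x * v i x) * (\<phi>2 x * W0 j x))" for i j
        using cutoff_weak_limit[OF \<Omega> p W \<phi> v, of j i] by (simp add: \<phi>12(3) mult_ac)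
      then show ?thesis unfolding J_def by (intro tendsto_diff)
    qed
    show "(\<lambda>m. J (V n) (W m)) \<longlonglongrightarrow> J (V n) W0" for n by (rule lim[OF Vn])
    show "(\<lambda>m. J V0 (W m)) \<longlonglongrightarrow> J V0 W0" by (rule lim[OF V0])
    have lim: "(\<lambda>m. J (V m) w) \<longlonglongrightarrow> J V0 w" 
      if w: "\<And>k. w k \<in> borel_measurable borel" "\<And>k x. x \<notin> \<Omega> \<Longrightarrow> w k x = 0" "\<And>k. integrable lborel (\<lambda>x. \<bar>w k x\<bar> powr p)" for w
    proof -
      have "(\<lambda>m. LINT x|lborel. (\<phi>1 x * V m i x) * (\<phi>2 x * w j x)) \<longlonglongrightarrow> (LINT x|lborel. (\<phi>1 x * V0 i x) * (\<phi>2 x * w j x))" for i j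
        using cutoff_weak_limit[OF \<Omega> p V \<phi> w, of i j] by (simp add: \<phi>12(3) mult_ac)
      then show ?thesis unfolding J_def by (intro tendsto_diff)
    qed
    show "(\<lambda>m. J (V m) (W n)) \<longlonglongrightarrow> J V0 (W n)" for n by (rule lim[OF Wn])
    show "(\<lambda>n. J (V n) W0) \<longlonglongrightarrow> J V0 W0" by (rule lim[OF W0])
  qed
  then show ?thesis using J[OF L(1) L(2)] J[OF L(3) L(4)] by simp
qed

section \<open>Weak sequential compactness in \<open>L\<^sup>p\<close>\<close>

text \<open>Young's inequality with a weight \<open>c\<close> replaces Hoelder's inequality: a small
  \<open>c\<close> makes the part in L^p small, at the price of a large constant on the dual
  part.\<close>

lemma Lp_Young:
  fixes p :: real assumes "p > 1" "c > 0"
  shows "\<bar>a * b\<bar> \<le> c powr p / p * \<bar>a\<bar> powr p + c powr (- (p / (p - 1))) / (p / (p - 1)) * \<bar>b\<bar> powr (p / (p - 1))"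
proof -
  have "(c * \<bar>a\<bar>) * (\<bar>b\<bar> / c) \<le> (c * \<bar>a\<bar>) powr p / p + (\<bar>b\<bar> / c) powr (p / (p - 1)) / (p / (p - 1))"
    using assms by (intro Youngs_inequality) (auto simp: field_simps)
  moreover have "(c * \<bar>a\<bar>) * (\<bar>b\<bar> / c) = \<bar>a * b\<bar>" using assms by (simp add: abs_mult)
  moreover have "(c * \<bar>a\<bar>) powr p = c powr p * \<bar>a\<bar> powr p" by (rule powr_mult)
  moreover have "(\<bar>b\<bar> / c) powr (p / (p - 1)) = c powr (- (p / (p - 1))) * \<bar>b\<bar> powr (p / (p - 1))"
    using assms by (simp add: powr_divide powr_minus_divide)
  ultimately show ?thesis by (simp add: mult_ac)
qed

lemma (in finite_measure) Lp_imp_integrable: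
  fixes p :: real and u :: "'a \<Rightarrow> real"
  assumes [measurable]: "u \<in> borel_measurable M" and "p > 1" and i: "integrable M (\<lambda>x. \<bar>u x\<bar> powr p)"
  shows "integrable M u"
proof (rule Bochner_Integration.integrable_bound)
  show "integrable M (\<lambda>x. 1 + \<bar>u x\<bar> powr p)" using i by simp
  have "\<bar>a\<bar> \<le> 1 + \<bar>a\<bar> powr p" for a :: real
    using powr_mono[of 1 p "\<bar>a\<bar>"] assms by (cases "\<bar>a\<bar> \<le> 1") (auto intro: order_trans[of _ 1])
  then show "AE x in M. norm (u x) \<le> norm (1 + \<bar>u x\<bar> powr p)" by simp
qed simp

text \<open>Uniform integrability. \<open>K\<close> depends only on \<open>p\<close>,
  \<open>\<epsilon>\<close> and \<open>B\<close>, hence not on the measure, the function or the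
  set.\<close>

lemma set_integral_small:
  fixes p \<epsilon> B :: real
  assumes "p > 1" "\<epsilon> > 0"
  obtains K where "K > 0" 
    "\<And>(M :: 'a measure) u A. \<lbrakk>finite_measure M; u \<in> borel_measurable M; integrable M (\<lambda>x. \<bar>u x\<bar> powr p); 
      (LINT x|M. \<bar>u x\<bar> powr p) \<le> B; A \<in> sets M\<rbrakk> \<Longrightarrow> \<bar>LINT x|M. indicator A x * u x\<bar> \<le> K * measure M A + \<epsilon>"
proof -
  define B' where "B' = max B 1"
  \<comment> \<open>Solves c^p B' / p = \<epsilon>; the maximum with 1 in \<open>B'\<close> keeps
    the quotient positive and finite.\<close>
  define c where "c = (\<epsilon> * p / B') powr (1 / p)"
  have B': "B' > 0" "B \<le> B'" by (auto simp: B'_def)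
  have l: "c > 0" using assms B' by (simp add: c_def)
  have lp: "c powr p = \<epsilon> * p / B'" using assms B' by (simp add: c_def powr_powr)
  let ?K = "c powr (- (p / (p - 1))) / (p / (p - 1))"
  have K: "?K > 0" using assms l by simp
  have "\<bar>LINT x|M. indicator A x * u x\<bar> \<le> ?K * measure M A + \<epsilon>"
    if M: "finite_measure M" and u[measurable]: "u \<in> borel_measurable M" and i: "integrable M (\<lambda>x. \<bar>u x\<bar> powr p)"
      and B: "(LINT x|M. \<bar>u x\<bar> powr p) \<le> B" and A[measurable]: "A \<in> sets M" for M u and A :: "'a set"
  proof -
    interpret finite_measure M by fact
    have iu: "integrable M u" by (rule Lp_imp_integrable[OF u assms(1) i])
    have iA: "integrable M (indicat_real A)" by (simp add: integrable_real_indicator emeasure_eq_measure)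
    have "\<bar>LINT x|M. indicator A x * u x\<bar> \<le> (LINT x|M. \<bar>indicator A x * u x\<bar>)" by (rule integral_abs_bound)
    also have "\<dots> \<le> (LINT x|M. c powr p / p * \<bar>u x\<bar> powr p + ?K * indicator A x)"
    proof (rule integral_mono)
      show "integrable M (\<lambda>x. \<bar>indicator A x * u x\<bar>)" using integrable_real_mult_indicator[OF A iu] by (simp add: mult.commute)
      show "integrable M (\<lambda>x. c powr p / p * \<bar>u x\<bar> powr p + ?K * indicator A x)"
        using i iA by (intro Bochner_Integration.integrable_add integrable_mult_right)
      show "\<bar>indicator A x * u x\<bar> \<le> c powr p / p * \<bar>u x\<bar> powr p + ?K * indicator A x" for x
        using Lp_Young[OF assms(1) l, of "u x" "indicator A x"] assms by (cases "x \<in> A") (auto simp: mult.commute)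
    qed
    also have "\<dots> = c powr p / p * (LINT x|M. \<bar>u x\<bar> powr p) + ?K * measure M A"
      using i iA by simp
    also have "c powr p / p * (LINT x|M. \<bar>u x\<bar> powr p) \<le> c powr p / p * B'"
      using B B' assms by (intro mult_left_mono) auto
    also have "\<dots> = \<epsilon>" using assms B' by (simp add: lp)
    finally show ?thesis by simp
  qed
  then show thesis by (rule that[OF K])
qed

text \<open>Finite intersections of members of a countable basis. Countability allows a diagonal
  subsequence, stability under intersections allows Dynkin's induction, and the whole space arises
  as the empty intersection.\<close>

lemma borel_countable_Int_generator:
  obtains G :: "'a::second_countable_topology set set" where "countable G" "Int_stable G" "sets borel = sigma_sets UNIV G" "UNIV \<in> G"
proof -
  obtain B :: "'a set set" where B: "countable B" "topological_basis B" using ex_countable_basis by blast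
  define G where "G = Inter ` {F. finite F \<and> F \<subseteq> B}"
  have "countable G" unfolding G_def using countable_Collect_finite_subset[OF B(1)] by simp
  moreover have "Int_stable G"
  proof (rule Int_stableI)
    fix a b assume "a \<in> G" "b \<in> G"
    then obtain F F' where "finite F" "F \<subseteq> B" "a = \<Inter>F" "finite F'" "F' \<subseteq> B" "b = \<Inter>F'" by (auto simp: G_def)
    then have "a \<inter> b = \<Inter>(F \<union> F')" "finite (F \<union> F')" "F \<union> F' \<subseteq> B" by auto
    then show "a \<inter> b \<in> G" unfolding G_def by blast
  qed
  moreover have "sets borel = sigma_sets UNIV G"
  proof -
    have sB: "sets borel = sigma_sets UNIV B"
      by (simp add: borel_eq_countable_basis[OF B])
    have BG: "B \<subseteq> G"
    proof
      fix b assume "b \<in> B"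
      then have "b = \<Inter>{b}" "finite {b}" "{b} \<subseteq> B" by auto
      then show "b \<in> G" unfolding G_def by blast
    qed
    have "G \<subseteq> sets borel"
    proof
      fix a assume "a \<in> G"
      then obtain F where F: "finite F" "F \<subseteq> B" "a = \<Inter>F" by (auto simp: G_def)
      have "open a" unfolding F(3) using F(1,2) topological_basis_open[OF B(2)] by (intro open_Inter) auto
      then show "a \<in> sets borel" by simp
    qed
    then have "sigma_sets UNIV G \<subseteq> sets borel" using sets.sigma_sets_subset[of G borel] by simp
    moreover have "sigma_sets UNIV B \<subseteq> sigma_sets UNIV G" by (rule sigma_sets_mono') (rule BG)
    ultimately show ?thesis using sB by simp
  qed
  moreover have "UNIV \<in> G" unfolding G_def by (intro image_eqI[of _ _ "{}"]) auto
  ultimately show thesis by (rule that)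
qed

lemma bounded_real_sequences_diagonal:
  fixes a :: "nat \<Rightarrow> nat \<Rightarrow> real"
  assumes "\<And>k. bounded (range (a k))"
  obtains r where "strict_mono r" "\<And>k. convergent (\<lambda>n. a k (r n))"
proof -
  interpret subseqs "\<lambda>k s. convergent (\<lambda>n. a k (s n))"
  proof
    fix k and s :: "nat \<Rightarrow> nat" assume "strict_mono s"
    have "bounded (range (\<lambda>n. a k (s n)))" by (rule bounded_subset[OF assms[of k]]) auto
    then obtain l r where "strict_mono r" "((\<lambda>n. a k (s n)) \<circ> r) \<longlonglongrightarrow> l"
      using bounded_imp_convergent_subsequence by blast
    then show "\<exists>r'. strict_mono r' \<and> convergent (\<lambda>n. a k ((s \<circ> r') n))"
      by (auto simp: convergent_def o_def)
  qed
  have "convergent (\<lambda>n. a k (diagseq n))" for k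
  proof -
    \<comment> \<open>The diagonal sequence is a subsequence of the k-th selection only after an
      initial segment has been dropped.\<close>
    have "convergent (\<lambda>n. a k ((diagseq \<circ> ((+) (Suc k))) n))"
    proof (rule diagseq_holds)
      fix r s :: "nat \<Rightarrow> nat" and n assume "strict_mono r" "convergent (\<lambda>m. a n (s m))"
      then show "convergent (\<lambda>m. a n ((s \<circ> r) m))"
        using convergent_subseq_convergent[of "\<lambda>m. a n (s m)" r] by (simp add: o_def)
    qed
    then have "convergent (\<lambda>n. a k (diagseq (n + Suc k)))" by (simp add: o_def add.commute)
    then show ?thesis using convergent_ignore_initial_segment[of "\<lambda>n. a k (diagseq n)" "Suc k"] by (simp del: add_Suc_right)
  qed
  then show thesis using that[OF subseq_diagseq] by blast
qed

text \<open>Interchange of limits under an approximation uniform in \<open>n\<close>. With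
  \<open>k\<close> counting the sets of a disjoint union, the first part gives the limit on the
  union and the second one countable additivity.\<close>

lemma limit_of_uniform_approx:
  fixes x :: "nat \<Rightarrow> real" and y :: "nat \<Rightarrow> nat \<Rightarrow> real"
  assumes y: "\<And>k. y k \<longlonglongrightarrow> l k" and approx: "\<And>\<epsilon>. \<epsilon> > 0 \<Longrightarrow> \<exists>k0. \<forall>k\<ge>k0. \<forall>n. \<bar>x n - y k n\<bar> \<le> \<epsilon>"
  shows "convergent x" "l \<longlonglongrightarrow> lim x"
proof -
  have "Cauchy x"
  proof (rule metric_CauchyI)
    fix e :: real assume e: "e > 0"
    obtain k where k: "\<And>n. \<bar>x n - y k n\<bar> \<le> e / 4" using approx[of "e / 4"] e by auto
    have "Cauchy (y k)" using y by (rule LIMSEQ_imp_Cauchy)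
    then obtain N where N: "\<And>m n. m \<ge> N \<Longrightarrow> n \<ge> N \<Longrightarrow> dist (y k m) (y k n) < e / 4"
      using e by (meson divide_pos_pos metric_CauchyD zero_less_numeral)
    have "dist (x m) (x n) < e" if "m \<ge> N" "n \<ge> N" for m n
      using k[of m, unfolded abs_le_iff] k[of n, unfolded abs_le_iff] N[OF that, unfolded dist_real_def abs_less_iff] e
      unfolding dist_real_def abs_less_iff by simp
    then show "\<exists>N. \<forall>m\<ge>N. \<forall>n\<ge>N. dist (x m) (x n) < e" by blast
  qed
  then show c: "convergent x" by (simp add: Cauchy_convergent_iff)
  then have x: "x \<longlonglongrightarrow> lim x" by (simp add: convergent_LIMSEQ_iff)
  show "l \<longlonglongrightarrow> lim x"
  proof (rule LIMSEQ_I)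
    fix e :: real assume e: "e > 0"
    obtain k0 where k0: "\<And>k n. k \<ge> k0 \<Longrightarrow> \<bar>x n - y k n\<bar> \<le> e / 2" using approx[of "e / 2"] e by auto
    have "norm (l k - lim x) < e" if "k \<ge> k0" for k
    proof -
      have "(\<lambda>n. \<bar>x n - y k n\<bar>) \<longlonglongrightarrow> \<bar>lim x - l k\<bar>" by (intro tendsto_rabs tendsto_diff x y)
      then have "\<bar>lim x - l k\<bar> \<le> e / 2" by (rule LIMSEQ_le_const2) (use k0[OF that] in blast)
      then show ?thesis using e by (simp add: abs_minus_commute)
    qed
    then show "\<exists>k0. \<forall>k\<ge>k0. norm (l k - lim x) < e" by blast
  qed
qed

text \<open>The set functions A -> integral of u_n over A converge along a diagonal subsequence on a
  countable generator, and uniform integrability carries this to all Borel sets. The limit is a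
  finite measure, absolutely continuous with respect to \<open>M\<close>, and its density is the
  weak limit. Nonnegativity ensures that the limit is an ordinary measure.\<close>

lemma weak_limit_nonneg:
  fixes u :: "nat \<Rightarrow> 'a::second_countable_topology \<Rightarrow> real"
  assumes M: "finite_measure M" "sets M = sets borel" and p: "p > 1"
    and u[measurable]: "\<And>n. u n \<in> borel_measurable M" and u0: "\<And>n x. 0 \<le> u n x"
    and i: "\<And>n. integrable M (\<lambda>x. \<bar>u n x\<bar> powr p)" and B: "\<And>n. (LINT x|M. \<bar>u n x\<bar> powr p) \<le> B"
  obtains r f where "strict_mono r" "integrable M f" 
    "\<And>A. A \<in> sets M \<Longrightarrow> (\<lambda>n. LINT x|M. indicator A x * u (r n) x) \<longlonglongrightarrow> (LINT x|M. indicator A x * f x)"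
proof -
  interpret finite_measure M by fact
  have sp: "space M = UNIV" using sets_eq_imp_space_eq[OF M(2)] by simp
  obtain G :: "'a set set" where G: "countable G" "Int_stable G" "sets borel = sigma_sets UNIV G" "UNIV \<in> G"
    by (rule borel_countable_Int_generator)
  have iu: "integrable M (u n)" for n by (rule Lp_imp_integrable[OF u p i])
  define \<nu> where "\<nu> A n = (LINT x|M. indicator A x * u n x)" for A n
  have iA: "integrable M (\<lambda>x. indicator A x * u n x)" if "A \<in> sets M" for A n
    using integrable_real_mult_indicator[OF that iu[of n]] by (simp add: mult.commute)
  obtain L where L: "\<And>A n. A \<in> sets M \<Longrightarrow> \<bar>\<nu> A n\<bar> \<le> L"
  proof -
    obtain K where K: "K > 0" 
      "\<And>M u (A :: 'a set). \<lbrakk>finite_measure M; u \<in> borel_measurable M; integrable M (\<lambda>x. \<bar>u x\<bar> powr p); 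
      (LINT x|M. \<bar>u x\<bar> powr p) \<le> B; A \<in> sets M\<rbrakk> \<Longrightarrow> \<bar>LINT x|M. indicator A x * u x\<bar> \<le> K * measure M A + 1"
      by (rule set_integral_small[OF p zero_less_one, of B, where 'a='a], rule that)
    have "\<bar>\<nu> A n\<bar> \<le> K * measure M (space M) + 1" if "A \<in> sets M" for A n
      using K(2)[OF M(1) u i B that, of n] mult_left_mono[OF bounded_measure[of A], of K] K(1) unfolding \<nu>_def by linarith
    then show thesis using that by blast
  qed
  have GM: "A \<in> sets M" if "A \<in> G" for A using that G(3) M(2) by auto
  have "bounded (range (\<nu> (from_nat_into G k)))" for k
    using L[OF GM[OF from_nat_into[of G]]] G(4) by (intro boundedI[where B=L]) auto
  then obtain r where r: "strict_mono r" "\<And>k. convergent (\<lambda>n. \<nu> (from_nat_into G k) (r n))"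
    using bounded_real_sequences_diagonal[of "\<lambda>k. \<nu> (from_nat_into G k)"] by blast
  have \<nu>_diff: "\<nu> (A - C) n = \<nu> A n - \<nu> C n" if "A \<in> sets M" "C \<in> sets M" "C \<subseteq> A" for A C n
  proof -
    have "\<nu> (A - C) n = (LINT x|M. indicator A x * u n x - indicator C x * u n x)"
      unfolding \<nu>_def using that(3) by (intro Bochner_Integration.integral_cong refl) (auto simp: indicator_def)
    then show ?thesis unfolding \<nu>_def using iA that by simp
  qed
  have \<nu>_sum: "\<nu> (\<Union>j<k. A j) n = (\<Sum>j<k. \<nu> (A j) n)" if "disjoint_family A" "\<And>j. A j \<in> sets M" for A :: "nat \<Rightarrow> 'a set" and k n
  proof -
    have ind: "indicator (\<Union>j<k. A j) x = (\<Sum>j<k. indicat_real (A j) x)" for x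
    proof (rule indicator_UN_disjoint)
      show "disjoint_family_on A {..<k}" using that(1) by (rule disjoint_family_on_mono[rotated]) simp
    qed simp
    then have "\<nu> (\<Union>j<k. A j) n = (LINT x|M. (\<Sum>j<k. indicator (A j) x * u n x))"
      unfolding \<nu>_def by (simp only: ind sum_distrib_right)
    also have "\<dots> = (\<Sum>j<k. \<nu> (A j) n)" 
      unfolding \<nu>_def by (rule Bochner_Integration.integral_sum) (rule iA[OF that(2)])
    finally show ?thesis .
  qed
  \<comment> \<open>The tails of a disjoint union have measure tending to 0, so uniform
    integrability makes their integrals small for all \<open>n\<close> at once.\<close>
  have tail: "\<exists>k0. \<forall>k\<ge>k0. \<forall>n. \<bar>\<nu> (\<Union>j. A j) (r n) - (\<Sum>j<k. \<nu> (A j) (r n))\<bar> \<le> \<epsilon>" 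
    if A: "disjoint_family A" "\<And>j. A j \<in> sets M" and \<epsilon>: "\<epsilon> > 0" for A :: "nat \<Rightarrow> 'a set" and \<epsilon>
  proof -
    obtain K where K: "K > 0" 
      "\<And>M u (A :: 'a set). \<lbrakk>finite_measure M; u \<in> borel_measurable M; integrable M (\<lambda>x. \<bar>u x\<bar> powr p); 
      (LINT x|M. \<bar>u x\<bar> powr p) \<le> B; A \<in> sets M\<rbrakk> \<Longrightarrow> \<bar>LINT x|M. indicator A x * u x\<bar> \<le> K * measure M A + \<epsilon> / 2"
      by (rule set_integral_small[OF p half_gt_zero[OF \<epsilon>], of B, where 'a='a], rule that)
    define T where "T k = (\<Union>j. A j) - (\<Union>j<k. A j)" for k
    have T: "T k \<in> sets M" for k unfolding T_def using A(2) by auto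
    have "(\<lambda>k. measure M (T k)) \<longlonglongrightarrow> measure M (\<Inter>k. T k)"
      by (rule finite_Lim_measure_decseq) (use T in \<open>auto simp: T_def decseq_def\<close>)
    moreover have "(\<Inter>k. T k) = {}"
    proof -
      have "x \<notin> (\<Inter>k. T k)" for x
      proof
        assume x: "x \<in> (\<Inter>k. T k)"
        then have "x \<in> T 0" by blast
        then obtain j where "x \<in> A j" by (auto simp: T_def)
        then have "x \<notin> T (Suc j)" by (auto simp: T_def)
        then show False using x by blast
      qed
      then show ?thesis by blast
    qed
    ultimately have "(\<lambda>k. measure M (T k)) \<longlonglongrightarrow> 0" by simp
    then have "\<forall>\<^sub>F k in sequentially. measure M (T k) < \<epsilon> / (2 * K)" using \<epsilon> K(1) by (intro order_tendstoD) auto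
    then obtain k0 where k0: "\<And>k. k \<ge> k0 \<Longrightarrow> measure M (T k) < \<epsilon> / (2 * K)" by (auto simp: eventually_sequentially)
    have "\<bar>\<nu> (\<Union>j. A j) (r n) - (\<Sum>j<k. \<nu> (A j) (r n))\<bar> \<le> \<epsilon>" if "k \<ge> k0" for k n
    proof -
      have "\<nu> (T k) (r n) = \<nu> (\<Union>j. A j) (r n) - \<nu> (\<Union>j<k. A j) (r n)"
        unfolding T_def by (rule \<nu>_diff) (use A in auto)
      then have "\<nu> (\<Union>j. A j) (r n) - (\<Sum>j<k. \<nu> (A j) (r n)) = \<nu> (T k) (r n)"
        using \<nu>_sum[OF A, of k "r n"] by simp
      moreover have "\<bar>\<nu> (T k) (r n)\<bar> \<le> K * measure M (T k) + \<epsilon> / 2"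
        unfolding \<nu>_def by (rule K(2)[OF M(1) u i B T])
      moreover have "K * measure M (T k) \<le> \<epsilon> / 2"
        using mult_left_mono[OF less_imp_le[OF k0[OF that]], of K] K(1) by simp
      ultimately show ?thesis by linarith
    qed
    then show ?thesis by blast
  qed
  have conv: "convergent (\<lambda>n. \<nu> A (r n))" if "A \<in> sets M" for A
  proof -
    have As: "A \<in> sigma_sets UNIV G" using that M(2) G(3) by simp
    have Gp: "G \<subseteq> Pow UNIV" by simp
    from G(2) Gp As show ?thesis
    proof (induction rule: sigma_sets_induct_disjoint)
      case (basic A)
      then obtain k where "A = from_nat_into G k" using G(1) by (metis from_nat_into_surj)
      then show ?case using r(2) by simp
    next
      case empty
      show ?case by (simp add: \<nu>_def convergent_const)
    next
      case (compl A)
      \<comment> \<open>Complements need convergence of the total mass, which is why the whole space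
        belongs to the generator.\<close>
      obtain k where "UNIV = from_nat_into G k" using G(1,4) by (metis from_nat_into_surj)
      then have "convergent (\<lambda>n. \<nu> UNIV (r n))" using r(2)[of k] by simp
      then have "convergent (\<lambda>n. \<nu> UNIV (r n) - \<nu> A (r n))" using compl(2) by (rule convergent_diff)
      moreover have "\<nu> (UNIV - A) (r n) = \<nu> UNIV (r n) - \<nu> A (r n)" for n
        using compl(1) G(3) M(2) sp by (intro \<nu>_diff) auto
      ultimately show ?case by simp
    next
      case (union A)
      have A: "A j \<in> sets M" for j using union(2) G(3) M(2) by auto
      have "(\<lambda>n. \<Sum>j<k. \<nu> (A j) (r n)) \<longlonglongrightarrow> (\<Sum>j<k. lim (\<lambda>n. \<nu> (A j) (r n)))" for k
        using union(3) by (intro tendsto_sum) (simp add: convergent_LIMSEQ_iff)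
      from limit_of_uniform_approx(1)[of "\<lambda>k n. \<Sum>j<k. \<nu> (A j) (r n)", OF this tail[OF union(1) A]]
      show ?case .
    qed
  qed
  define \<mu> where "\<mu> A = lim (\<lambda>n. \<nu> A (r n))" for A
  have \<mu>: "(\<lambda>n. \<nu> A (r n)) \<longlonglongrightarrow> \<mu> A" if "A \<in> sets M" for A
    using conv[OF that] by (simp add: \<mu>_def convergent_LIMSEQ_iff)
  have \<nu>0: "\<nu> A n \<ge> 0" for A n unfolding \<nu>_def by (intro integral_nonneg_AE) (simp add: u0)
  have \<mu>0: "\<mu> A \<ge> 0" if "A \<in> sets M" for A
    by (rule LIMSEQ_le_const[OF \<mu>[OF that]]) (use \<nu>0 in auto)
  define N where "N = measure_of UNIV (sets M) (\<lambda>A. ennreal (\<mu> A))"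
  have sN[simp]: "sets N = sets M" unfolding N_def using sp sets.space_closed[of M] by (simp add: sets.sigma_sets_eq[of M, unfolded sp])
  have eN: "emeasure N A = ennreal (\<mu> A)" if "A \<in> sets M" for A
    unfolding N_def
  proof (rule emeasure_measure_of_sigma)
    show "sigma_algebra UNIV (sets M)" using sets.sigma_algebra_axioms[of M] sp by simp
    show "positive (sets M) (\<lambda>A. ennreal (\<mu> A))"
      by (simp add: positive_def \<mu>_def \<nu>_def)
    show "countably_additive (sets M) (\<lambda>A. ennreal (\<mu> A))"
    proof (rule countably_additiveI)
      fix A :: "nat \<Rightarrow> 'a set" assume A: "range A \<subseteq> sets M" "disjoint_family A" "(\<Union>i. A i) \<in> sets M"
      then have Aj: "A j \<in> sets M" for j by auto
      have l: "(\<lambda>n. \<Sum>j<k. \<nu> (A j) (r n)) \<longlonglongrightarrow> (\<Sum>j<k. \<mu> (A j))" for k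
        by (intro tendsto_sum \<mu> Aj)
      have "(\<lambda>k. \<Sum>j<k. \<mu> (A j)) \<longlonglongrightarrow> \<mu> (\<Union>i. A i)"
        unfolding \<mu>_def[of "\<Union>i. A i"]
        by (rule limit_of_uniform_approx(2)[of "\<lambda>k n. \<Sum>j<k. \<nu> (A j) (r n)", OF l tail[OF A(2) Aj]])
      then show "(\<Sum>i. ennreal (\<mu> (A i))) = ennreal (\<mu> (\<Union>i. A i))"
        by (intro suminf_ennreal_eq \<mu>0 Aj) (simp add: sums_def)
    qed
  qed fact
  have spN: "space N = UNIV" using sets_eq_imp_space_eq[OF sN] sp by simp
  have fN: "finite_measure N" using eN[of UNIV] spN sp sets.top[of M] by (intro finite_measureI) simp
  have ac: "absolutely_continuous M N"
    unfolding absolutely_continuous_def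
  proof
    fix A assume A: "A \<in> null_sets M"
    have "\<nu> A n = 0" for n
      unfolding \<nu>_def using AE_not_in[OF A] by (intro integral_eq_zero_AE) (auto elim: eventually_mono)
    then have "\<mu> A = 0" by (simp add: \<mu>_def)
    then show "A \<in> null_sets N" using A eN[of A] by (auto simp: null_sets_def)
  qed
  obtain f where f: "f \<in> borel_measurable M" "AE x in M. RN_deriv M N x = ennreal (f x)" "\<And>x. 0 \<le> f x"
    using real_RN_deriv[OF fN ac sN] by blast
  have dens: "density M (\<lambda>x. ennreal (f x)) = N"
    using density_RN_deriv[OF ac sN] density_cong[OF _ _ f(2)] f(1) by simp
  have hb: "has_bochner_integral M (\<lambda>x. indicator A x * f x) (\<mu> A)" if A: "A \<in> sets M" for A
  proof (rule has_bochner_integral_nn_integral)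
    have "(\<integral>\<^sup>+x. ennreal (indicator A x * f x) \<partial>M) = (\<integral>\<^sup>+x. ennreal (f x) * indicator A x \<partial>M)"
      by (intro nn_integral_cong) (auto simp: indicator_def)
    also have "\<dots> = emeasure N A" unfolding dens[symmetric] using f(1) A by (subst emeasure_density) auto
    finally show "(\<integral>\<^sup>+x. ennreal (indicator A x * f x) \<partial>M) = ennreal (\<mu> A)" using eN[OF A] by simp
  qed (use f A \<mu>0[OF A] in auto)
  have "integrable M f" using hb[of UNIV] sp sets.top[of M] by (auto dest: integrable.intros)
  moreover have "(\<lambda>n. LINT x|M. indicator A x * u (r n) x) \<longlonglongrightarrow> (LINT x|M. indicator A x * f x)" if "A \<in> sets M" for A
    using \<mu>[OF that] has_bochner_integral_integral_eq[OF hb[OF that]] by (simp add: \<nu>_def)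
  ultimately show thesis by (rule that[OF r(1)])
qed

text \<open>Values are rounded down to multiples of \<open>e\<close>; boundedness leaves finitely
  many levels, which are indexed by integers.\<close>

lemma bounded_step_approx:
  fixes \<psi> :: "'a \<Rightarrow> real"
  assumes \<psi>: "\<psi> \<in> borel_measurable M" and c: "\<And>x. \<bar>\<psi> x\<bar> \<le> c" and e: "e > 0"
  obtains J :: "int set" and A d where "finite J" "\<And>j. j \<in> J \<Longrightarrow> A j \<in> sets M" 
    "\<And>x. x \<in> space M \<Longrightarrow> \<bar>\<psi> x - (\<Sum>j\<in>J. d j * indicator (A j) x)\<bar> \<le> e"
proof -
  define J where "J = {\<lfloor>- c / e\<rfloor>..\<lfloor>c / e\<rfloor>}"
  define A where "A j = {x\<in>space M. \<lfloor>\<psi> x / e\<rfloor> = j}" for j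
  have "finite J" by (simp add: J_def)
  moreover have "A j \<in> sets M" for j unfolding A_def using \<psi> by measurable
  moreover have "\<bar>\<psi> x - (\<Sum>j\<in>J. (e * of_int j) * indicator (A j) x)\<bar> \<le> e" if x: "x \<in> space M" for x
  proof -
    have "- c \<le> \<psi> x" "\<psi> x \<le> c" using c[of x] by auto
    then have "- c / e \<le> \<psi> x / e" "\<psi> x / e \<le> c / e" using e by (intro divide_right_mono; simp)+
    then have "\<lfloor>\<psi> x / e\<rfloor> \<in> J" unfolding J_def atLeastAtMost_iff by (intro conjI floor_mono)
    moreover have "(e * of_int j) * indicator (A j) x = (if \<lfloor>\<psi> x / e\<rfloor> = j then e * of_int j else 0)" for j
      using x by (auto simp: A_def)
    ultimately have "(\<Sum>j\<in>J. (e * of_int j) * indicator (A j) x) = e * of_int \<lfloor>\<psi> x / e\<rfloor>"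
      by (simp add: J_def)
    moreover have "e * of_int \<lfloor>\<psi> x / e\<rfloor> \<le> e * (\<psi> x / e)"
      using e by (intro mult_left_mono of_int_floor_le) auto
    moreover have "e * (\<psi> x / e) \<le> e * (of_int \<lfloor>\<psi> x / e\<rfloor> + 1)"
      using e by (intro mult_left_mono real_of_int_floor_add_one_ge) auto
    ultimately show ?thesis using e by (simp add: distrib_left abs_le_iff)
  qed
  ultimately show thesis by (rule that)
qed

text \<open>Convergence on sets extends to step functions by linearity, and a uniform approximation
  costs \<open>e\<close> times the bounded L^1 norms.\<close>

lemma weak_limit_bounded_test:
  fixes u :: "nat \<Rightarrow> 'a \<Rightarrow> real"
  assumes iu: "\<And>n. integrable M (u n)" and L: "\<And>n. (LINT x|M. \<bar>u n x\<bar>) \<le> L" and f: "integrable M f"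
    and set: "\<And>A. A \<in> sets M \<Longrightarrow> (\<lambda>n. LINT x|M. indicator A x * u n x) \<longlonglongrightarrow> (LINT x|M. indicator A x * f x)"
    and \<psi>: "\<psi> \<in> borel_measurable M" "\<And>x. \<bar>\<psi> x\<bar> \<le> c"
  shows "(\<lambda>n. LINT x|M. u n x * \<psi> x) \<longlonglongrightarrow> (LINT x|M. f x * \<psi> x)"
proof (rule LIMSEQ_I)
  fix r :: real assume r: "r > 0"
  \<comment> \<open>One constant dominates the L^1 norms of the sequence and of the limit; the added
    1 makes it a valid denominator for \<open>e\<close>.\<close>
  define L' where "L' = L + (LINT x|M. \<bar>f x\<bar>) + 1"
  have L0: "L \<ge> 0" by (rule order_trans[OF _ L[of 0]]) simp
  have L': "L' > 0" "L \<le> L'" "(LINT x|M. \<bar>f x\<bar>) \<le> L'" using L0 by (auto simp: L'_def add_nonneg_pos)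
  define e where "e = r / (4 * L')"
  have e: "e > 0" using r L' by (simp add: e_def)
  obtain J :: "int set" and A d where J: "finite J" "\<And>j. j \<in> J \<Longrightarrow> A j \<in> sets M" 
    "\<And>x. x \<in> space M \<Longrightarrow> \<bar>\<psi> x - (\<Sum>j\<in>J. d j * indicator (A j) x)\<bar> \<le> e"
    by (rule bounded_step_approx[OF \<psi> e]) blast
  let ?s = "\<lambda>x. \<Sum>j\<in>J. d j * indicator (A j) x"
  have iA: "integrable M (\<lambda>x. indicator A x * v x)" if "A \<in> sets M" "integrable M v" for A and v :: "'a \<Rightarrow> real"
    using integrable_real_mult_indicator[OF that] by (simp add: mult.commute)
  have eq: "(\<lambda>x. v x * ?s x) = (\<lambda>x. \<Sum>j\<in>J. d j * (indicator (A j) x * v x))" for v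
    by (simp add: fun_eq_iff sum_distrib_left mult_ac)
  have si: "integrable M (\<lambda>x. v x * ?s x)" if "integrable M v" for v
    unfolding eq by (intro Bochner_Integration.integrable_sum integrable_mult_right iA J(2) that)
  have se: "(LINT x|M. v x * ?s x) = (\<Sum>j\<in>J. d j * (LINT x|M. indicator (A j) x * v x))" if "integrable M v" for v
    unfolding eq
    by (subst Bochner_Integration.integral_sum) (auto intro!: integrable_mult_right iA J(2) that)
  have vi: "integrable M (\<lambda>x. v x * \<psi> x)" if "integrable M v" for v
  proof (rule Bochner_Integration.integrable_bound[of _ "\<lambda>x. c * v x"])
    show "AE x in M. norm (v x * \<psi> x) \<le> norm (c * v x)"
    proof (rule AE_I2)
      fix x
      have "\<bar>v x\<bar> * \<bar>\<psi> x\<bar> \<le> \<bar>v x\<bar> * \<bar>c\<bar>" using \<psi>(2)[of x] by (intro mult_left_mono) auto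
      then show "norm (v x * \<psi> x) \<le> norm (c * v x)" by (simp add: abs_mult mult.commute)
    qed
  qed (use that \<psi>(1) in auto)
  have close: "\<bar>(LINT x|M. v x * \<psi> x) - (LINT x|M. v x * ?s x)\<bar> \<le> r / 4" if v: "integrable M v" "(LINT x|M. \<bar>v x\<bar>) \<le> L'" for v
  proof -
    have "\<bar>(LINT x|M. v x * \<psi> x) - (LINT x|M. v x * ?s x)\<bar> = \<bar>LINT x|M. v x * \<psi> x - v x * ?s x\<bar>"
      using vi[OF v(1)] si[OF v(1)] by simp
    also have "\<dots> \<le> (LINT x|M. \<bar>v x * \<psi> x - v x * ?s x\<bar>)" by (rule integral_abs_bound)
    also have "\<dots> \<le> (LINT x|M. e * \<bar>v x\<bar>)"
    proof (rule integral_mono)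
      show "integrable M (\<lambda>x. \<bar>v x * \<psi> x - v x * ?s x\<bar>)" using vi[OF v(1)] si[OF v(1)] by simp
      show "integrable M (\<lambda>x. e * \<bar>v x\<bar>)" using v(1) by simp
      fix x assume "x \<in> space M"
      then have "\<bar>v x\<bar> * \<bar>\<psi> x - ?s x\<bar> \<le> \<bar>v x\<bar> * e" by (intro mult_left_mono J(3)) auto
      then show "\<bar>v x * \<psi> x - v x * ?s x\<bar> \<le> e * \<bar>v x\<bar>"
        unfolding right_diff_distrib[symmetric] abs_mult mult.commute[of e] .
    qed
    also have "\<dots> = e * (LINT x|M. \<bar>v x\<bar>)" by simp
    also have "\<dots> \<le> e * L'" using v(2) e by (intro mult_left_mono) auto
    also have "\<dots> = r / 4" using L' by (simp add: e_def)
    finally show ?thesis .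
  qed
  have "(\<lambda>n. LINT x|M. u n x * ?s x) \<longlonglongrightarrow> (LINT x|M. f x * ?s x)"
    unfolding se[OF iu] se[OF f] by (intro tendsto_sum tendsto_mult tendsto_const set J(2))
  from LIMSEQ_D[OF this, of "r / 4"] r
  obtain n0 where n0: "\<And>n. n \<ge> n0 \<Longrightarrow> \<bar>(LINT x|M. u n x * ?s x) - (LINT x|M. f x * ?s x)\<bar> < r / 4" by auto
  have "norm ((LINT x|M. u n x * \<psi> x) - (LINT x|M. f x * \<psi> x)) < r" if "n \<ge> n0" for n
    using n0[OF that, unfolded abs_less_iff] close[OF iu[of n] order_trans[OF L L'(2)], unfolded abs_le_iff] 
      close[OF f L'(3), unfolded abs_le_iff] r
    unfolding real_norm_def abs_less_iff by simp
  then show "\<exists>n0. \<forall>n\<ge>n0. norm ((LINT x|M. u n x * \<psi> x) - (LINT x|M. f x * \<psi> x)) < r" by blast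
qed

text \<open>Lower semicontinuity of the norm by duality. The extremal dual function of
  \<open>f\<close>, truncated to be bounded, is used as test function, and the truncation is then
  removed by monotone convergence.\<close>

lemma weak_limit_in_Lp:
  fixes u :: "nat \<Rightarrow> 'a \<Rightarrow> real"
  assumes p: "p > 1" and um: "\<And>n. u n \<in> borel_measurable M" and i: "\<And>n. integrable M (\<lambda>x. \<bar>u n x\<bar> powr p)" 
    and B: "\<And>n. (LINT x|M. \<bar>u n x\<bar> powr p) \<le> B" and fin: "finite_measure M" and f: "f \<in> borel_measurable M" 
    and lim: "\<And>\<psi> c. \<psi> \<in> borel_measurable M \<Longrightarrow> (\<And>x. \<bar>\<psi> x\<bar> \<le> c) \<Longrightarrow> 
      (\<lambda>n. LINT x|M. u n x * \<psi> x) \<longlonglongrightarrow> (LINT x|M. f x * \<psi> x)"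
  shows "integrable M (\<lambda>x. \<bar>f x\<bar> powr p)" "(LINT x|M. \<bar>f x\<bar> powr p) \<le> B"
proof -
  interpret finite_measure M by fact
  have [measurable]: "f \<in> borel_measurable M" "u n \<in> borel_measurable M" for n using f um by auto
  let ?q = "p / (p - 1)"
  define g where "g k x = (if \<bar>f x\<bar> \<le> real k then \<bar>f x\<bar> powr p else 0)" for k :: nat and x
  have [measurable]: "g k \<in> borel_measurable M" for k unfolding g_def by measurable
  have gi: "integrable M (g k)" for k
  proof (rule integrable_const_bound)
    show "AE x in M. norm (g k x) \<le> real k powr p" using p by (intro AE_I2) (auto simp: g_def intro: powr_mono2)
  qed measurable
  have gB: "(LINT x|M. g k x) \<le> B" for k
  proof -
    \<comment> \<open>Equality case of Young's inequality: both f \<psi> and the dual power of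
      |\<psi>| equal \<open>g k\<close>.\<close>
    define \<psi> where "\<psi> x = (if \<bar>f x\<bar> \<le> real k then sgn (f x) * \<bar>f x\<bar> powr (p - 1) else 0)" for x
    have \<psi>m[measurable]: "\<psi> \<in> borel_measurable M" unfolding \<psi>_def by measurable
    have \<psi>b: "\<bar>\<psi> x\<bar> \<le> real k powr (p - 1)" for x
      using p by (auto simp: \<psi>_def abs_mult sgn_if intro: powr_mono2)
    have f\<psi>: "f x * \<psi> x = g k x" for x
    proof (cases "f x = 0")
      case False
      have "f x * (sgn (f x) * \<bar>f x\<bar> powr (p - 1)) = \<bar>f x\<bar> powr 1 * \<bar>f x\<bar> powr (p - 1)"
        using False by (simp add: sgn_if)
      also have "\<dots> = \<bar>f x\<bar> powr p" unfolding powr_add[symmetric] by simp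
      finally show ?thesis by (simp add: \<psi>_def g_def)
    qed (simp add: \<psi>_def g_def)
    have \<psi>q: "\<bar>\<psi> x\<bar> powr ?q = g k x" for x
      using p by (cases "f x = 0") (auto simp: \<psi>_def g_def abs_mult powr_powr)
    have "(LINT x|M. u n x * \<psi> x) \<le> B / p + (LINT x|M. g k x) / ?q" for n
    proof -
      have "(LINT x|M. u n x * \<psi> x) \<le> (LINT x|M. 1 / p * \<bar>u n x\<bar> powr p + 1 / ?q * g k x)"
      proof (rule integral_mono)
        have "integrable M (u n)" by (rule Lp_imp_integrable[OF _ p i]) simp
        then have "integrable M (\<lambda>x. real k powr (p - 1) * u n x)" by simp
        then show "integrable M (\<lambda>x. u n x * \<psi> x)"
        proof (rule Bochner_Integration.integrable_bound)
          show "AE x in M. norm (u n x * \<psi> x) \<le> norm (real k powr (p - 1) * u n x)"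
          proof (rule AE_I2)
            fix x
            have "\<bar>u n x\<bar> * \<bar>\<psi> x\<bar> \<le> \<bar>u n x\<bar> * real k powr (p - 1)" by (intro mult_left_mono \<psi>b) simp
            then show "norm (u n x * \<psi> x) \<le> norm (real k powr (p - 1) * u n x)" by (simp add: abs_mult mult.commute)
          qed
        qed measurable
        show "integrable M (\<lambda>x. 1 / p * \<bar>u n x\<bar> powr p + 1 / ?q * g k x)" using i gi by simp
        show "u n x * \<psi> x \<le> 1 / p * \<bar>u n x\<bar> powr p + 1 / ?q * g k x" for x
          using Lp_Young[OF p zero_less_one, of "u n x" "\<psi> x"] by (simp add: \<psi>q abs_le_iff)
      qed
      also have "\<dots> = 1 / p * (LINT x|M. \<bar>u n x\<bar> powr p) + 1 / ?q * (LINT x|M. g k x)" using i gi by simp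
      also have "\<dots> \<le> 1 / p * B + 1 / ?q * (LINT x|M. g k x)" using B p by (intro add_right_mono mult_left_mono) auto
      finally show ?thesis by (simp add: mult.commute)
    qed
    then have "(LINT x|M. f x * \<psi> x) \<le> B / p + (LINT x|M. g k x) / ?q"
      by (intro LIMSEQ_le_const2[OF lim[OF \<psi>m \<psi>b]]) blast
    \<comment> \<open>The integral of \<open>g k\<close> is finite and stands on the right with the
      factor 1 / q = 1 - 1 / p, so it can be absorbed.\<close>
    then have "(LINT x|M. g k x) \<le> B / p + (LINT x|M. g k x) * (p - 1) / p" by (simp add: f\<psi>)
    then show ?thesis using p by (simp add: field_simps)
  qed
  have lim': "(\<lambda>k. LINT x|M. g k x) \<longlonglongrightarrow> (SUP k. LINT x|M. g k x)"
  proof (rule LIMSEQ_incseq_SUP)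
    show "bdd_above (range (\<lambda>k. LINT x|M. g k x))" using gB by (intro bdd_aboveI[of _ B]) auto
    show "incseq (\<lambda>k. LINT x|M. g k x)"
      by (intro incseq_SucI integral_mono gi) (auto simp: g_def)
  qed
  have hb: "has_bochner_integral M (\<lambda>x. \<bar>f x\<bar> powr p) (SUP k. LINT x|M. g k x)"
  proof (rule has_bochner_integral_monotone_convergence[OF gi _ _ lim'])
    show "AE x in M. mono (\<lambda>k. g k x)" by (intro AE_I2 monoI) (auto simp: g_def)
    show "AE x in M. (\<lambda>k. g k x) \<longlonglongrightarrow> \<bar>f x\<bar> powr p"
    proof (intro AE_I2 tendsto_eventually)
      fix x
      obtain n0 where "\<bar>f x\<bar> \<le> real n0" using real_arch_simple by blast
      then show "\<forall>\<^sub>F k in sequentially. g k x = \<bar>f x\<bar> powr p"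
        unfolding eventually_sequentially by (intro exI[of _ n0]) (auto simp: g_def)
    qed
  qed measurable
  show "integrable M (\<lambda>x. \<bar>f x\<bar> powr p)" using hb by (rule integrable.intros)
  have "(SUP k. LINT x|M. g k x) \<le> B" using gB by (intro cSUP_least) auto
  then show "(LINT x|M. \<bar>f x\<bar> powr p) \<le> B" using has_bochner_integral_integral_eq[OF hb] by simp
qed

text \<open>The test function is truncated to a bounded one. The error is made small by Young's
  inequality, first choosing the weight \<open>c\<close> and then the truncation level
  \<open>k\<close>.\<close>

lemma weak_limit_Lp_test:
  fixes u :: "nat \<Rightarrow> 'a \<Rightarrow> real"
  assumes p: "p > 1" and um: "\<And>n. u n \<in> borel_measurable M" and i: "\<And>n. integrable M (\<lambda>x. \<bar>u n x\<bar> powr p)" 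
    and B: "\<And>n. (LINT x|M. \<bar>u n x\<bar> powr p) \<le> B" 
    and f: "f \<in> borel_measurable M" "integrable M (\<lambda>x. \<bar>f x\<bar> powr p)" "(LINT x|M. \<bar>f x\<bar> powr p) \<le> B" 
    and lim: "\<And>\<psi> c. \<psi> \<in> borel_measurable M \<Longrightarrow> (\<And>x. \<bar>\<psi> x\<bar> \<le> c) \<Longrightarrow> 
      (\<lambda>n. LINT x|M. u n x * \<psi> x) \<longlonglongrightarrow> (LINT x|M. f x * \<psi> x)"
    and \<psi>: "\<psi> \<in> borel_measurable M" "integrable M (\<lambda>x. \<bar>\<psi> x\<bar> powr (p / (p - 1)))"
  shows "(\<lambda>n. LINT x|M. u n x * \<psi> x) \<longlonglongrightarrow> (LINT x|M. f x * \<psi> x)"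
proof (rule LIMSEQ_I)
  fix r :: real assume r: "r > 0"
  let ?q = "p / (p - 1)"
  have [measurable]: "\<psi> \<in> borel_measurable M" by fact
  define t where "t k x = (if \<bar>\<psi> x\<bar> \<le> real k then \<psi> x else 0)" for k :: nat and x
  have tm[measurable]: "t k \<in> borel_measurable M" for k unfolding t_def by measurable
  have tb: "\<bar>t k x\<bar> \<le> real k" for k x by (simp add: t_def)
  define B' where "B' = max B 1"
  have B': "B' > 0" "B \<le> B'" by (auto simp: B'_def)
  \<comment> \<open>Makes the part in L^p at most r / 8, uniformly over the sequence and its limit;
    the level \<open>k\<close> later bounds the dual part by r / 8 as well.\<close>
  define c where "c = (r / 8 * p / B') powr (1 / p)"
  have c: "c > 0" using r B' p by (simp add: c_def)
  have cp: "c powr p / p * B' = r / 8" using r B' p by (simp add: c_def powr_powr)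
  let ?K = "c powr (- ?q) / ?q"
  have "(\<lambda>k. LINT x|M. \<bar>\<psi> x - t k x\<bar> powr ?q) \<longlonglongrightarrow> (LINT x|M. 0)"
  proof (rule integral_dominated_convergence[OF _ _ \<psi>(2)])
    show "AE x in M. (\<lambda>k. \<bar>\<psi> x - t k x\<bar> powr ?q) \<longlonglongrightarrow> 0"
    proof (intro AE_I2 tendsto_eventually)
      fix x
      obtain n0 where "\<bar>\<psi> x\<bar> \<le> real n0" using real_arch_simple by blast
      then show "\<forall>\<^sub>F k in sequentially. \<bar>\<psi> x - t k x\<bar> powr ?q = 0"
        unfolding eventually_sequentially by (intro exI[of _ n0]) (auto simp: t_def)
    qed
    show "AE x in M. norm (\<bar>\<psi> x - t k x\<bar> powr ?q) \<le> \<bar>\<psi> x\<bar> powr ?q" for k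
      by (intro AE_I2) (simp add: t_def)
  qed measurable
  then have "(\<lambda>k. ?K * (LINT x|M. \<bar>\<psi> x - t k x\<bar> powr ?q)) \<longlonglongrightarrow> ?K * 0" by (intro tendsto_mult tendsto_const) simp
  then have "\<forall>\<^sub>F k in sequentially. ?K * (LINT x|M. \<bar>\<psi> x - t k x\<bar> powr ?q) < r / 8" using r by (intro order_tendstoD) auto
  then obtain k where k: "?K * (LINT x|M. \<bar>\<psi> x - t k x\<bar> powr ?q) < r / 8" by (auto simp: eventually_sequentially)
  have ti: "integrable M (\<lambda>x. \<bar>\<psi> x - t k x\<bar> powr ?q)"
  proof (rule Bochner_Integration.integrable_bound[OF \<psi>(2)])
    show "AE x in M. norm (\<bar>\<psi> x - t k x\<bar> powr ?q) \<le> norm (\<bar>\<psi> x\<bar> powr ?q)" by (intro AE_I2) (simp add: t_def)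
  qed measurable
  have young: "\<bar>v x * \<phi> x\<bar> \<le> c powr p / p * \<bar>v x\<bar> powr p + ?K * \<bar>\<phi> x\<bar> powr ?q" for v \<phi> :: "'a \<Rightarrow> real" and x
    by (rule Lp_Young[OF p c])
  have pi: "integrable M (\<lambda>x. v x * \<phi> x)" if "v \<in> borel_measurable M" "integrable M (\<lambda>x. \<bar>v x\<bar> powr p)" 
      "\<phi> \<in> borel_measurable M" "integrable M (\<lambda>x. \<bar>\<phi> x\<bar> powr ?q)" for v \<phi> :: "'a \<Rightarrow> real"
  proof (rule Bochner_Integration.integrable_bound)
    show "integrable M (\<lambda>x. c powr p / p * \<bar>v x\<bar> powr p + ?K * \<bar>\<phi> x\<bar> powr ?q)"
      using that by (intro Bochner_Integration.integrable_add integrable_mult_right)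
    show "AE x in M. norm (v x * \<phi> x) \<le> norm (c powr p / p * \<bar>v x\<bar> powr p + ?K * \<bar>\<phi> x\<bar> powr ?q)"
      using order_trans[OF young abs_ge_self] by (intro AE_I2) simp
  qed (use that in measurable)
  have close: "\<bar>(LINT x|M. v x * \<psi> x) - (LINT x|M. v x * t k x)\<bar> \<le> r / 4" 
    if v: "v \<in> borel_measurable M" "integrable M (\<lambda>x. \<bar>v x\<bar> powr p)" "(LINT x|M. \<bar>v x\<bar> powr p) \<le> B" for v
  proof -
    have i1: "integrable M (\<lambda>x. v x * \<psi> x)" by (rule pi[OF v(1,2) \<psi>])
    have i2: "integrable M (\<lambda>x. v x * (\<psi> x - t k x))" by (rule pi[OF v(1,2) _ ti]) measurable
    have i3: "integrable M (\<lambda>x. v x * t k x)"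
      using Bochner_Integration.integrable_diff[OF i1 i2] by (simp add: right_diff_distrib)
    have "\<bar>(LINT x|M. v x * \<psi> x) - (LINT x|M. v x * t k x)\<bar> = \<bar>LINT x|M. v x * (\<psi> x - t k x)\<bar>"
      unfolding right_diff_distrib using i1 i3 by simp
    also have "\<dots> \<le> (LINT x|M. \<bar>v x * (\<psi> x - t k x)\<bar>)" by (rule integral_abs_bound)
    also have "\<dots> \<le> (LINT x|M. c powr p / p * \<bar>v x\<bar> powr p + ?K * \<bar>\<psi> x - t k x\<bar> powr ?q)"
      by (rule integral_mono[OF integrable_abs[OF i2] _ young[where v=v and \<phi>="\<lambda>x. \<psi> x - t k x"]]) 
         (intro Bochner_Integration.integrable_add integrable_mult_right v ti)
    also have "\<dots> = c powr p / p * (LINT x|M. \<bar>v x\<bar> powr p) + ?K * (LINT x|M. \<bar>\<psi> x - t k x\<bar> powr ?q)"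
      using v(2) ti by simp
    also have "\<dots> \<le> c powr p / p * B' + ?K * (LINT x|M. \<bar>\<psi> x - t k x\<bar> powr ?q)"
      using v(3) B' p by (intro add_right_mono mult_left_mono) auto
    finally have "\<bar>(LINT x|M. v x * \<psi> x) - (LINT x|M. v x * t k x)\<bar> \<le> r / 8 + r / 8"
      using add_mono[OF eq_refl[OF cp] less_imp_le[OF k]] by (rule order_trans)
    then show ?thesis by simp
  qed
  from LIMSEQ_D[OF lim[OF tm tb], of "r / 4" k] r
  obtain n0 where n0: "\<And>n. n \<ge> n0 \<Longrightarrow> \<bar>(LINT x|M. u n x * t k x) - (LINT x|M. f x * t k x)\<bar> < r / 4" by auto
  have "norm ((LINT x|M. u n x * \<psi> x) - (LINT x|M. f x * \<psi> x)) < r" if "n \<ge> n0" for n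
    using n0[OF that, unfolded abs_less_iff] close[OF um[of n] i[of n] B[of n], unfolded abs_le_iff] 
      close[OF f, unfolded abs_le_iff] r
    unfolding real_norm_def abs_less_iff by simp
  then show "\<exists>n0. \<forall>n\<ge>n0. norm ((LINT x|M. u n x * \<psi> x) - (LINT x|M. f x * \<psi> x)) < r" by blast
qed

text \<open>Positive and negative parts are treated one after the other, the second subsequence
  being extracted from the first, because the limit of set functions is required to be a
  measure.\<close>

theorem Lp_weakly_sequentially_compact:
  fixes u :: "nat \<Rightarrow> 'a::second_countable_topology \<Rightarrow> real"
  assumes M: "finite_measure M" "sets M = sets borel" and p: "p > 1"
    and u: "\<And>n. u n \<in> borel_measurable M" 
    and i: "\<And>n. integrable M (\<lambda>x. \<bar>u n x\<bar> powr p)" and B: "\<And>n. (LINT x|M. \<bar>u n x\<bar> powr p) \<le> B"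
  obtains r f where "strict_mono r" "f \<in> borel_measurable M" "integrable M (\<lambda>x. \<bar>f x\<bar> powr p)" 
    "\<And>\<psi>. \<psi> \<in> borel_measurable M \<Longrightarrow> integrable M (\<lambda>x. \<bar>\<psi> x\<bar> powr (p / (p - 1))) \<Longrightarrow> 
      (\<lambda>n. LINT x|M. u (r n) x * \<psi> x) \<longlonglongrightarrow> (LINT x|M. f x * \<psi> x)"
proof -
  interpret finite_measure M by fact
  have [measurable]: "u n \<in> borel_measurable M" for n using u .
  have iu: "integrable M (u n)" for n by (rule Lp_imp_integrable[OF u p i])
  define up um where "up n x = max 0 (u n x)" and "um n x = max 0 (- u n x)" for n x
  have part: "integrable M (\<lambda>x. \<bar>max 0 (s * u n x)\<bar> powr p)" "(LINT x|M. \<bar>max 0 (s * u n x)\<bar> powr p) \<le> B" 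
    if s: "s = 1 \<or> s = -1" for s n
  proof -
    have pt: "\<bar>max 0 (s * u n x)\<bar> powr p \<le> \<bar>u n x\<bar> powr p" for x
      using s p by (intro powr_mono2) auto
    show ip: "integrable M (\<lambda>x. \<bar>max 0 (s * u n x)\<bar> powr p)"
      by (rule Bochner_Integration.integrable_bound[OF i[of n]]) (use pt in auto)
    show "(LINT x|M. \<bar>max 0 (s * u n x)\<bar> powr p) \<le> B"
      using integral_mono[OF ip i[of n] pt] B[of n] by linarith
  qed
  obtain r1 f1 where 1: "strict_mono r1" "integrable M f1" 
    "\<And>A. A \<in> sets M \<Longrightarrow> (\<lambda>n. LINT x|M. indicator A x * up (r1 n) x) \<longlonglongrightarrow> (LINT x|M. indicator A x * f1 x)"
    by (rule weak_limit_nonneg[OF M p, of up B]) (use part[of 1] in \<open>auto simp: up_def[abs_def]\<close>)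
  obtain r2 f2 where 2: "strict_mono r2" "integrable M f2" 
    "\<And>A. A \<in> sets M \<Longrightarrow> (\<lambda>n. LINT x|M. indicator A x * um (r1 (r2 n)) x) \<longlonglongrightarrow> (LINT x|M. indicator A x * f2 x)"
    by (rule weak_limit_nonneg[OF M p, of "\<lambda>n. um (r1 n)" B]) (use part[of "-1"] in \<open>auto simp: um_def[abs_def]\<close>)
  define r where "r n = r1 (r2 n)" for n
  define f where "f x = f1 x - f2 x" for x
  have r: "strict_mono r" using 1(1) 2(1) by (simp add: r_def strict_mono_def)
  have f: "integrable M f" unfolding f_def[abs_def] using 1 2 by simp
  have iA: "integrable M (\<lambda>x. indicator A x * v x)" if "A \<in> sets M" "integrable M v" for A and v :: "'a \<Rightarrow> real"
    using integrable_real_mult_indicator[OF that] by (simp add: mult.commute)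
  have set: "(\<lambda>n. LINT x|M. indicator A x * u (r n) x) \<longlonglongrightarrow> (LINT x|M. indicator A x * f x)" if A: "A \<in> sets M" for A
  proof -
    have "(\<lambda>n. LINT x|M. indicator A x * up (r1 (r2 n)) x) \<longlonglongrightarrow> (LINT x|M. indicator A x * f1 x)"
      using LIMSEQ_subseq_LIMSEQ[OF 1(3)[OF A] 2(1)] by (simp add: o_def)
    from tendsto_diff[OF this 2(3)[OF A]]
    have "(\<lambda>n. (LINT x|M. indicator A x * up (r n) x) - (LINT x|M. indicator A x * um (r n) x)) \<longlonglongrightarrow> 
       (LINT x|M. indicator A x * f1 x) - (LINT x|M. indicator A x * f2 x)" by (simp add: r_def)
    moreover have "(LINT x|M. indicator A x * up n x) - (LINT x|M. indicator A x * um n x) = (LINT x|M. indicator A x * u n x)" for n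
    proof -
      have "integrable M (up n)" "integrable M (um n)" using iu[of n] by (auto simp: up_def[abs_def] um_def[abs_def])
      then have "(LINT x|M. indicator A x * up n x) - (LINT x|M. indicator A x * um n x) = 
          (LINT x|M. indicator A x * up n x - indicator A x * um n x)"
        using iA[OF A] by simp
      also have "\<dots> = (LINT x|M. indicator A x * u n x)"
        by (intro Bochner_Integration.integral_cong refl) (auto simp: up_def um_def indicator_def)
      finally show ?thesis .
    qed
    moreover have "(LINT x|M. indicator A x * f1 x) - (LINT x|M. indicator A x * f2 x) = (LINT x|M. indicator A x * f x)"
      using iA[OF A 1(2)] iA[OF A 2(2)] by (simp add: f_def right_diff_distrib)
    ultimately show ?thesis by simp
  qed
  have L: "(LINT x|M. \<bar>u n x\<bar>) \<le> measure M (space M) + B" for n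
  proof -
    have "\<bar>a\<bar> \<le> 1 + \<bar>a\<bar> powr p" for a :: real
      using powr_mono[of 1 p "\<bar>a\<bar>"] p by (cases "\<bar>a\<bar> \<le> 1") (auto intro: order_trans[of _ 1])
    then have "(LINT x|M. \<bar>u n x\<bar>) \<le> (LINT x|M. 1 + \<bar>u n x\<bar> powr p)"
      using iu[of n] i[of n] by (intro integral_mono) auto
    also have "\<dots> \<le> measure M (space M) + B" using i[of n] B[of n] by simp
    finally show ?thesis .
  qed
  have lim: "(\<lambda>n. LINT x|M. u (r n) x * \<psi> x) \<longlonglongrightarrow> (LINT x|M. f x * \<psi> x)"
    if "\<psi> \<in> borel_measurable M" "\<And>x. \<bar>\<psi> x\<bar> \<le> c" for \<psi> c
    by (rule weak_limit_bounded_test[OF iu L f set that])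
  have fm: "f \<in> borel_measurable M" using f by auto
  note fLp = weak_limit_in_Lp[OF p u i B M(1) fm lim]
  show thesis
    by (rule that[OF r fm fLp(1)]) (assumption | rule weak_limit_Lp_test[OF p u i B fm fLp lim])+
qed

section \<open>Borel representatives\<close>

text \<open>A Borel version extended by zero turns integrals over
  \<open>lebesgue_on \<Omega>\<close> into integrals over \<open>lborel\<close>, where Fubini and
  convolution are applied.\<close>

definition rep_on :: "(real^'d::finite) set \<Rightarrow> (real^'d \<Rightarrow> real) \<Rightarrow> (real^'d \<Rightarrow> real) \<Rightarrow> bool" where
  "rep_on \<Omega> f f' \<longleftrightarrow> f' \<in> borel_measurable borel \<and> (\<forall>x. x \<notin> \<Omega> \<longrightarrow> f' x = 0) \<and> (AE x in lborel. x \<in> \<Omega> \<longrightarrow> f' x = f x)"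

lemma rep_on_exists:
  assumes \<Omega>: "open \<Omega>" and f: "f \<in> borel_measurable (lebesgue_on \<Omega>)"
  shows "\<exists>f'. rep_on \<Omega> f f'"
proof -
  have "(\<lambda>x. indicator \<Omega> x *\<^sub>R f x) \<in> borel_measurable lebesgue"
    using f \<Omega> by (subst (asm) borel_measurable_restrict_space_iff) auto
  then obtain g where g: "g \<in> borel_measurable lborel" "AE x in lborel. indicator \<Omega> x *\<^sub>R f x = g x"
    using completion_ex_borel_measurable_real by blast
  have [measurable]: "\<Omega> \<in> sets borel" "g \<in> borel_measurable borel" using \<Omega> g by auto
  have "rep_on \<Omega> f (\<lambda>x. indicator \<Omega> x * g x)"
    unfolding rep_on_def
  proof (intro conjI)
    show "(\<lambda>x. indicator \<Omega> x * g x) \<in> borel_measurable borel" by measurable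
    show "AE x in lborel. x \<in> \<Omega> \<longrightarrow> indicator \<Omega> x * g x = f x" using g(2) by eventually_elim auto
  qed auto
  then show ?thesis by blast
qed

lemma
  assumes \<Omega>: "open \<Omega>" and h: "rep_on \<Omega> h h'"
  shows rep_on_measurable: "h \<in> borel_measurable (lebesgue_on \<Omega>)"
    and rep_on_integrable: "integrable (lebesgue_on \<Omega>) h \<longleftrightarrow> integrable lborel h'"
    and rep_on_integral: "integral\<^sup>L (lebesgue_on \<Omega>) h = integral\<^sup>L lborel h'"
proof -
  have hm: "h' \<in> borel_measurable borel" using h by (simp add: rep_on_def)
  have hl: "h' \<in> borel_measurable lebesgue" using hm by (simp add: measurable_completion)
  have "\<Omega> \<in> sets lborel" using \<Omega> by simp
  then have [simp]: "\<Omega> \<in> sets lebesgue" by (rule sets_completionI_sets)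
  have "AE x in lborel. indicator \<Omega> x *\<^sub>R h x = h' x"
    using h unfolding rep_on_def by (auto elim!: eventually_mono simp: indicator_def)
  then have ae: "AE x in lebesgue. indicator \<Omega> x *\<^sub>R h x = h' x" by (rule AE_completion)
  have m: "(\<lambda>x. indicator \<Omega> x *\<^sub>R h x) \<in> borel_measurable lebesgue"
    by (rule borel_measurable_AE[OF hl]) (use ae in \<open>auto elim: eventually_mono\<close>)
  show "h \<in> borel_measurable (lebesgue_on \<Omega>)" using m by (subst borel_measurable_restrict_space_iff) (use \<Omega> in \<open>auto simp del: real_scaleR_def\<close>)
  have "integrable (lebesgue_on \<Omega>) h \<longleftrightarrow> integrable lebesgue (\<lambda>x. indicator \<Omega> x *\<^sub>R h x)"
    by (rule integrable_restrict_space) simp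
  also have "\<dots> \<longleftrightarrow> integrable lebesgue h'" by (rule integrable_cong_AE[OF m hl ae])
  also have "\<dots> \<longleftrightarrow> integrable lborel h'" using hm by (simp add: integrable_completion)
  finally show "integrable (lebesgue_on \<Omega>) h \<longleftrightarrow> integrable lborel h'" .
  have "integral\<^sup>L (lebesgue_on \<Omega>) h = integral\<^sup>L lebesgue (\<lambda>x. indicator \<Omega> x *\<^sub>R h x)"
    by (rule integral_restrict_space) simp
  also have "\<dots> = integral\<^sup>L lebesgue h'" by (rule integral_cong_AE[OF m hl ae])
  also have "\<dots> = integral\<^sup>L lborel h'" using hm by (simp add: integral_completion)
  finally show "integral\<^sup>L (lebesgue_on \<Omega>) h = integral\<^sup>L lborel h'" .
qed

lemma rep_on_self: "f \<in> borel_measurable borel \<Longrightarrow> (\<And>x. x \<notin> \<Omega> \<Longrightarrow> f x = 0) \<Longrightarrow> rep_on \<Omega> f f"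
  by (simp add: rep_on_def)

lemma rep_on_map2:
  assumes "rep_on \<Omega> f f'" "rep_on \<Omega> g g'" "(\<lambda>x. F (f' x) (g' x)) \<in> borel_measurable borel" "F 0 0 = 0"
  shows "rep_on \<Omega> (\<lambda>x. F (f x) (g x)) (\<lambda>x. F (f' x) (g' x))"
proof -
  have "AE x in lborel. x \<in> \<Omega> \<longrightarrow> f' x = f x" "AE x in lborel. x \<in> \<Omega> \<longrightarrow> g' x = g x"
    using assms by (simp_all add: rep_on_def)
  then have "AE x in lborel. x \<in> \<Omega> \<longrightarrow> F (f' x) (g' x) = F (f x) (g x)" by eventually_elim simp
  then show ?thesis using assms by (simp add: rep_on_def)
qed

lemma rep_on_borel: "rep_on \<Omega> f f' \<Longrightarrow> f' \<in> borel_measurable borel"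
  by (simp add: rep_on_def)

lemma rep_on_zero: "rep_on \<Omega> f f' \<Longrightarrow> x \<notin> \<Omega> \<Longrightarrow> f' x = 0"
  by (simp add: rep_on_def)

lemma rep_on_add: "rep_on \<Omega> f f' \<Longrightarrow> rep_on \<Omega> g g' \<Longrightarrow> rep_on \<Omega> (\<lambda>x. f x + g x) (\<lambda>x. f' x + g' x)"
  by (rule rep_on_map2) (simp_all add: borel_measurable_add rep_on_borel)

lemma rep_on_diff: "rep_on \<Omega> f f' \<Longrightarrow> rep_on \<Omega> g g' \<Longrightarrow> rep_on \<Omega> (\<lambda>x. f x - g x) (\<lambda>x. f' x - g' x)"
  by (rule rep_on_map2) (simp_all add: borel_measurable_diff rep_on_borel)

lemma rep_on_mult: "rep_on \<Omega> f f' \<Longrightarrow> rep_on \<Omega> g g' \<Longrightarrow> rep_on \<Omega> (\<lambda>x. f x * g x) (\<lambda>x. f' x * g' x)"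
  by (rule rep_on_map2) (simp_all add: borel_measurable_times rep_on_borel)

lemma rep_on_uminus: "rep_on \<Omega> f f' \<Longrightarrow> rep_on \<Omega> (\<lambda>x. - f x) (\<lambda>x. - f' x)"
  by (rule rep_on_map2[of \<Omega> f f' f f' "\<lambda>u v. - u"]) (simp_all add: borel_measurable_uminus rep_on_borel)

lemma rep_on_sum: "(\<And>i. i \<in> I \<Longrightarrow> rep_on \<Omega> (f i) (f' i)) \<Longrightarrow> rep_on \<Omega> (\<lambda>x. \<Sum>i\<in>I. f i x) (\<lambda>x. \<Sum>i\<in>I. f' i x)"
proof (induction I rule: infinite_finite_induct)
  case (insert i I)
  then have "rep_on \<Omega> (f i) (f' i)" "rep_on \<Omega> (\<lambda>x. \<Sum>i\<in>I. f i x) (\<lambda>x. \<Sum>i\<in>I. f' i x)" by auto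
  from rep_on_add[OF this] show ?case using insert by simp
qed (simp_all add: rep_on_def)

lemma rep_on_mult_borel:
  assumes f: "rep_on \<Omega> f f'" and \<phi>: "\<phi> \<in> borel_measurable borel"
  shows "rep_on \<Omega> (\<lambda>x. f x * \<phi> x) (\<lambda>x. f' x * \<phi> x)"
proof -
  have "AE x in lborel. x \<in> \<Omega> \<longrightarrow> f' x = f x" using f by (simp add: rep_on_def)
  then have "AE x in lborel. x \<in> \<Omega> \<longrightarrow> f' x * \<phi> x = f x * \<phi> x" by eventually_elim simp
  then show ?thesis using rep_on_borel[OF f] rep_on_zero[OF f] \<phi> by (simp add: rep_on_def)
qed

lemma rep_on_powr:
  assumes f: "rep_on \<Omega> f f'" shows "rep_on \<Omega> (\<lambda>x. \<bar>f x\<bar> powr r) (\<lambda>x. \<bar>f' x\<bar> powr r)"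
proof -
  have [measurable]: "f' \<in> borel_measurable borel" by (rule rep_on_borel[OF f])
  show ?thesis by (rule rep_on_map2[OF f f, of "\<lambda>u v. \<bar>u\<bar> powr r"]) simp_all
qed

lemma rep_on_continuous:
  fixes c :: "real^'d::finite \<Rightarrow> real"
  assumes "open \<Omega>" "continuous_on \<Omega> c"
  shows "rep_on \<Omega> c (\<lambda>x. indicator \<Omega> x * c x)"
proof -
  have "(\<lambda>x. indicator \<Omega> x *\<^sub>R c x) \<in> borel_measurable borel"
    using assms by (intro borel_measurable_continuous_on_indicator) auto
  then show ?thesis by (auto simp: rep_on_def)
qed

text \<open>Averaging the representatives of h_ij and h_ji makes them equal at every point and not
  merely almost everywhere, so that index symmetry may be used as an equation of functions.\<close>

lemma rep_on_symmetrize: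
  assumes "open \<Omega>" "rep_on \<Omega> f f'" "rep_on \<Omega> g g'" "AE x in lebesgue_on \<Omega>. f x = g x"
  shows "rep_on \<Omega> f (\<lambda>x. (f' x + g' x) / 2)"
proof -
  have "AE x in lborel. x \<in> \<Omega> \<longrightarrow> f x = g x"
    using assms(1,4) by (subst (asm) AE_restrict_space_iff) (auto simp: AE_completion_iff)
  moreover have "AE x in lborel. x \<in> \<Omega> \<longrightarrow> f' x = f x" "AE x in lborel. x \<in> \<Omega> \<longrightarrow> g' x = g x"
    using assms by (auto simp: rep_on_def)
  ultimately have "AE x in lborel. x \<in> \<Omega> \<longrightarrow> (f' x + g' x) / 2 = f x" by eventually_elim auto
  then show ?thesis using assms by (auto simp: rep_on_def)
qed

lemma distr_fun_rep:
  assumes "open \<Omega>" "rep_on \<Omega> f f'" "test_function \<Omega> \<phi>"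
  shows "distr_fun \<Omega> f \<phi> = (LINT x|lborel. f' x * \<phi> x)"
  unfolding distr_fun_def
  by (rule rep_on_integral[OF assms(1) rep_on_mult_borel[OF assms(2) test_function_measurable[OF assms(3)]]])

definition Lp_rep :: "real \<Rightarrow> (real^'d::finite) set \<Rightarrow> (real^'d \<Rightarrow> real) \<Rightarrow> bool" where
  "Lp_rep p \<Omega> u \<longleftrightarrow> u \<in> borel_measurable borel \<and> (\<forall>x. x \<notin> \<Omega> \<longrightarrow> u x = 0) \<and> integrable lborel (\<lambda>x. \<bar>u x\<bar> powr p)"

lemma
  assumes "open \<Omega>" "rep_on \<Omega> f f'"
  shows Lp_rep_of_in_Lp: "in_Lp p \<Omega> f \<Longrightarrow> Lp_rep p \<Omega> f'"
    and in_Lp_of_Lp_rep: "Lp_rep p \<Omega> f' \<Longrightarrow> in_Lp p \<Omega> f"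
  using rep_on_integrable[OF assms(1) rep_on_powr[OF assms(2)], of p] rep_on_measurable[OF assms] rep_on_borel[OF assms(2)] 
    rep_on_zero[OF assms(2)] by (simp_all add: Lp_rep_def in_Lp_def)

lemma
  assumes "open \<Omega>" "bounded \<Omega>" "p > 2" and u: "Lp_rep p \<Omega> u"
  shows Lp_rep_integrable: "integrable lborel u" and Lp_rep_L2: "L2 lborel u"
proof -
  have "u \<in> borel_measurable borel" "\<And>x. x \<notin> \<Omega> \<Longrightarrow> u x = 0" "integrable lborel (\<lambda>x. \<bar>u x\<bar> powr p)"
    using u by (simp_all add: Lp_rep_def)
  note * = Lp_bounded_support[OF assms(1-3) this]
  show "integrable lborel u" by (rule *(2))
  show "L2 lborel u" by (rule *(3))
qed

lemma weakly_conv_rep: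
  assumes \<Omega>: "open \<Omega>" and w: "weakly_conv_Lp p \<Omega> F f" and F: "\<And>n. rep_on \<Omega> (F n) (F' n)" and f: "rep_on \<Omega> f f'"
    and \<psi>: "Lp_rep (p / (p - 1)) \<Omega> \<psi>"
  shows "(\<lambda>n. LINT x|lborel. F' n x * \<psi> x) \<longlonglongrightarrow> (LINT x|lborel. f' x * \<psi> x)"
proof -
  have r: "rep_on \<Omega> \<psi> \<psi>" using \<psi> by (simp add: Lp_rep_def rep_on_def)
  have "in_Lp (p / (p - 1)) \<Omega> \<psi>" by (rule in_Lp_of_Lp_rep[OF \<Omega> r \<psi>])
  then have "(\<lambda>n. LINT x|lebesgue_on \<Omega>. F n x * \<psi> x) \<longlonglongrightarrow> (LINT x|lebesgue_on \<Omega>. f x * \<psi> x)"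
    using w by (simp add: weakly_conv_Lp_def)
  moreover have "(LINT x|lebesgue_on \<Omega>. F n x * \<psi> x) = (LINT x|lborel. F' n x * \<psi> x)" for n
    by (rule rep_on_integral[OF \<Omega> rep_on_mult[OF F r]])
  moreover have "(LINT x|lebesgue_on \<Omega>. f x * \<psi> x) = (LINT x|lborel. f' x * \<psi> x)"
    by (rule rep_on_integral[OF \<Omega> rep_on_mult[OF f r]])
  ultimately show ?thesis by simp
qed

lemma bounded_Lp_rep:
  fixes \<psi> :: "real^'d::finite \<Rightarrow> real"
  assumes \<Omega>: "open \<Omega>" "bounded \<Omega>" and q: "q > 0" and \<psi>: "\<psi> \<in> borel_measurable borel" "\<And>x. x \<notin> \<Omega> \<Longrightarrow> \<psi> x = 0" "\<And>x. \<bar>\<psi> x\<bar> \<le> B"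
  shows "Lp_rep q \<Omega> \<psi>"
proof -
  have [measurable]: "\<psi> \<in> borel_measurable borel" "\<Omega> \<in> sets borel" using \<psi> \<Omega> by auto
  have "integrable lborel (\<lambda>x. \<bar>\<psi> x\<bar> powr q)"
  proof (rule Bochner_Integration.integrable_bound)
    show "integrable lborel (\<lambda>x. B powr q * indicat_real \<Omega> x)"
      using emeasure_bounded_finite[OF \<Omega>(2)] by (intro integrable_mult_right integrable_real_indicator) auto
    show "AE x in lborel. norm (\<bar>\<psi> x\<bar> powr q) \<le> norm (B powr q * indicat_real \<Omega> x)"
    proof (rule AE_I2)
      fix x
      have "\<bar>\<psi> x\<bar> powr q \<le> B powr q" using q \<psi>(3) by (intro powr_mono2) auto
      then show "norm (\<bar>\<psi> x\<bar> powr q) \<le> norm (B powr q * indicat_real \<Omega> x)" using \<psi>(2)[of x] by (cases "x \<in> \<Omega>") auto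
    qed
  qed measurable
  then show ?thesis using \<psi> by (simp add: Lp_rep_def)
qed

text \<open>Tested with the sign of the difference of the two limits.\<close>

lemma weak_limit_unique_AE:
  assumes \<Omega>: "open \<Omega>" "bounded \<Omega>" and p: "p > 2" 
    and u: "weakly_conv_Lp p \<Omega> U u" and v: "weakly_conv_Lp p \<Omega> V v"
    and eq: "\<And>n. AE x in lebesgue_on \<Omega>. U n x = s * V n x"
  shows "AE x in lebesgue_on \<Omega>. u x = s * v x"
proof -
  have meas: "\<And>n. U n \<in> borel_measurable (lebesgue_on \<Omega>)" "\<And>n. V n \<in> borel_measurable (lebesgue_on \<Omega>)" 
    "u \<in> borel_measurable (lebesgue_on \<Omega>)" "v \<in> borel_measurable (lebesgue_on \<Omega>)"
    using u v by (auto simp: weakly_conv_Lp_def in_Lp_def)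
  obtain U' where U': "\<And>n. rep_on \<Omega> (U n) (U' n)" using rep_on_exists[OF \<Omega>(1) meas(1)] by metis
  obtain V' where V': "\<And>n. rep_on \<Omega> (V n) (V' n)" using rep_on_exists[OF \<Omega>(1) meas(2)] by metis
  obtain u' where u': "rep_on \<Omega> u u'" using rep_on_exists[OF \<Omega>(1) meas(3)] by blast
  obtain v' where v': "rep_on \<Omega> v v'" using rep_on_exists[OF \<Omega>(1) meas(4)] by blast
  have Lu: "integrable lborel u'" "integrable lborel v'"
    using u v by (auto simp: weakly_conv_Lp_def intro: Lp_rep_integrable[OF \<Omega> p Lp_rep_of_in_Lp[OF \<Omega>(1) u']] Lp_rep_integrable[OF \<Omega> p Lp_rep_of_in_Lp[OF \<Omega>(1) v']])
  have [measurable]: "u' \<in> borel_measurable borel" "v' \<in> borel_measurable borel" using Lu by auto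
  define \<psi> where "\<psi> x = sgn (u' x - s * v' x)" for x
  have [measurable]: "\<psi> \<in> borel_measurable borel" unfolding \<psi>_def by measurable
  have \<psi>L: "Lp_rep (p / (p - 1)) \<Omega> \<psi>"
  proof (rule bounded_Lp_rep[OF \<Omega>, of _ _ 1])
    show "\<psi> x = 0" if "x \<notin> \<Omega>" for x using u' v' that by (simp add: \<psi>_def rep_on_def)
    show "\<bar>\<psi> x\<bar> \<le> 1" for x by (simp add: \<psi>_def sgn_if)
  qed (use p in auto)
  have "(LINT x|lborel. U' n x * \<psi> x) = s * (LINT x|lborel. V' n x * \<psi> x)" for n
  proof -
    have ae: "AE x in lborel. x \<in> \<Omega> \<longrightarrow> U n x = s * V n x"
      using eq[of n] \<Omega>(1) by (subst (asm) AE_restrict_space_iff) (auto simp: AE_completion_iff)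
    have [measurable]: "U' n \<in> borel_measurable borel" "V' n \<in> borel_measurable borel" using U'[of n] V'[of n] by (auto simp: rep_on_def)
    have "(LINT x|lborel. U' n x * \<psi> x) = (LINT x|lborel. s * (V' n x * \<psi> x))"
    proof (rule integral_cong_AE)
      have "AE x in lborel. x \<in> \<Omega> \<longrightarrow> U' n x = U n x" "AE x in lborel. x \<in> \<Omega> \<longrightarrow> V' n x = V n x"
        using U'[of n] V'[of n] by (auto simp: rep_on_def)
      with ae show "AE x in lborel. U' n x * \<psi> x = s * (V' n x * \<psi> x)"
      proof eventually_elim
        case (elim x)
        then show ?case using U'[of n] V'[of n] by (cases "x \<in> \<Omega>") (auto simp: rep_on_def)
      qed
    qed measurable
    then show ?thesis by simp
  qed
  moreover have "(\<lambda>n. LINT x|lborel. U' n x * \<psi> x) \<longlonglongrightarrow> (LINT x|lborel. u' x * \<psi> x)"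
    by (rule weakly_conv_rep[OF \<Omega>(1) u U' u' \<psi>L])
  moreover have "(\<lambda>n. s * (LINT x|lborel. V' n x * \<psi> x)) \<longlonglongrightarrow> s * (LINT x|lborel. v' x * \<psi> x)"
    by (intro tendsto_mult tendsto_const weakly_conv_rep[OF \<Omega>(1) v V' v' \<psi>L])
  ultimately have "(LINT x|lborel. u' x * \<psi> x) = s * (LINT x|lborel. v' x * \<psi> x)" using LIMSEQ_unique by auto
  moreover have "integrable lborel (\<lambda>x. w x * \<psi> x)" if "integrable lborel w" for w
    using bounded_mult_integrable[OF that, of \<psi> 1] by (simp add: \<psi>_def sgn_if mult.commute)
  ultimately have "(LINT x|lborel. (u' x - s * v' x) * \<psi> x) = 0"
    using Lu by (simp add: left_diff_distrib mult.assoc)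
  moreover have "(u' x - s * v' x) * \<psi> x = \<bar>u' x - s * v' x\<bar>" for x by (simp add: \<psi>_def sgn_if)
  ultimately have "(LINT x|lborel. \<bar>u' x - s * v' x\<bar>) = 0" by simp
  then have "AE x in lborel. \<bar>u' x - s * v' x\<bar> = 0"
    using Lu by (subst (asm) integral_nonneg_eq_0_iff_AE) auto
  moreover have "AE x in lborel. x \<in> \<Omega> \<longrightarrow> u' x = u x" "AE x in lborel. x \<in> \<Omega> \<longrightarrow> v' x = v x"
    using u' v' by (auto simp: rep_on_def)
  ultimately have "AE x in lborel. x \<in> \<Omega> \<longrightarrow> u x = s * v x" by eventually_elim auto
  then show ?thesis using \<Omega>(1) by (subst AE_restrict_space_iff) (auto simp: AE_completion_iff)
qed

section \<open>Coefficients\<close>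

lemma continuous_on_det:
  fixes A :: "'a::topological_space \<Rightarrow> real^'n::finite^'n"
  assumes "\<And>i j. continuous_on S (\<lambda>x. A x $ i $ j)"
  shows "continuous_on S (\<lambda>x. det (A x))"
  unfolding det_def by (intro continuous_intros assms)

lemma metric_det_nz:
  assumes "riemannian_metric_on \<Omega> g" "x \<in> \<Omega>"
  shows "det (g x) \<noteq> 0"
proof
  assume "det (g x) = 0"
  then have "\<not> invertible (g x)" by (simp add: invertible_det_nz)
  then obtain v where "v \<noteq> 0" "g x *v v = 0"
    using invertible_left_inverse[of "g x"] matrix_left_invertible_ker[of "g x"] by blast
  then show False using assms unfolding riemannian_metric_on_def by (metis inner_zero_right less_irrefl)
qed

lemma continuous_on_metric:
  assumes "riemannian_metric_on \<Omega> g"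
  shows "continuous_on \<Omega> (\<lambda>x. g x $ i $ j)" "continuous_on \<Omega> (pd k (\<lambda>x. g x $ i $ j))"
proof -
  have "Ck_on (Suc (Suc 0)) \<Omega> (\<lambda>x. g x $ i $ j)" using assms by (simp add: riemannian_metric_on_def numeral_2_eq_2)
  then show "continuous_on \<Omega> (\<lambda>x. g x $ i $ j)" "continuous_on \<Omega> (pd k (\<lambda>x. g x $ i $ j))"
    by (auto intro: differentiable_imp_continuous_on)
qed

text \<open>Cramer's rule writes every entry of the inverse as a quotient of determinants in the
  entries of the metric, with nonvanishing denominator.\<close>

lemma continuous_on_ginv:
  fixes g :: "real^'d::finite \<Rightarrow> real^'d^'d"
  assumes g: "riemannian_metric_on \<Omega> g"
  shows "continuous_on \<Omega> (ginv g i j)"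
proof -
  have eq: "ginv g i j x = det (\<chi> r s. if s = i then (axis j 1 :: real^'d) $ r else g x $ r $ s) / det (g x)" if "x \<in> \<Omega>" for x
  proof -
    have nz: "det (g x) \<noteq> 0" by (rule metric_det_nz[OF g that])
    then have "invertible (g x)" by (simp add: invertible_det_nz)
    then have "g x ** matrix_inv (g x) = mat 1 \<and> matrix_inv (g x) ** g x = mat 1"
      unfolding matrix_inv_def invertible_def by (rule someI_ex)
    then have "g x ** matrix_inv (g x) = mat 1" by simp
    then have "g x *v (matrix_inv (g x) *v axis j 1) = axis j 1"
      by (simp add: matrix_vector_mul_assoc)
    then have "matrix_inv (g x) *v axis j 1 = (\<chi> k. det (\<chi> r s. if s = k then (axis j 1 :: real^'d) $ r else g x $ r $ s) / det (g x))"
      using cramer[OF nz] by blast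
    then have "(matrix_inv (g x) *v axis j 1) $ i = det (\<chi> r s. if s = i then (axis j 1 :: real^'d) $ r else g x $ r $ s) / det (g x)"
      by simp
    then show ?thesis by (simp add: ginv_def matrix_vector_mult_basis column_def)
  qed
  have "continuous_on \<Omega> (\<lambda>x. det (\<chi> r s. if s = i then (axis j 1 :: real^'d) $ r else g x $ r $ s) / det (g x))"
  proof (intro continuous_on_divide continuous_on_det)
    show "continuous_on \<Omega> (\<lambda>x. (\<chi> r s. if s = i then (axis j 1 :: real^'d) $ r else g x $ r $ s) $ r $ s)" for r s
      using continuous_on_metric(1)[OF g] by (cases "s = i") auto
  qed (use metric_det_nz[OF g] continuous_on_metric(1)[OF g] in auto)
  then show ?thesis by (subst continuous_on_cong[OF refl eq])
qed

lemma continuous_on_christoffel: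
  assumes g: "riemannian_metric_on \<Omega> g"
  shows "continuous_on \<Omega> (christoffel g k i j)"
  unfolding christoffel_def[abs_def] by (intro continuous_intros continuous_on_ginv[OF g] continuous_on_metric(2)[OF g])

text \<open>The coefficient may be unbounded near the boundary of \<open>\<Omega>\<close>, but it is
  bounded on the compact support of \<open>\<phi>\<close>.\<close>

lemma coefficient_bound:
  fixes c :: "real^'d::finite \<Rightarrow> real"
  assumes c: "continuous_on \<Omega> c" and \<phi>: "test_function \<Omega> \<phi>"
  obtains B where "B \<ge> 0" "\<And>x. \<bar>indicator \<Omega> x * c x * \<phi> x\<bar> \<le> B"
proof -
  let ?S = "closure {x. \<phi> x \<noteq> 0}"
  obtain B where B: "B \<ge> 0" "\<And>x. x \<in> ?S \<Longrightarrow> \<bar>c x\<bar> \<le> B"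
    by (rule compact_abs_bound[OF continuous_on_subset[OF c test_function_support(2)[OF \<phi>]] test_function_support(1)[OF \<phi>]]) blast
  obtain b where b: "b \<ge> 0" "\<And>x. \<bar>\<phi> x\<bar> \<le> b" by (rule test_function_bounded[OF \<phi>]) blast
  have "\<bar>indicator \<Omega> x * c x * \<phi> x\<bar> \<le> B * b" for x
  proof (cases "x \<in> ?S")
    case True
    then have "\<bar>c x\<bar> * \<bar>\<phi> x\<bar> \<le> B * b" using B b by (intro mult_mono) auto
    then show ?thesis using B(1) b(1) by (auto simp: indicator_def abs_mult)
  next
    case False
    then have "\<phi> x = 0" by (rule zero_outside_support)
    then show ?thesis using B(1) b(1) by simp
  qed
  then show thesis using that[of "B * b"] B(1) b(1) by simp
qed


section \<open>Bounded families and distributional convergence\<close>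

definition L1_bdd :: "(nat \<Rightarrow> real^'d::finite \<Rightarrow> real) \<Rightarrow> bool" where
  "L1_bdd w \<longleftrightarrow> (\<exists>B. \<forall>n. integrable lborel (w n) \<and> (LINT x|lborel. \<bar>w n x\<bar>) \<le> B)"

text \<open>Local, because the Christoffel symbols and the inverse metric are controlled only on
  compact subsets of \<open>\<Omega>\<close>.\<close>

definition L1_loc_bdd :: "(real^'d::finite) set \<Rightarrow> (nat \<Rightarrow> real^'d \<Rightarrow> real) \<Rightarrow> bool" where
  "L1_loc_bdd \<Omega> w \<longleftrightarrow> (\<forall>C. compact C \<longrightarrow> C \<subseteq> \<Omega> \<longrightarrow> L1_bdd (\<lambda>n x. indicator C x * w n x))"

lemma L1_bddD:
  assumes "L1_bdd w"
  obtains B where "\<And>n. integrable lborel (w n)" "\<And>n. (LINT x|lborel. \<bar>w n x\<bar>) \<le> B"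
  using assms unfolding L1_bdd_def by blast

lemma L1_bddI: "(\<And>n. integrable lborel (w n)) \<Longrightarrow> (\<And>n. (LINT x|lborel. \<bar>w n x\<bar>) \<le> B) \<Longrightarrow> L1_bdd w"
  unfolding L1_bdd_def by blast

lemma L1_bdd_borel: "L1_bdd w \<Longrightarrow> w n \<in> borel_measurable borel"
  using L1_bddD[of w] borel_measurable_integrable[of lborel "w n"] by (metis measurable_lborel2)

lemma L1_bdd_dominated:
  assumes w: "L1_bdd w" and m: "\<And>n. v n \<in> borel_measurable lborel" and le: "\<And>n x. \<bar>v n x\<bar> \<le> B * \<bar>w n x\<bar>"
  shows "L1_bdd v"
proof -
  obtain A where A: "\<And>n. integrable lborel (w n)" "\<And>n. (LINT x|lborel. \<bar>w n x\<bar>) \<le> A" by (rule L1_bddD[OF w]) blast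
  have wa: "integrable lborel (\<lambda>x. B * \<bar>w n x\<bar>)" for n using A(1) by (intro integrable_mult_right integrable_abs)
  have v: "integrable lborel (v n)" for n
  proof (rule Bochner_Integration.integrable_bound[OF wa[of n] m])
    show "AE x in lborel. norm (v n x) \<le> norm (B * \<bar>w n x\<bar>)"
      using le[of n] by (intro AE_I2) (metis abs_ge_self order_trans real_norm_def)
  qed
  have "(LINT x|lborel. \<bar>v n x\<bar>) \<le> \<bar>B\<bar> * A" for n
  proof -
    have "(LINT x|lborel. \<bar>v n x\<bar>) \<le> (LINT x|lborel. B * \<bar>w n x\<bar>)"
      using v wa le by (intro integral_mono integrable_abs) auto
    also have "\<dots> = B * (LINT x|lborel. \<bar>w n x\<bar>)" by simp
    also have "\<dots> \<le> \<bar>B\<bar> * (LINT x|lborel. \<bar>w n x\<bar>)" by (intro mult_right_mono) auto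
    also have "\<dots> \<le> \<bar>B\<bar> * A" using A(2) by (intro mult_left_mono) auto
    finally show ?thesis .
  qed
  with v show ?thesis by (rule L1_bddI)
qed

lemma L1_bdd_add:
  assumes u: "L1_bdd u" and v: "L1_bdd v"
  shows "L1_bdd (\<lambda>n x. u n x + v n x)"
proof -
  obtain A where A: "\<And>n. integrable lborel (u n)" "\<And>n. (LINT x|lborel. \<bar>u n x\<bar>) \<le> A" by (rule L1_bddD[OF u]) blast
  obtain B where B: "\<And>n. integrable lborel (v n)" "\<And>n. (LINT x|lborel. \<bar>v n x\<bar>) \<le> B" by (rule L1_bddD[OF v]) blast
  have "(LINT x|lborel. \<bar>u n x + v n x\<bar>) \<le> A + B" for n
  proof -
    have "(LINT x|lborel. \<bar>u n x + v n x\<bar>) \<le> (LINT x|lborel. \<bar>u n x\<bar> + \<bar>v n x\<bar>)"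
      using A(1)[of n] B(1)[of n] by (intro integral_mono integrable_abs Bochner_Integration.integrable_add) auto
    also have "\<dots> = (LINT x|lborel. \<bar>u n x\<bar>) + (LINT x|lborel. \<bar>v n x\<bar>)"
      using A(1)[of n] B(1)[of n] by (intro Bochner_Integration.integral_add integrable_abs)
    finally show ?thesis using A(2)[of n] B(2)[of n] by linarith
  qed
  with A(1) B(1) show ?thesis by (intro L1_bddI) auto
qed

lemma L1_bdd_uminus: "L1_bdd u \<Longrightarrow> L1_bdd (\<lambda>n x. - u n x)"
  by (simp add: L1_bdd_def)

lemma L1_loc_bdd_add:
  assumes "L1_loc_bdd \<Omega> u" "L1_loc_bdd \<Omega> v" shows "L1_loc_bdd \<Omega> (\<lambda>n x. u n x + v n x)"
  unfolding L1_loc_bdd_def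
proof (intro allI impI)
  fix C assume C: "compact C" "C \<subseteq> \<Omega>"
  have "L1_bdd (\<lambda>n x. indicator C x * u n x + indicator C x * v n x)"
    using assms C by (intro L1_bdd_add) (simp_all add: L1_loc_bdd_def)
  then show "L1_bdd (\<lambda>n x. indicator C x * (u n x + v n x))" by (simp add: distrib_left)
qed

lemma L1_loc_bdd_uminus: "L1_loc_bdd \<Omega> u \<Longrightarrow> L1_loc_bdd \<Omega> (\<lambda>n x. - u n x)"
  by (simp add: L1_loc_bdd_def L1_bdd_def)

lemma L1_loc_bdd_diff: "L1_loc_bdd \<Omega> u \<Longrightarrow> L1_loc_bdd \<Omega> v \<Longrightarrow> L1_loc_bdd \<Omega> (\<lambda>n x. u n x - v n x)"
  using L1_loc_bdd_add[OF _ L1_loc_bdd_uminus, of \<Omega> u v] by simp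

lemma L1_loc_bdd_sum: "(\<And>i. i \<in> I \<Longrightarrow> L1_loc_bdd \<Omega> (u i)) \<Longrightarrow> L1_loc_bdd \<Omega> (\<lambda>n x. \<Sum>i\<in>I. u i n x)"
proof (induction I rule: infinite_finite_induct)
  case (insert i I)
  then have "L1_loc_bdd \<Omega> (u i)" "L1_loc_bdd \<Omega> (\<lambda>n x. \<Sum>i\<in>I. u i n x)" by auto
  from L1_loc_bdd_add[OF this] show ?case using insert by simp
qed (simp_all add: L1_loc_bdd_def L1_bdd_def, blast+)

lemma L1_loc_bdd_coefficient:
  fixes c :: "real^'d::finite \<Rightarrow> real"
  assumes \<Omega>: "open \<Omega>" and c: "continuous_on \<Omega> c" and w: "L1_bdd w"
  shows "L1_loc_bdd \<Omega> (\<lambda>n x. indicator \<Omega> x * c x * w n x)"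
  unfolding L1_loc_bdd_def
proof (intro allI impI)
  fix C assume C: "compact C" "C \<subseteq> \<Omega>"
  obtain B where B: "B \<ge> 0" "\<And>x. x \<in> C \<Longrightarrow> \<bar>c x\<bar> \<le> B" by (rule compact_abs_bound[OF continuous_on_subset[OF c C(2)] C(1)]) blast
  have [measurable]: "C \<in> sets borel" using C by (simp add: compact_imp_closed)
  have cm[measurable]: "(\<lambda>x. indicator \<Omega> x * c x) \<in> borel_measurable borel"
    by (rule rep_on_borel[OF rep_on_continuous[OF \<Omega> c]])
  have wm[measurable]: "w n \<in> borel_measurable borel" for n by (rule L1_bdd_borel[OF w])
  show "L1_bdd (\<lambda>n x. indicator C x * (indicator \<Omega> x * c x * w n x))"
  proof (rule L1_bdd_dominated[OF w, where B=B])
    show "\<bar>indicator C x * (indicator \<Omega> x * c x * w n x)\<bar> \<le> B * \<bar>w n x\<bar>" for n x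
    proof (cases "x \<in> C")
      case True then show ?thesis using B(2)[OF True] C by (auto simp: abs_mult intro!: mult_right_mono)
    qed (use B(1) in simp)
  qed measurable
qed

lemma L1_loc_bdd_L1:
  assumes w: "L1_bdd w"
  shows "L1_loc_bdd \<Omega> w"
  unfolding L1_loc_bdd_def
proof (intro allI impI)
  fix C assume C: "compact C" "C \<subseteq> \<Omega>"
  have [measurable]: "C \<in> sets borel" using C by (simp add: compact_imp_closed)
  have wm[measurable]: "w n \<in> borel_measurable borel" for n by (rule L1_bdd_borel[OF w])
  show "L1_bdd (\<lambda>n x. indicator C x * w n x)"
    by (rule L1_bdd_dominated[OF w, where B=1]) (measurable, simp add: indicator_def)
qed

text \<open>Weak convergence restated for Borel representatives, with the bound on the norms
  included.\<close>

definition weak_Lp :: "real \<Rightarrow> (real^'d::finite) set \<Rightarrow> (nat \<Rightarrow> real^'d \<Rightarrow> real) \<Rightarrow> (real^'d \<Rightarrow> real) \<Rightarrow> bool" where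
  "weak_Lp p \<Omega> U u \<longleftrightarrow> (\<forall>n. Lp_rep p \<Omega> (U n)) \<and> (\<exists>B. \<forall>n. (LINT x|lborel. \<bar>U n x\<bar> powr p) \<le> B) \<and> Lp_rep p \<Omega> u \<and>
    (\<forall>\<psi>. Lp_rep (p / (p - 1)) \<Omega> \<psi> \<longrightarrow> (\<lambda>n. LINT x|lborel. U n x * \<psi> x) \<longlonglongrightarrow> (LINT x|lborel. u x * \<psi> x))"

lemma weak_LpD:
  assumes "weak_Lp p \<Omega> U u"
  shows "Lp_rep p \<Omega> (U n)" "Lp_rep p \<Omega> u" "\<exists>B. \<forall>n. (LINT x|lborel. \<bar>U n x\<bar> powr p) \<le> B"
    "Lp_rep (p / (p - 1)) \<Omega> \<psi> \<Longrightarrow> (\<lambda>n. LINT x|lborel. U n x * \<psi> x) \<longlonglongrightarrow> (LINT x|lborel. u x * \<psi> x)"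
  using assms by (simp_all add: weak_Lp_def)

lemma weak_Lp_L1_bdd:
  assumes \<Omega>: "open \<Omega>" "bounded \<Omega>" and p: "p > 2" and U: "weak_Lp p \<Omega> U u"
  shows "L1_bdd U"
proof -
  obtain B where B: "\<And>n. (LINT x|lborel. \<bar>U n x\<bar> powr p) \<le> B" using weak_LpD(3)[OF U] by blast
  have "integrable lborel (U n) \<and> (LINT x|lborel. \<bar>U n x\<bar>) \<le> measure lborel \<Omega> + B" for n
  proof -
    have *: "U n \<in> borel_measurable borel" "\<And>x. x \<notin> \<Omega> \<Longrightarrow> U n x = 0" "integrable lborel (\<lambda>x. \<bar>U n x\<bar> powr p)"
      using weak_LpD(1)[OF U, of n] by (simp_all add: Lp_rep_def)
    note ** = Lp_bounded_support[OF \<Omega> p *]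
    show ?thesis using **(2) **(4) B[of n] by linarith
  qed
  then show ?thesis unfolding L1_bdd_def by blast
qed

lemma weak_Lp_mult_L1_bdd:
  assumes \<Omega>: "open \<Omega>" "bounded \<Omega>" and p: "p > 2" and U: "weak_Lp p \<Omega> U u" and V: "weak_Lp p \<Omega> V v"
  shows "L1_bdd (\<lambda>n x. U n x * V n x)"
proof -
  have key: "\<exists>B. \<forall>n. L2 lborel (U n) \<and> norm2 lborel (U n) \<le> B" if U: "weak_Lp p \<Omega> U u" for U u
  proof -
    obtain B where B: "\<And>n. (LINT x|lborel. \<bar>U n x\<bar> powr p) \<le> B" using weak_LpD(3)[OF U] by blast
    have "L2 lborel (U n) \<and> norm2 lborel (U n) \<le> sqrt (measure lborel \<Omega> + B)" for n
    proof -
      have *: "U n \<in> borel_measurable borel" "\<And>x. x \<notin> \<Omega> \<Longrightarrow> U n x = 0" "integrable lborel (\<lambda>x. \<bar>U n x\<bar> powr p)"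
        using weak_LpD(1)[OF U, of n] by (simp_all add: Lp_rep_def)
      note ** = Lp_bounded_support[OF \<Omega> p *]
      have "sqrt (measure lborel \<Omega> + (LINT x|lborel. \<bar>U n x\<bar> powr p)) \<le> sqrt (measure lborel \<Omega> + B)"
        using B[of n] by simp
      then show ?thesis using **(3) **(5) by linarith
    qed
    then show ?thesis by blast
  qed
  obtain A where A: "\<And>n. L2 lborel (U n)" "\<And>n. norm2 lborel (U n) \<le> A" using key[OF U] by blast
  obtain B where B: "\<And>n. L2 lborel (V n)" "\<And>n. norm2 lborel (V n) \<le> B" using key[OF V] by blast
  have "(LINT x|lborel. \<bar>U n x * V n x\<bar>) \<le> A * B" for n
  proof -
    have abs: "L2 lborel (\<lambda>x. \<bar>U n x\<bar>)" "L2 lborel (\<lambda>x. \<bar>V n x\<bar>)" using A(1)[of n] B(1)[of n] by (auto simp: L2_def)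
    have "\<bar>LINT x|lborel. \<bar>U n x\<bar> * \<bar>V n x\<bar>\<bar> \<le> norm2 lborel (\<lambda>x. \<bar>U n x\<bar>) * norm2 lborel (\<lambda>x. \<bar>V n x\<bar>)"
      by (rule L2_Cauchy_Schwarz[OF abs])
    also have "\<dots> = norm2 lborel (U n) * norm2 lborel (V n)" by (simp add: norm2_def)
    also have "\<dots> \<le> A * B"
      using A(2)[of n] B(2)[of n] norm2_nonneg[of lborel "U n"] norm2_nonneg[of lborel "V n"] by (intro mult_mono) linarith+
    finally show ?thesis by (simp add: abs_mult abs_le_iff)
  qed
  then show ?thesis using L2_mult_integrable[OF A(1) B(1)] by (intro L1_bddI)
qed

text \<open>Integrability of every pairing is part of the notion, so that sums can be integrated
  term by term.\<close>

definition dist_conv :: "(real^'d::finite) set \<Rightarrow> (nat \<Rightarrow> real^'d \<Rightarrow> real) \<Rightarrow> (real^'d \<Rightarrow> real) \<Rightarrow> bool" where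
  "dist_conv \<Omega> U u \<longleftrightarrow> (\<forall>\<phi>. test_function \<Omega> \<phi> \<longrightarrow> (\<forall>n. integrable lborel (\<lambda>x. U n x * \<phi> x)) \<and> integrable lborel (\<lambda>x. u x * \<phi> x) \<and>
    (\<lambda>n. LINT x|lborel. U n x * \<phi> x) \<longlonglongrightarrow> (LINT x|lborel. u x * \<phi> x))"

lemma dist_convD:
  "dist_conv \<Omega> U u \<Longrightarrow> test_function \<Omega> \<phi> \<Longrightarrow> (\<lambda>n. LINT x|lborel. U n x * \<phi> x) \<longlonglongrightarrow> (LINT x|lborel. u x * \<phi> x)"
  by (simp add: dist_conv_def)

lemma dist_conv_add:
  assumes "dist_conv \<Omega> U u" "dist_conv \<Omega> V v"
  shows "dist_conv \<Omega> (\<lambda>n x. U n x + V n x) (\<lambda>x. u x + v x)"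
  using assms by (simp add: dist_conv_def distrib_right tendsto_add)

lemma dist_conv_uminus: "dist_conv \<Omega> U u \<Longrightarrow> dist_conv \<Omega> (\<lambda>n x. - U n x) (\<lambda>x. - u x)"
  by (simp add: dist_conv_def tendsto_minus)

lemma dist_conv_diff: 
  assumes "dist_conv \<Omega> U u" "dist_conv \<Omega> V v"
  shows "dist_conv \<Omega> (\<lambda>n x. U n x - V n x) (\<lambda>x. u x - v x)"
  using dist_conv_add[OF assms(1) dist_conv_uminus[OF assms(2)]] by simp

lemma dist_conv_sum: 
  "(\<And>i. i \<in> I \<Longrightarrow> dist_conv \<Omega> (U i) (u i)) \<Longrightarrow> dist_conv \<Omega> (\<lambda>n x. \<Sum>i\<in>I. U i n x) (\<lambda>x. \<Sum>i\<in>I. u i x)"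
proof (induction I rule: infinite_finite_induct)
  case (insert i I)
  then have "dist_conv \<Omega> (U i) (u i)" "dist_conv \<Omega> (\<lambda>n x. \<Sum>i\<in>I. U i n x) (\<lambda>x. \<Sum>i\<in>I. u i x)" by auto
  from dist_conv_add[OF this] show ?case using insert by simp
qed (simp_all add: dist_conv_def)

text \<open>With a single weakly convergent factor the coefficient can be absorbed into the test
  function: their product is bounded and vanishes outside \<open>\<Omega>\<close>, hence lies in the
  dual space.\<close>

lemma dist_conv_linear:
  fixes c :: "real^'d::finite \<Rightarrow> real"
  assumes \<Omega>: "open \<Omega>" "bounded \<Omega>" and p: "p > 2" and c: "continuous_on \<Omega> c" and U: "weak_Lp p \<Omega> U u"
  shows "dist_conv \<Omega> (\<lambda>n x. indicator \<Omega> x * c x * U n x) (\<lambda>x. indicator \<Omega> x * c x * u x)"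
  unfolding dist_conv_def
proof (intro allI impI)
  fix \<phi> assume \<phi>: "test_function \<Omega> \<phi>"
  obtain B where B: "\<And>x. \<bar>indicator \<Omega> x * c x * \<phi> x\<bar> \<le> B" by (rule coefficient_bound[OF c \<phi>]) blast
  have [measurable]: "\<phi> \<in> borel_measurable borel" "(\<lambda>x. indicator \<Omega> x * c x) \<in> borel_measurable borel"
    by (rule test_function_measurable[OF \<phi>], rule rep_on_borel[OF rep_on_continuous[OF \<Omega>(1) c]])
  have \<psi>: "(\<lambda>x. indicator \<Omega> x * c x * \<phi> x) \<in> borel_measurable borel" by measurable
  have L: "Lp_rep (p / (p - 1)) \<Omega> (\<lambda>x. indicator \<Omega> x * c x * \<phi> x)"
    by (rule bounded_Lp_rep[OF \<Omega> _ \<psi> _ B]) (use p in auto)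
  have i: "integrable lborel (\<lambda>x. w x * (indicator \<Omega> x * c x * \<phi> x))" if "Lp_rep p \<Omega> w" for w
    using bounded_mult_integrable[OF Lp_rep_integrable[OF \<Omega> p that], OF _ B] \<psi> by (simp add: mult.commute)
  have eq: "indicator \<Omega> x * c x * w * \<phi> x = w * (indicator \<Omega> x * c x * \<phi> x)" for w x by (simp add: mult_ac)
  show "(\<forall>n. integrable lborel (\<lambda>x. indicator \<Omega> x * c x * U n x * \<phi> x)) \<and> integrable lborel (\<lambda>x. indicator \<Omega> x * c x * u x * \<phi> x) \<and>
    (\<lambda>n. LINT x|lborel. indicator \<Omega> x * c x * U n x * \<phi> x) \<longlonglongrightarrow> (LINT x|lborel. indicator \<Omega> x * c x * u x * \<phi> x)"
    unfolding eq using i[OF weak_LpD(1)[OF U]] i[OF weak_LpD(2)[OF U]] weak_LpD(4)[OF U L] by blast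
qed

lemma weak_Lp_dist_conv:
  assumes \<Omega>: "open \<Omega>" "bounded \<Omega>" and p: "p > 2" and U: "weak_Lp p \<Omega> U u"
  shows "dist_conv \<Omega> U u"
proof -
  have eq: "indicator \<Omega> x * 1 * w x = w x" if "Lp_rep p \<Omega> w" for w and x :: "real^'a" using that by (auto simp: indicator_def Lp_rep_def)
  have "dist_conv \<Omega> (\<lambda>n x. indicator \<Omega> x * 1 * U n x) (\<lambda>x. indicator \<Omega> x * 1 * u x)"
    by (rule dist_conv_linear[OF \<Omega> p _ U]) simp
  then show ?thesis unfolding eq[OF weak_LpD(1)[OF U]] eq[OF weak_LpD(2)[OF U]] .
qed

text \<open>By the Stone--Weierstrass theorem the coefficient is uniformly close to a polynomial on the
  support of the test function, and test functions are stable under multiplication by polynomials.\<close>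

lemma dist_conv_coefficient:
  fixes c :: "real^'d::finite \<Rightarrow> real"
  assumes \<Omega>: "open \<Omega>" and c: "continuous_on \<Omega> c" and w: "dist_conv \<Omega> w w0" and b: "L1_bdd w" and w0: "integrable lborel w0"
  shows "dist_conv \<Omega> (\<lambda>n x. indicator \<Omega> x * c x * w n x) (\<lambda>x. indicator \<Omega> x * c x * w0 x)"
  unfolding dist_conv_def
proof (intro allI impI)
  fix \<phi> assume \<phi>: "test_function \<Omega> \<phi>"
  obtain C where C: "\<And>n. integrable lborel (w n)" "\<And>n. (LINT x|lborel. \<bar>w n x\<bar>) \<le> C" by (rule L1_bddD[OF b]) blast
  define A where "A = max C (LINT x|lborel. \<bar>w0 x\<bar>)"
  have A: "(LINT x|lborel. \<bar>w n x\<bar>) \<le> A" "(LINT x|lborel. \<bar>w0 x\<bar>) \<le> A" for n using C(2)[of n] by (simp_all add: A_def)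
  have "0 \<le> (LINT x|lborel. \<bar>w0 x\<bar>)" by simp
  then have A0: "A \<ge> 0" using A(2) by linarith
  obtain D where D: "D \<ge> 0" "\<And>x. \<bar>\<phi> x\<bar> \<le> D" by (rule test_function_bounded[OF \<phi>]) blast
  obtain B where B: "\<And>x. \<bar>indicator \<Omega> x * c x * \<phi> x\<bar> \<le> B" by (rule coefficient_bound[OF c \<phi>]) blast
  have \<phi>m[measurable]: "\<phi> \<in> borel_measurable borel" by (rule test_function_measurable[OF \<phi>])
  have [measurable]: "(\<lambda>x. indicator \<Omega> x * c x) \<in> borel_measurable borel"
    by (rule rep_on_borel[OF rep_on_continuous[OF \<Omega>(1) c]])
  have \<psi>: "(\<lambda>x. indicator \<Omega> x * c x * \<phi> x) \<in> borel_measurable lborel" by measurable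
  have i: "integrable lborel (\<lambda>x. indicator \<Omega> x * c x * \<phi> x * v x)" if "integrable lborel v" for v
    by (rule bounded_mult_integrable[OF that \<psi> B])
  have eq: "indicator \<Omega> x * c x * v * \<phi> x = indicator \<Omega> x * c x * \<phi> x * v" for v x by (simp add: mult_ac)
  let ?S = "closure {x. \<phi> x \<noteq> 0}"
  have S: "compact ?S" "?S \<subseteq> \<Omega>" by (rule test_function_support[OF \<phi>])+
  have lim: "(\<lambda>n. LINT x|lborel. indicator \<Omega> x * c x * \<phi> x * w n x) \<longlonglongrightarrow> (LINT x|lborel. indicator \<Omega> x * c x * \<phi> x * w0 x)"
  proof (rule LIMSEQ_I)
    fix r :: real assume r: "r > 0"
    \<comment> \<open>The approximation error is at most e D A, which is below e (D A + 1) = r /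
      3.\<close>
    define e where "e = r / (3 * (D * A + 1))"
    have "D * A + 1 > 0" using D(1) A0 by (simp add: add_nonneg_pos)
    then have e: "e > 0" and eA: "e * (D * A + 1) = r / 3" using r by (simp_all add: e_def divide_simps)
    obtain P where P: "real_polynomial_function P" "\<And>x. x \<in> ?S \<Longrightarrow> \<bar>c x - P x\<bar> < e"
      using Stone_Weierstrass_real_polynomial_function[OF S(1) continuous_on_subset[OF c S(2)] e] by blast
    have \<phi>P: "test_function \<Omega> (\<lambda>x. \<phi> x * P x)"
      by (rule test_function_mult_smooth[OF \<phi> real_polynomial_function_Ck_on[OF open_UNIV P(1)]])
    have iP: "integrable lborel (\<lambda>x. \<phi> x * P x * v x)" if "integrable lborel v" for v
      by (rule test_function_mult_integrable[OF \<phi>P that])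
    have err: "\<bar>(LINT x|lborel. indicator \<Omega> x * c x * \<phi> x * v x) - (LINT x|lborel. \<phi> x * P x * v x)\<bar> < r / 3"
      if v: "integrable lborel v" "(LINT x|lborel. \<bar>v x\<bar>) \<le> A" for v
    proof -
      have pt: "\<bar>indicator \<Omega> x * c x * \<phi> x * v x - \<phi> x * P x * v x\<bar> \<le> (e * D) * \<bar>v x\<bar>" for x
      proof (cases "x \<in> ?S")
        case True
        then have "indicator \<Omega> x * c x * \<phi> x * v x - \<phi> x * P x * v x = (c x - P x) * \<phi> x * v x"
          using S(2) by (auto simp: algebra_simps)
        moreover have "\<bar>c x - P x\<bar> * \<bar>\<phi> x\<bar> \<le> e * D" using P(2)[OF True] D e by (intro mult_mono) auto
        then have "\<bar>(c x - P x) * \<phi> x * v x\<bar> \<le> (e * D) * \<bar>v x\<bar>" by (simp add: abs_mult mult_right_mono)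
        ultimately show ?thesis by simp
      next
        case False
        then have "\<phi> x = 0" by (rule zero_outside_support)
        then show ?thesis using e D(1) by simp
      qed
      have "(LINT x|lborel. indicator \<Omega> x * c x * \<phi> x * v x) - (LINT x|lborel. \<phi> x * P x * v x) =
          (LINT x|lborel. indicator \<Omega> x * c x * \<phi> x * v x - \<phi> x * P x * v x)"
        by (rule Bochner_Integration.integral_diff[OF i[OF v(1)] iP[OF v(1)], symmetric])
      also have "\<bar>\<dots>\<bar> \<le> (LINT x|lborel. \<bar>indicator \<Omega> x * c x * \<phi> x * v x - \<phi> x * P x * v x\<bar>)" by (rule integral_abs_bound)
      also have "\<dots> \<le> (LINT x|lborel. (e * D) * \<bar>v x\<bar>)"
        using i[OF v(1)] iP[OF v(1)] v(1) pt 
        by (intro integral_mono integrable_abs Bochner_Integration.integrable_diff integrable_mult_right) auto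
      also have "\<dots> = (e * D) * (LINT x|lborel. \<bar>v x\<bar>)" by simp
      also have "\<dots> \<le> (e * D) * A" using v(2) e D(1) by (intro mult_left_mono) auto
      also have "\<dots> < e * (D * A + 1)" using e by (simp add: algebra_simps)
      finally show ?thesis using eA by simp
    qed
    have "(\<lambda>n. LINT x|lborel. w n x * (\<phi> x * P x)) \<longlonglongrightarrow> (LINT x|lborel. w0 x * (\<phi> x * P x))" by (rule dist_convD[OF w \<phi>P])
    then have "\<exists>no. \<forall>n\<ge>no. norm ((LINT x|lborel. w n x * (\<phi> x * P x)) - (LINT x|lborel. w0 x * (\<phi> x * P x))) < r / 3"
      using r by (intro LIMSEQ_D) auto
    then obtain no where no: "\<And>n. n \<ge> no \<Longrightarrow> \<bar>(LINT x|lborel. \<phi> x * P x * w n x) - (LINT x|lborel. \<phi> x * P x * w0 x)\<bar> < r / 3"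
      by (auto simp: mult.commute)
    have "norm ((LINT x|lborel. indicator \<Omega> x * c x * \<phi> x * w n x) - (LINT x|lborel. indicator \<Omega> x * c x * \<phi> x * w0 x)) < r" if "n \<ge> no" for n
      using err[OF C(1) A(1), of n] err[OF w0 A(2)] no[OF that] unfolding real_norm_def abs_less_iff by linarith
    then show "\<exists>no. \<forall>n\<ge>no. norm ((LINT x|lborel. indicator \<Omega> x * c x * \<phi> x * w n x) - (LINT x|lborel. indicator \<Omega> x * c x * \<phi> x * w0 x)) < r" by blast
  qed
  show "(\<forall>n. integrable lborel (\<lambda>x. indicator \<Omega> x * c x * w n x * \<phi> x)) \<and> integrable lborel (\<lambda>x. indicator \<Omega> x * c x * w0 x * \<phi> x) \<and>
    (\<lambda>n. LINT x|lborel. indicator \<Omega> x * c x * w n x * \<phi> x) \<longlonglongrightarrow> (LINT x|lborel. indicator \<Omega> x * c x * w0 x * \<phi> x)"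
    unfolding eq using i[OF C(1)] i[OF w0] lim by blast
qed

lemma admissibleI:
  fixes V :: "nat \<Rightarrow> 'd::finite \<Rightarrow> real^'d \<Rightarrow> real"
  assumes V: "\<And>k. weak_Lp p \<Omega> (\<lambda>n. V n k) (V0 k)" and anti: "\<And>n m k x. F n m k x = - F n k m x"
    and F: "\<And>m k. L1_loc_bdd \<Omega> (\<lambda>n. F n m k)"
    and eq: "\<And>n m k \<phi>. test_function \<Omega> \<phi> \<Longrightarrow> (LINT x|lborel. V n k x * pd m \<phi> x - V n m x * pd k \<phi> x) = (LINT x|lborel. F n m k x * \<phi> x)"
  shows "admissible p \<Omega> V V0 F"
  unfolding admissible_def
proof (intro conjI)
  have L: "Lp_rep p \<Omega> (V n k)" "Lp_rep p \<Omega> (V0 k)" for n k using weak_LpD(1,2)[OF V] by blast+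
  show "\<forall>n k. V n k \<in> borel_measurable borel \<and> (\<forall>x. x \<notin> \<Omega> \<longrightarrow> V n k x = 0)" using L by (simp add: Lp_rep_def)
  show "\<forall>k. V0 k \<in> borel_measurable borel \<and> (\<forall>x. x \<notin> \<Omega> \<longrightarrow> V0 k x = 0) \<and> integrable lborel (\<lambda>x. \<bar>V0 k x\<bar> powr p)"
    using L by (simp add: Lp_rep_def)
  have "\<forall>k. \<exists>B. \<forall>n. (LINT x|lborel. \<bar>V n k x\<bar> powr p) \<le> B" using weak_LpD(3)[OF V] by blast
  then obtain B where B: "\<And>k n. (LINT x|lborel. \<bar>V n k x\<bar> powr p) \<le> B k" by metis
  have nn: "B k \<ge> 0" for k using B[where k=k and n=0] by (rule order_trans[rotated]) simp
  have "(LINT x|lborel. \<bar>V n k x\<bar> powr p) \<le> (\<Sum>k\<in>UNIV. B k)" for n k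
    using B[of n k] member_le_sum[of k UNIV B] nn by force
  then show "\<exists>B. \<forall>n k. integrable lborel (\<lambda>x. \<bar>V n k x\<bar> powr p) \<and> (LINT x|lborel. \<bar>V n k x\<bar> powr p) \<le> B"
    using L by (auto simp: Lp_rep_def)
  show "\<forall>k \<psi>. \<psi> \<in> borel_measurable borel \<longrightarrow> (\<forall>x. x \<notin> \<Omega> \<longrightarrow> \<psi> x = 0) \<longrightarrow> 
       integrable lborel (\<lambda>x. \<bar>\<psi> x\<bar> powr (p / (p - 1))) \<longrightarrow>
       (\<lambda>n. LINT x|lborel. V n k x * \<psi> x) \<longlonglongrightarrow> (LINT x|lborel. V0 k x * \<psi> x)"
    using weak_LpD(4)[OF V] by (simp add: Lp_rep_def)
  show "\<forall>n m k x. F n m k x = - F n k m x" using anti by blast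
  show "\<forall>C. compact C \<longrightarrow> C \<subseteq> \<Omega> \<longrightarrow> (\<exists>B. \<forall>n m k. integrable lborel (\<lambda>x. indicat_real C x * F n m k x) \<and> 
       (LINT x|lborel. \<bar>indicat_real C x * F n m k x\<bar>) \<le> B)"
  proof (intro allI impI)
    fix C assume C: "compact C" "C \<subseteq> \<Omega>"
    have "\<forall>m k. \<exists>B. \<forall>n. integrable lborel (\<lambda>x. indicat_real C x * F n m k x) \<and> (LINT x|lborel. \<bar>indicat_real C x * F n m k x\<bar>) \<le> B"
      using F C by (simp add: L1_loc_bdd_def L1_bdd_def)
    then obtain B where B: "\<And>m k n. integrable lborel (\<lambda>x. indicat_real C x * F n m k x)" 
        "\<And>m k n. (LINT x|lborel. \<bar>indicat_real C x * F n m k x\<bar>) \<le> B m k" by metis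
    have nn: "B m k \<ge> 0" for m k using B(2)[of 0 m k] by (rule order_trans[rotated]) simp
    have "(LINT x|lborel. \<bar>indicat_real C x * F n m k x\<bar>) \<le> (\<Sum>m\<in>UNIV. \<Sum>k\<in>UNIV. B m k)" for n m k
    proof -
      have "B m k \<le> (\<Sum>k\<in>UNIV. B m k)" using nn by (intro member_le_sum) auto
      also have "\<dots> \<le> (\<Sum>m\<in>UNIV. \<Sum>k\<in>UNIV. B m k)" using nn by (intro member_le_sum[where f="\<lambda>m. \<Sum>k\<in>UNIV. B m k"] sum_nonneg) auto
      finally show ?thesis using B(2)[of n m k] by linarith
    qed
    with B(1) show "\<exists>B. \<forall>n m k. integrable lborel (\<lambda>x. indicat_real C x * F n m k x) \<and> 
       (LINT x|lborel. \<bar>indicat_real C x * F n m k x\<bar>) \<le> B" by blast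
  qed
  show "\<forall>n m k \<phi>. test_function \<Omega> \<phi> \<longrightarrow>
       (LINT x|lborel. V n k x * pd m \<phi> x - V n m x * pd k \<phi> x) = (LINT x|lborel. F n m k x * \<phi> x)" using eq by blast
qed


text \<open>Integrability of the limit and the L^1 bound are recorded as well, because
  \<open>dist_conv_coefficient\<close> asks for them when the wedge carries a coefficient.\<close>

lemma wedge_dist_conv:
  fixes V W :: "nat \<Rightarrow> 'd::finite \<Rightarrow> real^'d \<Rightarrow> real"
  assumes \<Omega>: "open \<Omega>" "bounded \<Omega>" and p: "p > 2"
    and V: "admissible p \<Omega> V V0 F" "\<And>k. weak_Lp p \<Omega> (\<lambda>n. V n k) (V0 k)"
    and W: "admissible p \<Omega> W W0 F'" "\<And>k. weak_Lp p \<Omega> (\<lambda>n. W n k) (W0 k)"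
  shows "dist_conv \<Omega> (\<lambda>n x. V n k x * W n l x - V n l x * W n k x) (\<lambda>x. V0 k x * W0 l x - V0 l x * W0 k x)"
    and "integrable lborel (\<lambda>x. V0 k x * W0 l x - V0 l x * W0 k x)"
    and "L1_bdd (\<lambda>n x. V n k x * W n l x - V n l x * W n k x)"
proof -
  note VL = Lp_rep_L2[OF \<Omega> p weak_LpD(1)[OF V(2)]] Lp_rep_L2[OF \<Omega> p weak_LpD(2)[OF V(2)]]
  note WL = Lp_rep_L2[OF \<Omega> p weak_LpD(1)[OF W(2)]] Lp_rep_L2[OF \<Omega> p weak_LpD(2)[OF W(2)]]
  have i: "integrable lborel (\<lambda>x. V n k x * W n l x - V n l x * W n k x)" for n
    by (intro Bochner_Integration.integrable_diff L2_mult_integrable VL WL)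
  show i0: "integrable lborel (\<lambda>x. V0 k x * W0 l x - V0 l x * W0 k x)"
    by (intro Bochner_Integration.integrable_diff L2_mult_integrable VL WL)
  show "dist_conv \<Omega> (\<lambda>n x. V n k x * W n l x - V n l x * W n k x) (\<lambda>x. V0 k x * W0 l x - V0 l x * W0 k x)"
    unfolding dist_conv_def
  proof (intro allI impI)
    fix \<phi> assume \<phi>: "test_function \<Omega> \<phi>"
    note t = test_function_mult_integrable[OF \<phi> i] test_function_mult_integrable[OF \<phi> i0] div_curl[OF \<Omega> p V(1) W(1) \<phi>, of k l]
    show "(\<forall>n. integrable lborel (\<lambda>x. (V n k x * W n l x - V n l x * W n k x) * \<phi> x)) \<and> 
      integrable lborel (\<lambda>x. (V0 k x * W0 l x - V0 l x * W0 k x) * \<phi> x) \<and>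
      (\<lambda>n. LINT x|lborel. (V n k x * W n l x - V n l x * W n k x) * \<phi> x) \<longlonglongrightarrow> (LINT x|lborel. (V0 k x * W0 l x - V0 l x * W0 k x) * \<phi> x)"
      using t by (simp only: mult.commute[of _ "\<phi> _"]) blast
  qed
  have "L1_bdd (\<lambda>n x. V n k x * W n l x + - (V n l x * W n k x))"
    by (intro L1_bdd_add L1_bdd_uminus weak_Lp_mult_L1_bdd[OF \<Omega> p V(2) W(2)])
  then show "L1_bdd (\<lambda>n x. V n k x * W n l x - V n l x * W n k x)" by simp
qed

section \<open>Passage to the limit in the Gauss-Codazzi-Ricci system\<close>

text \<open>The part of the Codazzi equation without derivatives of the unknowns. The Christoffel
  symbols are a parameter, so that the same expression serves for them and for their extension by
  zero.\<close>

definition codazzi_rest ::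
  "('d \<Rightarrow> 'd \<Rightarrow> 'd \<Rightarrow> real^'d::finite \<Rightarrow> real) \<Rightarrow> nat \<Rightarrow> 'd sff \<Rightarrow> 'd nconn \<Rightarrow> nat \<Rightarrow> 'd \<Rightarrow> 'd \<Rightarrow> 'd \<Rightarrow> real^'d \<Rightarrow> real" where
  "codazzi_rest \<Gamma> c h \<kappa> a j k l x =
     (\<Sum>m\<in>UNIV. \<Gamma> m l j x * h a k m x) - (\<Sum>m\<in>UNIV. \<Gamma> m k j x * h a l m x)
     + (\<Sum>b\<in>{1..c}. \<kappa> a k b x * h b l j x) - (\<Sum>b\<in>{1..c}. \<kappa> a l b x * h b k j x)"

definition ricci_rest ::
  "('d \<Rightarrow> 'd \<Rightarrow> real^'d::finite \<Rightarrow> real) \<Rightarrow> nat \<Rightarrow> 'd sff \<Rightarrow> 'd nconn \<Rightarrow> nat \<Rightarrow> nat \<Rightarrow> 'd \<Rightarrow> 'd \<Rightarrow> real^'d \<Rightarrow> real" where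
  "ricci_rest G c h \<kappa> a b k l x =
     - (\<Sum>m\<in>UNIV. \<Sum>n\<in>UNIV. G m n x * (h a m l x * h b k n x - h a m k x * h b l n x))
     + (\<Sum>e\<in>{1..c}. \<kappa> a k e x * \<kappa> e l b x) - (\<Sum>e\<in>{1..c}. \<kappa> a l e x * \<kappa> e k b x)"

text \<open>Regroups the quadratic terms into wedges in \<open>k\<close> and \<open>l\<close>, the
  combinations that are weakly continuous.\<close>

lemma codazzi_rest_wedge:
  "codazzi_rest \<Gamma> c h \<kappa> a j k l x =
     (\<Sum>m\<in>UNIV. \<Gamma> m l j x * h a k m x) - (\<Sum>m\<in>UNIV. \<Gamma> m k j x * h a l m x)
     + (\<Sum>b\<in>{1..c}. \<kappa> a k b x * h b l j x - \<kappa> a l b x * h b k j x)"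
  by (simp add: codazzi_rest_def sum_subtractf)

lemma ricci_rest_wedge:
  "ricci_rest G c h \<kappa> a b k l x =
     - (\<Sum>m\<in>UNIV. \<Sum>n\<in>UNIV. G m n x * (h a m l x * h b k n x - h a m k x * h b l n x))
     + (\<Sum>e\<in>{1..c}. \<kappa> a k e x * \<kappa> e l b x - \<kappa> a l e x * \<kappa> e k b x)"
  by (simp add: ricci_rest_def sum_subtractf)

lemma codazzi_rest_antisym: "codazzi_rest \<Gamma> c h \<kappa> a j k l x = - codazzi_rest \<Gamma> c h \<kappa> a j l k x"
  by (simp add: codazzi_rest_def)

lemma ricci_rest_antisym: "ricci_rest G c h \<kappa> a b k l x = - ricci_rest G c h \<kappa> a b l k x"
proof -
  have "(\<Sum>m\<in>UNIV. \<Sum>n\<in>UNIV. G m n x * (h a m l x * h b k n x - h a m k x * h b l n x)) =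
      - (\<Sum>m\<in>UNIV. \<Sum>n\<in>UNIV. G m n x * (h a m k x * h b l n x - h a m l x * h b k n x))"
    unfolding sum_negf[symmetric] by (simp add: algebra_simps)
  then show ?thesis by (simp add: ricci_rest_def)
qed

text \<open>The situation after passing to representatives: equations integrated by parts, the
  symmetry of h valid at every point, and the metric present only through two families of continuous
  coefficients.\<close>

locale GCR_sequence =
  fixes \<Omega> :: "(real^'d::finite) set" and p :: real and c :: nat
    and \<Gamma> :: "'d \<Rightarrow> 'd \<Rightarrow> 'd \<Rightarrow> real^'d \<Rightarrow> real" and G :: "'d \<Rightarrow> 'd \<Rightarrow> real^'d \<Rightarrow> real"
    and H :: "nat \<Rightarrow> 'd sff" and K :: "nat \<Rightarrow> 'd nconn" and h :: "'d sff" and \<kappa> :: "'d nconn"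
  assumes \<Omega>: "open \<Omega>" "bounded \<Omega>" and p: "p > 2"
    and \<Gamma>: "\<And>m i j. continuous_on \<Omega> (\<Gamma> m i j)" and G: "\<And>m n. continuous_on \<Omega> (G m n)"
    and H: "\<And>a i j. a \<in> {1..c} \<Longrightarrow> weak_Lp p \<Omega> (\<lambda>n. H n a i j) (h a i j)"
    and K: "\<And>a b l. a \<in> {1..c} \<Longrightarrow> b \<in> {1..c} \<Longrightarrow> weak_Lp p \<Omega> (\<lambda>n. K n a l b) (\<kappa> a l b)"
    and H_sym: "\<And>n a i j. a \<in> {1..c} \<Longrightarrow> H n a i j = H n a j i" and h_sym: "\<And>a i j. a \<in> {1..c} \<Longrightarrow> h a i j = h a j i"
    and codazzi: "\<And>n a j k l \<phi>. a \<in> {1..c} \<Longrightarrow> test_function \<Omega> \<phi> \<Longrightarrow> 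
      - (LINT x|lborel. H n a l j x * pd k \<phi> x) + (LINT x|lborel. H n a k j x * pd l \<phi> x) +
      (LINT x|lborel. codazzi_rest (\<lambda>m i j x. indicator \<Omega> x * \<Gamma> m i j x) c (H n) (K n) a j k l x * \<phi> x) = 0"
    and ricci: "\<And>n a b k l \<phi>. a \<in> {1..c} \<Longrightarrow> b \<in> {1..c} \<Longrightarrow> test_function \<Omega> \<phi> \<Longrightarrow> 
      - (LINT x|lborel. K n a l b x * pd k \<phi> x) + (LINT x|lborel. K n a k b x * pd l \<phi> x) +
      (LINT x|lborel. ricci_rest (\<lambda>m n x. indicator \<Omega> x * G m n x) c (H n) (K n) a b k l x * \<phi> x) = 0"
begin

abbreviation "\<Gamma>' \<equiv> \<lambda>m i j x. indicator \<Omega> x * \<Gamma> m i j x"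
abbreviation "G' \<equiv> \<lambda>m n x. indicator \<Omega> x * G m n x"

lemma curl_form:
  assumes U: "weak_Lp p \<Omega> U u" and V: "weak_Lp p \<Omega> V v" and \<phi>: "test_function \<Omega> \<phi>"
    and eq: "- (LINT x|lborel. U n x * pd k \<phi> x) + (LINT x|lborel. V n x * pd l \<phi> x) + I = 0"
  shows "(LINT x|lborel. U n x * pd k \<phi> x - V n x * pd l \<phi> x) = I"
proof -
  have "integrable lborel (\<lambda>x. U n x * pd k \<phi> x)" "integrable lborel (\<lambda>x. V n x * pd l \<phi> x)"
    using weak_Lp_dist_conv[OF \<Omega> p U] weak_Lp_dist_conv[OF \<Omega> p V] test_function_pd[OF \<phi>] by (simp_all add: dist_conv_def)
  then show ?thesis using eq by simp
qed

text \<open>For fixed \<open>a\<close> and \<open>j\<close> the first lower index of h makes it a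
  vector field, and the Codazzi equation identifies the negative of its curl. Products of two fields
  bounded in L^2 give the local L^1 bound.\<close>

lemma sff_admissible:
  assumes a: "a \<in> {1..c}"
  shows "admissible p \<Omega> (\<lambda>n l. H n a l j) (\<lambda>l. h a l j) (\<lambda>n k l. codazzi_rest \<Gamma>' c (H n) (K n) a j k l)"
proof (rule admissibleI)
  show "weak_Lp p \<Omega> (\<lambda>n. H n a k j) (h a k j)" for k by (rule H[OF a])
  show "codazzi_rest \<Gamma>' c (H n) (K n) a j k l x = - codazzi_rest \<Gamma>' c (H n) (K n) a j l k x" for n k l x
    by (rule codazzi_rest_antisym)
  have q: "L1_bdd (\<lambda>n x. K n a k b x * H n b l j x)" if "b \<in> {1..c}" for b k l
    by (rule weak_Lp_mult_L1_bdd[OF \<Omega> p K[OF a that] H[OF that]])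
  have "L1_loc_bdd \<Omega> (\<lambda>n x. codazzi_rest \<Gamma>' c (H n) (K n) a j k l x)" for k l
    unfolding codazzi_rest_def
    by (intro L1_loc_bdd_add L1_loc_bdd_diff L1_loc_bdd_sum L1_loc_bdd_coefficient[OF \<Omega>(1) \<Gamma>] weak_Lp_L1_bdd[OF \<Omega> p H[OF a]]
        L1_loc_bdd_L1 q)
  then show "L1_loc_bdd \<Omega> (\<lambda>n. codazzi_rest \<Gamma>' c (H n) (K n) a j k l)" for k l .
  show "(LINT x|lborel. H n a l j x * pd k \<phi> x - H n a k j x * pd l \<phi> x) = (LINT x|lborel. codazzi_rest \<Gamma>' c (H n) (K n) a j k l x * \<phi> x)"
    if \<phi>: "test_function \<Omega> \<phi>" for n k l \<phi> by (rule curl_form[OF H[OF a] H[OF a] \<phi> codazzi[OF a \<phi>]])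
qed

text \<open>The same reading of the Ricci equation, with \<kappa> for fixed \<open>a\<close> and
  \<open>b\<close> as the vector field.\<close>

lemma nconn_admissible:
  assumes a: "a \<in> {1..c}" and b: "b \<in> {1..c}"
  shows "admissible p \<Omega> (\<lambda>n l. K n a l b) (\<lambda>l. \<kappa> a l b) (\<lambda>n k l. ricci_rest G' c (H n) (K n) a b k l)"
proof (rule admissibleI)
  show "weak_Lp p \<Omega> (\<lambda>n. K n a k b) (\<kappa> a k b)" for k by (rule K[OF a b])
  show "ricci_rest G' c (H n) (K n) a b k l x = - ricci_rest G' c (H n) (K n) a b l k x" for n k l x
    by (rule ricci_rest_antisym)
  have d: "L1_bdd (\<lambda>n x. H n a i j x * H n b k l x - H n a i' j' x * H n b k' l' x)" for i j k l i' j' k' l'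
    using L1_bdd_add[OF weak_Lp_mult_L1_bdd[OF \<Omega> p H[OF a] H[OF b]] L1_bdd_uminus[OF weak_Lp_mult_L1_bdd[OF \<Omega> p H[OF a] H[OF b]]],
        of i j k l i' j' k' l'] by simp
  have q: "L1_bdd (\<lambda>n x. K n a k e x * K n e l b x)" if "e \<in> {1..c}" for e k l
    by (rule weak_Lp_mult_L1_bdd[OF \<Omega> p K[OF a that] K[OF that b]])
  have "L1_loc_bdd \<Omega> (\<lambda>n x. ricci_rest G' c (H n) (K n) a b k l x)" for k l
    unfolding ricci_rest_def
    by (intro L1_loc_bdd_add L1_loc_bdd_diff L1_loc_bdd_uminus L1_loc_bdd_sum L1_loc_bdd_coefficient[OF \<Omega>(1) G] d
        L1_loc_bdd_L1 q)
  then show "L1_loc_bdd \<Omega> (\<lambda>n. ricci_rest G' c (H n) (K n) a b k l)" for k l .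
  show "(LINT x|lborel. K n a l b x * pd k \<phi> x - K n a k b x * pd l \<phi> x) = (LINT x|lborel. ricci_rest G' c (H n) (K n) a b k l x * \<phi> x)"
    if \<phi>: "test_function \<Omega> \<phi>" for n k l \<phi> by (rule curl_form[OF K[OF a b] K[OF a b] \<phi> ricci[OF a b \<phi>]])
qed

lemmas sff_sff_wedge = wedge_dist_conv[OF \<Omega> p sff_admissible H sff_admissible H]
lemmas nconn_sff_wedge = wedge_dist_conv[OF \<Omega> p nconn_admissible K sff_admissible H]
lemmas nconn_nconn_wedge = wedge_dist_conv[OF \<Omega> p nconn_admissible K nconn_admissible K]

text \<open>For each \<open>a\<close> the two products form the wedge, in the indices
  \<open>j\<close> and \<open>k\<close>, of the vector fields given by the columns \<open>i\<close>
  and \<open>l\<close> of h.\<close>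

lemma gauss_conv:
  "dist_conv \<Omega> (\<lambda>n x. (\<Sum>a\<in>{1..c}. H n a j i x * H n a k l x) - (\<Sum>a\<in>{1..c}. H n a k i x * H n a j l x))
     (\<lambda>x. (\<Sum>a\<in>{1..c}. h a j i x * h a k l x) - (\<Sum>a\<in>{1..c}. h a k i x * h a j l x))"
  unfolding sum_subtractf[symmetric] by (intro dist_conv_sum sff_sff_wedge(1))

lemma codazzi_rest_conv:
  assumes a: "a \<in> {1..c}"
  shows "dist_conv \<Omega> (\<lambda>n x. codazzi_rest \<Gamma>' c (H n) (K n) a j k l x) (\<lambda>x. codazzi_rest \<Gamma>' c h \<kappa> a j k l x)"
  unfolding codazzi_rest_wedge
  by (intro dist_conv_add dist_conv_diff[of _ "\<lambda>n x. \<Sum>m\<in>UNIV. _ n x m"] dist_conv_sum dist_conv_linear[OF \<Omega> p \<Gamma> H[OF a]] nconn_sff_wedge(1) a)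

lemma ricci_rest_conv:
  assumes a: "a \<in> {1..c}" and b: "b \<in> {1..c}"
  shows "dist_conv \<Omega> (\<lambda>n x. ricci_rest G' c (H n) (K n) a b k l x) (\<lambda>x. ricci_rest G' c h \<kappa> a b k l x)"
proof -
  have w: "dist_conv \<Omega> (\<lambda>n x. indicator \<Omega> x * G i j x * (H n a i l x * H n b k j x - H n a i k x * H n b l j x))
      (\<lambda>x. indicator \<Omega> x * G i j x * (h a i l x * h b k j x - h a i k x * h b l j x))" for i j
    \<comment> \<open>In the Ricci equation the wedge indices of the first factor stand in its
      second lower slot. Symmetry moves them to the first slot, where the Codazzi equation controls
      the curl.\<close>
    unfolding H_sym[OF a, of _ i l] H_sym[OF a, of _ i k] h_sym[OF a, of i l] h_sym[OF a, of i k]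
    by (rule dist_conv_coefficient[OF \<Omega>(1) G]) (rule sff_sff_wedge[OF a a b b])+
  show ?thesis
    unfolding ricci_rest_wedge by (intro dist_conv_add dist_conv_uminus dist_conv_sum w nconn_nconn_wedge(1) a b)
qed

lemma curl_limit:
  assumes U: "weak_Lp p \<Omega> U u" and V: "weak_Lp p \<Omega> V v" and R: "dist_conv \<Omega> R r" and \<phi>: "test_function \<Omega> \<phi>"
    and eq: "\<And>n. - (LINT x|lborel. U n x * pd k \<phi> x) + (LINT x|lborel. V n x * pd l \<phi> x) + (LINT x|lborel. R n x * \<phi> x) = 0"
  shows "- (LINT x|lborel. u x * pd k \<phi> x) + (LINT x|lborel. v x * pd l \<phi> x) + (LINT x|lborel. r x * \<phi> x) = 0"
proof -
  have "(\<lambda>n. - (LINT x|lborel. U n x * pd k \<phi> x) + (LINT x|lborel. V n x * pd l \<phi> x) + (LINT x|lborel. R n x * \<phi> x)) \<longlonglongrightarrow>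
      - (LINT x|lborel. u x * pd k \<phi> x) + (LINT x|lborel. v x * pd l \<phi> x) + (LINT x|lborel. r x * \<phi> x)"
    by (intro tendsto_add tendsto_minus dist_convD[OF weak_Lp_dist_conv[OF \<Omega> p U]] dist_convD[OF weak_Lp_dist_conv[OF \<Omega> p V]] 
        dist_convD[OF R] test_function_pd \<phi>)
  then show ?thesis unfolding eq by (simp add: LIMSEQ_const_iff)
qed

lemma codazzi_limit:
  assumes "a \<in> {1..c}" "test_function \<Omega> \<phi>"
  shows "- (LINT x|lborel. h a l j x * pd k \<phi> x) + (LINT x|lborel. h a k j x * pd l \<phi> x) +
      (LINT x|lborel. codazzi_rest \<Gamma>' c h \<kappa> a j k l x * \<phi> x) = 0"
  by (rule curl_limit[OF H[OF assms(1)] H[OF assms(1)] codazzi_rest_conv[OF assms(1)] assms(2) codazzi[OF assms]])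

lemma ricci_limit:
  assumes "a \<in> {1..c}" "b \<in> {1..c}" "test_function \<Omega> \<phi>"
  shows "- (LINT x|lborel. \<kappa> a l b x * pd k \<phi> x) + (LINT x|lborel. \<kappa> a k b x * pd l \<phi> x) +
      (LINT x|lborel. ricci_rest G' c h \<kappa> a b k l x * \<phi> x) = 0"
  by (rule curl_limit[OF K[OF assms(1,2)] K[OF assms(1,2)] ricci_rest_conv[OF assms(1,2)] assms(3) ricci[OF assms]])

end


section \<open>Transfer between the distributional system and its Borel representatives\<close>

lemma Lp_norm_integral_bound:
  assumes \<Omega>: "open \<Omega>" and f: "rep_on \<Omega> f f'" and p: "p > 0" and B: "Lp_norm p \<Omega> f \<le> B"
  shows "(LINT x|lborel. \<bar>f' x\<bar> powr p) \<le> (max B 0) powr p"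
proof -
  let ?I = "LINT x|lborel. \<bar>f' x\<bar> powr p"
  have nn: "0 \<le> ?I" by simp
  have "Lp_norm p \<Omega> f = ?I powr (1 / p)"
    by (simp add: Lp_norm_def rep_on_integral[OF \<Omega> rep_on_powr[OF f]])
  then have "?I powr (1 / p) \<le> max B 0" using B by simp
  then have "(?I powr (1 / p)) powr p \<le> (max B 0) powr p" using p by (intro powr_mono2) auto
  then show ?thesis using p nn by (simp add: powr_powr)
qed

lemma weak_Lp_of_weakly_conv:
  assumes \<Omega>: "open \<Omega>" and p: "p > 2" and w: "weakly_conv_Lp p \<Omega> F f" and B: "\<And>n. Lp_norm p \<Omega> (F n) \<le> B"
    and F: "\<And>n. rep_on \<Omega> (F n) (F' n)" and f: "rep_on \<Omega> f f'"
  shows "weak_Lp p \<Omega> F' f'"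
proof -
  have "in_Lp p \<Omega> (F n)" "in_Lp p \<Omega> f" for n using w by (simp_all add: weakly_conv_Lp_def)
  then have "Lp_rep p \<Omega> (F' n)" "Lp_rep p \<Omega> f'" for n using Lp_rep_of_in_Lp[OF \<Omega>] F f by blast+
  moreover have "(LINT x|lborel. \<bar>F' n x\<bar> powr p) \<le> (max B 0) powr p" for n
    using Lp_norm_integral_bound[OF \<Omega> F] p B[of n] by simp
  ultimately show ?thesis using weakly_conv_rep[OF \<Omega> w F f] unfolding weak_Lp_def by blast
qed

lemma in_L2_loc_of_in_Lp:
  assumes \<Omega>: "open \<Omega>" "bounded \<Omega>" and p: "p > 2" and f: "in_Lp p \<Omega> f"
  shows "in_L2_loc \<Omega> f"
proof -
  have fm: "f \<in> borel_measurable (lebesgue_on \<Omega>)" using f by (simp add: in_Lp_def)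
  obtain f' where f': "rep_on \<Omega> f f'" using rep_on_exists[OF \<Omega>(1) fm] by blast
  have L: "Lp_rep p \<Omega> f'" by (rule Lp_rep_of_in_Lp[OF \<Omega>(1) f' f])
  have "integrable lborel (\<lambda>x. \<bar>f' x\<bar> powr 2)"
    by (rule Lp_bounded_support(1)[OF \<Omega> p]) (use L p in \<open>simp_all add: Lp_rep_def\<close>)
  then have "Lp_rep 2 \<Omega> f'" using L by (simp add: Lp_rep_def)
  then have "in_Lp 2 \<Omega> f" by (rule in_Lp_of_Lp_rep[OF \<Omega>(1) f'])
  then have i: "integrable (lebesgue_on \<Omega>) (\<lambda>x. \<bar>f x\<bar> powr 2)" by (simp add: in_Lp_def)
  have sets: "\<Omega> \<in> sets lebesgue" using \<Omega>(1) by (intro sets_completionI_sets) simp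
  have "in_Lp 2 C f" if C: "compact C" "C \<subseteq> \<Omega>" for C
  proof -
    have "C \<in> sets lborel" using C(1) by (simp add: compact_imp_closed)
    then have setsC: "C \<in> sets lebesgue" by (rule sets_completionI_sets)
    have "set_integrable lebesgue \<Omega> (\<lambda>x. \<bar>f x\<bar> powr 2)" 
      using i sets by (simp add: integrable_restrict_space set_integrable_def)
    then have "set_integrable lebesgue C (\<lambda>x. \<bar>f x\<bar> powr 2)" by (rule set_integrable_subset[OF _ setsC C(2)])
    then have "integrable (lebesgue_on C) (\<lambda>x. \<bar>f x\<bar> powr 2)" 
      using setsC by (simp add: integrable_restrict_space set_integrable_def)
    then show ?thesis using measurable_restrict_mono[OF fm C(2)] by (simp add: in_Lp_def)
  qed
  then show ?thesis by (simp add: in_L2_loc_def)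
qed

text \<open>Symmetry of the representative of h is demanded at every point, since the wedges of the
  Ricci equation are formed by exchanging its lower indices.\<close>

definition GCR_rep ::
  "nat \<Rightarrow> (real^'d::finite) set \<Rightarrow> 'd sff \<Rightarrow> 'd nconn \<Rightarrow> 'd sff \<Rightarrow> 'd nconn \<Rightarrow> bool" where
  "GCR_rep c \<Omega> h \<kappa> h' \<kappa>' \<longleftrightarrow> 
     (\<forall>a\<in>{1..c}. \<forall>i j. rep_on \<Omega> (h a i j) (h' a i j) \<and> h' a i j = h' a j i) \<and>
     (\<forall>a\<in>{1..c}. \<forall>b\<in>{1..c}. \<forall>l. rep_on \<Omega> (\<kappa> a l b) (\<kappa>' a l b))"

lemma GCR_repD:
  assumes "GCR_rep c \<Omega> h \<kappa> h' \<kappa>'" "a \<in> {1..c}"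
  shows "rep_on \<Omega> (h a i j) (h' a i j)" "h' a i j = h' a j i" "b \<in> {1..c} \<Longrightarrow> rep_on \<Omega> (\<kappa> a l b) (\<kappa>' a l b)"
  using assms by (simp_all add: GCR_rep_def)

lemma GCR_rep_exists:
  fixes h :: "'d::finite sff"
  assumes \<Omega>: "open \<Omega>" 
    and h: "\<And>a i j. a \<in> {1..c} \<Longrightarrow> h a i j \<in> borel_measurable (lebesgue_on \<Omega>)"
    and \<kappa>: "\<And>a b l. a \<in> {1..c} \<Longrightarrow> b \<in> {1..c} \<Longrightarrow> \<kappa> a l b \<in> borel_measurable (lebesgue_on \<Omega>)"
    and sym: "\<And>a i j. a \<in> {1..c} \<Longrightarrow> AE x in lebesgue_on \<Omega>. h a i j x = h a j i x"
  shows "\<exists>h' \<kappa>'. GCR_rep c \<Omega> h \<kappa> h' \<kappa>'"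
proof -
  have "\<forall>a i j. \<exists>f'. a \<in> {1..c} \<longrightarrow> rep_on \<Omega> (h a i j) f'" using rep_on_exists[OF \<Omega> h] by blast
  then obtain R where R: "\<And>a i j. a \<in> {1..c} \<Longrightarrow> rep_on \<Omega> (h a i j) (R a i j)" by metis
  have "\<forall>a l b. \<exists>f'. a \<in> {1..c} \<longrightarrow> b \<in> {1..c} \<longrightarrow> rep_on \<Omega> (\<kappa> a l b) f'" using rep_on_exists[OF \<Omega> \<kappa>] by blast
  then obtain S where S: "\<And>a l b. a \<in> {1..c} \<Longrightarrow> b \<in> {1..c} \<Longrightarrow> rep_on \<Omega> (\<kappa> a l b) (S a l b)" by metis
  have "rep_on \<Omega> (h a i j) (\<lambda>x. (R a i j x + R a j i x) / 2)" if "a \<in> {1..c}" for a i j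
    by (rule rep_on_symmetrize[OF \<Omega> R[OF that] R[OF that] sym[OF that]])
  then have "GCR_rep c \<Omega> h \<kappa> (\<lambda>a i j x. (R a i j x + R a j i x) / 2) S"
    using S by (simp add: GCR_rep_def add.commute)
  then show ?thesis by blast
qed

lemma distr_pd_rep:
  assumes "open \<Omega>" "rep_on \<Omega> f f'" "test_function \<Omega> \<phi>"
  shows "distr_pd \<Omega> k f \<phi> = - (LINT x|lborel. f' x * pd k \<phi> x)"
  unfolding distr_pd_def by (simp add: distr_fun_rep[OF assms(1,2) test_function_pd[OF assms(3)]])

lemma gauss_eq_rep:
  assumes \<Omega>: "open \<Omega>" and r: "GCR_rep c \<Omega> h \<kappa> h' \<kappa>'"
  shows "gauss_eq c \<Omega> g h \<longleftrightarrow> (\<forall>i j k l \<phi>. test_function \<Omega> \<phi> \<longrightarrow>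
    (LINT x|lborel. ((\<Sum>a\<in>{1..c}. h' a j i x * h' a k l x) - (\<Sum>a\<in>{1..c}. h' a k i x * h' a j l x)) * \<phi> x)
     = distr_fun \<Omega> (riemann g i j k l) \<phi>)"
proof -
  have rep: "rep_on \<Omega> (\<lambda>x. (\<Sum>a\<in>{1..c}. h a j i x * h a k l x) - (\<Sum>a\<in>{1..c}. h a k i x * h a j l x)) 
      (\<lambda>x. (\<Sum>a\<in>{1..c}. h' a j i x * h' a k l x) - (\<Sum>a\<in>{1..c}. h' a k i x * h' a j l x))" for i j k l
    by (intro rep_on_diff rep_on_sum rep_on_mult GCR_repD(1)[OF r])
  have "distr_fun \<Omega> (\<lambda>x. (\<Sum>a\<in>{1..c}. h a j i x * h a k l x) - (\<Sum>a\<in>{1..c}. h a k i x * h a j l x)) \<phi> =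
      (LINT x|lborel. ((\<Sum>a\<in>{1..c}. h' a j i x * h' a k l x) - (\<Sum>a\<in>{1..c}. h' a k i x * h' a j l x)) * \<phi> x)"
    if "test_function \<Omega> \<phi>" for i j k l \<phi> by (rule distr_fun_rep[OF \<Omega> rep that])
  then show ?thesis unfolding gauss_eq_def by (simp cong: imp_cong)
qed

lemma codazzi_eq_rep:
  assumes \<Omega>: "open \<Omega>" and g: "riemannian_metric_on \<Omega> g" and r: "GCR_rep c \<Omega> h \<kappa> h' \<kappa>'"
  shows "codazzi_eq c \<Omega> g h \<kappa> \<longleftrightarrow> (\<forall>a\<in>{1..c}. \<forall>j k l \<phi>. test_function \<Omega> \<phi> \<longrightarrow>
    - (LINT x|lborel. h' a l j x * pd k \<phi> x) + (LINT x|lborel. h' a k j x * pd l \<phi> x) +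
      (LINT x|lborel. codazzi_rest (\<lambda>m i j x. indicator \<Omega> x * christoffel g m i j x) c h' \<kappa>' a j k l x * \<phi> x) = 0)"
proof -
  have rep: "rep_on \<Omega> (\<lambda>x. codazzi_rest (christoffel g) c h \<kappa> a j k l x) 
      (\<lambda>x. codazzi_rest (\<lambda>m i j x. indicator \<Omega> x * christoffel g m i j x) c h' \<kappa>' a j k l x)" if a: "a \<in> {1..c}" for a j k l
    unfolding codazzi_rest_def
    by (intro rep_on_add rep_on_diff rep_on_sum rep_on_mult rep_on_continuous[OF \<Omega> continuous_on_christoffel[OF g]] 
        GCR_repD(1,3)[OF r] a)
  have "distr_pd \<Omega> k (h a l j) \<phi> - distr_pd \<Omega> l (h a k j) \<phi> + distr_fun \<Omega> (\<lambda>x. codazzi_rest (christoffel g) c h \<kappa> a j k l x) \<phi> =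
      - (LINT x|lborel. h' a l j x * pd k \<phi> x) + (LINT x|lborel. h' a k j x * pd l \<phi> x) +
      (LINT x|lborel. codazzi_rest (\<lambda>m i j x. indicator \<Omega> x * christoffel g m i j x) c h' \<kappa>' a j k l x * \<phi> x)"
    if a: "a \<in> {1..c}" and \<phi>: "test_function \<Omega> \<phi>" for a j k l \<phi>
    by (simp add: distr_pd_rep[OF \<Omega> GCR_repD(1)[OF r a] \<phi>] distr_fun_rep[OF \<Omega> rep[OF a] \<phi>])
  then show ?thesis unfolding codazzi_eq_def codazzi_rest_def[of "christoffel g", symmetric] by (simp cong: imp_cong)
qed

lemma ricci_eq_rep:
  assumes \<Omega>: "open \<Omega>" and g: "riemannian_metric_on \<Omega> g" and r: "GCR_rep c \<Omega> h \<kappa> h' \<kappa>'"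
  shows "ricci_eq c \<Omega> g h \<kappa> \<longleftrightarrow> (\<forall>a\<in>{1..c}. \<forall>b\<in>{1..c}. \<forall>k l \<phi>. test_function \<Omega> \<phi> \<longrightarrow>
    - (LINT x|lborel. \<kappa>' a l b x * pd k \<phi> x) + (LINT x|lborel. \<kappa>' a k b x * pd l \<phi> x) +
      (LINT x|lborel. ricci_rest (\<lambda>m n x. indicator \<Omega> x * ginv g m n x) c h' \<kappa>' a b k l x * \<phi> x) = 0)"
proof -
  have rep: "rep_on \<Omega> (\<lambda>x. ricci_rest (ginv g) c h \<kappa> a b k l x) 
      (\<lambda>x. ricci_rest (\<lambda>m n x. indicator \<Omega> x * ginv g m n x) c h' \<kappa>' a b k l x)" if a: "a \<in> {1..c}" "b \<in> {1..c}" for a b k l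
    unfolding ricci_rest_def
    by (intro rep_on_add rep_on_diff rep_on_uminus rep_on_sum rep_on_mult rep_on_continuous[OF \<Omega> continuous_on_ginv[OF g]] 
        GCR_repD(1,3)[OF r] a)
  have "distr_pd \<Omega> k (\<kappa> a l b) \<phi> - distr_pd \<Omega> l (\<kappa> a k b) \<phi> + distr_fun \<Omega> (\<lambda>x. ricci_rest (ginv g) c h \<kappa> a b k l x) \<phi> =
      - (LINT x|lborel. \<kappa>' a l b x * pd k \<phi> x) + (LINT x|lborel. \<kappa>' a k b x * pd l \<phi> x) +
      (LINT x|lborel. ricci_rest (\<lambda>m n x. indicator \<Omega> x * ginv g m n x) c h' \<kappa>' a b k l x * \<phi> x)"
    if a: "a \<in> {1..c}" "b \<in> {1..c}" and \<phi>: "test_function \<Omega> \<phi>" for a b k l \<phi>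
    by (simp add: distr_pd_rep[OF \<Omega> GCR_repD(3)[OF r a] \<phi>] distr_fun_rep[OF \<Omega> rep[OF a] \<phi>])
  then show ?thesis unfolding ricci_eq_def ricci_rest_def[of "ginv g", symmetric] by (simp cong: imp_cong)
qed

lemma GCR_weak_limit:
  fixes \<Omega> :: "(real^'d::finite) set"
  assumes \<Omega>: "open \<Omega>" "bounded \<Omega>" and g: "riemannian_metric_on \<Omega> g" and p: "p > 2"
    and sol: "\<And>n. GCR_solution c \<Omega> g (H n) (K n)" and bdd: "bounded_fields_Lp p c \<Omega> H K"
    and lim: "weak_limit_fields_Lp p c \<Omega> H K h \<kappa>"
  shows "GCR_solution c \<Omega> g h \<kappa>"
proof -
  have cH: "weakly_conv_Lp p \<Omega> (\<lambda>n. H n a i j) (h a i j)" if "a \<in> {1..c}" for a i j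
    using lim that by (simp add: weak_limit_fields_Lp_def)
  have cK: "weakly_conv_Lp p \<Omega> (\<lambda>n. K n a l b) (\<kappa> a l b)" if "a \<in> {1..c}" "b \<in> {1..c}" for a b l
    using lim that by (simp add: weak_limit_fields_Lp_def)
  have LH: "in_Lp p \<Omega> (H n a i j)" "in_Lp p \<Omega> (h a i j)" if "a \<in> {1..c}" for n a i j
    using cH[OF that] by (simp_all add: weakly_conv_Lp_def)
  have LK: "in_Lp p \<Omega> (K n a l b)" "in_Lp p \<Omega> (\<kappa> a l b)" if "a \<in> {1..c}" "b \<in> {1..c}" for n a b l
    using cK[OF that] by (simp_all add: weakly_conv_Lp_def)
  obtain B where B: "\<And>n a i j. a \<in> {1..c} \<Longrightarrow> Lp_norm p \<Omega> (H n a i j) \<le> B"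
      "\<And>n a b l. a \<in> {1..c} \<Longrightarrow> b \<in> {1..c} \<Longrightarrow> Lp_norm p \<Omega> (K n a l b) \<le> B"
    using bdd unfolding bounded_fields_Lp_def by blast
  have symH: "AE x in lebesgue_on \<Omega>. H n a i j x = H n a j i x" if "a \<in> {1..c}" for n a i j
    using sol[of n] that by (simp add: GCR_solution_def)
  have skewK: "AE x in lebesgue_on \<Omega>. K n a k b x = - K n b k a x" if "a \<in> {1..c}" "b \<in> {1..c}" for n a b k
    using sol[of n] that by (simp add: GCR_solution_def)
  \<comment> \<open>Both algebraic symmetries pass to the limit by uniqueness of weak limits, with
    the factor 1 for h and -1 for \<kappa>.\<close>
  have symh: "AE x in lebesgue_on \<Omega>. h a i j x = h a j i x" if a: "a \<in> {1..c}" for a i j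
    using weak_limit_unique_AE[OF \<Omega> p cH[OF a, of i j] cH[OF a, of j i], of 1] symH[OF a, of _ i j] by simp
  have skew\<kappa>: "AE x in lebesgue_on \<Omega>. \<kappa> a k b x = - \<kappa> b k a x" if a: "a \<in> {1..c}" and b: "b \<in> {1..c}" for a b k
    using weak_limit_unique_AE[OF \<Omega> p cK[OF a b, of k] cK[OF b a, of k], of "-1"] skewK[OF a b, of _ k] by simp
  have "\<exists>h' \<kappa>'. GCR_rep c \<Omega> (H n) (K n) h' \<kappa>'" for n
    by (rule GCR_rep_exists[OF \<Omega>(1) _ _ symH]) (use LH LK in \<open>simp_all add: in_Lp_def\<close>)
  then obtain H' K' where rn: "\<And>n. GCR_rep c \<Omega> (H n) (K n) (H' n) (K' n)" by metis
  have "\<exists>h' \<kappa>'. GCR_rep c \<Omega> h \<kappa> h' \<kappa>'"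
    by (rule GCR_rep_exists[OF \<Omega>(1) _ _ symh]) (use LH LK in \<open>simp_all add: in_Lp_def\<close>)
  then obtain h' \<kappa>' where r: "GCR_rep c \<Omega> h \<kappa> h' \<kappa>'" by blast
  have gauss: "gauss_eq c \<Omega> g (H n)" and codazzi: "codazzi_eq c \<Omega> g (H n) (K n)" and ricci: "ricci_eq c \<Omega> g (H n) (K n)" for n
    using sol[of n] by (simp_all add: GCR_solution_def)
  note gauss' = gauss[unfolded gauss_eq_rep[OF \<Omega>(1) rn], rule_format]
  note codazzi' = codazzi[unfolded codazzi_eq_rep[OF \<Omega>(1) g rn], rule_format]
  note ricci' = ricci[unfolded ricci_eq_rep[OF \<Omega>(1) g rn], rule_format]
  interpret GCR_sequence \<Omega> p c "christoffel g" "ginv g" H' K' h' \<kappa>'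
  proof
    show "weak_Lp p \<Omega> (\<lambda>n. H' n a i j) (h' a i j)" if a: "a \<in> {1..c}" for a i j
      by (rule weak_Lp_of_weakly_conv[OF \<Omega>(1) p cH[OF a] B(1)[OF a] GCR_repD(1)[OF rn a] GCR_repD(1)[OF r a]])
    show "weak_Lp p \<Omega> (\<lambda>n. K' n a l b) (\<kappa>' a l b)" if a: "a \<in> {1..c}" "b \<in> {1..c}" for a b l
      by (rule weak_Lp_of_weakly_conv[OF \<Omega>(1) p cK[OF a] B(2)[OF a] GCR_repD(3)[OF rn a] GCR_repD(3)[OF r a]])
    show "H' n a i j = H' n a j i" if a: "a \<in> {1..c}" for n a i j by (rule GCR_repD(2)[OF rn a])
    show "h' a i j = h' a j i" if a: "a \<in> {1..c}" for a i j by (rule GCR_repD(2)[OF r a])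
  qed (fact \<Omega> p continuous_on_christoffel[OF g] continuous_on_ginv[OF g] codazzi' ricci')+
  have "gauss_eq c \<Omega> g h"
    unfolding gauss_eq_rep[OF \<Omega>(1) r]
  proof (intro allI impI)
    fix i j k l \<phi> assume \<phi>: "test_function \<Omega> \<phi>"
    show "(LINT x|lborel. ((\<Sum>a\<in>{1..c}. h' a j i x * h' a k l x) - (\<Sum>a\<in>{1..c}. h' a k i x * h' a j l x)) * \<phi> x)
        = distr_fun \<Omega> (riemann g i j k l) \<phi>"
      \<comment> \<open>The curvature side is the same number for every member of the sequence, so a
        constant sequence converges to the pairing of the limit.\<close>
      using dist_convD[OF gauss_conv \<phi>, of j i k l] unfolding gauss'[OF \<phi>] by (simp add: LIMSEQ_const_iff)
  qed
  moreover have "codazzi_eq c \<Omega> g h \<kappa>"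
    unfolding codazzi_eq_rep[OF \<Omega>(1) g r] using codazzi_limit by blast
  moreover have "ricci_eq c \<Omega> g h \<kappa>"
    unfolding ricci_eq_rep[OF \<Omega>(1) g r] using ricci_limit by blast
  ultimately show ?thesis
    using in_L2_loc_of_in_Lp[OF \<Omega> p LH(2)] in_L2_loc_of_in_Lp[OF \<Omega> p LK(2)] symh skew\<kappa> by (simp add: GCR_solution_def)
qed

section \<open>Existence of weakly convergent subsequences\<close>

lemma weakly_conv_subsequence:
  fixes F :: "nat \<Rightarrow> real^'d::finite \<Rightarrow> real"
  assumes \<Omega>: "open \<Omega>" "bounded \<Omega>" and p: "p > 2" and F: "\<And>n. in_Lp p \<Omega> (F n)" and B: "\<And>n. Lp_norm p \<Omega> (F n) \<le> B"
  shows "\<exists>r f. strict_mono r \<and> weakly_conv_Lp p \<Omega> (\<lambda>n. F (r n)) f"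
proof -
  have [measurable]: "\<Omega> \<in> sets borel" using \<Omega> by simp
  have "F n \<in> borel_measurable (lebesgue_on \<Omega>)" for n using F by (simp add: in_Lp_def)
  then have "\<exists>f'. rep_on \<Omega> (F n) f'" for n by (rule rep_on_exists[OF \<Omega>(1)])
  then obtain F' where F': "\<And>n. rep_on \<Omega> (F n) (F' n)" by metis
  have L: "Lp_rep p \<Omega> (F' n)" for n by (rule Lp_rep_of_in_Lp[OF \<Omega>(1) F' F])
  have F'm[measurable]: "F' n \<in> borel_measurable borel" and F'z: "x \<notin> \<Omega> \<Longrightarrow> F' n x = 0" for n x
    using L[of n] by (simp_all add: Lp_rep_def)
  \<comment> \<open>Lebesgue measure restricted to \<open>\<Omega>\<close>, but realised as a
    density on the whole space so that its sets remain the Borel sets, as the compactness theorem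
    requires.\<close>
  define M where "M = density lborel (\<lambda>x. ennreal (indicat_real \<Omega> x))"
  have M: "finite_measure M" "sets M = sets borel"
  proof -
    have "emeasure M (space M) = emeasure lborel \<Omega>"
      by (simp add: M_def emeasure_density ennreal_indicator)
    then show "finite_measure M" using emeasure_bounded_finite[OF \<Omega>(2)] by (intro finite_measureI) auto
  qed (simp add: M_def)
  have iM: "integrable M f \<longleftrightarrow> integrable lborel (\<lambda>x. indicator \<Omega> x * f x)" "integral\<^sup>L M f = (LINT x|lborel. indicator \<Omega> x * f x)"
    if "f \<in> borel_measurable borel" for f :: "real^'d \<Rightarrow> real"
    using that unfolding M_def by (simp_all add: integrable_real_density integral_real_density)
  have ind: "indicator \<Omega> x * (\<bar>F' n x\<bar> powr p) = \<bar>F' n x\<bar> powr p" "indicator \<Omega> x * (F' n x * t) = F' n x * t" for n x t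
    using F'z by (auto simp: indicator_def)
  have FM: "F' n \<in> borel_measurable M" for n using F'm M(2) by (simp cong: measurable_cong_sets)
  have FI: "integrable M (\<lambda>x. \<bar>F' n x\<bar> powr p)" for n
    using L[of n] by (simp add: iM(1) ind Lp_rep_def)
  have FB: "(LINT x|M. \<bar>F' n x\<bar> powr p) \<le> (max B 0) powr p" for n
    using Lp_norm_integral_bound[OF \<Omega>(1) F' _ B] p by (simp add: iM(2) ind)
  have "p > 1" using p by simp
  then obtain r f where r: "strict_mono r" and f: "f \<in> borel_measurable M" "integrable M (\<lambda>x. \<bar>f x\<bar> powr p)"
    and lim: "\<And>\<psi>. \<psi> \<in> borel_measurable M \<Longrightarrow> integrable M (\<lambda>x. \<bar>\<psi> x\<bar> powr (p / (p - 1))) \<Longrightarrow> 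
       (\<lambda>n. LINT x|M. F' (r n) x * \<psi> x) \<longlonglongrightarrow> (LINT x|M. f x * \<psi> x)"
    by (rule Lp_weakly_sequentially_compact[where u=F', OF M _ FM FI FB]) blast
  have [measurable]: "f \<in> borel_measurable borel" using f(1) M(2) by (simp cong: measurable_cong_sets)
  define f0 where "f0 x = indicator \<Omega> x * f x" for x
  have f0m: "f0 \<in> borel_measurable borel" unfolding f0_def by measurable
  have "(\<lambda>x. indicator \<Omega> x * \<bar>f x\<bar> powr p) = (\<lambda>x. \<bar>f0 x\<bar> powr p)" by (auto simp: f0_def indicator_def)
  then have L0: "Lp_rep p \<Omega> f0" using f(2) f0m by (simp add: iM(1) Lp_rep_def f0_def)
  have rep0: "rep_on \<Omega> f0 f0" using f0m by (intro rep_on_self) (simp_all add: f0_def)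
  have "weakly_conv_Lp p \<Omega> (\<lambda>n. F (r n)) f0"
    unfolding weakly_conv_Lp_def
  proof (intro conjI allI impI)
    show "in_Lp p \<Omega> (F (r n))" for n by (rule F)
    show "in_Lp p \<Omega> f0" by (rule in_Lp_of_Lp_rep[OF \<Omega>(1) rep0 L0])
    fix \<psi> assume \<psi>: "in_Lp (p / (p - 1)) \<Omega> \<psi>"
    then have "\<psi> \<in> borel_measurable (lebesgue_on \<Omega>)" by (simp add: in_Lp_def)
    then obtain \<psi>' where \<psi>': "rep_on \<Omega> \<psi> \<psi>'" using rep_on_exists[OF \<Omega>(1)] by blast
    have L\<psi>: "Lp_rep (p / (p - 1)) \<Omega> \<psi>'" by (rule Lp_rep_of_in_Lp[OF \<Omega>(1) \<psi>' \<psi>])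
    have \<psi>'m[measurable]: "\<psi>' \<in> borel_measurable borel" by (rule rep_on_borel[OF \<psi>'])
    have "(\<lambda>x. indicator \<Omega> x * \<bar>\<psi>' x\<bar> powr (p / (p - 1))) = (\<lambda>x. \<bar>\<psi>' x\<bar> powr (p / (p - 1)))"
      using rep_on_zero[OF \<psi>'] by (auto simp: indicator_def fun_eq_iff)
    then have "integrable M (\<lambda>x. \<bar>\<psi>' x\<bar> powr (p / (p - 1)))" using L\<psi> by (simp add: iM(1) Lp_rep_def)
    moreover have "\<psi>' \<in> borel_measurable M" using \<psi>'m M(2) by (simp cong: measurable_cong_sets)
    ultimately have "(\<lambda>n. LINT x|M. F' (r n) x * \<psi>' x) \<longlonglongrightarrow> (LINT x|M. f x * \<psi>' x)" by (intro lim)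
    moreover have "(LINT x|M. F' (r n) x * \<psi>' x) = (LINT x|lebesgue_on \<Omega>. F (r n) x * \<psi> x)" for n
      using rep_on_integral[OF \<Omega>(1) rep_on_mult[OF F' \<psi>'], of "r n"] by (simp add: iM(2) ind)
    moreover have "(LINT x|M. f x * \<psi>' x) = (LINT x|lebesgue_on \<Omega>. f0 x * \<psi> x)"
      using rep_on_integral[OF \<Omega>(1) rep_on_mult[OF rep0 \<psi>']] by (simp add: iM(2) f0_def mult.assoc)
    ultimately show "(\<lambda>n. LINT x|lebesgue_on \<Omega>. F (r n) x * \<psi> x) \<longlonglongrightarrow> (LINT x|lebesgue_on \<Omega>. f0 x * \<psi> x)" by simp
  qed
  with r show ?thesis by blast
qed

lemma weakly_conv_Lp_subsequence:
  assumes "weakly_conv_Lp p \<Omega> F f" "strict_mono r"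
  shows "weakly_conv_Lp p \<Omega> (\<lambda>n. F (r n)) f"
  using assms LIMSEQ_subseq_LIMSEQ[OF _ assms(2)] by (fastforce simp: weakly_conv_Lp_def o_def)

text \<open>Finitely many components allow successive extraction; convergence obtained earlier
  survives in later subsequences.\<close>

lemma weakly_conv_subsequence_family:
  fixes U :: "'s \<Rightarrow> nat \<Rightarrow> real^'d::finite \<Rightarrow> real"
  assumes \<Omega>: "open \<Omega>" "bounded \<Omega>" and p: "p > 2" and S: "finite S"
    and U: "\<And>s n. s \<in> S \<Longrightarrow> in_Lp p \<Omega> (U s n)" "\<And>s n. s \<in> S \<Longrightarrow> Lp_norm p \<Omega> (U s n) \<le> B"
  shows "\<exists>r u. strict_mono r \<and> (\<forall>s\<in>S. weakly_conv_Lp p \<Omega> (\<lambda>n. U s (r n)) (u s))"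
  using S U
proof (induction S)
  case empty
  then show ?case using strict_mono_id by blast
next
  case (insert s S)
  have "\<exists>r u. strict_mono r \<and> (\<forall>t\<in>S. weakly_conv_Lp p \<Omega> (\<lambda>n. U t (r n)) (u t))"
    by (rule insert.IH) (use insert.prems in simp_all)
  then obtain r u where r: "strict_mono r" and u: "\<And>t. t \<in> S \<Longrightarrow> weakly_conv_Lp p \<Omega> (\<lambda>n. U t (r n)) (u t)" by blast
  have "\<exists>r' f. strict_mono r' \<and> weakly_conv_Lp p \<Omega> (\<lambda>n. U s (r (r' n))) f"
    by (rule weakly_conv_subsequence[OF \<Omega> p, where F="\<lambda>n. U s (r n)" and B=B]) (use insert.prems in simp_all)
  then obtain r' f where r': "strict_mono r'" and f: "weakly_conv_Lp p \<Omega> (\<lambda>n. U s (r (r' n))) f" by blast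
  have "weakly_conv_Lp p \<Omega> (\<lambda>n. U t (r (r' n))) ((u(s := f)) t)" if "t \<in> insert s S" for t
  proof (cases "t = s")
    case False
    then have "weakly_conv_Lp p \<Omega> (\<lambda>n. U t (r n)) (u t)" using that u by simp
    from weakly_conv_Lp_subsequence[OF this r'] show ?thesis using False by simp
  qed (use f in simp)
  then have "strict_mono (r \<circ> r') \<and> (\<forall>t\<in>insert s S. weakly_conv_Lp p \<Omega> (\<lambda>n. U t ((r \<circ> r') n)) ((u(s := f)) t))"
    using strict_mono_o[OF r r'] by simp
  then show ?case by blast
qed

lemma weak_limit_fields_exist:
  fixes \<Omega> :: "(real^'d::finite) set"
  assumes \<Omega>: "open \<Omega>" "bounded \<Omega>" and p: "p > 2" and bdd: "bounded_fields_Lp p c \<Omega> H K"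
  shows "\<exists>r h \<kappa>. strict_mono r \<and> weak_limit_fields_Lp p c \<Omega> (H \<circ> r) (K \<circ> r) h \<kappa>"
proof -
  obtain B where B: "\<And>n a i j. a \<in> {1..c} \<Longrightarrow> in_Lp p \<Omega> (H n a i j) \<and> Lp_norm p \<Omega> (H n a i j) \<le> B"
      "\<And>n a b l. a \<in> {1..c} \<Longrightarrow> b \<in> {1..c} \<Longrightarrow> in_Lp p \<Omega> (K n a l b) \<and> Lp_norm p \<Omega> (K n a l b) \<le> B"
    using bdd unfolding bounded_fields_Lp_def by blast
  \<comment> \<open>A disjoint sum of the index sets of h and \<kappa>, so that one subsequence
    serves all components of both fields.\<close>
  define S :: "(nat \<times> 'd \<times> 'd + nat \<times> 'd \<times> nat) set" where "S = ({1..c} \<times> UNIV \<times> UNIV) <+> ({1..c} \<times> UNIV \<times> {1..c})"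
  define U where "U s n = (case s of Inl (a, i, j) \<Rightarrow> H n a i j | Inr (a, l, b) \<Rightarrow> K n a l b)" for s n
  have "finite S" by (simp add: S_def)
  moreover have "in_Lp p \<Omega> (U s n)" "Lp_norm p \<Omega> (U s n) \<le> B" if "s \<in> S" for s n
    using that B by (auto simp: S_def U_def)
  ultimately obtain r u where r: "strict_mono r" and u: "\<And>s. s \<in> S \<Longrightarrow> weakly_conv_Lp p \<Omega> (\<lambda>n. U s (r n)) (u s)"
    using weakly_conv_subsequence_family[OF \<Omega> p, of S U B] by blast
  have "weakly_conv_Lp p \<Omega> (\<lambda>n. H (r n) a i j) (u (Inl (a, i, j)))" if "a \<in> {1..c}" for a i j
  proof -
    have "Inl (a, i, j) \<in> S" using that by (auto simp: S_def)
    from u[OF this] show ?thesis by (simp add: U_def)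
  qed
  moreover have "weakly_conv_Lp p \<Omega> (\<lambda>n. K (r n) a l b) (u (Inr (a, l, b)))" if "a \<in> {1..c}" "b \<in> {1..c}" for a l b
  proof -
    have "Inr (a, l, b) \<in> S" using that by (auto simp: S_def)
    from u[OF this] show ?thesis by (simp add: U_def)
  qed
  ultimately have "weak_limit_fields_Lp p c \<Omega> (H \<circ> r) (K \<circ> r) (\<lambda>a i j. u (Inl (a, i, j))) (\<lambda>a l b. u (Inr (a, l, b)))"
    by (simp add: weak_limit_fields_Lp_def)
  with r show ?thesis by blast
qed

text \<open>The existence clause keeps the clause about all limits from being vacuous;
  \<open>r\<close> makes the passage to a subsequence explicit.\<close>

theorem theorem3p3:
  fixes \<Omega> :: "(real^'d::finite) set"
    and g :: "real^'d \<Rightarrow> real^'d^'d"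
    and N :: nat
    and p :: real
    and H :: "nat \<Rightarrow> nat \<Rightarrow> 'd \<Rightarrow> 'd \<Rightarrow> real^'d \<Rightarrow> real"
    and K :: "nat \<Rightarrow> nat \<Rightarrow> 'd \<Rightarrow> nat \<Rightarrow> real^'d \<Rightarrow> real"
  assumes "CARD('d) \<ge> 3"
    and "CARD('d) \<le> N"
    and "open \<Omega>" and "bounded \<Omega>"
    and "riemannian_metric_on \<Omega> g"
    and "p > 2"
    and "\<And>n. GCR_solution (N - CARD('d)) \<Omega> g (H n) (K n)"
    and "bounded_fields_Lp p (N - CARD('d)) \<Omega> H K"
  shows "(\<exists>r h \<kappa>. strict_mono r \<and>
            weak_limit_fields_Lp p (N - CARD('d)) \<Omega> (H \<circ> r) (K \<circ> r) h \<kappa>) \<and>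
         (\<forall>r h \<kappa>. strict_mono r \<and>
            weak_limit_fields_Lp p (N - CARD('d)) \<Omega> (H \<circ> r) (K \<circ> r) h \<kappa>
            \<longrightarrow> GCR_solution (N - CARD('d)) \<Omega> g h \<kappa>)"
proof (intro conjI allI impI)
  show "\<exists>r h \<kappa>. strict_mono r \<and> weak_limit_fields_Lp p (N - CARD('d)) \<Omega> (H \<circ> r) (K \<circ> r) h \<kappa>"
    by (rule weak_limit_fields_exist[OF assms(3,4,6,8)])
  fix r :: "nat \<Rightarrow> nat" and h \<kappa>
  assume *: "strict_mono r \<and> weak_limit_fields_Lp p (N - CARD('d)) \<Omega> (H \<circ> r) (K \<circ> r) h \<kappa>"
  \<comment> \<open>A subsequence inherits the equations and the uniform bound, so the limit theorem
    applies to it directly.\<close>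
  have "GCR_solution (N - CARD('d)) \<Omega> g ((H \<circ> r) n) ((K \<circ> r) n)" for n using assms(7) by simp
  moreover have "bounded_fields_Lp p (N - CARD('d)) \<Omega> (H \<circ> r) (K \<circ> r)"
    using assms(8) unfolding bounded_fields_Lp_def o_def by meson
  ultimately show "GCR_solution (N - CARD('d)) \<Omega> g h \<kappa>"
    using GCR_weak_limit[OF assms(3,4,5,6)] * by blast
qed

end
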